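(* Let $U_{\mathcal P}=\{\Omega\}$ (a single patch covering the whole domain) and let $\mathcal N$ be an $L(\mathcal N)$-Lipschitz continuous network trained on the training set $\mathcal F=\{f_1,\dots,f_{N_T}\}$ with $f_i\in C(\bar\Omega)$, $i=1,\dots,N_T$, such that the loss function is reduced to the error order of $\epsilon^2$ for each training problem, i.e. $\|\mathrm y^i-\mathcal N(\mathrm x^i)\|_2^2\le C\epsilon^2$ for all $i\in\{1,\dots,N_T\}$ with a fixed constant $C$. For $f\in H^{r-1}(\Omega)\cap C(\bar\Omega)$, let $u\in H^{r+1}(\Omega)\cap H^1_0(\Omega)$ be the solution of the Poisson problem $-\Delta u=f$ in $\Omega$, $u=0$ on $\partial\Omega$, and let $u_{\mathcal N}\in V_h$ be the hybrid solution. Then $$ \|\nabla(u-u_{\mathcal N})\|\le c\Bigg(h^r\|f\|_{r-1}+\min_{f_i\in\mathcal F}\Big\{\|f-f_i\|_{-1}+L(\mathcal N)h^{-1}\big(\|u_H-u_H^i\|+\|I_h(f-f_i)\|\big)\Big\}+h^{\frac d2-1}\epsilon\Bigg), $$ where $c>0$ is a constant independent of $h,H,\epsilon,f,\mathcal F$ and $\mathcal N$.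
   Context: **Domain and meshes.** $\Omega\subset\mathbb R^d$, $d\in\{2,3\}$, is a convex domain with polygonal (polyhedral) boundary. $\Omega_H$ is a coarse quadrilateral or triangular (2D) or hexahedral or tetrahedral (3D) mesh, and $\Omega_h$ is obtained from $\Omega_H$ by successive uniform refinement of all cells (so $h\le H$); the meshes satisfy the usual structural and shape regularity assumptions (conforming, uniformly shape regular) and are quasi-uniform. The subscript is the diameter of the largest cell. **Finite elements.** For fixed $r\ge1$, $V_h=\{\phi\in C(\bar\Omega):\phi|_T\in P^{(r)}(T)\ \forall T\in\Omega_h,\ \phi|_{\partial\Omega}=0\}$, where $P^{(r)}(T)$ denotes polynomials of degree at most $r$ on simplices and tensor-product polynomials of degree at most $r$ in each coordinate on quadrilaterals/hexahedra; $V_H\subset V_h$ is defined likewise on $\Omega_H$. For a right hand side $f$, $u_h\in V_h$ solves $(\nabla u_h,\nabla\phi_h)=\langle f,\phi_h\rangle$ for all $\phi_h\in V_h$, and $u_H\in V_H$ solves the same problem in $V_H$. For right hand side $f_i$ the corresponding solutions are $u_h^i$ and $u_H^i$. It is a standing assumption that for the considered $f\in H^{r-1}(\Omega)$ (with $H^0=L^2$) the weak solution $u$ lies in $H^{r+1}(\Omega)$ and that $\|u-u_h\|+h\|\nabla(u-u_h)\|\le c\,h^{r+1}\|f\|_{r-1}$. **Norms.** $\|\cdot\|$ is the $L^2(\Omega)$-norm, $\|\cdot\|_{s}$ the $H^s(\Omega)$-norm, and $\|\cdot\|_{-1}$ the norm of $H^{-1}(\Omega)$, the dual of $H^1_0(\Omega)$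 equipped with $\|\nabla\cdot\|$. $\|\cdot\|_2$ is the Euclidean norm. **Nodes and interpolation.** $X^h$, $X^H$ are the sets of nodes (Lagrange nodes of degree $r$) of $\Omega_h$, $\Omega_H$ in $\bar\Omega$. $I_hg$ is the Lagrange interpolant of $g\in C(\bar\Omega)$, i.e. the continuous piecewise polynomial of degree $r$ on $\Omega_h$ that agrees with $g$ at all nodes in $X^h$. **Network and hybrid solution.** A network is a multilayer perceptron $\mathcal N=l_L\circ\sigma\circ l_{L-1}\circ\dots\circ\sigma\circ l_1:\mathbb R^{N_0}\to\mathbb R^{N_L}$ with affine layers $l_j(x)=W_jx+b_j$ and activation function $\sigma:\mathbb R\to\mathbb R$ applied componentwise; $L(\mathcal N)$ is a Lipschitz constant of $\mathcal N$ with respect to Euclidean norms. Its input is $\mathrm x=\big((u_H(x))_{x\in X^H},(f(x))_{x\in X^h}\big)$. With the nodal basis functions $\phi_j$ of $V_h$, $w_{\mathcal N}=\sum_j\mathcal N(\mathrm x)_j\phi_j$, where $\mathcal N(\mathrm x)_j$ is the output component attached to the node of $\phi_j$. In the single-patch case the hybrid solution is $u_{\mathcal N}=u_H+w_{\mathcal N}\in V_h$. **Training data.** For $f_i\in\mathcal F$, $\mathrm x^i$ is the input vector built from $u_H^i$ and $f_i$ in place of $u_H$ and $f$, and the target is $\mathrm y^i=(u_h^i(x)-u_H^i(x))_{x\in X^h}$. The loss is $\frac1{N_T}\sum_{i}\|\mathrm y^i-\mathcal N(\mathrm x^i)\|_2^2$. *)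

theory Defs
  imports "HOL-Analysis.Analysis" "Jordan_Normal_Form.Matrix"
begin

no_notation vec_index (infixl "$" 100)
no_notation scalar_prod (infix "\<bullet>" 70)

section \<open>Sobolev spaces of integer order on an open set\<close>

definition L2 :: "(real ^ 'n) set \<Rightarrow> (real ^ 'n \<Rightarrow> 'b::euclidean_space) set" where
  "L2 \<Omega> = {g. g \<in> borel_measurable (lebesgue_on \<Omega>) \<and>
               integrable (lebesgue_on \<Omega>) (\<lambda>x. (norm (g x))\<^sup>2)}"

definition L2_norm :: "(real ^ 'n) set \<Rightarrow> (real ^ 'n \<Rightarrow> 'b::euclidean_space) \<Rightarrow> real" where
  "L2_norm \<Omega> g = sqrt (integral\<^sup>L (lebesgue_on \<Omega>) (\<lambda>x. (norm (g x))\<^sup>2))"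

definition L2_inner ::
  "(real ^ 'n) set \<Rightarrow> (real ^ 'n \<Rightarrow> 'b::euclidean_space) \<Rightarrow> (real ^ 'n \<Rightarrow> 'b) \<Rightarrow> real" where
  "L2_inner \<Omega> g k = integral\<^sup>L (lebesgue_on \<Omega>) (\<lambda>x. inner (g x) (k x))"

definition pdiff :: "'n \<Rightarrow> (real ^ 'n \<Rightarrow> real) \<Rightarrow> real ^ 'n \<Rightarrow> real" where
  "pdiff i g x = frechet_derivative g (at x) (axis i 1)"

definition pdiffs :: "'n list \<Rightarrow> (real ^ 'n \<Rightarrow> real) \<Rightarrow> real ^ 'n \<Rightarrow> real" where
  "pdiffs is g = foldr pdiff is g"

text \<open>The space of infinitely differentiable functions with compact support in \<open>\<Omega>\<close>.\<close>

definition test_functions :: "(real ^ 'n) set \<Rightarrow> (real ^ 'n \<Rightarrow> real) set" where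
  "test_functions \<Omega> = {\<psi>. (\<forall>is x. pdiffs is \<psi> differentiable (at x)) \<and>
     compact (closure {x. \<psi> x \<noteq> 0}) \<and> closure {x. \<psi> x \<noteq> 0} \<subseteq> \<Omega>}"

text \<open>Multi-indices are functions \<open>\<alpha> :: 'n \<Rightarrow> nat\<close>. The coordinate type carries no order, so the
  classical derivative of order \<open>\<alpha>\<close> of a test function is taken along every list of directions in
  which each \<open>i\<close> occurs \<open>\<alpha> i\<close> times; all these lists give the same function.\<close>

definition has_weak_deriv ::
  "(real ^ 'n) set \<Rightarrow> ('n \<Rightarrow> nat) \<Rightarrow> (real ^ 'n \<Rightarrow> real) \<Rightarrow> (real ^ 'n \<Rightarrow> real) \<Rightarrow> bool" where
  "has_weak_deriv \<Omega> \<alpha> u g \<longleftrightarrow> g \<in> L2 \<Omega> \<and>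
     (\<forall>\<psi>\<in>test_functions \<Omega>. \<forall>is. count_list is = \<alpha> \<longrightarrow>
        L2_inner \<Omega> u (pdiffs is \<psi>) = (- 1) ^ sum \<alpha> UNIV * L2_inner \<Omega> g \<psi>)"

text \<open>Weak derivatives are unique up to null sets; an arbitrary representative is chosen.\<close>

definition weak_deriv ::
  "(real ^ 'n) set \<Rightarrow> ('n \<Rightarrow> nat) \<Rightarrow> (real ^ 'n \<Rightarrow> real) \<Rightarrow> real ^ 'n \<Rightarrow> real" where
  "weak_deriv \<Omega> \<alpha> u = (SOME g. has_weak_deriv \<Omega> \<alpha> u g)"

definition weak_grad :: "(real ^ 'n) set \<Rightarrow> (real ^ 'n \<Rightarrow> real) \<Rightarrow> real ^ 'n \<Rightarrow> real ^ 'n" where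
  "weak_grad \<Omega> u x = (\<chi> i. weak_deriv \<Omega> (\<lambda>j. if j = i then 1 else 0) u x)"

definition sobolev :: "nat \<Rightarrow> (real ^ 'n) set \<Rightarrow> (real ^ 'n \<Rightarrow> real) set" where
  "sobolev s \<Omega> = {u \<in> L2 \<Omega>. \<forall>\<alpha>. sum \<alpha> UNIV \<le> s \<longrightarrow> (\<exists>g. has_weak_deriv \<Omega> \<alpha> u g)}"

definition sobolev_norm :: "nat \<Rightarrow> (real ^ 'n) set \<Rightarrow> (real ^ 'n \<Rightarrow> real) \<Rightarrow> real" where
  "sobolev_norm s \<Omega> u = sqrt (\<Sum>\<alpha> | sum \<alpha> UNIV \<le> s. (L2_norm \<Omega> (weak_deriv \<Omega> \<alpha> u))\<^sup>2)"

definition H10 :: "(real ^ 'n) set \<Rightarrow> (real ^ 'n \<Rightarrow> real) set" where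
  "H10 \<Omega> = {u \<in> sobolev 1 \<Omega>. \<exists>\<psi>. (\<forall>k. \<psi> k \<in> test_functions \<Omega>) \<and>
     (\<lambda>k::nat. sobolev_norm 1 \<Omega> (\<lambda>x. u x - \<psi> k x)) \<longlonglongrightarrow> 0}"

text \<open>The norm of the functional induced by \<open>g \<in> L2 \<Omega>\<close> in the dual of \<open>H10 \<Omega>\<close>, where
  \<open>H10 \<Omega>\<close> carries the norm of the gradient.\<close>

definition Hm1_norm :: "(real ^ 'n) set \<Rightarrow> (real ^ 'n \<Rightarrow> real) \<Rightarrow> real" where
  "Hm1_norm \<Omega> g =
     (SUP \<psi>\<in>{\<psi> \<in> H10 \<Omega>. L2_norm \<Omega> (weak_grad \<Omega> \<psi>) \<le> 1}. \<bar>L2_inner \<Omega> g \<psi>\<bar>)"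

definition poisson_solution ::
  "(real ^ 'n) set \<Rightarrow> (real ^ 'n \<Rightarrow> real) \<Rightarrow> (real ^ 'n \<Rightarrow> real) \<Rightarrow> bool" where
  "poisson_solution \<Omega> f u \<longleftrightarrow> u \<in> H10 \<Omega> \<and>
     (\<forall>\<psi>\<in>H10 \<Omega>. L2_inner \<Omega> (weak_grad \<Omega> u) (weak_grad \<Omega> \<psi>) = L2_inner \<Omega> f \<psi>)"


section \<open>Meshes\<close>

text \<open>\<open>Simplicial\<close>: triangles and tetrahedra; \<open>Cubical\<close>: quadrilaterals and hexahedra.\<close>

datatype shape = Simplicial | Cubical

fun ref_cell :: "shape \<Rightarrow> (real ^ 'n) set" where
  "ref_cell Simplicial = convex hull (insert 0 Basis)"
| "ref_cell Cubical = cbox 0 1"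

text \<open>Exponents of the monomials spanning the polynomials of total degree at most \<open>r\<close>, respectively
  of degree at most \<open>r\<close> in each coordinate.\<close>

fun exponents :: "shape \<Rightarrow> nat \<Rightarrow> ('n::finite \<Rightarrow> nat) set" where
  "exponents Simplicial r = {\<alpha>. sum \<alpha> UNIV \<le> r}"
| "exponents Cubical r = {\<alpha>. \<forall>i. \<alpha> i \<le> r}"

definition ref_poly :: "shape \<Rightarrow> nat \<Rightarrow> (real ^ 'n \<Rightarrow> real) set" where
  "ref_poly S r =
     range (\<lambda>a x. \<Sum>\<alpha>\<in>exponents S r. a \<alpha> * (\<Prod>i\<in>UNIV. (x $ i) ^ \<alpha> i))"

text \<open>A cell \<open>T\<close> is represented by its reference map \<open>F\<close>, \<open>T = F ` ref_cell S\<close>, which is affine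
  for simplices and multilinear for quadrilaterals and hexahedra: its components are reference
  polynomials of degree 1. A mesh is a finite set of such maps. Being polynomial, \<open>F\<close> is determined
  by its restriction to the reference cell. Two different cells of a mesh meet in a common proper
  face (vertex, edge, 2-face or empty).\<close>

definition is_cell :: "shape \<Rightarrow> (real ^ 'n \<Rightarrow> real ^ 'n) \<Rightarrow> bool" where
  "is_cell S F \<longleftrightarrow> (\<forall>i. (\<lambda>x. F x $ i) \<in> ref_poly S 1) \<and> inj_on F (ref_cell S)"

definition is_mesh ::
  "shape \<Rightarrow> (real ^ 'n) set \<Rightarrow> (real ^ 'n \<Rightarrow> real ^ 'n) set \<Rightarrow> bool" where
  "is_mesh S \<Omega> M \<longleftrightarrow> finite M \<and> (\<forall>F\<in>M. is_cell S F) \<and>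
     (\<Union>F\<in>M. F ` ref_cell S) = closure \<Omega> \<and>
     (\<forall>F\<in>M. \<forall>G\<in>M. F \<noteq> G \<longrightarrow>
        (\<exists>A B. A face_of ref_cell S \<and> A \<noteq> ref_cell S \<and> B face_of ref_cell S \<and> B \<noteq> ref_cell S \<and>
               F ` ref_cell S \<inter> G ` ref_cell S = F ` A \<and> F ` A = G ` B))"

definition cell_diam :: "shape \<Rightarrow> (real ^ 'n \<Rightarrow> real ^ 'n) \<Rightarrow> real" where
  "cell_diam S F = diameter (F ` ref_cell S)"

definition mesh_size :: "shape \<Rightarrow> (real ^ 'n \<Rightarrow> real ^ 'n) set \<Rightarrow> real" where
  "mesh_size S M = Max (cell_diam S ` M)"

text \<open>Shape regularity in terms of the reference maps: with \<open>h\<^sub>T\<close> the diameter of the cell,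
  \<open>DF\<close> is bounded by \<open>\<kappa> h\<^sub>T\<close> and its inverse by \<open>\<kappa> / h\<^sub>T\<close>, at every point of the reference cell.\<close>

definition shape_regular :: "real \<Rightarrow> shape \<Rightarrow> (real ^ 'n \<Rightarrow> real ^ 'n) set \<Rightarrow> bool" where
  "shape_regular \<kappa> S M \<longleftrightarrow> (\<forall>F\<in>M. \<forall>x\<in>ref_cell S. \<forall>v.
     norm (frechet_derivative F (at x) v) \<le> \<kappa> * cell_diam S F * norm v \<and>
     norm v \<le> \<kappa> / cell_diam S F * norm (frechet_derivative F (at x) v))"

definition quasi_uniform :: "real \<Rightarrow> shape \<Rightarrow> (real ^ 'n \<Rightarrow> real ^ 'n) set \<Rightarrow> bool" where
  "quasi_uniform q S M \<longleftrightarrow> (\<forall>F\<in>M. mesh_size S M \<le> q * cell_diam S F)"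

definition ref_vertices :: "shape \<Rightarrow> (real ^ 'n) set" where
  "ref_vertices S = {v. v extreme_point_of ref_cell S}"

text \<open>Uniform refinement of the reference cell into \<open>2 ^ d\<close> cells, as a set of maps of the reference
  cell into itself. A cube is cut into its half-size copies at the vertices. For simplices, the
  subcells use only the vertices and edge midpoints, and the half-size copies at the vertices are
  among them: this is the red refinement, which in 2D leaves the middle triangle and in 3D cuts the
  middle octahedron into 4 tetrahedra along any one of its three diagonals.\<close>

fun uniform_subdivision :: "shape \<Rightarrow> (real ^ 'n \<Rightarrow> real ^ 'n) set \<Rightarrow> bool" where
  "uniform_subdivision Cubical R \<longleftrightarrow> R = midpoint ` ref_vertices Cubical"
| "uniform_subdivision Simplicial R \<longleftrightarrow>
     is_mesh Simplicial (interior (ref_cell Simplicial)) R \<and>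
     midpoint ` ref_vertices Simplicial \<subseteq> R \<and>
     (\<forall>A\<in>R. \<forall>v\<in>ref_vertices Simplicial.
        \<exists>p\<in>ref_vertices Simplicial. \<exists>q\<in>ref_vertices Simplicial. A v = midpoint p q)"

definition uniform_refinement ::
  "shape \<Rightarrow> (real ^ 'n \<Rightarrow> real ^ 'n) set \<Rightarrow> (real ^ 'n \<Rightarrow> real ^ 'n) set \<Rightarrow> bool" where
  "uniform_refinement S M M' \<longleftrightarrow>
     (\<exists>R. (\<forall>F\<in>M. uniform_subdivision S (R F)) \<and> M' = (\<Union>F\<in>M. (\<lambda>A. F \<circ> A) ` R F))"


section \<open>Finite elements\<close>

text \<open>On quadrilaterals and hexahedra the polynomials are taken in the coordinates of the reference
  cell (mapped tensor-product elements); on simplices, where the reference maps are affine, this is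
  the space of polynomials of degree at most \<open>r\<close> on the cell itself. Only the values on
  \<open>closure \<Omega>\<close> matter.\<close>

definition fe_space ::
  "shape \<Rightarrow> (real ^ 'n) set \<Rightarrow> (real ^ 'n \<Rightarrow> real ^ 'n) set \<Rightarrow> nat \<Rightarrow> (real ^ 'n \<Rightarrow> real) set" where
  "fe_space S \<Omega> M r = {v. continuous_on (closure \<Omega>) v \<and>
     (\<forall>F\<in>M. \<exists>p\<in>ref_poly S r. \<forall>x\<in>ref_cell S. v (F x) = p x)}"

definition fe_space0 ::
  "shape \<Rightarrow> (real ^ 'n) set \<Rightarrow> (real ^ 'n \<Rightarrow> real ^ 'n) set \<Rightarrow> nat \<Rightarrow> (real ^ 'n \<Rightarrow> real) set" where
  "fe_space0 S \<Omega> M r = {v \<in> fe_space S \<Omega> M r. \<forall>x\<in>frontier \<Omega>. v x = 0}"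

definition ref_nodes :: "shape \<Rightarrow> nat \<Rightarrow> (real ^ 'n) set" where
  "ref_nodes S r = (\<lambda>\<alpha>. \<chi> i. real (\<alpha> i) / real r) ` exponents S r"

definition nodes :: "shape \<Rightarrow> (real ^ 'n \<Rightarrow> real ^ 'n) set \<Rightarrow> nat \<Rightarrow> (real ^ 'n) set" where
  "nodes S M r = (\<Union>F\<in>M. F ` ref_nodes S r)"

definition galerkin_solution ::
  "shape \<Rightarrow> (real ^ 'n) set \<Rightarrow> (real ^ 'n \<Rightarrow> real ^ 'n) set \<Rightarrow> nat \<Rightarrow>
   (real ^ 'n \<Rightarrow> real) \<Rightarrow> (real ^ 'n \<Rightarrow> real) \<Rightarrow> bool" where
  "galerkin_solution S \<Omega> M r f v \<longleftrightarrow> v \<in> fe_space0 S \<Omega> M r \<and>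
     (\<forall>\<psi>\<in>fe_space0 S \<Omega> M r.
        L2_inner \<Omega> (weak_grad \<Omega> v) (weak_grad \<Omega> \<psi>) = L2_inner \<Omega> f \<psi>)"

definition lagrange_interpolant ::
  "shape \<Rightarrow> (real ^ 'n) set \<Rightarrow> (real ^ 'n \<Rightarrow> real ^ 'n) set \<Rightarrow> nat \<Rightarrow>
   (real ^ 'n \<Rightarrow> real) \<Rightarrow> (real ^ 'n \<Rightarrow> real) \<Rightarrow> bool" where
  "lagrange_interpolant S \<Omega> M r g v \<longleftrightarrow>
     v \<in> fe_space S \<Omega> M r \<and> (\<forall>p\<in>nodes S M r. v p = g p)"

text \<open>The nodal basis of \<open>fe_space0 S \<Omega> M r\<close> is indexed by the nodes that are not on the boundary.\<close>

definition nodal_basis ::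
  "shape \<Rightarrow> (real ^ 'n) set \<Rightarrow> (real ^ 'n \<Rightarrow> real ^ 'n) set \<Rightarrow> nat \<Rightarrow>
   (real ^ 'n \<Rightarrow> real ^ 'n \<Rightarrow> real) \<Rightarrow> bool" where
  "nodal_basis S \<Omega> M r \<phi> \<longleftrightarrow> (\<forall>p\<in>nodes S M r - frontier \<Omega>.
     \<phi> p \<in> fe_space0 S \<Omega> M r \<and> (\<forall>q\<in>nodes S M r. \<phi> p q = (if q = p then 1 else 0)))"


section \<open>Multilayer perceptrons and the hybrid solution\<close>

type_synonym layer = "real mat \<times> real Matrix.vec"

definition affine_layer :: "layer \<Rightarrow> real Matrix.vec \<Rightarrow> real Matrix.vec" where
  "affine_layer l x = mult_mat_vec (fst l) x + snd l"

fun mlp :: "(real \<Rightarrow> real) \<Rightarrow> layer list \<Rightarrow> real Matrix.vec \<Rightarrow> real Matrix.vec" where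
  "mlp \<sigma> [] x = x"
| "mlp \<sigma> [l] x = affine_layer l x"
| "mlp \<sigma> (l # l' # ls) x = mlp \<sigma> (l' # ls) (map_vec \<sigma> (affine_layer l x))"

text \<open>\<open>mlp_dims n ls m\<close>: \<open>ls\<close> is a nonempty list of layers of matching sizes, with input
  dimension \<open>n\<close> and output dimension \<open>m\<close>.\<close>

fun mlp_dims :: "nat \<Rightarrow> layer list \<Rightarrow> nat \<Rightarrow> bool" where
  "mlp_dims n [] m \<longleftrightarrow> False"
| "mlp_dims n [l] m \<longleftrightarrow> fst l \<in> carrier_mat m n \<and> snd l \<in> carrier_vec m"
| "mlp_dims n (l # l' # ls) m \<longleftrightarrow> fst l \<in> carrier_mat (dim_vec (snd l)) n \<and>
     mlp_dims (dim_vec (snd l)) (l' # ls) m"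

definition enorm :: "real Matrix.vec \<Rightarrow> real" where
  "enorm x = sqrt (scalar_prod x x)"

definition lipschitz_net :: "nat \<Rightarrow> real \<Rightarrow> (real Matrix.vec \<Rightarrow> real Matrix.vec) \<Rightarrow> bool" where
  "lipschitz_net n L N \<longleftrightarrow>
     (\<forall>x\<in>carrier_vec n. \<forall>y\<in>carrier_vec n. enorm (N x - N y) \<le> L * enorm (x - y))"

text \<open>\<open>X\<^sub>H\<close> and \<open>X\<^sub>h\<close> enumerate the nodes; the enumeration attaches vector components to nodes.\<close>

definition enumerates :: "'a list \<Rightarrow> 'a set \<Rightarrow> bool" where
  "enumerates xs A \<longleftrightarrow> distinct xs \<and> set xs = A"

definition net_input ::
  "'a list \<Rightarrow> 'a list \<Rightarrow> ('a \<Rightarrow> real) \<Rightarrow> ('a \<Rightarrow> real) \<Rightarrow> real Matrix.vec" where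
  "net_input X\<^sub>H X\<^sub>h u\<^sub>H f = vec_of_list (map u\<^sub>H X\<^sub>H @ map f X\<^sub>h)"

definition net_target ::
  "'a list \<Rightarrow> ('a \<Rightarrow> real) \<Rightarrow> ('a \<Rightarrow> real) \<Rightarrow> real Matrix.vec" where
  "net_target X\<^sub>h u\<^sub>h u\<^sub>H = vec_of_list (map (\<lambda>p. u\<^sub>h p - u\<^sub>H p) X\<^sub>h)"

text \<open>Output components at boundary nodes have no basis function and are discarded.\<close>

definition net_correction ::
  "(real ^ 'n) set \<Rightarrow> (real ^ 'n) list \<Rightarrow> (real ^ 'n \<Rightarrow> real ^ 'n \<Rightarrow> real) \<Rightarrow>
   real Matrix.vec \<Rightarrow> real ^ 'n \<Rightarrow> real" where
  "net_correction \<Omega> X\<^sub>h \<phi> y x =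
     (\<Sum>j | j < length X\<^sub>h \<and> X\<^sub>h ! j \<notin> frontier \<Omega>. vec_index y j * \<phi> (X\<^sub>h ! j) x)"

definition hybrid_solution ::
  "(real ^ 'n) set \<Rightarrow> (real ^ 'n) list \<Rightarrow> (real ^ 'n) list \<Rightarrow>
   (real ^ 'n \<Rightarrow> real ^ 'n \<Rightarrow> real) \<Rightarrow> (real Matrix.vec \<Rightarrow> real Matrix.vec) \<Rightarrow>
   (real ^ 'n \<Rightarrow> real) \<Rightarrow> (real ^ 'n \<Rightarrow> real) \<Rightarrow> real ^ 'n \<Rightarrow> real" where
  "hybrid_solution \<Omega> X\<^sub>H X\<^sub>h \<phi> N u\<^sub>H f x =
     u\<^sub>H x + net_correction \<Omega> X\<^sub>h \<phi> (N (net_input X\<^sub>H X\<^sub>h u\<^sub>H f)) x"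

end

theory Submission
  imports Defs "Jordan_Normal_Form.Determinant"
begin

text \<open>The error is split as
  \<open>u - u\<^sub>N = (u - u\<^sub>h) + (u\<^sub>h - v\<^sub>h) - (u\<^sub>H - v\<^sub>H) + (v\<^sub>h - v\<^sub>H - w(y)) - (w(x) - w(y))\<close>, where \<open>v\<^sub>h\<close>, \<open>v\<^sub>H\<close> are the
  Galerkin solutions of a training problem with right hand side \<open>g\<close>, and \<open>w(x)\<close>, \<open>w(y)\<close> are the network
  corrections for \<open>f\<close> and \<open>g\<close>. Testing the difference of two Galerkin equations with its own solution bounds
  the second and third terms by \<open>\<parallel>f - g\<parallel>\<close> in the dual norm, since finite element functions belong to \<open>H\<^sup>1\<^sub>0\<close>. The last
  two terms are finite element functions whose nodal values are bounded by the training error and by the Lipschitz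
  constant of the network, respectively; an inverse estimate in terms of nodal values, which scales like \<open>h ^ (d/2 - 1)\<close>,
  bounds their gradients, and the equivalence of nodal values and the \<open>L\<^sup>2\<close> norm, which scales like \<open>h ^ (-d/2)\<close>, turns the
  network input back into \<open>u\<^sub>H - v\<^sub>H\<close> and the interpolant of \<open>f - g\<close>.\<close>

text \<open>Three obstacles shape the proof. \<open>weak_grad\<close> is an arbitrary choice, so
  gradients are computed with explicit representatives and transferred by uniqueness almost
  everywhere. \<open>H10\<close> is a closure of test functions, so a finite element function needs
  explicit approximants: it is extended by zero to a globally Lipschitz function, and convexity of
  the domain lets a dilation detach its support from the boundary before it is smoothed. Finally,
  the reference maps of quadrilaterals and hexahedra are not affine and their inverses are not
  polynomial, so no integral is transformed to the reference cell. Three facts about a cell suffice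
  for all quantitative estimates: it lies in a ball of radius \<open>h\<close>, its reference map
  stretches every vector at least by a factor \<open>c\<close>, and it therefore contains balls of
  radius \<open>c * \<rho>\<close> about images of centres of balls of radius \<open>\<rho>\<close>.
  Shape regularity and quasi-uniformity give \<open>c = h / (q * \<kappa>)\<close>. The ratio
  \<open>h / c\<close> is thus a constant, and only the powers of \<open>h\<close> in the claim
  remain.\<close>

no_notation vec_index (infixl "$" 100)
no_notation scalar_prod (infix "\<bullet>" 70)

section \<open>The space L2\<close>

lemma L2_measurable: "g \<in> L2 \<Omega> \<Longrightarrow> g \<in> borel_measurable (lebesgue_on \<Omega>)"
  by (simp add: L2_def)

lemma L2_integrable_norm: "g \<in> L2 \<Omega> \<Longrightarrow> integrable (lebesgue_on \<Omega>) (\<lambda>x. (norm (g x))\<^sup>2)"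
  by (simp add: L2_def)

lemma L2I:
  assumes "g \<in> borel_measurable (lebesgue_on \<Omega>)" "integrable (lebesgue_on \<Omega>) (\<lambda>x. (norm (g x))\<^sup>2)"
  shows "g \<in> L2 \<Omega>"
  using assms by (simp add: L2_def)

lemma L2_norm_nonneg [simp]: "L2_norm \<Omega> g \<ge> 0"
  by (simp add: L2_norm_def integral_nonneg_AE)

lemma L2_norm_power2: "(L2_norm \<Omega> g)\<^sup>2 = integral\<^sup>L (lebesgue_on \<Omega>) (\<lambda>x. (norm (g x))\<^sup>2)"
  by (simp add: L2_norm_def integral_nonneg_AE)

lemma L2_inner_self: "L2_inner \<Omega> g g = (L2_norm \<Omega> g)\<^sup>2"
  by (simp add: L2_norm_power2 L2_inner_def power2_norm_eq_inner)

lemma L2_inner_commute: "L2_inner \<Omega> g k = L2_inner \<Omega> k g"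
  by (simp add: L2_inner_def inner_commute)

lemma L2_inner_integrable:
  fixes g k :: "real ^ 'n \<Rightarrow> 'b::euclidean_space"
  assumes "g \<in> L2 \<Omega>" "k \<in> L2 \<Omega>"
  shows "integrable (lebesgue_on \<Omega>) (\<lambda>x. inner (g x) (k x))"
proof (rule Bochner_Integration.integrable_bound)
  show "integrable (lebesgue_on \<Omega>) (\<lambda>x. (norm (g x))\<^sup>2 + (norm (k x))\<^sup>2)"
    using assms by (intro Bochner_Integration.integrable_add L2_integrable_norm)
  show "(\<lambda>x. inner (g x) (k x)) \<in> borel_measurable (lebesgue_on \<Omega>)"
    using assms by (intro borel_measurable_inner L2_measurable)
  have "\<bar>inner (g x) (k x)\<bar> \<le> (norm (g x))\<^sup>2 + (norm (k x))\<^sup>2" for x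
  proof -
    have "2 * (norm (g x) * norm (k x)) \<le> (norm (g x))\<^sup>2 + (norm (k x))\<^sup>2"
      using sum_squares_bound[of "norm (g x)" "norm (k x)"] by (simp add: mult.assoc)
    moreover have "0 \<le> norm (g x) * norm (k x)" by simp
    ultimately show ?thesis
      using Cauchy_Schwarz_ineq2[of "g x" "k x"] by linarith
  qed
  then show "AE x in lebesgue_on \<Omega>. norm (inner (g x) (k x)) \<le> norm ((norm (g x))\<^sup>2 + (norm (k x))\<^sup>2)"
    by (intro AE_I2) (simp add: order_trans[OF _ abs_ge_self])
qed

lemma L2_add:
  fixes g k :: "real ^ 'n \<Rightarrow> 'b::euclidean_space"
  assumes "g \<in> L2 \<Omega>" "k \<in> L2 \<Omega>"
  shows "(\<lambda>x. g x + k x) \<in> L2 \<Omega>"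
proof (rule L2I)
  show "(\<lambda>x. g x + k x) \<in> borel_measurable (lebesgue_on \<Omega>)"
    using assms by (intro borel_measurable_add L2_measurable)
  have "integrable (lebesgue_on \<Omega>) (\<lambda>x. (norm (g x))\<^sup>2 + 2 * inner (g x) (k x) + (norm (k x))\<^sup>2)"
    using assms by (intro Bochner_Integration.integrable_add integrable_mult_right L2_integrable_norm L2_inner_integrable)
  moreover have "(norm (g x))\<^sup>2 + 2 * inner (g x) (k x) + (norm (k x))\<^sup>2 = (norm (g x + k x))\<^sup>2" for x
    by (simp add: power2_norm_eq_inner inner_add_left inner_add_right inner_commute)
  ultimately show "integrable (lebesgue_on \<Omega>) (\<lambda>x. (norm (g x + k x))\<^sup>2)" by simp
qed

lemma L2_scaleR:
  fixes g :: "real ^ 'n \<Rightarrow> 'b::euclidean_space"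
  assumes "g \<in> L2 \<Omega>"
  shows "(\<lambda>x. c *\<^sub>R g x) \<in> L2 \<Omega>"
  using assms by (auto simp: L2_def power_mult_distrib intro!: borel_measurable_scaleR)

lemma L2_cmult:
  fixes g :: "real ^ 'n \<Rightarrow> real"
  assumes "g \<in> L2 \<Omega>"
  shows "(\<lambda>x. c * g x) \<in> L2 \<Omega>"
  using L2_scaleR[OF assms, of c] by simp

lemma L2_diff:
  fixes g k :: "real ^ 'n \<Rightarrow> 'b::euclidean_space"
  assumes "g \<in> L2 \<Omega>" "k \<in> L2 \<Omega>"
  shows "(\<lambda>x. g x - k x) \<in> L2 \<Omega>"
  using L2_add[OF assms(1) L2_scaleR[OF assms(2), of "-1"]] by simp

lemma L2_inner_add_left:
  fixes g k l :: "real ^ 'n \<Rightarrow> 'b::euclidean_space"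
  assumes "g \<in> L2 \<Omega>" "k \<in> L2 \<Omega>" "l \<in> L2 \<Omega>"
  shows "L2_inner \<Omega> (\<lambda>x. g x + k x) l = L2_inner \<Omega> g l + L2_inner \<Omega> k l"
  using L2_inner_integrable[OF assms(1,3)] L2_inner_integrable[OF assms(2,3)]
  by (simp add: L2_inner_def inner_add_left)

lemma L2_inner_diff_left:
  fixes g k l :: "real ^ 'n \<Rightarrow> 'b::euclidean_space"
  assumes "g \<in> L2 \<Omega>" "k \<in> L2 \<Omega>" "l \<in> L2 \<Omega>"
  shows "L2_inner \<Omega> (\<lambda>x. g x - k x) l = L2_inner \<Omega> g l - L2_inner \<Omega> k l"
  using L2_inner_integrable[OF assms(1,3)] L2_inner_integrable[OF assms(2,3)]
  by (simp add: L2_inner_def inner_diff_left)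

lemma L2_inner_scaleR_left: "L2_inner \<Omega> (\<lambda>x. c *\<^sub>R g x) l = c * L2_inner \<Omega> g l"
  by (simp add: L2_inner_def)

lemma L2_norm_scaleR: "L2_norm \<Omega> (\<lambda>x. c *\<^sub>R g x) = \<bar>c\<bar> * L2_norm \<Omega> g"
  by (simp add: L2_norm_def power_mult_distrib real_sqrt_mult)

lemma L2_norm_cmult:
  fixes g :: "real ^ 'n \<Rightarrow> real"
  shows "L2_norm \<Omega> (\<lambda>x. c * g x) = \<bar>c\<bar> * L2_norm \<Omega> g"
  using L2_norm_scaleR[of \<Omega> c g] by simp

lemma L2_norm_minus_commute: "L2_norm \<Omega> (\<lambda>x. g x - k x) = L2_norm \<Omega> (\<lambda>x. k x - g x)"
  by (simp add: L2_norm_def norm_minus_commute)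

text \<open>The discriminant argument: the squared norm of \<open>g - t k\<close> is a nonnegative
  quadratic in \<open>t\<close>. On functions the form is only semidefinite, so the leading
  coefficient may vanish and this case is treated separately.\<close>

lemma L2_cauchy_schwarz:
  fixes g k :: "real ^ 'n \<Rightarrow> 'b::euclidean_space"
  assumes g: "g \<in> L2 \<Omega>" and k: "k \<in> L2 \<Omega>"
  shows "\<bar>L2_inner \<Omega> g k\<bar> \<le> L2_norm \<Omega> g * L2_norm \<Omega> k"
proof -
  define a b i where "a = (L2_norm \<Omega> g)\<^sup>2" and "b = (L2_norm \<Omega> k)\<^sup>2" and "i = L2_inner \<Omega> g k"
  have q: "0 \<le> a - 2 * t * i + t\<^sup>2 * b" for t
  proof -
    have tk: "(\<lambda>x. t *\<^sub>R k x) \<in> L2 \<Omega>" using k by (rule L2_scaleR)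
    have "(L2_norm \<Omega> (\<lambda>x. g x - t *\<^sub>R k x))\<^sup>2
        = L2_inner \<Omega> g (\<lambda>x. g x - t *\<^sub>R k x) - L2_inner \<Omega> (\<lambda>x. t *\<^sub>R k x) (\<lambda>x. g x - t *\<^sub>R k x)"
      unfolding L2_inner_self[symmetric] by (rule L2_inner_diff_left[OF g tk L2_diff[OF g tk]])
    also have "\<dots> = L2_inner \<Omega> (\<lambda>x. g x - t *\<^sub>R k x) g - t * L2_inner \<Omega> (\<lambda>x. g x - t *\<^sub>R k x) k"
      unfolding L2_inner_scaleR_left by (simp only: L2_inner_commute)
    also have "\<dots> = a - 2 * t * i + t\<^sup>2 * b"
      unfolding L2_inner_diff_left[OF g tk g] L2_inner_diff_left[OF g tk k] L2_inner_scaleR_left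
      by (simp add: a_def b_def i_def L2_inner_self L2_inner_commute[of \<Omega> k g] power2_eq_square algebra_simps)
    finally show ?thesis using zero_le_power2 by metis
  qed
  have "i\<^sup>2 \<le> a * b"
  proof (cases "b = 0")
    case True
    have "i = 0"
    proof (rule ccontr)
      assume "i \<noteq> 0"
      \<comment> \<open>With \<open>b = 0\<close> the quadratic is linear in \<open>t\<close>, and
        this \<open>t\<close> gives it the value \<open>-1\<close>.\<close>
      then show False using q[of "(a + 1) / (2 * i)"] True by (simp add: field_simps)
    qed
    then show ?thesis using True by simp
  next
    case False
    then have "b > 0" unfolding b_def by simp
    \<comment> \<open>The minimiser of the quadratic is \<open>i / b\<close>.\<close>
    have "0 \<le> b * (a - 2 * (i / b) * i + (i / b)\<^sup>2 * b)"
      using q[of "i / b"] \<open>b > 0\<close> by (intro mult_nonneg_nonneg) auto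
    also have "\<dots> = a * b - i\<^sup>2"
      using \<open>b > 0\<close> by (simp add: field_simps power2_eq_square)
    finally show ?thesis by simp
  qed
  then have "i\<^sup>2 \<le> (L2_norm \<Omega> g * L2_norm \<Omega> k)\<^sup>2" by (simp add: a_def b_def power_mult_distrib)
  then show ?thesis unfolding i_def using abs_le_square_iff[of i] by (simp add: power2_le_iff_abs_le i_def)
qed

lemma L2_norm_triangle:
  fixes g k :: "real ^ 'n \<Rightarrow> 'b::euclidean_space"
  assumes g: "g \<in> L2 \<Omega>" and k: "k \<in> L2 \<Omega>"
  shows "L2_norm \<Omega> (\<lambda>x. g x + k x) \<le> L2_norm \<Omega> g + L2_norm \<Omega> k"
proof (rule power2_le_imp_le)
  have "(L2_norm \<Omega> (\<lambda>x. g x + k x))\<^sup>2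
      = L2_inner \<Omega> (\<lambda>x. g x + k x) g + L2_inner \<Omega> (\<lambda>x. g x + k x) k"
    unfolding L2_inner_self[symmetric] L2_inner_add_left[OF g k L2_add[OF g k]] by (simp only: L2_inner_commute)
  also have "\<dots> = (L2_norm \<Omega> g)\<^sup>2 + 2 * L2_inner \<Omega> g k + (L2_norm \<Omega> k)\<^sup>2"
    unfolding L2_inner_add_left[OF g k g] L2_inner_add_left[OF g k k] by (simp add: L2_inner_self L2_inner_commute[of \<Omega> k g])
  also have "\<dots> \<le> (L2_norm \<Omega> g + L2_norm \<Omega> k)\<^sup>2"
    using L2_cauchy_schwarz[OF g k] by (simp add: power2_sum)
  finally show "(L2_norm \<Omega> (\<lambda>x. g x + k x))\<^sup>2 \<le> (L2_norm \<Omega> g + L2_norm \<Omega> k)\<^sup>2" .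
qed simp

lemma L2_norm_cong_AE:
  assumes "AE x in lebesgue_on \<Omega>. g x = k x"
    "g \<in> borel_measurable (lebesgue_on \<Omega>)" "k \<in> borel_measurable (lebesgue_on \<Omega>)"
  shows "L2_norm \<Omega> g = L2_norm \<Omega> k"
proof -
  have "integral\<^sup>L (lebesgue_on \<Omega>) (\<lambda>x. (norm (g x))\<^sup>2) = integral\<^sup>L (lebesgue_on \<Omega>) (\<lambda>x. (norm (k x))\<^sup>2)"
  proof (rule integral_cong_AE)
    show "AE x in lebesgue_on \<Omega>. (norm (g x))\<^sup>2 = (norm (k x))\<^sup>2"
      using assms(1) by eventually_elim simp
  qed (use assms in \<open>auto intro!: borel_measurable_power borel_measurable_norm\<close>)
  then show ?thesis by (simp add: L2_norm_def)
qed

lemma L2_inner_cong_AE: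
  fixes g k g' k' :: "real ^ 'n \<Rightarrow> 'b::euclidean_space"
  assumes "AE x in lebesgue_on \<Omega>. g x = g' x" "AE x in lebesgue_on \<Omega>. k x = k' x"
    "g \<in> L2 \<Omega>" "g' \<in> L2 \<Omega>" "k \<in> L2 \<Omega>" "k' \<in> L2 \<Omega>"
  shows "L2_inner \<Omega> g k = L2_inner \<Omega> g' k'"
  unfolding L2_inner_def
proof (rule integral_cong_AE)
  show "AE x in lebesgue_on \<Omega>. inner (g x) (k x) = inner (g' x) (k' x)"
    using assms(1,2) by eventually_elim simp
qed (rule borel_measurable_inner L2_measurable assms)+

lemma L2_inner_cong:
  assumes "\<And>x. x \<in> \<Omega> \<Longrightarrow> g x = g' x" "\<And>x. x \<in> \<Omega> \<Longrightarrow> k x = k' x"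
  shows "L2_inner \<Omega> g k = L2_inner \<Omega> g' k'"
  unfolding L2_inner_def by (rule Bochner_Integration.integral_cong) (auto simp: assms)

lemma L2_cong:
  assumes "\<And>x. x \<in> \<Omega> \<Longrightarrow> g x = g' x"
  shows "g \<in> L2 \<Omega> \<longleftrightarrow> g' \<in> L2 \<Omega>"
proof -
  have "g \<in> borel_measurable (lebesgue_on \<Omega>) \<longleftrightarrow> g' \<in> borel_measurable (lebesgue_on \<Omega>)"
    by (rule measurable_cong) (auto simp: assms)
  moreover have "integrable (lebesgue_on \<Omega>) (\<lambda>x. (norm (g x))\<^sup>2) \<longleftrightarrow> integrable (lebesgue_on \<Omega>) (\<lambda>x. (norm (g' x))\<^sup>2)"
    by (rule Bochner_Integration.integrable_cong) (auto simp: assms)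
  ultimately show ?thesis by (simp add: L2_def)
qed

lemma integrable_bounded:
  fixes g :: "real ^ 'n \<Rightarrow> 'b::euclidean_space"
  assumes "\<Omega> \<in> lmeasurable" "g \<in> borel_measurable (lebesgue_on \<Omega>)" "\<And>x. x \<in> \<Omega> \<Longrightarrow> norm (g x) \<le> B"
  shows "integrable (lebesgue_on \<Omega>) g"
proof (rule Bochner_Integration.integrable_bound)
  show "integrable (lebesgue_on \<Omega>) (\<lambda>x. B)"
    using finite_measure.integrable_const[OF finite_measure_lebesgue_on[OF assms(1)]] .
  have "norm (g x) \<le> norm B" if "x \<in> \<Omega>" for x
    using assms(3)[OF that] by simp
  then show "AE x in lebesgue_on \<Omega>. norm (g x) \<le> norm B" by (intro AE_I2) auto
qed (rule assms)

lemma L2_bounded: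
  fixes g :: "real ^ 'n \<Rightarrow> 'b::euclidean_space"
  assumes "\<Omega> \<in> lmeasurable" "g \<in> borel_measurable (lebesgue_on \<Omega>)" "\<And>x. x \<in> \<Omega> \<Longrightarrow> norm (g x) \<le> B"
  shows "g \<in> L2 \<Omega>"
proof (rule L2I)
  have "(norm (g x))\<^sup>2 \<le> B\<^sup>2" if "x \<in> \<Omega>" for x
    using power_mono[OF assms(3)[OF that]] by simp
  then show "integrable (lebesgue_on \<Omega>) (\<lambda>x. (norm (g x))\<^sup>2)"
    using assms(2) by (intro integrable_bounded[OF assms(1), where B="B\<^sup>2"]) auto
qed (rule assms)

lemma L2_continuous:
  fixes g :: "real ^ 'n \<Rightarrow> 'b::euclidean_space"
  assumes "open \<Omega>" "bounded \<Omega>" "continuous_on (closure \<Omega>) g"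
  shows "g \<in> L2 \<Omega>"
proof -
  have "compact (g ` closure \<Omega>)"
    using assms by (intro compact_continuous_image) (auto simp: compact_closure)
  then obtain B where B: "\<And>x. x \<in> closure \<Omega> \<Longrightarrow> norm (g x) \<le> B"
    using compact_imp_bounded by (fastforce simp: bounded_iff)
  show ?thesis
  proof (rule L2_bounded)
    show "\<Omega> \<in> lmeasurable" using assms by (simp add: lmeasurable_open)
    show "g \<in> borel_measurable (lebesgue_on \<Omega>)"
      using assms by (intro continuous_imp_measurable_on_sets_lebesgue)
        (auto intro: continuous_on_subset[OF _ closure_subset])
    show "norm (g x) \<le> B" if "x \<in> \<Omega>" for x using B that closure_subset by blast
  qed
qed

section \<open>Smooth functions\<close>

definition smooth :: "(real ^ 'n \<Rightarrow> real) \<Rightarrow> bool" where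
  "smooth f \<longleftrightarrow> (\<forall>is x. pdiffs is f differentiable (at x))"

lemma test_functions_iff:
  "\<psi> \<in> test_functions \<Omega> \<longleftrightarrow>
     smooth \<psi> \<and> compact (closure {x. \<psi> x \<noteq> 0}) \<and> closure {x. \<psi> x \<noteq> 0} \<subseteq> \<Omega>"
  by (simp add: test_functions_def smooth_def)

lemma pdiffs_Nil [simp]: "pdiffs [] f = f"
  by (simp add: pdiffs_def)

lemma pdiffs_Cons [simp]: "pdiffs (i # is) f = pdiff i (pdiffs is f)"
  by (simp add: pdiffs_def)

lemma pdiffs_append: "pdiffs (is @ js) f = pdiffs is (pdiffs js f)"
  by (simp add: pdiffs_def)

lemma smooth_pdiff: "smooth f \<Longrightarrow> smooth (pdiff i f)"
  unfolding smooth_def by (metis pdiffs_append pdiffs_Cons pdiffs_Nil)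

lemma smooth_differentiable: "smooth f \<Longrightarrow> f differentiable (at x)"
  unfolding smooth_def by (metis pdiffs_Nil)

lemma smooth_continuous_on: "smooth f \<Longrightarrow> continuous_on A f"
  by (meson continuous_at_imp_continuous_on differentiable_imp_continuous_within smooth_differentiable)

text \<open>Iterated partial derivatives never leave a family that is closed under one of them. All
  smoothness proofs below use this: the function is put into a family large enough to be closed, and
  a single derivative is computed.\<close>

lemma smooth_closed_family:
  assumes "\<And>f x. f \<in> A \<Longrightarrow> f differentiable (at x)" "\<And>f i. f \<in> A \<Longrightarrow> pdiff i f \<in> A" "f \<in> A"
  shows "smooth f"
proof -
  have "pdiffs is f \<in> A" for "is" by (induction "is") (use assms in auto)
  then show ?thesis unfolding smooth_def using assms(1) by blast
qed

lemma pdiff_eq: "(f has_derivative f') (at x) \<Longrightarrow> pdiff i f x = f' (axis i 1)"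
  unfolding pdiff_def by (metis frechet_derivative_at)

lemma has_derivative_pdiff:
  fixes f :: "real ^ 'n \<Rightarrow> real"
  assumes "f differentiable (at x)"
  shows "(f has_derivative (\<lambda>h. \<Sum>i\<in>UNIV. h $ i * pdiff i f x)) (at x)"
proof -
  have d: "(f has_derivative frechet_derivative f (at x)) (at x)"
    using assms frechet_derivative_works by blast
  then have lin: "linear (frechet_derivative f (at x))" using has_derivative_linear by blast
  have "frechet_derivative f (at x) h = (\<Sum>i\<in>UNIV. h $ i * pdiff i f x)" for h
  proof -
    have "frechet_derivative f (at x) h = frechet_derivative f (at x) (\<Sum>i\<in>UNIV. h $ i *s axis i 1)"
      by (simp add: basis_expansion)
    also have "\<dots> = (\<Sum>i\<in>UNIV. h $ i * frechet_derivative f (at x) (axis i 1))"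
      unfolding linear_sum[OF lin] by (simp add: scalar_mult_eq_scaleR linear_cmul[OF lin])
    finally show ?thesis by (simp add: pdiff_def)
  qed
  then have "frechet_derivative f (at x) = (\<lambda>h. \<Sum>i\<in>UNIV. h $ i * pdiff i f x)" by blast
  with d show ?thesis by simp
qed

lemma pdiff_mult:
  assumes "f differentiable (at x)" "g differentiable (at x)"
  shows "pdiff i (\<lambda>x. f x * g x) x = f x * pdiff i g x + pdiff i f x * g x"
proof -
  have "((\<lambda>x. f x * g x) has_derivative
      (\<lambda>h. f x * (\<Sum>i\<in>UNIV. h $ i * pdiff i g x) + (\<Sum>i\<in>UNIV. h $ i * pdiff i f x) * g x)) (at x)"
    by (rule has_derivative_mult[OF has_derivative_pdiff[OF assms(1)] has_derivative_pdiff[OF assms(2)]])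
  from pdiff_eq[OF this, of i] show ?thesis by (simp add: axis_def if_distrib if_distribR cong: if_cong)
qed

lemma pdiff_add:
  assumes "f differentiable (at x)" "g differentiable (at x)"
  shows "pdiff i (\<lambda>x. f x + g x) x = pdiff i f x + pdiff i g x"
proof -
  have "((\<lambda>x. f x + g x) has_derivative
      (\<lambda>h. (\<Sum>i\<in>UNIV. h $ i * pdiff i f x) + (\<Sum>i\<in>UNIV. h $ i * pdiff i g x))) (at x)"
    by (rule has_derivative_add[OF has_derivative_pdiff[OF assms(1)] has_derivative_pdiff[OF assms(2)]])
  from pdiff_eq[OF this, of i] show ?thesis by (simp add: axis_def if_distrib if_distribR cong: if_cong)
qed

text \<open>The partial derivatives of a product leave the set of products, but not the set of sums of products.\<close>

inductive_set product_sums :: "(real ^ 'n \<Rightarrow> real) set" where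
  "smooth f \<Longrightarrow> smooth g \<Longrightarrow> (\<lambda>x. f x * g x) \<in> product_sums"
| "f \<in> product_sums \<Longrightarrow> g \<in> product_sums \<Longrightarrow> (\<lambda>x. f x + g x) \<in> product_sums"

lemma product_sums_closed:
  assumes "f \<in> product_sums"
  shows "(\<forall>x. f differentiable (at x)) \<and> (\<forall>i. pdiff i f \<in> product_sums)"
  using assms
proof induction
  case (1 f g)
  have eq: "pdiff i (\<lambda>x. f x * g x) = (\<lambda>x. f x * pdiff i g x + pdiff i f x * g x)" for i
    using pdiff_mult smooth_differentiable 1 by blast
  show ?case unfolding eq
    using 1 by (auto intro!: product_sums.intros smooth_pdiff differentiable_mult simp: smooth_differentiable)
next
  case (2 f g)
  have eq: "pdiff i (\<lambda>x. f x + g x) = (\<lambda>x. pdiff i f x + pdiff i g x)" for i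
    using pdiff_add 2 by blast
  show ?case unfolding eq using 2 by (auto intro!: product_sums.intros)
qed

lemma smooth_mult:
  assumes "smooth f" "smooth g"
  shows "smooth (\<lambda>x. f x * g x)"
  by (rule smooth_closed_family[of product_sums]) (use product_sums_closed product_sums.intros(1) assms in blast)+

lemma smooth_const: "smooth (\<lambda>x. c)"
proof (rule smooth_closed_family[of "range (\<lambda>c x. c)"])
  fix f :: "real ^ 'a \<Rightarrow> real" and x i assume "f \<in> range (\<lambda>c x. c)"
  then obtain c where f: "f = (\<lambda>x. c)" by blast
  show "f differentiable (at x)" unfolding f by simp
  have "pdiff i f = (\<lambda>x. 0)" unfolding f using pdiff_eq[OF has_derivative_const] by blast
  then show "pdiff i f \<in> range (\<lambda>c x. c)" by blast
qed blast

lemma smooth_prod: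
  assumes "finite A" "\<And>i. i \<in> A \<Longrightarrow> smooth (f i)"
  shows "smooth (\<lambda>x. \<Prod>i\<in>A. f i x)"
  using assms by (induction A rule: finite_induct) (auto intro: smooth_mult smooth_const)

section \<open>Flat functions and smooth bumps\<close>

definition flat :: "real poly \<Rightarrow> real \<Rightarrow> real" where
  "flat p t = (if t > 0 then poly p (1 / t) * exp (- (1 / t)) else 0)"

lemma poly_exp_tendsto_0: "((\<lambda>s. poly p s * exp (- s)) \<longlongrightarrow> 0) at_top" for p :: "real poly"
proof -
  have "((\<lambda>s. \<Sum>i\<le>degree p. coeff p i * (s ^ i / exp s)) \<longlongrightarrow> (\<Sum>i\<le>degree p. coeff p i * 0)) at_top"
    by (intro tendsto_intros tendsto_power_div_exp_0)
  moreover have "(\<Sum>i\<le>degree p. coeff p i * (s ^ i / exp s)) = poly p s * exp (- s)" for s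
    by (simp add: poly_altdef sum_distrib_right exp_minus divide_inverse mult.assoc)
  ultimately show ?thesis by simp
qed

text \<open>With \<open>s = 1 / t\<close> the chain rule turns \<open>p(s) * exp (- s)\<close> into
  \<open>s^2 * (p(s) - p'(s)) * exp (- s)\<close>, and \<open>[:0, 0, 1:]\<close> is the factor
  \<open>s^2\<close>. The polynomial factor in \<open>flat\<close> is there precisely to make the
  family closed under derivatives.\<close>

lemma DERIV_flat:
  "(flat p has_real_derivative flat ([:0, 0, 1:] * (p - pderiv p)) t) (at t)"
proof -
  consider "t > 0" | "t < 0" | "t = 0" by linarith
  then show ?thesis
  proof cases
    case 1
    have "((\<lambda>t. poly p (1 / t) * exp (- (1 / t))) has_real_derivative
       flat ([:0, 0, 1:] * (p - pderiv p)) t) (at t)"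
    proof -
      have d: "((\<lambda>t. 1 / t) has_real_derivative - (1 / t ^ 2)) (at t)"
        using 1 by (auto intro!: derivative_eq_intros simp: power2_eq_square)
      have "((\<lambda>t. poly p (1 / t)) has_real_derivative poly (pderiv p) (1 / t) * - (1 / t ^ 2)) (at t)"
        by (rule DERIV_chain2[OF poly_DERIV d])
      moreover have "((\<lambda>t. exp (- (1 / t))) has_real_derivative exp (- (1 / t)) * - (- (1 / t ^ 2))) (at t)"
        by (rule DERIV_chain2[OF DERIV_exp DERIV_minus[OF d]])
      ultimately have "((\<lambda>t. poly p (1 / t) * exp (- (1 / t))) has_real_derivative
          poly (pderiv p) (1 / t) * - (1 / t ^ 2) * exp (- (1 / t)) +
          exp (- (1 / t)) * - (- (1 / t ^ 2)) * poly p (1 / t)) (at t)"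
        by (rule DERIV_mult)
      moreover have "poly (pderiv p) (1 / t) * - (1 / t ^ 2) * exp (- (1 / t)) +
          exp (- (1 / t)) * - (- (1 / t ^ 2)) * poly p (1 / t) = flat ([:0, 0, 1:] * (p - pderiv p)) t"
        using 1 by (simp add: flat_def power2_eq_square left_diff_distrib right_diff_distrib mult_ac)
      ultimately show ?thesis by simp
    qed
    moreover have ev: "\<forall>\<^sub>F s in nhds t. poly p (1 / s) * exp (- (1 / s)) = flat p s"
      using eventually_nhds_in_open[of "{0<..}" t] 1 by (auto elim!: eventually_mono simp: flat_def)
    ultimately show ?thesis using DERIV_cong_ev[OF refl ev refl] by simp
  next
    case 2
    have ev: "\<forall>\<^sub>F s in nhds t. 0 = flat p s"
      using eventually_nhds_in_open[of "{..<0}" t] 2 by (auto elim!: eventually_mono simp: flat_def)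
    moreover have "((\<lambda>t. 0) has_real_derivative flat ([:0, 0, 1:] * (p - pderiv p)) t) (at t)"
      using 2 by (simp add: flat_def)
    ultimately show ?thesis using DERIV_cong_ev[OF refl ev refl] by simp
  next
    case 3
    \<comment> \<open>To the right of \<open>0\<close> the quotient is
      \<open>s * p(s) * exp (- s)\<close> at \<open>s = 1 / h\<close>, and \<open>pCons 0 p\<close>
      is the polynomial \<open>s * p(s)\<close>.\<close>
    have "((\<lambda>h. flat p h / h) \<longlongrightarrow> 0) (at_right 0)"
    proof -
      have "((\<lambda>h. poly (pCons 0 p) (inverse h) * exp (- inverse h)) \<longlongrightarrow> 0) (at_right (0::real))"
        by (rule filterlim_compose[OF poly_exp_tendsto_0 filterlim_inverse_at_top_right])
      then show ?thesis
        by (rule Lim_transform_eventually)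
          (auto simp: flat_def eventually_at_filter divide_inverse intro!: always_eventually)
    qed
    moreover have "((\<lambda>h. flat p h / h) \<longlongrightarrow> 0) (at_left 0)"
      by (rule Lim_transform_eventually[OF tendsto_const])
        (auto simp: flat_def eventually_at_filter intro!: always_eventually)
    ultimately have "((\<lambda>h. flat p h / h) \<longlongrightarrow> 0) (at 0)" by (simp add: filterlim_at_split)
    then show ?thesis using 3 by (simp add: DERIV_def flat_def)
  qed
qed

lemma smooth_flat_coordinate:
  fixes i :: "'n::finite"
  shows "smooth (\<lambda>x::real ^ 'n. flat p (m * (x $ i) + b))"
proof -
  \<comment> \<open>The scalar \<open>c\<close> absorbs the chain rule factor \<open>m\<close>; it
    becomes \<open>0\<close> for a derivative in another direction.\<close>
  let ?A = "{\<lambda>x::real ^ 'n. c * flat p (m * (x $ i) + b) |c p. True}"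
  have der: "((\<lambda>x::real ^ 'n. c * flat p (m * (x $ i) + b)) has_derivative
      (\<lambda>h. c * (flat ([:0, 0, 1:] * (p - pderiv p)) (m * (x $ i) + b) * (m * (h $ i))))) (at x)" for c p x
  proof -
    have "((\<lambda>x::real ^ 'n. m * (x $ i) + b) has_derivative (\<lambda>h. m * (h $ i))) (at x)"
      by (auto intro!: derivative_eq_intros bounded_linear.has_derivative[OF bounded_linear_vec_nth])
    from has_derivative_compose[OF this DERIV_flat[unfolded has_field_derivative_def]]
    show ?thesis by (intro has_derivative_mult_right)
  qed
  show ?thesis
  proof (rule smooth_closed_family[of ?A])
    fix f and x :: "real ^ 'n" and j assume "f \<in> ?A"
    then obtain c p where f: "f = (\<lambda>x::real ^ 'n. c * flat p (m * (x $ i) + b))" by blast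
    show "f differentiable (at x)" unfolding f differentiable_def using der by blast
    have "pdiff j f = (\<lambda>x. (c * (m * (if j = i then 1 else 0))) * flat ([:0, 0, 1:] * (p - pderiv p)) (m * (x $ i) + b))"
      unfolding f using pdiff_eq[OF der] by (auto simp: fun_eq_iff axis_def)
    then show "pdiff j f \<in> ?A" by blast
  next
    show "(\<lambda>x::real ^ 'n. flat p (m * (x $ i) + b)) \<in> ?A"
      by (intro CollectI exI[of _ 1] exI[of _ p]) simp
  qed
qed

text \<open>There is one flat factor per face of the box. The steepness \<open>m\<close> has two
  uses: for \<open>m\<close> tending to infinity the bumps approach the indicator of the box, and
  \<open>m = 1\<close> gives the kernel of the mollification.\<close>

definition bump :: "real ^ 'n \<Rightarrow> real ^ 'n \<Rightarrow> real \<Rightarrow> real ^ 'n \<Rightarrow> real" where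
  "bump a b m x = (\<Prod>i\<in>UNIV. flat 1 (m * (x $ i - a $ i))) * (\<Prod>i\<in>UNIV. flat 1 (m * (b $ i - x $ i)))"

lemma flat_1_bounds: "0 \<le> flat 1 t" "flat 1 t \<le> 1"
  by (auto simp: flat_def)

lemma smooth_bump: "smooth (bump a b m)"
proof -
  have "smooth (\<lambda>x::real ^ 'a. flat 1 (m * (x $ i - a $ i)))" for i
    using smooth_flat_coordinate[of 1 m i "- (m * a $ i)"] by (simp add: right_diff_distrib)
  moreover have "smooth (\<lambda>x::real ^ 'a. flat 1 (m * (b $ i - x $ i)))" for i
    using smooth_flat_coordinate[of 1 "- m" i "m * b $ i"] by (simp add: right_diff_distrib)
  ultimately show ?thesis unfolding bump_def[abs_def]
    by (intro smooth_mult smooth_prod) auto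
qed

lemma bump_nonneg: "0 \<le> bump a b m x"
  by (simp add: bump_def prod_nonneg flat_1_bounds)

lemma bump_le_1: "bump a b m x \<le> 1"
  unfolding bump_def by (intro mult_le_one prod_le_1 prod_nonneg) (auto simp: flat_1_bounds)

lemma bump_pos: "x \<in> box a b \<Longrightarrow> m > 0 \<Longrightarrow> 0 < bump a b m x"
  by (auto simp: bump_def mem_box_cart flat_def intro!: mult_pos_pos prod_pos)

lemma bump_zero: "x \<notin> box a b \<Longrightarrow> m > 0 \<Longrightarrow> bump a b m x = 0"
  by (auto simp: bump_def mem_box_cart flat_def not_less zero_less_mult_iff)

lemma bump_test_function:
  assumes "cbox a b \<subseteq> \<Omega>" "m > 0"
  shows "bump a b m \<in> test_functions \<Omega>"
proof -
  have "closure {x. bump a b m x \<noteq> 0} \<subseteq> cbox a b"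
  proof (rule closure_minimal)
    show "{x. bump a b m x \<noteq> 0} \<subseteq> cbox a b"
      using bump_zero[OF _ assms(2)] box_subset_cbox[of a b] by (metis (mono_tags, lifting) mem_Collect_eq subset_iff)
  qed (rule closed_cbox)
  moreover from this have "compact (closure {x. bump a b m x \<noteq> 0})"
    by (meson bounded_cbox bounded_subset closed_closure compact_eq_bounded_closed)
  ultimately show ?thesis
    using assms(1) smooth_bump unfolding test_functions_iff by blast
qed

text \<open>At a point of the box each factor is \<open>exp (- 1 / (m * t))\<close> with a fixed
  \<open>t > 0\<close>, hence tends to \<open>1\<close>; elsewhere every bump already
  vanishes.\<close>

lemma bump_tendsto: "(\<lambda>k. bump a b (real (Suc k)) x) \<longlonglongrightarrow> indicator (box a b) x"
proof (cases "x \<in> box a b")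
  case True
  have 1: "(\<lambda>k. flat 1 (real (Suc k) * t)) \<longlonglongrightarrow> 1" if "t > 0" for t
  proof -
    have "(\<lambda>k. exp (- (inverse (real (Suc k)) * (1 / t)))) \<longlonglongrightarrow> exp (- (0 * (1 / t)))"
      by (intro tendsto_intros LIMSEQ_inverse_real_of_nat)
    moreover have "exp (- (inverse (real (Suc k)) * (1 / t))) = flat 1 (real (Suc k) * t)" for k
    proof -
      have "real (Suc k) * t > 0" using that by (intro mult_pos_pos) auto
      moreover have "inverse (real (Suc k)) * (1 / t) = 1 / (real (Suc k) * t)" by (simp add: field_simps)
      ultimately show ?thesis by (simp add: flat_def)
    qed
    ultimately show ?thesis by simp
  qed
  have "(\<lambda>k. bump a b (real (Suc k)) x) \<longlonglongrightarrow> (\<Prod>i\<in>(UNIV::'a set). 1) * (\<Prod>i\<in>(UNIV::'a set). 1)"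
    unfolding bump_def using True by (intro tendsto_intros 1) (auto simp: mem_box_cart)
  then show ?thesis using True by simp
next
  case False
  then show ?thesis by (simp add: bump_zero)
qed

lemma test_function_bounded_support:
  assumes "\<psi> \<in> test_functions \<Omega>"
  obtains a b where "\<And>x. x \<notin> cbox a b \<Longrightarrow> \<psi> x = 0"
proof -
  have "bounded {x. \<psi> x \<noteq> 0}"
    using assms by (metis test_functions_iff bounded_subset closure_subset compact_imp_bounded)
  then obtain a where "{x. \<psi> x \<noteq> 0} \<subseteq> cbox (- a) a" using bounded_subset_cbox_symmetric by blast
  then show ?thesis by (intro that[of "- a" a]) blast
qed

lemma test_function_zero_outside:
  assumes "\<psi> \<in> test_functions \<Omega>" "x \<notin> \<Omega>"
  shows "\<psi> x = 0"
  using assms closure_subset[of "{x. \<psi> x \<noteq> 0}"] unfolding test_functions_iff by blast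

text \<open>The partial derivatives are bounded on the box by compactness and vanish on its open
  complement; their bounds add up to a Lipschitz constant.\<close>

lemma smooth_compact_support_lipschitz:
  fixes \<psi> :: "real ^ 'n \<Rightarrow> real"
  assumes "smooth \<psi>" "\<And>x. x \<notin> cbox a b \<Longrightarrow> \<psi> x = 0"
  obtains C where "C-lipschitz_on UNIV \<psi>"
proof -
  have "\<exists>B. \<forall>x. \<bar>pdiff i \<psi> x\<bar> \<le> B" for i
  proof -
    have "compact (pdiff i \<psi> ` cbox a b)"
      by (intro compact_continuous_image smooth_continuous_on smooth_pdiff assms compact_cbox)
    then obtain B where B: "\<And>x. x \<in> cbox a b \<Longrightarrow> \<bar>pdiff i \<psi> x\<bar> \<le> B"
      using compact_imp_bounded by (fastforce simp: bounded_iff)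
    have "\<bar>pdiff i \<psi> x\<bar> \<le> \<bar>B\<bar>" for x
    proof (cases "x \<in> cbox a b")
      case False
      then have "(\<psi> has_derivative (\<lambda>h. 0)) (at x)"
        using assms(2)
        by (intro has_derivative_transform_within_open[OF has_derivative_const[of 0] open_Compl[OF closed_cbox[of a b]]]) auto
      from pdiff_eq[OF this, of i] show ?thesis by simp
    qed (use B in force)
    then show ?thesis by blast
  qed
  then obtain B where B: "\<And>i x. \<bar>pdiff i \<psi> x\<bar> \<le> B i" by metis
  have B0: "0 \<le> B i" for i using B[of i undefined] by linarith
  have "(\<Sum>i\<in>UNIV. B i)-lipschitz_on UNIV \<psi>"
  proof (rule bounded_derivative_imp_lipschitz)
    show "(\<psi> has_derivative (\<lambda>h. \<Sum>i\<in>UNIV. h $ i * pdiff i \<psi> x)) (at x within UNIV)" for x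
      using has_derivative_pdiff[OF smooth_differentiable[OF assms(1)]] .
    show "onorm (\<lambda>h::real ^ 'n. \<Sum>i\<in>UNIV. h $ i * pdiff i \<psi> x) \<le> (\<Sum>i\<in>UNIV. B i)" for x
    proof (rule onorm_bound)
      fix h :: "real ^ 'n"
      have "norm (h $ i * pdiff i \<psi> x) \<le> B i * norm h" for i
        using mult_mono[OF B[of i x] component_le_norm_cart[of h i]] B0[of i] by (simp add: abs_mult mult.commute)
      then have "norm (\<Sum>i\<in>UNIV. h $ i * pdiff i \<psi> x) \<le> (\<Sum>i\<in>UNIV. B i * norm h)"
        by (rule sum_norm_le)
      then show "norm (\<Sum>i\<in>UNIV. h $ i * pdiff i \<psi> x) \<le> (\<Sum>i\<in>UNIV. B i) * norm h"
        by (simp add: sum_distrib_right)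
    qed (simp add: sum_nonneg B0)
  qed (simp_all add: sum_nonneg B0)
  then show ?thesis by (rule that)
qed

section \<open>Uniqueness of weak derivatives\<close>

text \<open>Open boxes generate the Borel sets and are stable under intersection, so the vanishing
  of the integral spreads to all Borel sets by a Dynkin argument. The hypothesis on the total
  integral takes care of complements.\<close>

lemma AE_zero_if_box_integrals_zero:
  fixes f :: "'a::euclidean_space \<Rightarrow> real"
  assumes f: "integrable lborel f" and total: "integral\<^sup>L lborel f = 0"
    and box: "\<And>a b. set_lebesgue_integral lborel (box a b) f = 0"
  shows "AE x in lborel. f x = 0"
proof (rule sigma_finite_measure.density_zero[OF sigma_finite_lborel f])
  fix A :: "'a set" assume A: "A \<in> sets lborel"
  have "Int_stable (range (\<lambda>(a, b). box a b :: 'a set))"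
    by (auto simp: Int_stable_def box_Int_box)
  moreover have "range (\<lambda>(a, b). box a b :: 'a set) \<subseteq> Pow UNIV" by auto
  moreover have "A \<in> sigma_sets UNIV (range (\<lambda>(a, b). box a b))"
    using A by (simp add: borel_eq_box)
  ultimately show "set_lebesgue_integral lborel A f = 0"
  proof (induction rule: sigma_sets_induct_disjoint)
    case (basic A) then show ?case using box by auto
  next
    case empty then show ?case by (simp add: set_lebesgue_integral_def)
  next
    case (compl A)
    then have A: "A \<in> sets borel" by (simp add: borel_eq_box)
    have i: "set_integrable lborel A f" "set_integrable lborel UNIV f"
      using f A unfolding set_integrable_def by (intro integrable_mult_indicator; simp)+
    have "(\<lambda>x. indicator (UNIV - A) x *\<^sub>R f x) = (\<lambda>x. f x - indicator A x *\<^sub>R f x)"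
      by (auto simp: indicator_def)
    then show ?case
      using compl total i f unfolding set_lebesgue_integral_def set_integrable_def by simp
  next
    case (union F)
    then have F: "F i \<in> sets lborel" for i by (auto simp: borel_eq_box subset_eq)
    have "set_integrable lborel (\<Union>i. F i) f"
      using f F unfolding set_integrable_def by (intro integrable_mult_indicator) auto
    moreover have "F i \<inter> F j = {}" if "i \<noteq> j" for i j
      using union(1) that by (auto simp: disjoint_family_on_def)
    ultimately show ?case
      using lebesgue_integral_countable_add[of F lborel f, OF F] union(3) by simp
  qed
qed

section \<open>Functions orthogonal to all test functions\<close>

lemma AE_lebesgue_on_iff:
  assumes "S \<in> sets lebesgue"
  shows "(AE x in lebesgue_on S. P x) \<longleftrightarrow> (AE x in lebesgue. x \<in> S \<longrightarrow> P x)"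
  using assms by (subst AE_restrict_space_iff) auto

lemma L2_indicator:
  assumes "B \<in> lmeasurable" "\<Omega> \<in> sets lebesgue"
  shows "(indicator B :: real ^ 'n \<Rightarrow> real) \<in> L2 \<Omega>"
proof (rule L2I)
  have B: "B \<in> sets lebesgue" using assms(1) by (simp add: fmeasurableD)
  show m: "(indicator B :: real ^ 'n \<Rightarrow> real) \<in> borel_measurable (lebesgue_on \<Omega>)"
    using B by (intro measurable_restrict_space1 borel_measurable_indicator)
  have "integrable lebesgue (\<lambda>x. indicator \<Omega> x *\<^sub>R (indicator B x :: real))"
    using assms B by (intro integrable_mult_indicator) (auto simp: fmeasurable_def)
  then have "integrable (lebesgue_on \<Omega>) (indicator B :: real ^ 'n \<Rightarrow> real)"
    using assms(2) by (subst integrable_restrict_space) auto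
  moreover have "(norm (indicator B x :: real))\<^sup>2 = indicator B x" for x :: "real ^ 'n"
    by (simp add: indicator_def)
  ultimately show "integrable (lebesgue_on \<Omega>) (\<lambda>x. (norm (indicator B x :: real))\<^sup>2)" by simp
qed

text \<open>The indicator of the box is the limit of bumps of growing steepness. They are test
  functions because the closed box lies in the domain, and \<open>d\<close> restricted to the box
  dominates their products with \<open>d\<close>.\<close>

lemma L2_orthogonal_boxes:
  fixes d :: "real ^ 'n \<Rightarrow> real"
  assumes \<Omega>: "open \<Omega>" and d: "d \<in> L2 \<Omega>"
    and ortho: "\<And>\<psi>. \<psi> \<in> test_functions \<Omega> \<Longrightarrow> L2_inner \<Omega> d \<psi> = 0"
    and sub: "cbox a b \<subseteq> \<Omega>"
  shows "L2_inner \<Omega> d (indicator (box a b)) = 0"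
proof -
  have "(\<lambda>k. L2_inner \<Omega> d (bump a b (real (Suc k)))) \<longlonglongrightarrow> L2_inner \<Omega> d (indicator (box a b))"
    unfolding L2_inner_def
  proof (rule integral_dominated_convergence)
    have ind: "(indicator (box a b) :: real ^ 'n \<Rightarrow> real) \<in> L2 \<Omega>"
      using \<Omega> by (intro L2_indicator) auto
    show "integrable (lebesgue_on \<Omega>) (\<lambda>x. norm (inner (d x) (indicator (box a b) x)))"
      by (intro integrable_norm L2_inner_integrable d ind)
    show "(\<lambda>x. inner (d x) (indicator (box a b) x)) \<in> borel_measurable (lebesgue_on \<Omega>)"
      using L2_inner_integrable[OF d ind] by (rule borel_measurable_integrable)
    show "(\<lambda>x. inner (d x) (bump a b (real (Suc k)) x)) \<in> borel_measurable (lebesgue_on \<Omega>)" for k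
      using \<Omega> by (intro borel_measurable_inner L2_measurable[OF d] continuous_imp_measurable_on_sets_lebesgue
          smooth_continuous_on smooth_bump) auto
    show "AE x in lebesgue_on \<Omega>. (\<lambda>k. inner (d x) (bump a b (real (Suc k)) x)) \<longlonglongrightarrow> inner (d x) (indicator (box a b) x)"
      by (intro AE_I2 tendsto_intros bump_tendsto)
    show "AE x in lebesgue_on \<Omega>. norm (inner (d x) (bump a b (real (Suc k)) x)) \<le> norm (inner (d x) (indicator (box a b) x))" for k
    proof (intro AE_I2)
      fix x
      show "norm (inner (d x) (bump a b (real (Suc k)) x)) \<le> norm (inner (d x) (indicator (box a b) x))"
        by (cases "x \<in> box a b")
          (use bump_nonneg[of a b "real (Suc k)" x] bump_le_1[of a b "real (Suc k)" x] in
            \<open>auto simp: bump_zero abs_mult mult_left_le\<close>)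
    qed
  qed
  moreover have "L2_inner \<Omega> d (bump a b (real (Suc k))) = 0" for k
    using sub by (intro ortho bump_test_function) auto
  ultimately show ?thesis by (simp add: LIMSEQ_const_iff)
qed

text \<open>The fundamental lemma of the calculus of variations. Countably many closed boxes cover
  the domain, so one box inside it is enough; there \<open>d\<close>, cut off to the open box, has
  integral zero over every box.\<close>

lemma L2_orthogonal_test_functions_zero:
  fixes d :: "real ^ 'n \<Rightarrow> real"
  assumes \<Omega>: "open \<Omega>" and d: "d \<in> L2 \<Omega>"
    and ortho: "\<And>\<psi>. \<psi> \<in> test_functions \<Omega> \<Longrightarrow> L2_inner \<Omega> d \<psi> = 0"
  shows "AE x in lebesgue_on \<Omega>. d x = 0"
proof -
  have \<Omega>m: "\<Omega> \<in> sets lebesgue" using \<Omega> by auto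
  have boxes: "AE x in lebesgue. x \<in> cbox a b \<longrightarrow> d x = 0" if sub: "cbox a b \<subseteq> \<Omega>" for a b
  proof -
    \<comment> \<open>The cut-off makes the function integrable on the whole space, and an integral
      of it over any box becomes an integral of \<open>d\<close> over an intersection of two
      boxes.\<close>
    define F where "F = (\<lambda>x. indicator \<Omega> x *\<^sub>R (inner (d x) (indicator (box a b) x :: real)))"
    have "integrable (lebesgue_on \<Omega>) (\<lambda>x. inner (d x) (indicator (box a b) x))"
      by (intro L2_inner_integrable d L2_indicator \<Omega>m) auto
    then have F: "integrable lebesgue F"
      unfolding F_def using \<Omega>m by (subst (asm) integrable_restrict_space) auto
    \<comment> \<open>\<open>d\<close> is only Lebesgue measurable, while the Dynkin argument runs
      over Borel sets; hence the passage to a Borel representative.\<close>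
    obtain f where f: "f \<in> borel_measurable lborel" "AE x in lborel. F x = f x"
      using completion_ex_borel_measurable_real[OF borel_measurable_integrable[OF F]] by blast
    have ae: "AE x in lebesgue. F x = f x" using f(2) by (rule AE_completion)
    have fl: "f \<in> borel_measurable lebesgue" using f(1) by (rule measurable_completion)
    have "integrable lebesgue f"
      using F integrable_cong_AE[OF borel_measurable_integrable[OF F] fl ae] by blast
    then have fi: "integrable lborel f" using f(1) by (simp add: integrable_completion)
    have box0: "set_lebesgue_integral lborel (box c e) f = 0" for c e
    proof -
      have m: "(\<lambda>x. indicator (box c e) x *\<^sub>R f x) \<in> borel_measurable lborel"
        using f(1) by (intro borel_measurable_scaleR borel_measurable_indicator) auto
      obtain p q where pq: "box p q = box a b \<inter> box c e" by (auto simp: box_Int_box)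
      have "set_lebesgue_integral lborel (box c e) f = integral\<^sup>L lebesgue (\<lambda>x. indicator (box c e) x *\<^sub>R f x)"
        unfolding set_lebesgue_integral_def using integral_completion[OF m[simplified measurable_lborel1]] by simp
      also have "\<dots> = integral\<^sup>L lebesgue (\<lambda>x. indicator (box c e) x *\<^sub>R F x)"
      proof (rule integral_cong_AE)
        show "AE x in lebesgue. indicator (box c e) x *\<^sub>R f x = indicator (box c e) x *\<^sub>R F x"
          using ae by eventually_elim simp
      qed (use fl borel_measurable_integrable[OF F] in \<open>auto intro!: borel_measurable_scaleR borel_measurable_indicator simp del: real_scaleR_def\<close>)
      also have "\<dots> = integral\<^sup>L lebesgue (\<lambda>x. indicator \<Omega> x *\<^sub>R inner (d x) (indicator (box p q) x))"
        by (rule Bochner_Integration.integral_cong) (auto simp: F_def pq indicator_def)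
      also have "\<dots> = L2_inner \<Omega> d (indicator (box p q))"
        unfolding L2_inner_def using \<Omega>m by (subst integral_restrict_space) auto
      also have "\<dots> = 0"
      proof (cases "box p q = {}")
        case True
        then show ?thesis by (simp add: L2_inner_def)
      next
        case False
        \<comment> \<open>The closed box is the closure of the open one only if the latter is
          nonempty. This is what keeps \<open>cbox p q\<close> inside the domain.\<close>
        then have "cbox p q = closure (box p q)" by (simp add: closure_box)
        also have "\<dots> \<subseteq> cbox a b"
          using pq box_subset_cbox[of a b] by (intro closure_minimal closed_cbox) auto
        finally show ?thesis
          using sub by (intro L2_orthogonal_boxes[OF \<Omega> d ortho]) auto
      qed
      finally show ?thesis .
    qed
    have "integral\<^sup>L lborel f = integral\<^sup>L lborel (\<lambda>x. indicator (box a b) x *\<^sub>R f x)"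
    proof (rule integral_cong_AE)
      show "AE x in lborel. f x = indicator (box a b) x *\<^sub>R f x"
        using f(2) by eventually_elim (auto simp: F_def indicator_def split: if_splits)
    qed (use f(1) in \<open>auto intro!: borel_measurable_scaleR borel_measurable_indicator\<close>)
    also have "\<dots> = 0" using box0[of a b] by (simp add: set_lebesgue_integral_def)
    finally have "AE x in lborel. f x = 0"
      by (intro AE_zero_if_box_integrals_zero fi box0)
    then have "AE x in lebesgue. f x = 0" by (rule AE_completion)
    \<comment> \<open>The faces, where \<open>F\<close> does not see \<open>d\<close>, form a null
      set.\<close>
    moreover have "AE x in lebesgue. x \<notin> cbox a b - box a b"
      by (intro AE_not_in) (metis negligible_iff_null_sets negligible_frontier_interval)
    ultimately show ?thesis
      using ae
    proof eventually_elim
      case (elim x)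
      show ?case
      proof
        assume x: "x \<in> cbox a b"
        then have "x \<in> box a b" "x \<in> \<Omega>" using elim sub by auto
        then show "d x = 0" using elim by (auto simp: F_def)
      qed
    qed
  qed
  obtain \<D> where \<D>: "countable \<D>" "\<D> \<subseteq> Pow \<Omega>" "\<And>X. X \<in> \<D> \<Longrightarrow> \<exists>a b. X = cbox a b" "\<Union>\<D> = \<Omega>"
    using open_countable_Union_open_cbox[OF \<Omega>] by metis
  have "\<forall>X\<in>\<D>. AE x in lebesgue. x \<in> X \<longrightarrow> d x = 0"
    using \<D>(2,3) boxes by blast
  then have "AE x in lebesgue. \<forall>X\<in>\<D>. x \<in> X \<longrightarrow> d x = 0"
    by (subst AE_ball_countable[OF \<D>(1)])
  then have "AE x in lebesgue. x \<in> \<Omega> \<longrightarrow> d x = 0"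
    by eventually_elim (use \<D>(4) in blast)
  then show ?thesis by (simp add: AE_lebesgue_on_iff[OF \<Omega>m])
qed

lemma test_functions_smooth: "\<psi> \<in> test_functions \<Omega> \<Longrightarrow> smooth \<psi>"
  by (simp add: test_functions_iff)

lemma test_function_L2:
  assumes "open \<Omega>" "bounded \<Omega>" "smooth \<psi>"
  shows "\<psi> \<in> L2 \<Omega>"
  using assms by (intro L2_continuous smooth_continuous_on)

lemma has_weak_deriv_L2: "has_weak_deriv \<Omega> \<alpha> u g \<Longrightarrow> g \<in> L2 \<Omega>"
  by (simp add: has_weak_deriv_def)

text \<open>Two weak derivatives have the same products with all test functions, so their difference
  is orthogonal to them. The list \<open>is\<close> is a witness that the condition in
  \<open>has_weak_deriv\<close>, which ranges over lists of this multiplicity, is not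
  vacuous.\<close>

lemma has_weak_deriv_unique:
  assumes \<Omega>: "open \<Omega>" "bounded \<Omega>" and g: "has_weak_deriv \<Omega> \<alpha> u g" and k: "has_weak_deriv \<Omega> \<alpha> u k"
    and ex: "count_list is = \<alpha>"
  shows "AE x in lebesgue_on \<Omega>. g x = k x"
proof -
  have L: "g \<in> L2 \<Omega>" "k \<in> L2 \<Omega>" using g k by (auto simp: has_weak_deriv_def)
  have "AE x in lebesgue_on \<Omega>. g x - k x = 0"
  proof (rule L2_orthogonal_test_functions_zero[OF \<Omega>(1) L2_diff[OF L]])
    fix \<psi> assume t: "\<psi> \<in> test_functions \<Omega>"
    have "(- 1) ^ sum \<alpha> UNIV * L2_inner \<Omega> g \<psi> = (- 1) ^ sum \<alpha> UNIV * L2_inner \<Omega> k \<psi>"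
      using g k t ex unfolding has_weak_deriv_def by metis
    then have "L2_inner \<Omega> g \<psi> = L2_inner \<Omega> k \<psi>" by simp
    then show "L2_inner \<Omega> (\<lambda>x. g x - k x) \<psi> = 0"
      using L2_inner_diff_left[OF L test_function_L2[OF \<Omega> test_functions_smooth[OF t]]] by simp
  qed
  then show ?thesis by simp
qed

lemma weak_deriv_AE:
  assumes "open \<Omega>" "bounded \<Omega>" "has_weak_deriv \<Omega> \<alpha> u g" "count_list is = \<alpha>"
  shows "AE x in lebesgue_on \<Omega>. weak_deriv \<Omega> \<alpha> u x = g x"
proof -
  have "has_weak_deriv \<Omega> \<alpha> u (weak_deriv \<Omega> \<alpha> u)"
    unfolding weak_deriv_def using someI[of "has_weak_deriv \<Omega> \<alpha> u", OF assms(3)] by simp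
  then show ?thesis using has_weak_deriv_unique assms by blast
qed

lemma has_weak_deriv_weak_deriv:
  "has_weak_deriv \<Omega> \<alpha> u g \<Longrightarrow> has_weak_deriv \<Omega> \<alpha> u (weak_deriv \<Omega> \<alpha> u)"
  unfolding weak_deriv_def by (rule someI[of "has_weak_deriv \<Omega> \<alpha> u"])

text \<open>Weak derivatives and all norms only see values inside the domain. This and the following
  congruences later allow a finite element function to be replaced by its extension by zero.\<close>

lemma has_weak_deriv_cong:
  assumes "\<And>x. x \<in> \<Omega> \<Longrightarrow> u x = v x"
  shows "has_weak_deriv \<Omega> \<alpha> u = has_weak_deriv \<Omega> \<alpha> v"
  unfolding has_weak_deriv_def[abs_def] using L2_inner_cong[of \<Omega> u v, OF assms refl] by simp

lemma weak_deriv_cong: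
  assumes "\<And>x. x \<in> \<Omega> \<Longrightarrow> u x = v x"
  shows "weak_deriv \<Omega> \<alpha> u = weak_deriv \<Omega> \<alpha> v"
  unfolding weak_deriv_def using has_weak_deriv_cong[of \<Omega> u v, OF assms] by simp

lemma weak_grad_cong:
  assumes "\<And>x. x \<in> \<Omega> \<Longrightarrow> u x = v x"
  shows "weak_grad \<Omega> u = weak_grad \<Omega> v"
  unfolding weak_grad_def[abs_def] using weak_deriv_cong[of \<Omega> u v, OF assms] by simp

lemma sobolev_cong:
  assumes "\<And>x. x \<in> \<Omega> \<Longrightarrow> u x = v x"
  shows "u \<in> sobolev s \<Omega> \<longleftrightarrow> v \<in> sobolev s \<Omega>"
  unfolding sobolev_def using has_weak_deriv_cong[of \<Omega> u v, OF assms] L2_cong[of \<Omega> u v, OF assms] by simp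

lemma sobolev_norm_cong:
  assumes "\<And>x. x \<in> \<Omega> \<Longrightarrow> u x = v x"
  shows "sobolev_norm s \<Omega> u = sobolev_norm s \<Omega> v"
  unfolding sobolev_norm_def using weak_deriv_cong[of \<Omega> u v, OF assms] by simp

lemma H10_cong:
  assumes "\<And>x. x \<in> \<Omega> \<Longrightarrow> u x = v x"
  shows "u \<in> H10 \<Omega> \<longleftrightarrow> v \<in> H10 \<Omega>"
proof -
  have "sobolev_norm 1 \<Omega> (\<lambda>x. u x - w x) = sobolev_norm 1 \<Omega> (\<lambda>x. v x - w x)" for w
    by (rule sobolev_norm_cong) (simp add: assms)
  then show ?thesis unfolding H10_def using sobolev_cong[of \<Omega> u v, OF assms] by simp
qed

section \<open>Weak derivatives of Lipschitz functions\<close>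

text \<open>The integral of each difference quotient vanishes because Lebesgue measure is
  translation invariant, and the Lipschitz bound permits the limit by dominated convergence.
  Differentiability is needed only almost everywhere, which suits functions with kinks at cell
  interfaces.\<close>

lemma integral_partial_derivative_zero:
  fixes \<phi> D :: "real ^ 'n \<Rightarrow> real"
  assumes lip: "C-lipschitz_on UNIV \<phi>" and supp: "\<And>x. x \<notin> cbox a b \<Longrightarrow> \<phi> x = 0"
    and D: "D \<in> borel_measurable lebesgue"
    and lim: "AE x in lebesgue. (\<lambda>k. real (Suc k) * (\<phi> (x + inverse (real (Suc k)) *\<^sub>R axis i 1) - \<phi> x)) \<longlonglongrightarrow> D x"
  shows "integral\<^sup>L lebesgue D = 0"
proof -
  have cont: "continuous_on UNIV \<phi>" using lip by (rule lipschitz_on_continuous_on)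
  have meas: "\<phi> \<in> borel_measurable borel" using cont by (rule borel_measurable_continuous_onI)
  let ?e = "\<lambda>k. inverse (real (Suc k)) *\<^sub>R (axis i 1 :: real ^ 'n)"
  let ?q = "\<lambda>k x. real (Suc k) * (\<phi> (x + ?e k) - \<phi> x)"
  have "(\<lambda>k. integral\<^sup>L lebesgue (?q k)) \<longlonglongrightarrow> integral\<^sup>L lebesgue D"
  proof (rule integral_dominated_convergence)
    \<comment> \<open>The shifts have length at most \<open>1\<close>, so the box enlarged by
      \<open>1\<close> on each side contains the supports of all difference quotients.\<close>
    show "integrable lebesgue (\<lambda>x. C * indicator (cbox (a - 1) (b + 1)) x)"
      using lmeasurable_cbox[of "a - 1" "b + 1"] by (intro integrable_mult_right) (auto simp: fmeasurable_def)
    show "?q k \<in> borel_measurable lebesgue" for k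
    proof -
      have "continuous_on UNIV (?q k)"
        by (intro continuous_intros continuous_on_compose2[OF cont]) auto
      then show ?thesis by (intro measurable_completion) (auto intro: borel_measurable_continuous_onI)
    qed
    show "AE x in lebesgue. norm (?q k x) \<le> C * indicator (cbox (a - 1) (b + 1)) x" for k
    proof (intro AE_I2)
      fix x :: "real ^ 'n"
      show "norm (?q k x) \<le> C * indicator (cbox (a - 1) (b + 1)) x"
      proof (cases "x \<in> cbox (a - 1) (b + 1)")
        case True
        have "\<bar>\<phi> (x + ?e k) - \<phi> x\<bar> \<le> C * norm (?e k)"
          using lipschitz_onD[OF lip, of "x + ?e k" x] by (simp add: dist_norm)
        also have "norm (?e k) = inverse (real (Suc k))" by (simp add: norm_axis_1)
        finally have "real (Suc k) * \<bar>\<phi> (x + ?e k) - \<phi> x\<bar> \<le> real (Suc k) * (C * inverse (real (Suc k)))"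
          by (intro mult_left_mono) auto
        also have "\<dots> = C" by simp
        finally have "\<bar>?q k x\<bar> \<le> C" by (simp only: abs_mult abs_of_nat)
        then show ?thesis using True by simp
      next
        case False
        then obtain j where j: "x $ j < a $ j - 1 \<or> x $ j > b $ j + 1"
          by (auto simp: mem_box_cart not_le)
        have "0 \<le> ?e k $ j" "?e k $ j \<le> 1" by (auto simp: axis_def inverse_le_1_iff)
        then have "\<not> (a $ j \<le> x $ j \<and> x $ j \<le> b $ j)" "\<not> (a $ j \<le> (x + ?e k) $ j \<and> (x + ?e k) $ j \<le> b $ j)"
          using j unfolding vector_add_component by linarith+
        then have "x \<notin> cbox a b" "x + ?e k \<notin> cbox a b"
          unfolding mem_box_cart by blast+
        then have "\<phi> x = 0" "\<phi> (x + ?e k) = 0" using supp by blast+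
        then show ?thesis using False by simp
      qed
    qed
  qed (use D lim in auto)
  moreover have "integral\<^sup>L lebesgue (?q k) = 0" for k
  proof -
    have "(\<lambda>x. indicator (cbox a b) x *\<^sub>R \<phi> x) = \<phi>"
      by (auto simp: fun_eq_iff indicator_def supp)
    then have int: "integrable lborel \<phi>"
      using borel_integrable_compact[OF compact_cbox[of a b] continuous_on_subset[OF cont]] by simp
    have shift: "integrable lborel (\<lambda>x. \<phi> (x + e)) \<and> integral\<^sup>L lborel (\<lambda>x. \<phi> (x + e)) = integral\<^sup>L lborel \<phi>" for e
      using integral_distr[of "(+) e" lborel borel \<phi>] integrable_distr_eq[of "(+) e" lborel borel \<phi>] int meas
      by (simp add: lborel_distr_plus add.commute)
    have "integral\<^sup>L lebesgue (?q k) = integral\<^sup>L lborel (?q k)"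
      by (intro integral_completion borel_measurable_times borel_measurable_diff borel_measurable_const meas
          measurable_compose[OF _ meas]) auto
    also have "\<dots> = real (Suc k) * (integral\<^sup>L lborel (\<lambda>x. \<phi> (x + ?e k)) - integral\<^sup>L lborel \<phi>)"
      using shift[of "?e k"] int by simp
    finally show ?thesis using shift by simp
  qed
  ultimately show ?thesis by (simp add: LIMSEQ_const_iff)
qed

lemma has_derivative_difference_quotients:
  fixes f :: "'a::real_normed_vector \<Rightarrow> real"
  assumes "(f has_derivative f') (at x)"
  shows "(\<lambda>k. real (Suc k) * (f (x + inverse (real (Suc k)) *\<^sub>R h) - f x)) \<longlonglongrightarrow> f' h"
proof -
  have "((\<lambda>t. x + t *\<^sub>R h) has_derivative (\<lambda>t. t *\<^sub>R h)) (at 0)"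
    by (auto intro!: derivative_eq_intros)
  moreover have "(f has_derivative f') (at (x + 0 *\<^sub>R h))" using assms by simp
  ultimately have "((\<lambda>t. f (x + t *\<^sub>R h)) has_derivative (\<lambda>t. f' (t *\<^sub>R h))) (at 0)"
    by (rule has_derivative_compose)
  moreover have "(\<lambda>t. f' (t *\<^sub>R h)) = (*) (f' h)"
    using linear_cmul[OF has_derivative_linear[OF assms]] by (auto simp: mult.commute)
  ultimately have "((\<lambda>t. f (x + t *\<^sub>R h)) has_real_derivative f' h) (at 0)"
    by (simp add: has_field_derivative_def)
  then have "((\<lambda>t. (f (x + t *\<^sub>R h) - f x) / t) \<longlongrightarrow> f' h) (at 0)"
    by (simp add: DERIV_def)
  moreover have "filterlim (\<lambda>k. inverse (real (Suc k))) (at 0) sequentially"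
    using LIMSEQ_inverse_real_of_nat by (simp add: filterlim_at)
  ultimately have "(\<lambda>k. (f (x + inverse (real (Suc k)) *\<^sub>R h) - f x) / inverse (real (Suc k))) \<longlonglongrightarrow> f' h"
    by (rule filterlim_compose)
  then show ?thesis by (simp add: divide_inverse mult.commute)
qed

text \<open>A relational counterpart of the chosen \<open>weak_grad\<close>: sums, multiples and
  explicit gradients can be handled as witnesses, and the choice enters only through
  uniqueness.\<close>

definition has_weak_grad :: "(real ^ 'n) set \<Rightarrow> (real ^ 'n \<Rightarrow> real) \<Rightarrow> (real ^ 'n \<Rightarrow> real ^ 'n) \<Rightarrow> bool" where
  "has_weak_grad \<Omega> u D \<longleftrightarrow> (\<forall>i. has_weak_deriv \<Omega> (\<lambda>j. if j = i then 1 else 0) u (\<lambda>x. D x $ i))"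

lemma count_list_single: "count_list [i] = (\<lambda>j. if j = i then 1 else 0)"
  by auto

text \<open>For a unit multi-index the quantification over lists of directions in
  \<open>has_weak_deriv\<close> collapses to a single list.\<close>

lemma count_list_eq_single_iff: "count_list is = (\<lambda>j. if j = i then 1 else 0) \<longleftrightarrow> is = [i]"
proof
  assume h: "count_list is = (\<lambda>j. if j = i then 1 else 0)"
  show "is = [i]"
  proof (cases "is")
    case Nil
    then show ?thesis using fun_cong[OF h, of i] by simp
  next
    case (Cons a js)
    then have "a = i" using fun_cong[OF h, of a] by (simp split: if_splits)
    then have "count_list js j = 0" for j
      using fun_cong[OF h, of j] Cons by (simp split: if_splits)
    then have "set js = {}" by (metis count_list_0_iff equals0I)
    then show ?thesis using Cons \<open>a = i\<close> by simp
  qed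
qed (use count_list_single in metis)

lemma sum_single: "sum (\<lambda>j::'n::finite. if j = i then 1 else 0 :: nat) UNIV = 1"
  by simp

lemma has_weak_deriv_single_iff:
  "has_weak_deriv \<Omega> (\<lambda>j. if j = i then 1 else 0) u g \<longleftrightarrow>
     g \<in> L2 \<Omega> \<and> (\<forall>\<psi>\<in>test_functions \<Omega>. L2_inner \<Omega> u (pdiff i \<psi>) = - L2_inner \<Omega> g \<psi>)"
  unfolding has_weak_deriv_def count_list_eq_single_iff sum_single by simp

lemma has_weak_deriv_0:
  assumes "u \<in> L2 \<Omega>"
  shows "has_weak_deriv \<Omega> (\<lambda>j. 0) u u"
proof -
  have nil: "is = []" if "count_list is = (\<lambda>j. 0)" for "is" :: "'a list"
    using that by (cases "is") (auto dest!: fun_cong[where x="hd is"])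
  have "L2_inner \<Omega> u (pdiffs is \<psi>) = L2_inner \<Omega> u \<psi>" if "count_list is = (\<lambda>j. 0)" for \<psi> "is"
    using nil[OF that] by simp
  then show ?thesis using assms by (simp add: has_weak_deriv_def)
qed

lemma borel_measurable_component:
  fixes D :: "'a \<Rightarrow> real ^ 'm"
  assumes "D \<in> borel_measurable M"
  shows "(\<lambda>x. D x $ i) \<in> borel_measurable M"
  using borel_measurable_inner[OF assms borel_measurable_const[of "axis i 1"]] by (simp add: inner_axis)

lemma norm_power2_component: "(norm x)\<^sup>2 = (\<Sum>i\<in>UNIV. (norm (x $ i))\<^sup>2)" for x :: "real ^ 'n"
  by (simp add: norm_vec_def L2_set_def sum_nonneg)

lemma L2_vec_iff:
  fixes D :: "real ^ 'n \<Rightarrow> real ^ 'm"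
  shows "D \<in> L2 \<Omega> \<longleftrightarrow> (\<forall>i. (\<lambda>x. D x $ i) \<in> L2 \<Omega>)"
proof
  assume D: "D \<in> L2 \<Omega>"
  show "\<forall>i. (\<lambda>x. D x $ i) \<in> L2 \<Omega>"
  proof
    fix i
    have m: "(\<lambda>x. D x $ i) \<in> borel_measurable (lebesgue_on \<Omega>)"
      using L2_measurable[OF D] by (rule borel_measurable_component)
    show "(\<lambda>x. D x $ i) \<in> L2 \<Omega>"
    proof (rule L2I[OF m], rule Bochner_Integration.integrable_bound[OF L2_integrable_norm[OF D]])
      show "AE x in lebesgue_on \<Omega>. norm ((norm (D x $ i))\<^sup>2) \<le> norm ((norm (D x))\<^sup>2)"
      proof (intro AE_I2)
        fix x
        have "(norm (D x $ i))\<^sup>2 \<le> (norm (D x))\<^sup>2"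
          using component_le_norm_cart[of "D x" i] by (intro power_mono) auto
        then show "norm ((norm (D x $ i))\<^sup>2) \<le> norm ((norm (D x))\<^sup>2)" by simp
      qed
    qed (use m in simp)
  qed
next
  assume h: "\<forall>i. (\<lambda>x. D x $ i) \<in> L2 \<Omega>"
  show "D \<in> L2 \<Omega>"
  proof (rule L2I)
    show "D \<in> borel_measurable (lebesgue_on \<Omega>)"
    proof (subst borel_measurable_euclidean_space, intro ballI)
      fix b :: "real ^ 'm" assume "b \<in> Basis"
      then obtain i where "b = axis i 1" by (auto simp: Basis_vec_def)
      then show "(\<lambda>x. inner (D x) b) \<in> borel_measurable (lebesgue_on \<Omega>)"
        using h L2_measurable by (auto simp: inner_axis)
    qed
    have "(norm (D x))\<^sup>2 = (\<Sum>i\<in>UNIV. (norm (D x $ i))\<^sup>2)" for x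
      by (rule norm_power2_component)
    then show "integrable (lebesgue_on \<Omega>) (\<lambda>x. (norm (D x))\<^sup>2)"
      using h by (auto intro!: Bochner_Integration.integrable_sum L2_integrable_norm simp del: real_norm_def power2_abs)
  qed
qed

lemma L2_norm_vec:
  fixes D :: "real ^ 'n \<Rightarrow> real ^ 'm"
  assumes "D \<in> L2 \<Omega>"
  shows "(L2_norm \<Omega> D)\<^sup>2 = (\<Sum>i\<in>UNIV. (L2_norm \<Omega> (\<lambda>x. D x $ i))\<^sup>2)"
proof -
  have "(norm (D x))\<^sup>2 = (\<Sum>i\<in>UNIV. (norm (D x $ i))\<^sup>2)" for x
    by (rule norm_power2_component)
  then show ?thesis
    unfolding L2_norm_power2
    using assms[unfolded L2_vec_iff] by (subst Bochner_Integration.integral_sum[symmetric]) (auto intro!: L2_integrable_norm simp del: real_norm_def)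
qed

lemma has_weak_grad_L2: "has_weak_grad \<Omega> u D \<Longrightarrow> D \<in> L2 \<Omega>"
  unfolding has_weak_grad_def L2_vec_iff using has_weak_deriv_L2 by blast

lemma has_weak_grad_weak_grad:
  assumes "has_weak_grad \<Omega> u D"
  shows "has_weak_grad \<Omega> u (weak_grad \<Omega> u)"
  using assms has_weak_deriv_weak_deriv unfolding has_weak_grad_def weak_grad_def by fastforce

lemma has_weak_grad_unique:
  assumes "open \<Omega>" "bounded \<Omega>" "has_weak_grad \<Omega> u D" "has_weak_grad \<Omega> u E"
  shows "AE x in lebesgue_on \<Omega>. D x = E x"
proof -
  have "AE x in lebesgue_on \<Omega>. \<forall>i\<in>UNIV. D x $ i = E x $ i"
    using assms(3,4) unfolding has_weak_grad_def
    by (intro AE_finite_allI has_weak_deriv_unique[OF assms(1,2) _ _ count_list_single]) (rule finite | erule spec)+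
  then show ?thesis by eventually_elim (simp add: Finite_Cartesian_Product.vec_eq_iff)
qed

text \<open>The point of transfer: the norm of the chosen gradient is computed from any
  representative.\<close>

lemma L2_norm_has_weak_grad:
  assumes "open \<Omega>" "bounded \<Omega>" "has_weak_grad \<Omega> u D"
  shows "L2_norm \<Omega> (weak_grad \<Omega> u) = L2_norm \<Omega> D"
  using assms has_weak_grad_weak_grad[OF assms(3)]
  by (intro L2_norm_cong_AE has_weak_grad_unique[of \<Omega> u]) (auto intro!: L2_measurable dest: has_weak_grad_L2)

lemma has_weak_grad_add:
  assumes \<Omega>: "open \<Omega>" "bounded \<Omega>" and "u \<in> L2 \<Omega>" "v \<in> L2 \<Omega>" "has_weak_grad \<Omega> u D" "has_weak_grad \<Omega> v E"
  shows "has_weak_grad \<Omega> (\<lambda>x. u x + v x) (\<lambda>x. D x + E x)"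
  unfolding has_weak_grad_def has_weak_deriv_single_iff
proof (intro allI conjI ballI)
  fix i
  have D: "(\<lambda>x. D x $ i) \<in> L2 \<Omega>" and E: "(\<lambda>x. E x $ i) \<in> L2 \<Omega>"
    using assms by (auto simp: has_weak_grad_def has_weak_deriv_def)
  show "(\<lambda>x. (D x + E x) $ i) \<in> L2 \<Omega>" using L2_add[OF D E] by simp
  fix \<psi> assume t: "\<psi> \<in> test_functions \<Omega>"
  have p: "\<psi> \<in> L2 \<Omega>" "pdiff i \<psi> \<in> L2 \<Omega>"
    using t test_functions_smooth smooth_pdiff \<Omega> by (auto intro!: test_function_L2)
  show "L2_inner \<Omega> (\<lambda>x. u x + v x) (pdiff i \<psi>) = - L2_inner \<Omega> (\<lambda>x. (D x + E x) $ i) \<psi>"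
    using assms t L2_inner_add_left[OF assms(3,4) p(2)] L2_inner_add_left[OF D E p(1)]
    by (simp add: has_weak_grad_def has_weak_deriv_single_iff)
qed

lemma L2_inner_cmult_left:
  fixes g :: "real ^ 'n \<Rightarrow> real"
  shows "L2_inner \<Omega> (\<lambda>x. c * g x) l = c * L2_inner \<Omega> g l"
  using L2_inner_scaleR_left[of \<Omega> c g l] by simp

lemma has_weak_grad_cmult:
  assumes "has_weak_grad \<Omega> u D"
  shows "has_weak_grad \<Omega> (\<lambda>x. c * u x) (\<lambda>x. c *\<^sub>R D x)"
  using assms L2_cmult[of _ \<Omega> c] unfolding has_weak_grad_def has_weak_deriv_single_iff
  by (simp add: L2_inner_cmult_left)

lemma has_weak_grad_diff:
  assumes "open \<Omega>" "bounded \<Omega>" "u \<in> L2 \<Omega>" "v \<in> L2 \<Omega>" "has_weak_grad \<Omega> u D" "has_weak_grad \<Omega> v E"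
  shows "has_weak_grad \<Omega> (\<lambda>x. u x - v x) (\<lambda>x. D x - E x)"
  using has_weak_grad_add[OF assms(1,2,3) L2_cmult[OF assms(4), of "-1"] assms(5) has_weak_grad_cmult[OF assms(6), of "-1"]]
  by simp

lemma multi_indices_le_1:
  "{\<alpha> :: 'n::finite \<Rightarrow> nat. sum \<alpha> UNIV \<le> 1} = insert (\<lambda>j. 0) (range (\<lambda>i j. if j = i then 1 else 0))" (is "?A = ?B")
proof
  show "?B \<subseteq> ?A" by auto
  show "?A \<subseteq> ?B"
  proof
    fix \<alpha> :: "'n \<Rightarrow> nat" assume "\<alpha> \<in> ?A"
    then have le: "sum \<alpha> UNIV \<le> 1" by simp
    show "\<alpha> \<in> ?B"
    proof (cases "\<alpha> = (\<lambda>j. 0)")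
      case False
      then obtain i where i: "\<alpha> i \<noteq> 0" by blast
      have split: "sum \<alpha> UNIV = \<alpha> i + sum \<alpha> (UNIV - {i})" by (simp add: sum.remove)
      have 1: "\<alpha> i = 1" using split le i by linarith
      have "sum \<alpha> (UNIV - {i}) = 0" using split le i by linarith
      then have "\<forall>j\<in>UNIV - {i}. \<alpha> j = 0" using sum_eq_0_iff[of "UNIV - {i}" \<alpha>] by simp
      then have "\<alpha> = (\<lambda>j. if j = i then 1 else 0)" using 1 by (auto simp: fun_eq_iff)
      then show ?thesis by blast
    qed simp
  qed
qed

lemma sobolev_1_iff:
  "u \<in> sobolev 1 \<Omega> \<longleftrightarrow> u \<in> L2 \<Omega> \<and> (\<exists>D. has_weak_grad \<Omega> u D)"
proof
  assume u: "u \<in> sobolev 1 \<Omega>"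
  have "\<exists>g. has_weak_deriv \<Omega> (\<lambda>j. if j = i then 1 else 0) u g" for i
    using u unfolding sobolev_def by simp
  then obtain g where "\<And>i. has_weak_deriv \<Omega> (\<lambda>j. if j = i then 1 else 0) u (g i)" by metis
  then have "has_weak_grad \<Omega> u (\<lambda>x. \<chi> i. g i x)" by (simp add: has_weak_grad_def)
  then show "u \<in> L2 \<Omega> \<and> (\<exists>D. has_weak_grad \<Omega> u D)" using u by (auto simp: sobolev_def)
next
  assume h: "u \<in> L2 \<Omega> \<and> (\<exists>D. has_weak_grad \<Omega> u D)"
  then have "\<exists>g. has_weak_deriv \<Omega> \<alpha> u g" if "\<alpha> \<in> {\<alpha>. sum \<alpha> UNIV \<le> 1}" for \<alpha>
    using that has_weak_deriv_0[of u \<Omega>] unfolding multi_indices_le_1 has_weak_grad_def by blast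
  then show "u \<in> sobolev 1 \<Omega>" using h by (simp add: sobolev_def)
qed

lemma sobolev_norm_1:
  assumes "open \<Omega>" "bounded \<Omega>" "u \<in> L2 \<Omega>" "has_weak_grad \<Omega> u D"
  shows "sobolev_norm 1 \<Omega> u = sqrt ((L2_norm \<Omega> u)\<^sup>2 + (L2_norm \<Omega> D)\<^sup>2)"
proof -
  have w: "L2_norm \<Omega> (weak_deriv \<Omega> \<alpha> u) = L2_norm \<Omega> g" if "has_weak_deriv \<Omega> \<alpha> u g" "count_list is = \<alpha>" for \<alpha> g "is"
    using L2_measurable[OF has_weak_deriv_L2[OF has_weak_deriv_weak_deriv[OF that(1)]]]
      L2_measurable[OF has_weak_deriv_L2[OF that(1)]] weak_deriv_AE[OF assms(1,2) that]
    by (intro L2_norm_cong_AE)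
  have inj: "inj (\<lambda>(i::'a) j. if j = i then 1 else 0 :: nat)"
  proof (rule injI)
    fix i k :: 'a assume "(\<lambda>j. if j = i then 1 else 0 :: nat) = (\<lambda>j. if j = k then 1 else 0)"
    from fun_cong[OF this, of i] show "i = k" by (simp split: if_splits)
  qed
  have notin: "(\<lambda>j::'a. 0::nat) \<notin> range (\<lambda>i j. if j = i then 1 else 0)"
    by (auto simp: fun_eq_iff) (metis one_neq_zero)
  have 0: "L2_norm \<Omega> (weak_deriv \<Omega> (\<lambda>j. 0) u) = L2_norm \<Omega> u"
    by (rule w[OF has_weak_deriv_0[OF assms(3)], of "[]"]) auto
  have 1: "L2_norm \<Omega> (weak_deriv \<Omega> (\<lambda>j. if j = i then 1 else 0) u) = L2_norm \<Omega> (\<lambda>x. D x $ i)" for i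
    using assms(4) by (intro w[OF _ count_list_single]) (auto simp: has_weak_grad_def)
  have "(\<Sum>\<alpha> | sum \<alpha> UNIV \<le> 1. (L2_norm \<Omega> (weak_deriv \<Omega> \<alpha> u))\<^sup>2)
      = (L2_norm \<Omega> u)\<^sup>2 + (\<Sum>i\<in>UNIV. (L2_norm \<Omega> (\<lambda>x. D x $ i))\<^sup>2)"
    unfolding multi_indices_le_1 using notin by (simp add: 0 1 sum.reindex[OF inj])
  then show ?thesis using L2_norm_vec[OF has_weak_grad_L2[OF assms(4)]] by (simp add: sobolev_norm_def)
qed

text \<open>A class containing both the test functions and the finite element functions extended by
  zero. The Lipschitz condition holds on the whole space, hence across cell interfaces and the
  boundary, and the gradient is continuous off a closed null set. Setting \<open>D\<close> to
  \<open>0\<close> on this null set makes it globally bounded and measurable.\<close>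

definition lipschitz_C1 :: "(real ^ 'n) set \<Rightarrow> (real ^ 'n \<Rightarrow> real) \<Rightarrow> (real ^ 'n \<Rightarrow> real ^ 'n) \<Rightarrow> bool" where
  "lipschitz_C1 \<Omega> v D \<longleftrightarrow> (\<exists>C. C-lipschitz_on UNIV v) \<and> (\<forall>x. x \<notin> \<Omega> \<longrightarrow> v x = 0) \<and>
     (\<exists>U. open U \<and> negligible (- U) \<and> (\<forall>x\<in>U. (v has_derivative (\<lambda>h. inner (D x) h)) (at x)) \<and>
        continuous_on U D \<and> (\<forall>x. x \<notin> U \<longrightarrow> D x = 0))"

definition grad :: "(real ^ 'n \<Rightarrow> real) \<Rightarrow> real ^ 'n \<Rightarrow> real ^ 'n" where
  "grad \<psi> x = (\<chi> i. pdiff i \<psi> x)"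

lemma has_derivative_grad:
  assumes "f differentiable (at x)"
  shows "(f has_derivative (\<lambda>h. inner (grad f x) h)) (at x)"
  using has_derivative_pdiff[OF assms] by (simp add: grad_def inner_vec_def mult.commute)

lemma continuous_on_grad: "smooth \<psi> \<Longrightarrow> continuous_on A (grad \<psi>)"
  unfolding grad_def by (intro continuous_on_vec_lambda smooth_continuous_on smooth_pdiff)

lemma test_function_lipschitz_C1:
  assumes "\<psi> \<in> test_functions \<Omega>"
  shows "lipschitz_C1 \<Omega> \<psi> (grad \<psi>)"
proof -
  have s: "smooth \<psi>" using assms by (rule test_functions_smooth)
  obtain a b where "\<And>x. x \<notin> cbox a b \<Longrightarrow> \<psi> x = 0" using test_function_bounded_support[OF assms] by blast
  then obtain C where "C-lipschitz_on UNIV \<psi>" using smooth_compact_support_lipschitz[OF s] by blast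
  moreover have "\<forall>x. x \<notin> \<Omega> \<longrightarrow> \<psi> x = 0" using test_function_zero_outside[OF assms] by blast
  ultimately show ?thesis
    unfolding lipschitz_C1_def using s
    by (intro conjI exI[of _ C] exI[of _ UNIV])
      (auto intro!: has_derivative_grad smooth_differentiable continuous_on_grad)
qed

text \<open>The difference quotients in the direction of the gradient \<open>d\<close> itself are at
  most \<open>C * norm d\<close> in modulus and converge to the square of
  \<open>norm d\<close>.\<close>

lemma lipschitz_C1_norm_le:
  assumes "C-lipschitz_on UNIV v" "(v has_derivative (\<lambda>h. inner d h)) (at x)"
  shows "norm d \<le> C"
proof -
  have "\<bar>inner d d\<bar> \<le> C * norm d"
  proof (rule LIMSEQ_le_const2)
    show "(\<lambda>k. \<bar>real (Suc k) * (v (x + inverse (real (Suc k)) *\<^sub>R d) - v x)\<bar>) \<longlonglongrightarrow> \<bar>inner d d\<bar>"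
      by (intro tendsto_rabs has_derivative_difference_quotients[OF assms(2)])
    have "\<bar>real (Suc k) * (v (x + inverse (real (Suc k)) *\<^sub>R d) - v x)\<bar> \<le> C * norm d" for k
    proof -
      have "\<bar>v (x + inverse (real (Suc k)) *\<^sub>R d) - v x\<bar> \<le> C * (inverse (real (Suc k)) * norm d)"
        using lipschitz_onD[OF assms(1), of "x + inverse (real (Suc k)) *\<^sub>R d" x] by (simp add: dist_norm)
      then have "real (Suc k) * \<bar>v (x + inverse (real (Suc k)) *\<^sub>R d) - v x\<bar> \<le> real (Suc k) * (C * (inverse (real (Suc k)) * norm d))"
        by (intro mult_left_mono) auto
      also have "\<dots> = C * norm d" by simp
      finally show ?thesis by (simp only: abs_mult abs_of_nat)
    qed
    then show "\<exists>N. \<forall>n\<ge>N. \<bar>real (Suc n) * (v (x + inverse (real (Suc n)) *\<^sub>R d) - v x)\<bar> \<le> C * norm d" by blast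
  qed
  then have "norm d * norm d \<le> C * norm d" by (simp add: dot_square_norm power2_eq_square)
  moreover have "0 \<le> C" using assms(1) by (rule lipschitz_on_nonneg)
  ultimately show ?thesis by (cases "norm d = 0") auto
qed

lemma lipschitz_C1_bounded:
  assumes "lipschitz_C1 \<Omega> v D" "C-lipschitz_on UNIV v"
  shows "norm (D x) \<le> C"
  using assms lipschitz_C1_norm_le[OF assms(2)] lipschitz_on_nonneg[OF assms(2)]
  unfolding lipschitz_C1_def by (metis norm_zero)

lemma lipschitz_C1_measurable:
  assumes "lipschitz_C1 \<Omega> v D"
  shows "D \<in> borel_measurable lebesgue"
proof -
  obtain U where U: "open U" "continuous_on U D" "\<And>x. x \<notin> U \<Longrightarrow> D x = 0"
    using assms unfolding lipschitz_C1_def by auto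
  have "D \<in> borel_measurable (lebesgue_on U)"
    using U by (intro continuous_imp_measurable_on_sets_lebesgue) auto
  then have "(\<lambda>x. indicator U x *\<^sub>R D x) \<in> borel_measurable lebesgue"
    using U(1) by (subst (asm) borel_measurable_restrict_space_iff) auto
  moreover have "(\<lambda>x. indicator U x *\<^sub>R D x) = D" using U(3) by (auto simp: fun_eq_iff indicator_def)
  ultimately show ?thesis by simp
qed

lemma lipschitz_C1_L2:
  assumes \<Omega>: "open \<Omega>" "bounded \<Omega>" and v: "lipschitz_C1 \<Omega> v D"
  shows "v \<in> L2 \<Omega>" "D \<in> L2 \<Omega>"
proof -
  obtain C where C: "C-lipschitz_on UNIV v" using v unfolding lipschitz_C1_def by blast
  show "v \<in> L2 \<Omega>"
    using \<Omega> lipschitz_on_continuous_on[OF C] by (intro L2_continuous) (auto intro: continuous_on_subset)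
  show "D \<in> L2 \<Omega>"
    using \<Omega> lipschitz_C1_bounded[OF v C] lipschitz_C1_measurable[OF v]
    by (intro L2_bounded measurable_restrict_space1 lmeasurable_open) auto
qed

text \<open>Integration by parts without boundary terms: the product of \<open>v\<close> with a test
  function is Lipschitz with bounded support, so the integral of its partial derivative vanishes,
  and the product rule splits this integral.\<close>

lemma has_weak_deriv_lipschitz_C1:
  fixes v :: "real ^ 'n \<Rightarrow> real"
  assumes \<Omega>: "open \<Omega>" "bounded \<Omega>" and v: "lipschitz_C1 \<Omega> v D"
  shows "has_weak_grad \<Omega> v D"
  unfolding has_weak_grad_def has_weak_deriv_single_iff
proof (intro allI conjI ballI)
  fix i
  note L2 = lipschitz_C1_L2[OF \<Omega> v]
  show Di: "(\<lambda>x. D x $ i) \<in> L2 \<Omega>" using L2(2) by (simp add: L2_vec_iff)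
  fix \<psi> assume t: "\<psi> \<in> test_functions \<Omega>"
  have s: "smooth \<psi>" using t by (rule test_functions_smooth)
  obtain a b where ab: "\<And>x. x \<notin> cbox a b \<Longrightarrow> \<psi> x = 0" using test_function_bounded_support[OF t] by blast
  obtain B where B: "B-lipschitz_on UNIV \<psi>" using smooth_compact_support_lipschitz[OF s ab] by blast
  obtain C U where C: "C-lipschitz_on UNIV v" and v0: "\<And>x. x \<notin> \<Omega> \<Longrightarrow> v x = 0"
    and U: "open U" "negligible (- U)" "\<And>x. x \<in> U \<Longrightarrow> (v has_derivative (\<lambda>h. inner (D x) h)) (at x)"
    using v unfolding lipschitz_C1_def by blast
  have cv: "continuous_on UNIV v" using C by (rule lipschitz_on_continuous_on)
  let ?\<phi> = "\<lambda>x. v x * \<psi> x"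
  let ?d = "\<lambda>x. v x * pdiff i \<psi> x + D x $ i * \<psi> x"
  \<comment> \<open>Continuity and bounded support bound both factors; the product of two Lipschitz
    functions needs such bounds to be Lipschitz.\<close>
  have bdd: "\<exists>M\<ge>0. \<forall>x. \<bar>g x\<bar> \<le> M" if "continuous_on UNIV g" "\<And>x. x \<notin> K \<Longrightarrow> g x = 0" "bounded K" for g :: "real ^ 'n \<Rightarrow> real" and K
  proof -
    have "compact (g ` closure K)"
      using that by (intro compact_continuous_image) (auto simp: compact_closure intro: continuous_on_subset)
    then obtain M where M: "\<And>x. x \<in> closure K \<Longrightarrow> \<bar>g x\<bar> \<le> M" using compact_imp_bounded by (fastforce simp: bounded_iff)
    have "\<bar>g x\<bar> \<le> \<bar>M\<bar>" for x
    proof (cases "x \<in> K")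
      case True
      then have "\<bar>g x\<bar> \<le> M" using M closure_subset by blast
      then show ?thesis by simp
    qed (simp add: that(2))
    then show ?thesis by (intro exI[of _ "\<bar>M\<bar>"]) auto
  qed
  obtain M where M: "M \<ge> 0" "\<And>x. \<bar>v x\<bar> \<le> M" using bdd[OF cv v0 \<Omega>(2)] by blast
  obtain N where N: "N \<ge> 0" "\<And>x. \<bar>\<psi> x\<bar> \<le> N" using bdd[OF smooth_continuous_on[OF s] ab bounded_cbox] by blast
  have "(M * B + N * C)-lipschitz_on UNIV ?\<phi>"
  proof (rule lipschitz_onI)
    fix x y
    have "\<bar>v x * \<psi> x - v y * \<psi> y\<bar> = \<bar>v x * (\<psi> x - \<psi> y) + \<psi> y * (v x - v y)\<bar>" by (simp add: algebra_simps)
    also have "\<dots> \<le> \<bar>v x\<bar> * \<bar>\<psi> x - \<psi> y\<bar> + \<bar>\<psi> y\<bar> * \<bar>v x - v y\<bar>"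
      by (metis abs_mult abs_triangle_ineq)
    also have "\<dots> \<le> M * (B * dist x y) + N * (C * dist x y)"
      using M N lipschitz_onD[OF B, of x y] lipschitz_onD[OF C, of x y]
      by (intro add_mono mult_mono) (auto simp: dist_real_def)
    finally show "dist (v x * \<psi> x) (v y * \<psi> y) \<le> (M * B + N * C) * dist x y"
      by (simp add: dist_real_def algebra_simps)
  qed (use M N lipschitz_on_nonneg[OF B] lipschitz_on_nonneg[OF C] in auto)
  moreover have "?\<phi> x = 0" if "x \<notin> cbox a b" for x using ab[OF that] by simp
  moreover have "?d \<in> borel_measurable lebesgue"
  proof -
    have "(\<lambda>x. D x $ i) \<in> borel_measurable lebesgue"
      using lipschitz_C1_measurable[OF v] by (rule borel_measurable_component)
    moreover have "g \<in> borel_measurable lebesgue" if "continuous_on UNIV g" for g :: "real ^ 'n \<Rightarrow> real"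
      using borel_measurable_continuous_onI[OF that] by (intro measurable_completion) simp
    ultimately show ?thesis
      by (intro borel_measurable_add borel_measurable_times) (auto intro: cv s smooth_continuous_on smooth_pdiff)
  qed
  moreover have "AE x in lebesgue. (\<lambda>k. real (Suc k) * (?\<phi> (x + inverse (real (Suc k)) *\<^sub>R axis i 1) - ?\<phi> x)) \<longlonglongrightarrow> ?d x"
  proof -
    have "(\<lambda>k. real (Suc k) * (?\<phi> (x + inverse (real (Suc k)) *\<^sub>R axis i 1) - ?\<phi> x)) \<longlonglongrightarrow> ?d x" if "x \<in> U" for x
      using has_derivative_difference_quotients[OF
          has_derivative_mult[OF U(3)[OF that] has_derivative_grad[OF smooth_differentiable[OF s, of x]]], of "axis i 1"]
      by (simp add: inner_axis grad_def)
    moreover have "AE x in lebesgue. x \<notin> - U"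
      using U(2) by (intro AE_not_in) (simp add: negligible_iff_null_sets)
    ultimately show ?thesis by (auto elim!: eventually_mono)
  qed
  ultimately have zero: "integral\<^sup>L lebesgue ?d = 0" by (rule integral_partial_derivative_zero)
  have "integral\<^sup>L lebesgue ?d = integral\<^sup>L lebesgue (\<lambda>x. indicator \<Omega> x *\<^sub>R ?d x)"
  proof (rule arg_cong[of _ _ "integral\<^sup>L lebesgue"], rule ext)
    fix x
    \<comment> \<open>Outside the domain both \<open>v\<close> and the test function vanish, and
      each summand contains one of them undifferentiated.\<close>
    show "?d x = indicator \<Omega> x *\<^sub>R ?d x"
      using v0[of x] test_function_zero_outside[OF t, of x] by (cases "x \<in> \<Omega>") auto
  qed
  also have "\<dots> = integral\<^sup>L (lebesgue_on \<Omega>) ?d"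
    using \<Omega> by (subst integral_restrict_space) auto
  also have "\<dots> = L2_inner \<Omega> v (pdiff i \<psi>) + L2_inner \<Omega> (\<lambda>x. D x $ i) \<psi>"
    using L2_inner_integrable[OF L2(1) test_function_L2[OF \<Omega> smooth_pdiff[OF s, of i]]]
      L2_inner_integrable[OF Di test_function_L2[OF \<Omega> s]]
    by (simp add: L2_inner_def)
  finally show "L2_inner \<Omega> v (pdiff i \<psi>) = - L2_inner \<Omega> (\<lambda>x. D x $ i) \<psi>"
    using zero by simp
qed

lemma has_weak_grad_test_function:
  assumes "open \<Omega>" "bounded \<Omega>" "\<psi> \<in> test_functions \<Omega>"
  shows "has_weak_grad \<Omega> \<psi> (grad \<psi>)"
  by (intro has_weak_deriv_lipschitz_C1 test_function_lipschitz_C1 assms)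

section \<open>The space H10\<close>

lemma smooth_coordinate: "smooth (\<lambda>x::real ^ 'n. x $ i)"
proof (rule smooth_closed_family[of "{\<lambda>x::real ^ 'n. c * x $ i + b |c b. True}"])
  have der: "((\<lambda>x::real ^ 'n. c * x $ i + b) has_derivative (\<lambda>h. c * h $ i)) (at x)" for c b x
    by (auto intro!: derivative_eq_intros bounded_linear.has_derivative[OF bounded_linear_vec_nth])
  fix f and x :: "real ^ 'n" and j assume "f \<in> {\<lambda>x::real ^ 'n. c * x $ i + b |c b. True}"
  then obtain c b where f: "f = (\<lambda>x. c * x $ i + b)" by blast
  show "f differentiable (at x)" unfolding f differentiable_def using der by blast
  have "pdiff j f = (\<lambda>x. 0 * x $ i + c * (if j = i then 1 else 0))"
    unfolding f using pdiff_eq[OF der] by (auto simp: fun_eq_iff axis_def)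
  then show "pdiff j f \<in> {\<lambda>x::real ^ 'n. c * x $ i + b |c b. True}" by blast
next
  show "(\<lambda>x::real ^ 'n. x $ i) \<in> {\<lambda>x::real ^ 'n. c * x $ i + b |c b. True}"
    by (intro CollectI exI[of _ 1] exI[of _ 0]) simp
qed

text \<open>The partial derivative of \<open>x_i * \<psi>^2\<close> in direction \<open>i\<close> is
  \<open>\<psi>^2 + 2 * x_i * \<psi> * pdiff i \<psi>\<close> and has integral zero. Cauchy-Schwarz
  and the bound \<open>R\<close> for the coordinate \<open>x_i\<close> give the constant
  \<open>2 * R\<close>; any direction \<open>i\<close> will do.\<close>

lemma poincare_test_function:
  fixes \<Omega> :: "(real ^ 'n) set"
  assumes \<Omega>: "open \<Omega>" "bounded \<Omega>" and R: "\<And>x. x \<in> \<Omega> \<Longrightarrow> norm x \<le> R" "R \<ge> 0"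
    and t: "\<psi> \<in> test_functions \<Omega>"
  shows "L2_norm \<Omega> \<psi> \<le> 2 * R * L2_norm \<Omega> (grad \<psi>)"
proof -
  fix i :: 'n
  have s: "smooth \<psi>" using t by (rule test_functions_smooth)
  obtain a b where ab: "\<And>x. x \<notin> cbox a b \<Longrightarrow> \<psi> x = 0" using test_function_bounded_support[OF t] by blast
  let ?\<phi> = "\<lambda>x. (\<psi> x * \<psi> x) * x $ i"
  let ?d = "\<lambda>x. inner (\<psi> x) (\<psi> x) + 2 * inner (\<psi> x) (x $ i * pdiff i \<psi> x)"
  have s\<phi>: "smooth ?\<phi>" by (intro smooth_mult s smooth_coordinate)
  have d: "pdiff i ?\<phi> x = ?d x" for x
  proof -
    have "pdiff i (\<lambda>x::real ^ 'n. x $ i) x = 1"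
      using pdiff_eq[OF bounded_linear.has_derivative[OF bounded_linear_vec_nth has_derivative_ident], of i i x] by (simp add: axis_def)
    then show ?thesis
      using s by (simp add: pdiff_mult smooth_differentiable smooth_mult smooth_coordinate algebra_simps)
  qed
  have \<phi>0: "?\<phi> x = 0" if "x \<notin> cbox a b" for x using ab[OF that] by simp
  obtain C where C: "C-lipschitz_on UNIV ?\<phi>" using smooth_compact_support_lipschitz[OF s\<phi> \<phi>0] by blast
  have "integral\<^sup>L lebesgue (pdiff i ?\<phi>) = 0"
  proof (rule integral_partial_derivative_zero[OF C \<phi>0])
    show "pdiff i ?\<phi> \<in> borel_measurable lebesgue"
      using borel_measurable_continuous_onI[OF smooth_continuous_on[OF smooth_pdiff[OF s\<phi>]]]
      by (intro measurable_completion) simp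
    show "AE x in lebesgue. (\<lambda>k. real (Suc k) * (?\<phi> (x + inverse (real (Suc k)) *\<^sub>R axis i 1) - ?\<phi> x)) \<longlonglongrightarrow> pdiff i ?\<phi> x"
    proof (intro AE_I2)
      fix x
      show "(\<lambda>k. real (Suc k) * (?\<phi> (x + inverse (real (Suc k)) *\<^sub>R axis i 1) - ?\<phi> x)) \<longlonglongrightarrow> pdiff i ?\<phi> x"
        using has_derivative_difference_quotients[OF has_derivative_grad[OF smooth_differentiable[OF s\<phi>]], of x "axis i 1"]
        by (simp add: inner_axis grad_def)
    qed
  qed
  moreover have "integral\<^sup>L lebesgue (pdiff i ?\<phi>) = integral\<^sup>L lebesgue (\<lambda>x. indicator \<Omega> x *\<^sub>R ?d x)"
  proof (rule arg_cong[of _ _ "integral\<^sup>L lebesgue"], rule ext)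
    fix x
    show "pdiff i ?\<phi> x = indicator \<Omega> x *\<^sub>R ?d x"
      using test_function_zero_outside[OF t, of x] unfolding d by (cases "x \<in> \<Omega>") auto
  qed
  moreover have "\<dots> = integral\<^sup>L (lebesgue_on \<Omega>) ?d"
    using \<Omega> by (subst integral_restrict_space) auto
  moreover have pL2: "\<psi> \<in> L2 \<Omega>" "(\<lambda>x. x $ i * pdiff i \<psi> x) \<in> L2 \<Omega>"
    by (intro test_function_L2 \<Omega> s smooth_mult smooth_coordinate smooth_pdiff)+
  moreover have "integral\<^sup>L (lebesgue_on \<Omega>) ?d = L2_inner \<Omega> \<psi> \<psi> + 2 * L2_inner \<Omega> \<psi> (\<lambda>x. x $ i * pdiff i \<psi> x)"
    unfolding L2_inner_def
    using L2_inner_integrable[OF pL2(1,1)] L2_inner_integrable[OF pL2] by simp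
  ultimately have "(L2_norm \<Omega> \<psi>)\<^sup>2 = - 2 * L2_inner \<Omega> \<psi> (\<lambda>x. x $ i * pdiff i \<psi> x)"
    unfolding L2_inner_self[symmetric] by simp
  also have "\<dots> \<le> 2 * (L2_norm \<Omega> \<psi> * L2_norm \<Omega> (\<lambda>x. x $ i * pdiff i \<psi> x))"
    using L2_cauchy_schwarz[OF pL2] by linarith
  also have "L2_norm \<Omega> (\<lambda>x. x $ i * pdiff i \<psi> x) \<le> R * L2_norm \<Omega> (grad \<psi>)"
  proof (rule power2_le_imp_le)
    have g: "grad \<psi> \<in> L2 \<Omega>" using has_weak_grad_L2[OF has_weak_grad_test_function[OF \<Omega> t]] .
    have "(L2_norm \<Omega> (\<lambda>x. x $ i * pdiff i \<psi> x))\<^sup>2 \<le> integral\<^sup>L (lebesgue_on \<Omega>) (\<lambda>x. R\<^sup>2 * (norm (grad \<psi> x))\<^sup>2)"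
      unfolding L2_norm_power2
    proof (rule integral_mono)
      fix x assume "x \<in> space (lebesgue_on \<Omega>)"
      then have "\<bar>x $ i\<bar> \<le> R" using R(1)[of x] component_le_norm_cart[of x i] by simp
      moreover have "\<bar>pdiff i \<psi> x\<bar> \<le> norm (grad \<psi> x)" using component_le_norm_cart[of "grad \<psi> x" i] by (simp add: grad_def)
      ultimately have "\<bar>x $ i\<bar> * \<bar>pdiff i \<psi> x\<bar> \<le> R * norm (grad \<psi> x)" by (intro mult_mono) auto
      then have "(\<bar>x $ i\<bar> * \<bar>pdiff i \<psi> x\<bar>)\<^sup>2 \<le> (R * norm (grad \<psi> x))\<^sup>2" by (intro power_mono) auto
      then show "(norm (x $ i * pdiff i \<psi> x))\<^sup>2 \<le> R\<^sup>2 * (norm (grad \<psi> x))\<^sup>2" by (simp add: power_mult_distrib abs_mult)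
    qed (use L2_integrable_norm[OF pL2(2)] L2_integrable_norm[OF g] in auto)
    then show "(L2_norm \<Omega> (\<lambda>x. x $ i * pdiff i \<psi> x))\<^sup>2 \<le> (R * L2_norm \<Omega> (grad \<psi>))\<^sup>2"
      by (simp add: L2_norm_power2 power_mult_distrib)
  qed (use R in simp)
  finally have "(L2_norm \<Omega> \<psi>)\<^sup>2 \<le> 2 * (L2_norm \<Omega> \<psi> * (R * L2_norm \<Omega> (grad \<psi>)))"
    by (simp add: mult_left_mono)
  then have "L2_norm \<Omega> \<psi> * L2_norm \<Omega> \<psi> \<le> (2 * R * L2_norm \<Omega> (grad \<psi>)) * L2_norm \<Omega> \<psi>"
    by (simp add: power2_eq_square algebra_simps)
  moreover have "0 \<le> 2 * R * L2_norm \<Omega> (grad \<psi>)" using R by simp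
  ultimately show ?thesis
    using L2_norm_nonneg[of \<Omega> \<psi>] by (cases "L2_norm \<Omega> \<psi> = 0") auto
qed

lemma H10_has_weak_grad:
  assumes "u \<in> H10 \<Omega>"
  shows "u \<in> L2 \<Omega>" "has_weak_grad \<Omega> u (weak_grad \<Omega> u)"
proof -
  have "u \<in> sobolev 1 \<Omega>" using assms unfolding H10_def by blast
  then obtain D where "u \<in> L2 \<Omega>" "has_weak_grad \<Omega> u D" unfolding sobolev_1_iff by blast
  then show "u \<in> L2 \<Omega>" "has_weak_grad \<Omega> u (weak_grad \<Omega> u)"
    by (auto intro: has_weak_grad_weak_grad)
qed

text \<open>Convergence in \<open>sobolev_norm 1\<close> refers to chosen weak derivatives. Here it
  is expressed by two limits in the \<open>L2\<close> norm with an explicit gradient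
  \<open>D\<close>, which is the form in which approximants are built.\<close>

lemma H10I:
  assumes \<Omega>: "open \<Omega>" "bounded \<Omega>" and u: "u \<in> L2 \<Omega>" "has_weak_grad \<Omega> u D"
    and t: "\<And>k. \<psi> k \<in> test_functions \<Omega>"
    and lim: "(\<lambda>k. L2_norm \<Omega> (\<lambda>x. u x - \<psi> k x)) \<longlonglongrightarrow> 0" "(\<lambda>k. L2_norm \<Omega> (\<lambda>x. D x - grad (\<psi> k) x)) \<longlonglongrightarrow> 0"
  shows "u \<in> H10 \<Omega>"
proof -
  have "sobolev_norm 1 \<Omega> (\<lambda>x. u x - \<psi> k x)
      = sqrt ((L2_norm \<Omega> (\<lambda>x. u x - \<psi> k x))\<^sup>2 + (L2_norm \<Omega> (\<lambda>x. D x - grad (\<psi> k) x))\<^sup>2)" for k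
    using t[of k] by (intro sobolev_norm_1 \<Omega> L2_diff has_weak_grad_diff u has_weak_grad_test_function
        test_function_L2 test_functions_smooth)
  moreover have "(\<lambda>k. sqrt ((L2_norm \<Omega> (\<lambda>x. u x - \<psi> k x))\<^sup>2 + (L2_norm \<Omega> (\<lambda>x. D x - grad (\<psi> k) x))\<^sup>2))
      \<longlonglongrightarrow> sqrt (0\<^sup>2 + 0\<^sup>2)"
    by (intro tendsto_intros lim)
  ultimately have "(\<lambda>k. sobolev_norm 1 \<Omega> (\<lambda>x. u x - \<psi> k x)) \<longlonglongrightarrow> 0" by simp
  moreover have "u \<in> sobolev 1 \<Omega>" using u sobolev_1_iff by blast
  ultimately show ?thesis using t unfolding H10_def by blast
qed

lemma H10E:
  assumes \<Omega>: "open \<Omega>" "bounded \<Omega>" and u: "u \<in> H10 \<Omega>"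
  obtains \<psi> where "\<And>k. \<psi> k \<in> test_functions \<Omega>" "(\<lambda>k. L2_norm \<Omega> (\<lambda>x. u x - \<psi> k x)) \<longlonglongrightarrow> 0"
    "(\<lambda>k. L2_norm \<Omega> (\<lambda>x. weak_grad \<Omega> u x - grad (\<psi> k) x)) \<longlonglongrightarrow> 0"
proof -
  obtain \<psi> where t: "\<And>k. \<psi> k \<in> test_functions \<Omega>"
    and lim: "(\<lambda>k::nat. sobolev_norm 1 \<Omega> (\<lambda>x. u x - \<psi> k x)) \<longlonglongrightarrow> 0"
    using u unfolding H10_def by blast
  let ?a = "\<lambda>k. L2_norm \<Omega> (\<lambda>x. u x - \<psi> k x)" and ?b = "\<lambda>k. L2_norm \<Omega> (\<lambda>x. weak_grad \<Omega> u x - grad (\<psi> k) x)"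
  have eq: "sobolev_norm 1 \<Omega> (\<lambda>x. u x - \<psi> k x) = sqrt ((?a k)\<^sup>2 + (?b k)\<^sup>2)" for k
    using t[of k] by (intro sobolev_norm_1 \<Omega> L2_diff has_weak_grad_diff H10_has_weak_grad[OF u] has_weak_grad_test_function
        test_function_L2 test_functions_smooth)
  have "?a k \<le> sobolev_norm 1 \<Omega> (\<lambda>x. u x - \<psi> k x)" "?b k \<le> sobolev_norm 1 \<Omega> (\<lambda>x. u x - \<psi> k x)" for k
    unfolding eq by (intro real_le_rsqrt; simp)+
  then have "?a \<longlonglongrightarrow> 0" "?b \<longlonglongrightarrow> 0"
    by (auto intro!: tendsto_sandwich[OF _ _ tendsto_const lim] always_eventually)
  then show ?thesis using that t by blast
qed

lemma test_function_cmult: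
  assumes "\<psi> \<in> test_functions \<Omega>"
  shows "(\<lambda>x. c * \<psi> x) \<in> test_functions \<Omega>" "grad (\<lambda>x. c * \<psi> x) = (\<lambda>x. c *\<^sub>R grad \<psi> x)"
proof -
  have s: "smooth \<psi>" using assms by (rule test_functions_smooth)
  have "closure {x. c * \<psi> x \<noteq> 0} \<subseteq> closure {x. \<psi> x \<noteq> 0}" by (intro closure_mono) auto
  moreover from this have "compact (closure {x. c * \<psi> x \<noteq> 0})"
    using assms unfolding test_functions_iff
    by (metis bounded_subset closed_closure compact_eq_bounded_closed)
  moreover have "smooth (\<lambda>x. c * \<psi> x)" by (intro smooth_mult smooth_const s)
  ultimately show "(\<lambda>x. c * \<psi> x) \<in> test_functions \<Omega>"
    using assms unfolding test_functions_iff by (meson order_trans)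
  have "pdiff i (\<lambda>x. c * \<psi> x) x = c * pdiff i \<psi> x" for i x
  proof -
    have "pdiff i (\<lambda>x. c) x = 0" using pdiff_eq[OF has_derivative_const] .
    then show ?thesis
      using pdiff_mult[OF smooth_differentiable[OF smooth_const[of c], of x] smooth_differentiable[OF s], of i] by simp
  qed
  then show "grad (\<lambda>x. c * \<psi> x) = (\<lambda>x. c *\<^sub>R grad \<psi> x)"
    by (auto simp: fun_eq_iff grad_def Finite_Cartesian_Product.vec_eq_iff)
qed

lemma H10_cmult:
  assumes \<Omega>: "open \<Omega>" "bounded \<Omega>" and u: "u \<in> H10 \<Omega>"
  shows "(\<lambda>x. c * u x) \<in> H10 \<Omega>"
proof -
  obtain \<psi> where t: "\<And>k. \<psi> k \<in> test_functions \<Omega>"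
    and lim: "(\<lambda>k. L2_norm \<Omega> (\<lambda>x. u x - \<psi> k x)) \<longlonglongrightarrow> 0"
      "(\<lambda>k. L2_norm \<Omega> (\<lambda>x. weak_grad \<Omega> u x - grad (\<psi> k) x)) \<longlonglongrightarrow> 0"
    using H10E[OF \<Omega> u] by blast
  show ?thesis
  proof (rule H10I[OF \<Omega> L2_cmult[OF H10_has_weak_grad(1)[OF u]] has_weak_grad_cmult[OF H10_has_weak_grad(2)[OF u]]
        test_function_cmult(1)[OF t]])
    have "(\<lambda>k. \<bar>c\<bar> * L2_norm \<Omega> (\<lambda>x. u x - \<psi> k x)) \<longlonglongrightarrow> \<bar>c\<bar> * 0" by (intro tendsto_intros lim)
    then show "(\<lambda>k. L2_norm \<Omega> (\<lambda>x. c * u x - c * \<psi> k x)) \<longlonglongrightarrow> 0"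
      by (simp add: L2_norm_cmult right_diff_distrib[symmetric])
    have "(\<lambda>k. \<bar>c\<bar> * L2_norm \<Omega> (\<lambda>x. weak_grad \<Omega> u x - grad (\<psi> k) x)) \<longlonglongrightarrow> \<bar>c\<bar> * 0" by (intro tendsto_intros lim)
    then show "(\<lambda>k. L2_norm \<Omega> (\<lambda>x. c *\<^sub>R weak_grad \<Omega> u x - grad (\<lambda>x. c * \<psi> k x) x)) \<longlonglongrightarrow> 0"
      by (simp add: test_function_cmult(2)[OF t] L2_norm_scaleR scaleR_diff_right[symmetric])
  qed
qed

text \<open>The inequality for test functions passes to the limit along an approximating sequence,
  since both sides are continuous in the two norms of \<open>H10E\<close>.\<close>

lemma poincare_H10:
  assumes \<Omega>: "open \<Omega>" "bounded \<Omega>"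
  obtains K where "K \<ge> 0" "\<And>u. u \<in> H10 \<Omega> \<Longrightarrow> L2_norm \<Omega> u \<le> K * L2_norm \<Omega> (weak_grad \<Omega> u)"
proof -
  obtain R0 where R0: "\<And>x. x \<in> \<Omega> \<Longrightarrow> norm x \<le> R0" using \<Omega>(2) by (auto simp: bounded_iff)
  define R where "R = \<bar>R0\<bar>"
  have R: "norm x \<le> R" if "x \<in> \<Omega>" for x using R0[OF that] by (simp add: R_def)
  have R': "R \<ge> 0" by (simp add: R_def)
  have "L2_norm \<Omega> u \<le> 2 * R * L2_norm \<Omega> (weak_grad \<Omega> u)" if u: "u \<in> H10 \<Omega>" for u
  proof -
    obtain \<psi> where t: "\<And>k. \<psi> k \<in> test_functions \<Omega>"
      and lim: "(\<lambda>k. L2_norm \<Omega> (\<lambda>x. u x - \<psi> k x)) \<longlonglongrightarrow> 0"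
        "(\<lambda>k. L2_norm \<Omega> (\<lambda>x. weak_grad \<Omega> u x - grad (\<psi> k) x)) \<longlonglongrightarrow> 0"
      using H10E[OF \<Omega> u] by blast
    note uL = H10_has_weak_grad[OF u]
    let ?a = "\<lambda>k. L2_norm \<Omega> (\<lambda>x. u x - \<psi> k x)" and ?b = "\<lambda>k. L2_norm \<Omega> (\<lambda>x. weak_grad \<Omega> u x - grad (\<psi> k) x)"
    have "L2_norm \<Omega> u \<le> ?a k + 2 * R * (?b k + L2_norm \<Omega> (weak_grad \<Omega> u))" for k
    proof -
      have p: "\<psi> k \<in> L2 \<Omega>" "grad (\<psi> k) \<in> L2 \<Omega>"
        using t[of k] test_function_L2[OF \<Omega> test_functions_smooth] has_weak_grad_L2[OF has_weak_grad_test_function[OF \<Omega>]] by blast+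
      have w: "weak_grad \<Omega> u \<in> L2 \<Omega>" using has_weak_grad_L2[OF uL(2)] .
      have "L2_norm \<Omega> u \<le> ?a k + L2_norm \<Omega> (\<psi> k)"
        using L2_norm_triangle[OF L2_diff[OF uL(1) p(1)] p(1)] by simp
      also have "L2_norm \<Omega> (\<psi> k) \<le> 2 * R * L2_norm \<Omega> (grad (\<psi> k))"
        by (rule poincare_test_function[OF \<Omega> R R' t])
      also have "L2_norm \<Omega> (grad (\<psi> k)) \<le> L2_norm \<Omega> (\<lambda>x. grad (\<psi> k) x - weak_grad \<Omega> u x) + L2_norm \<Omega> (weak_grad \<Omega> u)"
        using L2_norm_triangle[OF L2_diff[OF p(2) w] w] by simp
      also have "L2_norm \<Omega> (\<lambda>x. grad (\<psi> k) x - weak_grad \<Omega> u x) = ?b k" by (rule L2_norm_minus_commute)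
      finally show ?thesis using R' by (simp add: mult_left_mono)
    qed
    moreover have "(\<lambda>k. ?a k + 2 * R * (?b k + L2_norm \<Omega> (weak_grad \<Omega> u))) \<longlonglongrightarrow> 0 + 2 * R * (0 + L2_norm \<Omega> (weak_grad \<Omega> u))"
      by (intro tendsto_intros lim)
    ultimately show ?thesis
      using LIMSEQ_le_const[of _ "2 * R * L2_norm \<Omega> (weak_grad \<Omega> u)" "L2_norm \<Omega> u"] by simp
  qed
  then show ?thesis using that[of "2 * R"] R' by simp
qed

text \<open>\<open>Hm1_norm\<close> is a supremum of reals and carries information only if the
  values are bounded. The Poincare inequality provides the bound; afterwards a function with nonzero
  gradient is scaled into the unit ball.\<close>

lemma Hm1_norm_bound:
  assumes \<Omega>: "open \<Omega>" "bounded \<Omega>" and g: "g \<in> L2 \<Omega>"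
  shows "Hm1_norm \<Omega> g \<ge> 0"
    and "w \<in> H10 \<Omega> \<Longrightarrow> \<bar>L2_inner \<Omega> g w\<bar> \<le> Hm1_norm \<Omega> g * L2_norm \<Omega> (weak_grad \<Omega> w)"
proof -
  let ?B = "{\<psi> \<in> H10 \<Omega>. L2_norm \<Omega> (weak_grad \<Omega> \<psi>) \<le> 1}"
  obtain K where K: "K \<ge> 0" "\<And>u. u \<in> H10 \<Omega> \<Longrightarrow> L2_norm \<Omega> u \<le> K * L2_norm \<Omega> (weak_grad \<Omega> u)"
    using poincare_H10[OF \<Omega>] by blast
  have CS: "\<bar>L2_inner \<Omega> g u\<bar> \<le> L2_norm \<Omega> g * (K * L2_norm \<Omega> (weak_grad \<Omega> u))" if "u \<in> H10 \<Omega>" for u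
    using L2_cauchy_schwarz[OF g H10_has_weak_grad(1)[OF that]] mult_left_mono[OF K(2)[OF that] L2_norm_nonneg[of \<Omega> g]] by linarith
  have bdd: "bdd_above ((\<lambda>\<psi>. \<bar>L2_inner \<Omega> g \<psi>\<bar>) ` ?B)"
  proof (rule bdd_aboveI2)
    fix \<psi> assume "\<psi> \<in> ?B"
    then show "\<bar>L2_inner \<Omega> g \<psi>\<bar> \<le> L2_norm \<Omega> g * (K * 1)"
      using CS[of \<psi>] K(1) mult_left_mono[OF mult_left_mono[of "L2_norm \<Omega> (weak_grad \<Omega> \<psi>)" 1 K] L2_norm_nonneg[of \<Omega> g]] by auto
  qed
  have scaled: "\<bar>L2_inner \<Omega> g w\<bar> \<le> Hm1_norm \<Omega> g * L2_norm \<Omega> (weak_grad \<Omega> w)" if w: "w \<in> H10 \<Omega>" for w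
  proof (cases "L2_norm \<Omega> (weak_grad \<Omega> w) = 0")
    case True
    \<comment> \<open>A zero gradient cannot be normalised, but by \<open>CS\<close> the left-hand
      side then vanishes.\<close>
    then show ?thesis using CS[OF w] by simp
  next
    case False
    let ?n = "L2_norm \<Omega> (weak_grad \<Omega> w)"
    have n: "?n > 0" using False L2_norm_nonneg[of \<Omega> "weak_grad \<Omega> w"] by linarith
    let ?w = "\<lambda>x. inverse ?n * w x"
    have "L2_norm \<Omega> (weak_grad \<Omega> ?w) = L2_norm \<Omega> (\<lambda>x. inverse ?n *\<^sub>R weak_grad \<Omega> w x)"
      by (intro L2_norm_has_weak_grad \<Omega> has_weak_grad_cmult H10_has_weak_grad w)
    also have "\<dots> = 1" using n by (simp add: L2_norm_scaleR)
    finally have "?w \<in> ?B" using H10_cmult[OF \<Omega> w] by simp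
    then have "\<bar>L2_inner \<Omega> g ?w\<bar> \<le> Hm1_norm \<Omega> g"
      unfolding Hm1_norm_def by (intro cSUP_upper bdd)
    moreover have "L2_inner \<Omega> g ?w = inverse ?n * L2_inner \<Omega> g w"
      by (metis L2_inner_cmult_left L2_inner_commute)
    ultimately have "inverse ?n * \<bar>L2_inner \<Omega> g w\<bar> \<le> Hm1_norm \<Omega> g" using n by (simp add: abs_mult)
    then have "?n * (inverse ?n * \<bar>L2_inner \<Omega> g w\<bar>) \<le> ?n * Hm1_norm \<Omega> g"
      using n by (intro mult_left_mono) auto
    then show ?thesis using n by (simp add: mult.assoc[symmetric] mult.commute)
  qed
  then show "w \<in> H10 \<Omega> \<Longrightarrow> \<bar>L2_inner \<Omega> g w\<bar> \<le> Hm1_norm \<Omega> g * L2_norm \<Omega> (weak_grad \<Omega> w)" by blast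
  \<comment> \<open>The zero function belongs to the unit ball, and its value \<open>0\<close>
    bounds the supremum from below.\<close>
  have "(\<lambda>x. 0) \<in> test_functions \<Omega>" by (simp add: test_functions_iff smooth_const)
  then have z: "has_weak_grad \<Omega> (\<lambda>x. 0) (\<lambda>x. 0 *\<^sub>R grad (\<lambda>x. 0) x)" "(\<lambda>x. 0) \<in> H10 \<Omega>"
    using has_weak_grad_cmult[OF has_weak_grad_test_function[OF \<Omega>], of "\<lambda>x. 0" 0]
      H10I[OF \<Omega> _ has_weak_grad_test_function[OF \<Omega>], of "\<lambda>x. 0" "\<lambda>k x. 0"]
    by (auto simp: L2_norm_def L2_def)
  have "L2_norm \<Omega> (weak_grad \<Omega> (\<lambda>x. 0)) = 0"
    using L2_norm_has_weak_grad[OF \<Omega> z(1)] by (simp add: L2_norm_def)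
  then have "(\<lambda>x. 0) \<in> ?B" using z(2) by simp
  then have "\<bar>L2_inner \<Omega> g (\<lambda>x. 0)\<bar> \<le> Hm1_norm \<Omega> g"
    unfolding Hm1_norm_def by (intro cSUP_upper bdd)
  then show "Hm1_norm \<Omega> g \<ge> 0" by linarith
qed

section \<open>Mollification\<close>

text \<open>Differentiation under the integral puts every derivative on the kernel, so
  \<open>V\<close> need only be continuous, and the convolutions of \<open>V\<close> with smooth
  kernels form a family closed under derivatives.\<close>

lemma smooth_convolution:
  fixes V K :: "real ^ 'n \<Rightarrow> real"
  assumes V: "continuous_on (cbox a b) V" and K: "smooth K"
  shows "smooth (\<lambda>x. integral (cbox a b) (\<lambda>z. V z * K (x - z)))"
    and "pdiff i (\<lambda>x. integral (cbox a b) (\<lambda>z. V z * K (x - z))) = (\<lambda>x. integral (cbox a b) (\<lambda>z. V z * pdiff i K (x - z)))"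
proof -
  let ?c = "\<lambda>K x. integral (cbox a b) (\<lambda>z. V z * K (x - z))"
  let ?d = "\<lambda>K x z. V z *\<^sub>R (\<Sum>i\<in>UNIV. pdiff i K (x - z) *\<^sub>R blinfun_inner_right (axis i (1::real)))"
  have der: "(?c K has_derivative integral (cbox a b) (?d K x)) (at x)" if K: "smooth K" for K :: "real ^ 'n \<Rightarrow> real" and x
  proof (rule leibniz_rule[where U=UNIV and fx="?d K", simplified])
    fix x z :: "real ^ 'n"
    have "((\<lambda>x. x - z) has_derivative (\<lambda>h. h)) (at x)" by (auto intro!: derivative_eq_intros)
    from has_derivative_compose[OF this has_derivative_pdiff[OF smooth_differentiable[OF K]]]
    have "((\<lambda>x. K (x - z)) has_derivative (\<lambda>h. \<Sum>i\<in>UNIV. h $ i * pdiff i K (x - z))) (at x)" .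
    then have "((\<lambda>x. V z * K (x - z)) has_derivative (\<lambda>h. V z * (\<Sum>i\<in>UNIV. h $ i * pdiff i K (x - z)))) (at x)"
      by (rule has_derivative_mult_right)
    moreover have "blinfun_apply (?d K x z) = (\<lambda>h. V z * (\<Sum>i\<in>UNIV. h $ i * pdiff i K (x - z)))"
      by (auto simp: fun_eq_iff blinfun.scaleR_left blinfun.sum_left inner_axis' mult.commute)
    ultimately show "((\<lambda>x. V z * K (x - z)) has_derivative blinfun_apply (?d K x z)) (at x)" by simp
  next
    fix x :: "real ^ 'n"
    show "(\<lambda>z. V z * K (x - z)) integrable_on cbox a b"
      by (intro integrable_continuous continuous_intros V continuous_on_compose2[OF smooth_continuous_on[OF K, of UNIV]]) auto
  next
    show "continuous_on (UNIV \<times> cbox a b) (\<lambda>(x, z). ?d K x z)"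
      unfolding split_beta
      by (intro continuous_intros continuous_on_compose2[OF V] continuous_on_compose2[OF smooth_continuous_on[OF smooth_pdiff[OF K], of UNIV]]) auto
  qed
  have pd: "pdiff i (?c K) = ?c (pdiff i K)" if K: "smooth K" for K :: "real ^ 'n \<Rightarrow> real" and i
  proof (rule ext)
    fix x
    have int: "(?d K x) integrable_on cbox a b"
      by (intro integrable_continuous continuous_intros V continuous_on_compose2[OF smooth_continuous_on[OF smooth_pdiff[OF K], of UNIV]]) auto
    have "pdiff i (?c K) x = blinfun_apply (integral (cbox a b) (?d K x)) (axis i 1)"
      using pdiff_eq[OF der[OF K, of x], of i] by simp
    also have "\<dots> = integral (cbox a b) (\<lambda>z. blinfun_apply (?d K x z) (axis i 1))"
      by (rule blinfun_apply_integral[OF int])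
    also have "(\<lambda>z. blinfun_apply (?d K x z) (axis i 1)) = (\<lambda>z. V z * pdiff i K (x - z))"
    proof (rule ext)
      fix z
      have "(\<Sum>j\<in>UNIV. pdiff j K (x - z) * inner (axis j 1) (axis i (1::real))) = pdiff i K (x - z)"
        by (simp add: inner_axis_axis if_distrib cong: if_cong)
      then show "blinfun_apply (?d K x z) (axis i 1) = V z * pdiff i K (x - z)"
        by (simp add: blinfun.scaleR_left blinfun.sum_left)
    qed
    finally show "pdiff i (?c K) x = ?c (pdiff i K) x" .
  qed
  show "pdiff i (?c K) = ?c (pdiff i K)" using pd[OF K] .
  show "smooth (?c K)"
  proof (rule smooth_closed_family[of "{?c K |K. smooth K}"])
    fix f and x :: "real ^ 'n" and i assume "f \<in> {?c K |K. smooth K}"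
    then obtain K where f: "f = ?c K" and K: "smooth K" by blast
    show "f differentiable (at x)" unfolding f differentiable_def using der[OF K] by blast
    show "pdiff i f \<in> {?c K |K. smooth K}" unfolding f pd[OF K] using smooth_pdiff[OF K] by blast
  qed (use K in blast)
qed

text \<open>The average of \<open>g\<close> over the cube of half-width \<open>\<epsilon>\<close>
  about \<open>x\<close>, weighted by a bump; \<open>1\<close> is the all-ones vector. The Lebesgue
  integral makes it applicable to the discontinuous components of a gradient too.\<close>

definition mollify :: "real \<Rightarrow> (real ^ 'n \<Rightarrow> real) \<Rightarrow> real ^ 'n \<Rightarrow> real" where
  "mollify \<epsilon> g x = integral\<^sup>L lebesgue (\<lambda>z. g z * bump (x - \<epsilon> *\<^sub>R 1) (x + \<epsilon> *\<^sub>R 1) 1 z)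
     / integral\<^sup>L lebesgue (bump (- \<epsilon> *\<^sub>R 1) (\<epsilon> *\<^sub>R 1 :: real ^ 'n) 1)"

lemma bump_shift: "bump (x - \<epsilon> *\<^sub>R 1) (x + \<epsilon> *\<^sub>R 1) 1 z = bump (- \<epsilon> *\<^sub>R 1) (\<epsilon> *\<^sub>R 1) 1 (x - z)"
proof -
  have "(\<Prod>i\<in>UNIV. flat 1 (z $ i - (x $ i - \<epsilon>))) * (\<Prod>i\<in>UNIV. flat 1 (x $ i + \<epsilon> - z $ i))
      = (\<Prod>i\<in>UNIV. flat 1 (\<epsilon> - (x $ i - z $ i))) * (\<Prod>i\<in>UNIV. flat 1 (x $ i - z $ i - - \<epsilon>))"
    by (intro arg_cong2[of _ _ _ _ "(*)"] prod.cong refl arg_cong[of _ _ "flat 1"]) auto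
  then show ?thesis unfolding bump_def by (simp add: mult.commute)
qed

lemma bump_integrable:
  fixes a b :: "real ^ 'n"
  assumes "g \<in> borel_measurable lebesgue" "\<And>z. \<bar>g z\<bar> \<le> M"
  shows "integrable lebesgue (\<lambda>z. g z * bump a b 1 z)"
proof (rule Bochner_Integration.integrable_bound)
  show "integrable lebesgue (\<lambda>z. M * indicator (cbox a b) z)"
    using lmeasurable_cbox[of a b] by (intro integrable_mult_right) (auto simp: fmeasurable_def)
  have "bump a b 1 \<in> borel_measurable lebesgue"
    using borel_measurable_continuous_onI[OF smooth_continuous_on[OF smooth_bump]] by (intro measurable_completion) simp
  then show "(\<lambda>z. g z * bump a b 1 z) \<in> borel_measurable lebesgue" using assms(1) by (intro borel_measurable_times)
  have M: "M \<ge> 0" using assms(2)[of undefined] by linarith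
  show "AE z in lebesgue. norm (g z * bump a b 1 z) \<le> norm (M * indicator (cbox a b) z)"
  proof (intro AE_I2)
    fix z
    show "norm (g z * bump a b 1 z) \<le> norm (M * indicator (cbox a b) z)"
    proof (cases "z \<in> box a b")
      case True
      then have "z \<in> cbox a b" using box_subset_cbox by blast
      moreover have "\<bar>g z\<bar> * bump a b 1 z \<le> M * 1"
        using assms(2) M bump_le_1[of a b 1 z] bump_nonneg[of a b 1 z] by (intro mult_mono) auto
      ultimately show ?thesis using M bump_nonneg[of a b 1 z] by (simp add: abs_mult)
    qed (simp add: bump_zero)
  qed
qed

lemma integral_bump_shift:
  fixes x :: "real ^ 'n"
  shows
  "integral\<^sup>L lebesgue (bump (x - \<epsilon> *\<^sub>R 1) (x + \<epsilon> *\<^sub>R 1) 1) = integral\<^sup>L lebesgue (bump (- \<epsilon> *\<^sub>R 1) (\<epsilon> *\<^sub>R 1 :: real ^ 'n) 1)"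
proof -
  let ?K = "bump (- \<epsilon> *\<^sub>R 1) (\<epsilon> *\<^sub>R 1 :: real ^ 'n) 1"
  have m: "bump a b 1 \<in> borel_measurable lborel" for a b :: "real ^ 'n"
    using borel_measurable_continuous_onI[OF smooth_continuous_on[OF smooth_bump]] by simp
  have "lborel = distr lborel borel (\<lambda>z. x - z)"
    using lborel_affine[of "-1" x] by (simp add: density_1)
  then have "integral\<^sup>L lborel ?K = integral\<^sup>L (distr lborel borel (\<lambda>z. x - z)) ?K" by simp
  also have "\<dots> = integral\<^sup>L lborel (\<lambda>z. ?K (x - z))"
    using m by (intro integral_distr) auto
  finally show ?thesis
    using integral_completion[OF m] unfolding bump_shift[symmetric] by simp
qed

text \<open>If the integral were zero, the bump would vanish almost everywhere, and the nonempty
  open box on which it is positive would be negligible.\<close>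

lemma integral_bump_pos:
  assumes "\<epsilon> > 0"
  shows "integral\<^sup>L lebesgue (bump (- \<epsilon> *\<^sub>R 1) (\<epsilon> *\<^sub>R 1 :: real ^ 'n) 1) > 0"
proof -
  let ?K = "bump (- \<epsilon> *\<^sub>R 1) (\<epsilon> *\<^sub>R 1 :: real ^ 'n) 1" and ?B = "box (- \<epsilon> *\<^sub>R 1) (\<epsilon> *\<^sub>R 1 :: real ^ 'n)"
  have int: "integrable lebesgue ?K" using bump_integrable[of "\<lambda>z. 1" 1] by simp
  have "0 \<in> ?B" using assms by (simp add: mem_box_cart)
  have "integral\<^sup>L lebesgue ?K \<noteq> 0"
  proof
    assume "integral\<^sup>L lebesgue ?K = 0"
    then have "AE z in lebesgue. ?K z = 0"
      using integral_nonneg_eq_0_iff_AE[OF int] by (simp add: bump_nonneg)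
    then have "AE z in lebesgue. z \<notin> ?B"
      by eventually_elim (use bump_pos[of _ "- \<epsilon> *\<^sub>R 1" "\<epsilon> *\<^sub>R 1" 1] in force)
    then have "negligible ?B"
      using AE_iff_null_sets[of ?B lebesgue] by (simp add: negligible_iff_null_sets)
    then show False using open_not_negligible[OF open_box, of "- \<epsilon> *\<^sub>R 1" "\<epsilon> *\<^sub>R 1"] \<open>0 \<in> ?B\<close> by blast
  qed
  moreover have "integral\<^sup>L lebesgue ?K \<ge> 0" by (simp add: bump_nonneg)
  ultimately show ?thesis by linarith
qed

text \<open>The weights are nonnegative and, after division by \<open>J\<close>, have total mass
  one, so the mean of values within \<open>\<eta>\<close> of \<open>c\<close> stays within
  \<open>\<eta>\<close> of \<open>c\<close>. Boundedness of mollified gradients (with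
  \<open>c = 0\<close>) and both limits below are instances.\<close>

lemma mollify_average:
  fixes g :: "real ^ 'n \<Rightarrow> real"
  assumes \<epsilon>: "\<epsilon> > 0" and g: "g \<in> borel_measurable lebesgue" "\<And>z. \<bar>g z\<bar> \<le> M"
    and near: "\<And>z. z \<in> box (x - \<epsilon> *\<^sub>R 1) (x + \<epsilon> *\<^sub>R 1) \<Longrightarrow> \<bar>g z - c\<bar> \<le> \<eta>"
  shows "\<bar>mollify \<epsilon> g x - c\<bar> \<le> \<eta>"
proof -
  let ?K = "bump (x - \<epsilon> *\<^sub>R 1) (x + \<epsilon> *\<^sub>R 1) 1"
  define J where "J = integral\<^sup>L lebesgue ?K"
  have J: "J > 0" "J = integral\<^sup>L lebesgue (bump (- \<epsilon> *\<^sub>R 1) (\<epsilon> *\<^sub>R 1 :: real ^ 'n) 1)"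
    using integral_bump_pos[OF \<epsilon>, where 'n='n] integral_bump_shift[of x \<epsilon>] by (simp_all add: J_def)
  have K: "integrable lebesgue ?K" using bump_integrable[of "\<lambda>z. 1" 1] by simp
  have gK: "integrable lebesgue (\<lambda>z. g z * ?K z)" by (rule bump_integrable[OF g])
  have "integral\<^sup>L lebesgue (\<lambda>z. g z * ?K z) - c * J = integral\<^sup>L lebesgue (\<lambda>z. g z * ?K z - c * ?K z)"
    using K gK by (simp add: J_def)
  also have "\<bar>\<dots>\<bar> \<le> integral\<^sup>L lebesgue (\<lambda>z. \<eta> * ?K z)"
  proof (rule order_trans[OF integral_abs_bound], rule integral_mono)
    fix z
    show "\<bar>g z * ?K z - c * ?K z\<bar> \<le> \<eta> * ?K z"
    proof (cases "z \<in> box (x - \<epsilon> *\<^sub>R 1) (x + \<epsilon> *\<^sub>R 1)")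
      case True
      then have "\<bar>g z - c\<bar> * ?K z \<le> \<eta> * ?K z" using near bump_nonneg by (intro mult_right_mono) auto
      then show ?thesis
        by (simp add: left_diff_distrib[symmetric] abs_mult bump_nonneg)
    qed (simp add: bump_zero)
  qed (use K gK in auto)
  also have "\<dots> = \<eta> * J" by (simp add: J_def)
  finally have "\<bar>integral\<^sup>L lebesgue (\<lambda>z. g z * ?K z) - c * J\<bar> \<le> \<eta> * J" .
  moreover have "mollify \<epsilon> g x - c = (integral\<^sup>L lebesgue (\<lambda>z. g z * ?K z) - c * J) / J"
    using J by (simp add: mollify_def diff_divide_distrib)
  ultimately show ?thesis using J(1) by (simp add: pos_divide_le_eq)
qed

text \<open>The derivative falls on the kernel first. The kernel centred at \<open>x\<close> is
  itself a test function, so the weak derivative of \<open>V\<close> moves the derivative back onto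
  \<open>V\<close>; this gives the commutation with \<open>mollify\<close>.\<close>

lemma mollify_smooth:
  fixes V :: "real ^ 'n \<Rightarrow> real"
  assumes \<epsilon>: "\<epsilon> > 0" and \<Omega>: "open \<Omega>" "bounded \<Omega>" and V: "lipschitz_C1 \<Omega> V D"
  shows "smooth (mollify \<epsilon> V)" and "pdiff i (mollify \<epsilon> V) x = mollify \<epsilon> (\<lambda>z. D z $ i) x"
proof -
  let ?K = "bump (- \<epsilon> *\<^sub>R 1) (\<epsilon> *\<^sub>R 1 :: real ^ 'n) 1"
  define J where "J = integral\<^sup>L lebesgue ?K"
  have J: "J > 0" using integral_bump_pos[OF \<epsilon>] by (simp add: J_def)
  obtain C where C: "C-lipschitz_on UNIV V" and V0: "\<And>x. x \<notin> \<Omega> \<Longrightarrow> V x = 0"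
    using V unfolding lipschitz_C1_def by blast
  have cont: "continuous_on UNIV V" using C by (rule lipschitz_on_continuous_on)
  obtain a where a: "\<Omega> \<subseteq> cbox (- a) a" using bounded_subset_cbox_symmetric[OF \<Omega>(2)] by blast
  \<comment> \<open>\<open>smooth_convolution\<close> speaks of gauge integrals over a closed box;
    as \<open>V\<close> has bounded support, these agree with the Lebesgue integral over the whole
    space.\<close>
  have conv: "integral\<^sup>L lebesgue (\<lambda>z. V z * K (y - z)) = integral (cbox (- a) a) (\<lambda>z. V z * K (y - z))"
    if K: "smooth K" for K y
  proof -
    let ?f = "\<lambda>z. V z * K (y - z)"
    have c: "continuous_on UNIV ?f"
      by (intro continuous_intros cont continuous_on_compose2[OF smooth_continuous_on[OF K, of UNIV]]) auto
    have eq: "(\<lambda>z. indicator (cbox (- a) a) z *\<^sub>R ?f z) = ?f"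
      using V0 a by (auto simp: fun_eq_iff indicator_def)
    have int: "integrable lborel ?f"
      using borel_integrable_compact[OF compact_cbox[of "- a" a] continuous_on_subset[OF c]] unfolding eq by simp
    have "integral\<^sup>L lebesgue ?f = integral\<^sup>L lborel ?f"
      using borel_measurable_continuous_onI[OF c] by (intro integral_completion) simp
    moreover have "(?f has_integral integral\<^sup>L lborel ?f) UNIV" using has_integral_integral_lborel[OF int] .
    then have "((\<lambda>z. if z \<in> cbox (- a) a then ?f z else 0) has_integral integral\<^sup>L lborel ?f) UNIV"
      by (rule has_integral_eq[rotated]) (use V0 a in auto)
    then have "(?f has_integral integral\<^sup>L lborel ?f) (cbox (- a) a)"
      by (simp only: has_integral_restrict_UNIV)
    ultimately show ?thesis by (simp add: integral_unique)
  qed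
  have moll: "mollify \<epsilon> V = (\<lambda>y. integral (cbox (- a) a) (\<lambda>z. V z * ?K (y - z)) * inverse J)"
    unfolding mollify_def[abs_def] bump_shift conv[OF smooth_bump] J_def by (simp add: divide_inverse)
  note sc = smooth_convolution[OF continuous_on_subset[OF cont subset_UNIV] smooth_bump, where a="- a" and b=a]
  show "smooth (mollify \<epsilon> V)"
    unfolding moll by (intro smooth_mult smooth_const sc)
  \<comment> \<open>The kernel may reach beyond the domain. In a larger box that also contains its
    support it is a test function, and \<open>V\<close> keeps its weak gradient there.\<close>
  obtain c where c: "\<Omega> \<union> cbox (x - \<epsilon> *\<^sub>R 1) (x + \<epsilon> *\<^sub>R 1) \<subseteq> box (- c) c"
    using bounded_subset_box_symmetric[of "\<Omega> \<union> cbox (x - \<epsilon> *\<^sub>R 1) (x + \<epsilon> *\<^sub>R 1)"] \<Omega>(2) by auto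
  let ?W = "box (- c) c"
  have W: "open ?W" "bounded ?W" by auto
  have VW: "lipschitz_C1 ?W V D" using V c unfolding lipschitz_C1_def by blast
  have t: "bump (x - \<epsilon> *\<^sub>R 1) (x + \<epsilon> *\<^sub>R 1) 1 \<in> test_functions ?W" using c by (intro bump_test_function) auto
  have bump_pd: "pdiff i (bump (x - \<epsilon> *\<^sub>R 1) (x + \<epsilon> *\<^sub>R 1) 1) z = - pdiff i ?K (x - z)" for z
  proof -
    have "((\<lambda>z. x - z) has_derivative (\<lambda>h. - h)) (at z)" by (auto intro!: derivative_eq_intros)
    from has_derivative_compose[OF this has_derivative_grad[OF smooth_differentiable[OF smooth_bump[of "- \<epsilon> *\<^sub>R 1" "\<epsilon> *\<^sub>R 1" 1], of "x - z"]]]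
    have "((\<lambda>z. ?K (x - z)) has_derivative (\<lambda>h. inner (grad ?K (x - z)) (- h))) (at z)" .
    from pdiff_eq[OF this, of i] show ?thesis
      unfolding bump_shift[abs_def] by (simp add: inner_axis grad_def)
  qed
  have "L2_inner ?W V (pdiff i (bump (x - \<epsilon> *\<^sub>R 1) (x + \<epsilon> *\<^sub>R 1) 1))
      = - L2_inner ?W (\<lambda>z. D z $ i) (bump (x - \<epsilon> *\<^sub>R 1) (x + \<epsilon> *\<^sub>R 1) 1)"
    using has_weak_deriv_lipschitz_C1[OF W VW] t unfolding has_weak_grad_def has_weak_deriv_single_iff by blast
  moreover have "L2_inner ?W V (pdiff i (bump (x - \<epsilon> *\<^sub>R 1) (x + \<epsilon> *\<^sub>R 1) 1))
      = - integral\<^sup>L lebesgue (\<lambda>z. V z * pdiff i ?K (x - z))"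
  proof -
    have "L2_inner ?W V (pdiff i (bump (x - \<epsilon> *\<^sub>R 1) (x + \<epsilon> *\<^sub>R 1) 1))
        = integral\<^sup>L lebesgue (\<lambda>z. indicator ?W z *\<^sub>R inner (V z) (pdiff i (bump (x - \<epsilon> *\<^sub>R 1) (x + \<epsilon> *\<^sub>R 1) 1) z))"
      unfolding L2_inner_def by (subst integral_restrict_space) auto
    also have "(\<lambda>z. indicator ?W z *\<^sub>R inner (V z) (pdiff i (bump (x - \<epsilon> *\<^sub>R 1) (x + \<epsilon> *\<^sub>R 1) 1) z))
        = (\<lambda>z. - (V z * pdiff i ?K (x - z)))"
      using V0 c by (auto simp: fun_eq_iff bump_pd indicator_def)
    finally show ?thesis by simp
  qed
  moreover have "L2_inner ?W (\<lambda>z. D z $ i) (bump (x - \<epsilon> *\<^sub>R 1) (x + \<epsilon> *\<^sub>R 1) 1)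
      = integral\<^sup>L lebesgue (\<lambda>z. D z $ i * bump (x - \<epsilon> *\<^sub>R 1) (x + \<epsilon> *\<^sub>R 1) 1 z)"
  proof -
    have "L2_inner ?W (\<lambda>z. D z $ i) (bump (x - \<epsilon> *\<^sub>R 1) (x + \<epsilon> *\<^sub>R 1) 1)
        = integral\<^sup>L lebesgue (\<lambda>z. indicator ?W z *\<^sub>R inner (D z $ i) (bump (x - \<epsilon> *\<^sub>R 1) (x + \<epsilon> *\<^sub>R 1) 1 z))"
      unfolding L2_inner_def by (subst integral_restrict_space) auto
    also have "(\<lambda>z. indicator ?W z *\<^sub>R inner (D z $ i) (bump (x - \<epsilon> *\<^sub>R 1) (x + \<epsilon> *\<^sub>R 1) 1 z))
        = (\<lambda>z. D z $ i * bump (x - \<epsilon> *\<^sub>R 1) (x + \<epsilon> *\<^sub>R 1) 1 z)"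
    proof (rule ext)
      fix z
      show "indicator ?W z *\<^sub>R inner (D z $ i) (bump (x - \<epsilon> *\<^sub>R 1) (x + \<epsilon> *\<^sub>R 1) 1 z) = D z $ i * bump (x - \<epsilon> *\<^sub>R 1) (x + \<epsilon> *\<^sub>R 1) 1 z"
        using test_function_zero_outside[OF t, of z] by (cases "z \<in> ?W") auto
    qed
    finally show ?thesis .
  qed
  ultimately have parts: "integral\<^sup>L lebesgue (\<lambda>z. V z * pdiff i ?K (x - z))
      = integral\<^sup>L lebesgue (\<lambda>z. D z $ i * bump (x - \<epsilon> *\<^sub>R 1) (x + \<epsilon> *\<^sub>R 1) 1 z)" by simp
  have "pdiff i (\<lambda>y::real ^ 'n. inverse J) x = 0" using pdiff_eq[OF has_derivative_const] .
  then have "pdiff i (mollify \<epsilon> V) x = integral (cbox (- a) a) (\<lambda>z. V z * pdiff i ?K (x - z)) * inverse J"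
    unfolding moll by (subst pdiff_mult) (simp_all add: smooth_differentiable sc smooth_const)
  also have "\<dots> = mollify \<epsilon> (\<lambda>z. D z $ i) x"
    unfolding mollify_def parts[symmetric] conv[OF smooth_pdiff[OF smooth_bump]] J_def by (simp add: divide_inverse)
  finally show "pdiff i (mollify \<epsilon> V) x = mollify \<epsilon> (\<lambda>z. D z $ i) x" .
qed

lemma L2_norm_tendsto_0:
  fixes g :: "nat \<Rightarrow> real ^ 'n \<Rightarrow> 'b::euclidean_space"
  assumes \<Omega>: "\<Omega> \<in> lmeasurable" and g: "\<And>k. g k \<in> borel_measurable (lebesgue_on \<Omega>)"
    and bd: "\<And>k x. x \<in> \<Omega> \<Longrightarrow> norm (g k x) \<le> B"
    and lim: "AE x in lebesgue_on \<Omega>. (\<lambda>k. g k x) \<longlonglongrightarrow> 0"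
  shows "(\<lambda>k. L2_norm \<Omega> (g k)) \<longlonglongrightarrow> 0"
proof -
  have "(\<lambda>k. integral\<^sup>L (lebesgue_on \<Omega>) (\<lambda>x. (norm (g k x))\<^sup>2)) \<longlonglongrightarrow> integral\<^sup>L (lebesgue_on \<Omega>) (\<lambda>x. 0::real)"
  proof (rule integral_dominated_convergence)
    show "integrable (lebesgue_on \<Omega>) (\<lambda>x. B\<^sup>2)"
      using finite_measure.integrable_const[OF finite_measure_lebesgue_on[OF \<Omega>]] .
    show "AE x in lebesgue_on \<Omega>. (\<lambda>k. (norm (g k x))\<^sup>2) \<longlonglongrightarrow> 0"
      using lim
    proof eventually_elim
      case (elim x)
      have "(\<lambda>k. (norm (g k x))\<^sup>2) \<longlonglongrightarrow> (norm (0::'b))\<^sup>2" by (intro tendsto_intros elim)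
      then show ?case by simp
    qed
    show "AE x in lebesgue_on \<Omega>. norm ((norm (g k x))\<^sup>2) \<le> B\<^sup>2" for k
      using bd by (intro AE_I2) (simp add: power_mono)
  qed (use g in \<open>auto intro!: borel_measurable_power borel_measurable_norm\<close>)
  then have "(\<lambda>k. sqrt (integral\<^sup>L (lebesgue_on \<Omega>) (\<lambda>x. (norm (g k x))\<^sup>2))) \<longlonglongrightarrow> sqrt 0"
    by (intro tendsto_real_sqrt) simp
  then show ?thesis by (simp add: L2_norm_def)
qed

text \<open>Dilation by \<open>1 + \<delta>\<close> about an interior point shrinks the support;
  convexity ensures that points outside the domain stay outside. Lipschitz constant and gradient are
  scaled by \<open>1 + \<delta>\<close>.\<close>

lemma lipschitz_C1_dilate:
  fixes v :: "real ^ 'n \<Rightarrow> real"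
  assumes \<Omega>: "convex \<Omega>" and x0: "x0 \<in> \<Omega>" and \<delta>: "\<delta> > 0" and v: "lipschitz_C1 \<Omega> v D"
  shows "lipschitz_C1 \<Omega> (\<lambda>z. v (x0 + (1 + \<delta>) *\<^sub>R (z - x0))) (\<lambda>z. (1 + \<delta>) *\<^sub>R D (x0 + (1 + \<delta>) *\<^sub>R (z - x0)))"
proof -
  let ?\<zeta> = "\<lambda>z. x0 + (1 + \<delta>) *\<^sub>R (z - x0)" and ?\<xi> = "\<lambda>y. x0 + inverse (1 + \<delta>) *\<^sub>R (y - x0)"
  obtain C U where C: "C-lipschitz_on UNIV v" and v0: "\<And>x. x \<notin> \<Omega> \<Longrightarrow> v x = 0"
    and U: "open U" "negligible (- U)" "\<And>x. x \<in> U \<Longrightarrow> (v has_derivative (\<lambda>h. inner (D x) h)) (at x)"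
      "continuous_on U D" "\<And>x. x \<notin> U \<Longrightarrow> D x = 0"
    using v unfolding lipschitz_C1_def by blast
  have inv: "?\<xi> (?\<zeta> z) = z" "?\<zeta> (?\<xi> y) = y" for z y using \<delta> by simp_all
  have cont: "continuous_on UNIV ?\<zeta>" by (intro continuous_intros)
  let ?U = "?\<zeta> -` U"
  show ?thesis unfolding lipschitz_C1_def
  proof (intro conjI exI[of _ "C * (1 + \<delta>)"] exI[of _ ?U] ballI allI impI)
    show "(C * (1 + \<delta>))-lipschitz_on UNIV (\<lambda>z. v (?\<zeta> z))"
    proof (rule lipschitz_onI)
      fix x y :: "real ^ 'n"
      have "dist (v (?\<zeta> x)) (v (?\<zeta> y)) \<le> C * dist (?\<zeta> x) (?\<zeta> y)" by (rule lipschitz_onD[OF C]) auto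
      also have "dist (?\<zeta> x) (?\<zeta> y) = (1 + \<delta>) * dist x y"
      proof -
        have "?\<zeta> x - ?\<zeta> y = (1 + \<delta>) *\<^sub>R (x - y)" by (simp add: algebra_simps)
        then show ?thesis using \<delta> by (simp add: dist_norm)
      qed
      finally show "dist (v (?\<zeta> x)) (v (?\<zeta> y)) \<le> C * (1 + \<delta>) * dist x y" by (simp add: mult.assoc)
    qed (use lipschitz_on_nonneg[OF C] \<delta> in auto)
    fix z assume z: "z \<notin> \<Omega>"
    \<comment> \<open>\<open>z\<close> is a convex combination of \<open>x0\<close> and
      \<open>?\<zeta> z\<close>, so both lying in the domain would put \<open>z\<close>
      there.\<close>
    have "?\<zeta> z \<notin> \<Omega>"
    proof
      assume "?\<zeta> z \<in> \<Omega>"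
      then have "(1 - inverse (1 + \<delta>)) *\<^sub>R x0 + inverse (1 + \<delta>) *\<^sub>R ?\<zeta> z \<in> \<Omega>"
        using \<Omega> x0 \<delta> by (intro convexD_alt) (auto simp: inverse_le_1_iff)
      moreover have "(1 - inverse (1 + \<delta>)) *\<^sub>R x0 + inverse (1 + \<delta>) *\<^sub>R ?\<zeta> z = ?\<xi> (?\<zeta> z)"
        by (simp add: algebra_simps)
      ultimately show False using z unfolding inv by simp
    qed
    then show "v (?\<zeta> z) = 0" by (rule v0)
  next
    show "open ?U" using U(1) cont by (simp add: open_vimage)
    have "- ?U = ?\<xi> ` (- U)"
    proof (intro subset_antisym subsetI)
      fix z assume "z \<in> - ?U"
      then have "?\<xi> (?\<zeta> z) \<in> ?\<xi> ` (- U)" by (intro imageI) simp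
      then show "z \<in> ?\<xi> ` (- U)" unfolding inv .
    next
      fix z assume "z \<in> ?\<xi> ` (- U)"
      then obtain y where y: "z = ?\<xi> y" "y \<notin> U" by blast
      have "?\<zeta> z = y" unfolding y(1) inv ..
      then show "z \<in> - ?U" using y(2) by simp
    qed
    moreover have "negligible (?\<xi> ` (- U))"
      by (rule negligible_differentiable_image_negligible[OF _ U(2)])
        (auto intro!: differentiable_on_add differentiable_on_scaleR differentiable_on_diff differentiable_on_const differentiable_on_ident)
    ultimately show "negligible (- ?U)" by simp
  next
    fix z assume "z \<in> ?U"
    then have d: "(v has_derivative (\<lambda>h. inner (D (?\<zeta> z)) h)) (at (?\<zeta> z))" using U(3) by simp
    have "(?\<zeta> has_derivative (\<lambda>h. (1 + \<delta>) *\<^sub>R h)) (at z)" by (auto intro!: derivative_eq_intros)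
    from has_derivative_compose[OF this d]
    have "((\<lambda>z. v (?\<zeta> z)) has_derivative (\<lambda>h. inner (D (?\<zeta> z)) ((1 + \<delta>) *\<^sub>R h))) (at z)" .
    moreover have "(\<lambda>h. inner (D (?\<zeta> z)) ((1 + \<delta>) *\<^sub>R h)) = inner ((1 + \<delta>) *\<^sub>R D (?\<zeta> z))"
      by (simp add: fun_eq_iff)
    ultimately show "((\<lambda>z. v (?\<zeta> z)) has_derivative inner ((1 + \<delta>) *\<^sub>R D (?\<zeta> z))) (at z)" by simp
  next
    show "continuous_on ?U (\<lambda>z. (1 + \<delta>) *\<^sub>R D (?\<zeta> z))"
      by (intro continuous_intros continuous_on_compose2[OF U(4)]) auto
  next
    fix z assume "z \<notin> ?U"
    then show "(1 + \<delta>) *\<^sub>R D (?\<zeta> z) = 0" using U(5) by simp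
  qed
qed

lemma box_cart_dist:
  assumes "z \<in> box (x - \<epsilon> *\<^sub>R 1) (x + \<epsilon> *\<^sub>R 1 :: real ^ 'n)"
  shows "norm (z - x) \<le> \<epsilon> * real CARD('n)"
proof -
  have "norm (z - x) \<le> (\<Sum>i\<in>UNIV. \<bar>(z - x) $ i\<bar>)" by (rule norm_le_l1_cart)
  also have "\<dots> \<le> (\<Sum>i\<in>(UNIV::'n set). \<epsilon>)"
  proof (rule sum_mono)
    fix i
    have "x $ i - \<epsilon> < z $ i \<and> z $ i < x $ i + \<epsilon>" using assms by (simp add: mem_box_cart)
    then show "\<bar>(z - x) $ i\<bar> \<le> \<epsilon>" unfolding vector_minus_component by linarith
  qed
  finally show ?thesis by (simp add: mult.commute)
qed

text \<open>A Lipschitz function vanishing outside a convex domain is first dilated, which gives it compact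
  support, and then mollified; at every point where its gradient is continuous the gradients converge.\<close>

lemma lipschitz_C1_H10:
  fixes \<Omega> :: "(real ^ 'n) set"
  assumes \<Omega>: "open \<Omega>" "bounded \<Omega>" "convex \<Omega>" "\<Omega> \<noteq> {}" and v: "lipschitz_C1 \<Omega> v D"
  shows "v \<in> H10 \<Omega>"
proof -
  obtain x0 where x0: "x0 \<in> \<Omega>" using \<Omega>(4) by blast
  define \<delta> where "\<delta> = (\<lambda>k. inverse (real (Suc k)))"
  have \<delta>: "\<delta> k > 0" "\<delta> k \<le> 1" for k by (auto simp: \<delta>_def inverse_le_1_iff)
  have \<delta>lim: "\<delta> \<longlonglongrightarrow> 0" unfolding \<delta>_def by (rule LIMSEQ_inverse_real_of_nat)
  define \<zeta> where "\<zeta> = (\<lambda>k z. x0 + (1 + \<delta> k) *\<^sub>R (z - x0))"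
  define V where "V = (\<lambda>k z. v (\<zeta> k z))"
  define E where "E = (\<lambda>k z. (1 + \<delta> k) *\<^sub>R D (\<zeta> k z))"
  define n where "n = real CARD('n)"
  have n: "n > 0" by (simp add: n_def)
  have V: "lipschitz_C1 \<Omega> (V k) (E k)" for k
    unfolding V_def E_def \<zeta>_def by (rule lipschitz_C1_dilate[OF \<Omega>(3) x0 \<delta>(1) v])
  obtain C U where C: "C-lipschitz_on UNIV v" and v0: "\<And>x. x \<notin> \<Omega> \<Longrightarrow> v x = 0"
    and U: "open U" "negligible (- U)" "continuous_on U D"
    using v unfolding lipschitz_C1_def by blast
  have C0: "C \<ge> 0" using C by (rule lipschitz_on_nonneg)
  have Dbd: "norm (D x) \<le> C" for x by (rule lipschitz_C1_bounded[OF v C])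
  \<comment> \<open>The points that the dilation sends into the closed domain. The support of
    \<open>V k\<close> lies in this set, which is a compact subset of the open domain and so has
    positive distance to the complement.\<close>
  define S where "S = (\<lambda>k. \<zeta> k -` closure \<Omega>)"
  have S: "compact (S k)" "S k \<subseteq> \<Omega>" for k
  proof -
    have "S k = (\<lambda>y. x0 + inverse (1 + \<delta> k) *\<^sub>R (y - x0)) ` closure \<Omega>" (is "_ = ?\<xi> ` _")
    proof -
      have inv: "?\<xi> (\<zeta> k z) = z" "\<zeta> k (?\<xi> z) = z" for z using \<delta>(1)[of k] by (simp_all add: \<zeta>_def)
      show ?thesis
      proof (intro subset_antisym subsetI)
        fix z assume "z \<in> S k"
        then have "?\<xi> (\<zeta> k z) \<in> ?\<xi> ` closure \<Omega>" by (intro imageI) (simp add: S_def)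
        then show "z \<in> ?\<xi> ` closure \<Omega>" unfolding inv .
      next
        fix z assume "z \<in> ?\<xi> ` closure \<Omega>"
        then obtain y where y: "z = ?\<xi> y" "y \<in> closure \<Omega>" by blast
        have "\<zeta> k z = y" unfolding y(1) inv ..
        then show "z \<in> S k" using y(2) by (simp add: S_def)
      qed
    qed
    then show "compact (S k)"
      using \<Omega>(2) by (auto intro!: compact_continuous_image continuous_intros simp: compact_closure)
    show "S k \<subseteq> \<Omega>"
    proof
      fix z assume "z \<in> S k"
      then have cl: "\<zeta> k z \<in> closure \<Omega>" by (simp add: S_def)
      \<comment> \<open>\<open>z\<close> arises from \<open>\<zeta> k z\<close> by moving the
        fraction \<open>e\<close> of the way to \<open>x0\<close>, and a point of the closure of a
        convex set moved towards an interior point becomes interior.\<close>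
      define e where "e = 1 - inverse (1 + \<delta> k)"
      have e: "0 < e" "e \<le> 1" using \<delta>[of k] by (auto simp: e_def field_simps)
      have "\<zeta> k z - e *\<^sub>R (\<zeta> k z - x0) \<in> interior \<Omega>"
        using \<Omega> x0 cl e by (intro mem_interior_closure_convex_shrink) (auto simp: interior_open)
      moreover have "\<zeta> k z - e *\<^sub>R (\<zeta> k z - x0) = z"
      proof -
        have "(\<zeta> k z - x0) - e *\<^sub>R (\<zeta> k z - x0) = (inverse (1 + \<delta> k) * (1 + \<delta> k)) *\<^sub>R (z - x0)"
          by (simp add: e_def \<zeta>_def algebra_simps)
        also have "inverse (1 + \<delta> k) * (1 + \<delta> k) = 1" using \<delta>(1)[of k] by simp
        finally have w: "(\<zeta> k z - x0) - e *\<^sub>R (\<zeta> k z - x0) = z - x0" by simp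
        have "\<zeta> k z - e *\<^sub>R (\<zeta> k z - x0) = ((\<zeta> k z - x0) - e *\<^sub>R (\<zeta> k z - x0)) + x0" by simp
        also have "\<dots> = z" unfolding w by simp
        finally show ?thesis .
      qed
      ultimately show "z \<in> \<Omega>" using interior_subset by auto
    qed
  qed
  have "\<exists>e>0. (\<Union>x\<in>S k. ball x e) \<subseteq> \<Omega>" for k
    using compact_subset_open_imp_ball_epsilon_subset[OF S(1) \<Omega>(1) S(2)] by metis
  then obtain \<rho> where \<rho>: "\<And>k. \<rho> k > 0" "\<And>k. (\<Union>x\<in>S k. ball x (\<rho> k)) \<subseteq> \<Omega>" by metis
  \<comment> \<open>The kernel cube has Euclidean radius at most \<open>\<epsilon> k * n\<close>.
    This must stay below \<open>\<rho> k\<close>, to keep the support in the domain, and be at most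
    \<open>\<delta> k\<close>, to vanish in the limit.\<close>
  define \<epsilon> where "\<epsilon> = (\<lambda>k. min (\<rho> k / 2) (\<delta> k) / n)"
  have \<epsilon>: "\<epsilon> k > 0" "\<epsilon> k * n \<le> \<delta> k" "\<epsilon> k * n < \<rho> k" for k
    using \<rho>(1)[of k] \<delta>(1)[of k] n by (auto simp: \<epsilon>_def)
  define \<psi> where "\<psi> = (\<lambda>k. mollify (\<epsilon> k) (V k))"
  have smooth: "smooth (\<psi> k)" for k unfolding \<psi>_def by (rule mollify_smooth(1)[OF \<epsilon>(1) \<Omega>(1,2) V])
  have test: "\<psi> k \<in> test_functions \<Omega>" for k
  proof -
    let ?T = "{x + y |x y. x \<in> S k \<and> y \<in> cball 0 (\<epsilon> k * n)}"
    have T: "compact ?T" by (intro compact_sums S compact_cball)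
    have TO: "?T \<subseteq> \<Omega>"
    proof
      fix w assume "w \<in> ?T"
      then obtain x y where w: "w = x + y" "x \<in> S k" "norm y \<le> \<epsilon> k * n" by auto
      then have "w \<in> ball x (\<rho> k)" using \<epsilon>(3)[of k] by (simp add: dist_norm)
      then show "w \<in> \<Omega>" using \<rho>(2)[of k] w(2) by blast
    qed
    have sub: "{x. \<psi> k x \<noteq> 0} \<subseteq> ?T"
    proof
      fix x assume "x \<in> {x. \<psi> k x \<noteq> 0}"
      then have ne: "mollify (\<epsilon> k) (V k) x \<noteq> 0" by (simp add: \<psi>_def)
      have "\<exists>z\<in>box (x - \<epsilon> k *\<^sub>R 1) (x + \<epsilon> k *\<^sub>R 1). V k z \<noteq> 0"
      proof (rule ccontr)
        assume "\<not> ?thesis"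
        then have "V k z * bump (x - \<epsilon> k *\<^sub>R 1) (x + \<epsilon> k *\<^sub>R 1) 1 z = 0" for z
          by (cases "z \<in> box (x - \<epsilon> k *\<^sub>R 1) (x + \<epsilon> k *\<^sub>R 1)") (auto simp: bump_zero)
        then have "mollify (\<epsilon> k) (V k) x = 0" unfolding mollify_def by (simp only:) simp
        then show False using ne by contradiction
      qed
      then obtain z where z: "z \<in> box (x - \<epsilon> k *\<^sub>R 1) (x + \<epsilon> k *\<^sub>R 1)" "V k z \<noteq> 0" by blast
      have "\<zeta> k z \<in> \<Omega>" using z(2) v0 unfolding V_def by blast
      then have "z \<in> S k" using closure_subset[of \<Omega>] unfolding S_def by blast
      moreover have "x - z \<in> cball 0 (\<epsilon> k * n)"
        using box_cart_dist[OF z(1)] by (simp add: n_def norm_minus_commute)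
      ultimately show "x \<in> ?T" by (intro CollectI exI[of _ z] exI[of _ "x - z"]) auto
    qed
    have cl: "closure {x. \<psi> k x \<noteq> 0} \<subseteq> ?T" using sub by (rule closure_minimal) (rule compact_imp_closed[OF T])
    moreover have "compact (closure {x. \<psi> k x \<noteq> 0})"
      using bounded_subset[OF compact_imp_bounded[OF T] sub] by (simp add: compact_closure)
    ultimately show ?thesis using TO smooth[of k] unfolding test_functions_iff by blast
  qed
  obtain R1 where R1: "\<And>x. x \<in> \<Omega> \<Longrightarrow> norm x \<le> R1" using \<Omega>(2) by (auto simp: bounded_iff)
  define R where "R = R1 + norm x0"
  have R: "norm (x - x0) \<le> R" if "x \<in> \<Omega>" for x
    using R1[OF that] norm_triangle_ineq4[of x x0] by (simp add: R_def)
  have R0: "R \<ge> 0" using R[OF x0] by simp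
  \<comment> \<open>Every value that enters the average at \<open>x\<close> is taken within
    \<open>\<delta> k * (2 + R)\<close> of \<open>x\<close>: one \<open>\<delta> k\<close> is the
    kernel radius, the rest the displacement by the dilation.\<close>
  have near: "norm (\<zeta> k z - x) \<le> \<delta> k * (2 + R)"
    if x: "x \<in> \<Omega>" and z: "z \<in> box (x - \<epsilon> k *\<^sub>R 1) (x + \<epsilon> k *\<^sub>R 1)" for k x z
  proof -
    have zx: "norm (z - x) \<le> \<delta> k" using box_cart_dist[OF z] \<epsilon>(2)[of k] by (simp add: n_def)
    have "norm (z - x0) \<le> norm (z - x) + norm (x - x0)" using norm_triangle_ineq[of "z - x" "x - x0"] by simp
    then have zx0: "norm (z - x0) \<le> 1 + R" using zx \<delta>(2)[of k] R[OF x] by linarith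
    have eq: "\<zeta> k z - x = (z - x) + \<delta> k *\<^sub>R (z - x0)" by (simp add: \<zeta>_def algebra_simps)
    have "norm (\<zeta> k z - x) \<le> norm (z - x) + \<delta> k * norm (z - x0)"
      unfolding eq using norm_triangle_ineq[of "z - x" "\<delta> k *\<^sub>R (z - x0)"] \<delta>(1)[of k] by simp
    also have "\<dots> \<le> \<delta> k + \<delta> k * (1 + R)"
      using zx zx0 \<delta>(1)[of k] by (intro add_mono mult_left_mono) auto
    finally show ?thesis by (simp add: algebra_simps)
  qed
  define M where "M = \<bar>v x0\<bar> + C * R"
  have vM: "\<bar>v x\<bar> \<le> M" for x
  proof (cases "x \<in> \<Omega>")
    case True
    have "\<bar>v x - v x0\<bar> \<le> C * norm (x - x0)" using lipschitz_onD[OF C, of x x0] by (simp add: dist_norm)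
    also have "\<dots> \<le> C * R" using R[OF True] C0 by (intro mult_left_mono)
    finally show ?thesis unfolding M_def by linarith
  next
    case False
    then show ?thesis using v0 C0 R0 by (simp add: M_def)
  qed
  have lm: "\<Omega> \<in> lmeasurable" using \<Omega> by (simp add: lmeasurable_open)
  have vL: "v \<in> L2 \<Omega>" "D \<in> L2 \<Omega>" using lipschitz_C1_L2[OF \<Omega>(1,2) v] by auto
  have Vm: "V k \<in> borel_measurable lebesgue" for k
  proof -
    have "continuous_on UNIV (V k)" using V[of k] lipschitz_on_continuous_on unfolding lipschitz_C1_def by blast
    from borel_measurable_continuous_onI[OF this] show ?thesis by (intro measurable_completion) simp
  qed
  have Em: "(\<lambda>z. E k z $ i) \<in> borel_measurable lebesgue" for k i
    using lipschitz_C1_measurable[OF V] by (rule borel_measurable_component)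
  have \<psi>L: "\<psi> k \<in> L2 \<Omega>" "grad (\<psi> k) \<in> L2 \<Omega>" for k
    using test_function_L2[OF \<Omega>(1,2) smooth] has_weak_grad_L2[OF has_weak_grad_test_function[OF \<Omega>(1,2) test]] by auto
  have Ebd: "\<bar>E k z $ i\<bar> \<le> 2 * C" for k z i
  proof -
    have "\<bar>E k z $ i\<bar> \<le> norm (E k z)" by (rule component_le_norm_cart)
    also have "\<dots> = (1 + \<delta> k) * norm (D (\<zeta> k z))" using \<delta>(1)[of k] by (simp add: E_def)
    also have "\<dots> \<le> 2 * C" using \<delta>[of k] Dbd by (intro mult_mono) auto
    finally show ?thesis .
  qed
  have close: "\<bar>\<psi> k x - v x\<bar> \<le> C * (\<delta> k * (2 + R))" if x: "x \<in> \<Omega>" for k x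
    unfolding \<psi>_def
  proof (rule mollify_average[OF \<epsilon>(1) Vm])
    show "\<bar>V k z\<bar> \<le> M" for z unfolding V_def by (rule vM)
    fix z assume z: "z \<in> box (x - \<epsilon> k *\<^sub>R 1) (x + \<epsilon> k *\<^sub>R 1)"
    have "\<bar>V k z - v x\<bar> \<le> C * norm (\<zeta> k z - x)" using lipschitz_onD[OF C, of "\<zeta> k z" x] by (simp add: V_def dist_norm)
    also have "\<dots> \<le> C * (\<delta> k * (2 + R))" using near[OF x z] C0 by (intro mult_left_mono)
    finally show "\<bar>V k z - v x\<bar> \<le> C * (\<delta> k * (2 + R))" .
  qed
  have gbd: "\<bar>grad (\<psi> k) x $ i\<bar> \<le> 2 * C" for k x i
  proof -
    have "\<bar>mollify (\<epsilon> k) (\<lambda>z. E k z $ i) x - 0\<bar> \<le> 2 * C"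
      by (rule mollify_average[OF \<epsilon>(1) Em Ebd]) (use Ebd in auto)
    then show ?thesis by (simp add: grad_def \<psi>_def mollify_smooth(2)[OF \<epsilon>(1) \<Omega>(1,2) V])
  qed
  have glim: "(\<lambda>k. grad (\<psi> k) x $ i) \<longlonglongrightarrow> D x $ i" if x: "x \<in> \<Omega>" "x \<in> U" for x i
  proof (rule LIMSEQ_I)
    fix e :: real assume e: "e > 0"
    have "isCont D x" using U x(2) continuous_on_eq_continuous_at by blast
    then obtain d where d: "d > 0" "\<And>y. norm (y - x) < d \<Longrightarrow> norm (D y - D x) < e / 4"
      using e unfolding continuous_at_eps_delta dist_norm by (auto dest!: spec[of _ "e / 4"])
    have "(\<lambda>k. \<delta> k * (2 + R)) \<longlonglongrightarrow> 0" "(\<lambda>k. \<delta> k * C) \<longlonglongrightarrow> 0"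
      using tendsto_mult_left_zero[OF \<delta>lim] by blast+
    moreover have "e / 4 > 0" using e by simp
    ultimately have "\<forall>\<^sub>F k in sequentially. \<delta> k * (2 + R) < d" "\<forall>\<^sub>F k in sequentially. \<delta> k * C < e / 4"
      using d(1) order_tendstoD(2) by blast+
    then have "\<forall>\<^sub>F k in sequentially. norm (grad (\<psi> k) x $ i - D x $ i) < e"
    proof eventually_elim
      case (elim k)
      \<comment> \<open>One quarter of \<open>e\<close> pays for the continuity of \<open>D\<close>
        at \<open>x\<close>, another for the factor \<open>1 + \<delta> k\<close> in the dilated
        gradient.\<close>
      have "\<bar>mollify (\<epsilon> k) (\<lambda>z. E k z $ i) x - D x $ i\<bar> \<le> e / 2"
      proof (rule mollify_average[OF \<epsilon>(1) Em Ebd])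
        fix z assume z: "z \<in> box (x - \<epsilon> k *\<^sub>R 1) (x + \<epsilon> k *\<^sub>R 1)"
        have 1: "norm (D (\<zeta> k z) - D x) < e / 4" using d(2) near[OF x(1) z] elim(1) by fastforce
        have eq: "E k z - D x = (D (\<zeta> k z) - D x) + \<delta> k *\<^sub>R D (\<zeta> k z)" by (simp add: E_def algebra_simps)
        have "norm (E k z - D x) \<le> norm (D (\<zeta> k z) - D x) + \<delta> k * norm (D (\<zeta> k z))"
          unfolding eq using norm_triangle_ineq[of "D (\<zeta> k z) - D x" "\<delta> k *\<^sub>R D (\<zeta> k z)"] \<delta>(1)[of k] by simp
        moreover have "\<delta> k * norm (D (\<zeta> k z)) \<le> \<delta> k * C" using Dbd \<delta>(1)[of k] by (intro mult_left_mono) auto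
        ultimately have "norm (E k z - D x) \<le> e / 2" using 1 elim(2) by linarith
        then show "\<bar>E k z $ i - D x $ i\<bar> \<le> e / 2" using component_le_norm_cart[of "E k z - D x" i] by simp
      qed
      then show ?case using e by (simp add: grad_def \<psi>_def mollify_smooth(2)[OF \<epsilon>(1) \<Omega>(1,2) V])
    qed
    then show "\<exists>N. \<forall>k\<ge>N. norm (grad (\<psi> k) x $ i - D x $ i) < e" by (simp add: eventually_sequentially)
  qed
  show ?thesis
  proof (rule H10I[OF \<Omega>(1,2) vL(1) has_weak_deriv_lipschitz_C1[OF \<Omega>(1,2) v] test])
    show "(\<lambda>k. L2_norm \<Omega> (\<lambda>x. v x - \<psi> k x)) \<longlonglongrightarrow> 0"
    proof (rule L2_norm_tendsto_0[OF lm, where B="C * (1 * (2 + R))"])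
      show "(\<lambda>x. v x - \<psi> k x) \<in> borel_measurable (lebesgue_on \<Omega>)" for k
        using L2_measurable[OF L2_diff[OF vL(1) \<psi>L(1)]] .
      show "norm (v x - \<psi> k x) \<le> C * (1 * (2 + R))" if "x \<in> \<Omega>" for k x
      proof -
        have "C * (\<delta> k * (2 + R)) \<le> C * (1 * (2 + R))"
          using \<delta>[of k] C0 R0 by (intro mult_left_mono mult_right_mono) auto
        then show ?thesis using close[OF that, of k] by (simp add: abs_minus_commute)
      qed
      show "AE x in lebesgue_on \<Omega>. (\<lambda>k. v x - \<psi> k x) \<longlonglongrightarrow> 0"
      proof (intro AE_I2)
        fix x assume "x \<in> space (lebesgue_on \<Omega>)"
        then have x: "x \<in> \<Omega>" by simp
        have lim0: "(\<lambda>k. C * (\<delta> k * (2 + R))) \<longlonglongrightarrow> 0"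
          using tendsto_mult[OF tendsto_const tendsto_mult[OF \<delta>lim tendsto_const], of C "2 + R"] by simp
        show "(\<lambda>k. v x - \<psi> k x) \<longlonglongrightarrow> 0"
          by (rule Lim_null_comparison[OF _ lim0]) (use close[OF x] in \<open>simp add: abs_minus_commute\<close>)
      qed
    qed
    show "(\<lambda>k. L2_norm \<Omega> (\<lambda>x. D x - grad (\<psi> k) x)) \<longlonglongrightarrow> 0"
    proof (rule L2_norm_tendsto_0[OF lm, where B="C + 2 * C * n"])
      show "(\<lambda>x. D x - grad (\<psi> k) x) \<in> borel_measurable (lebesgue_on \<Omega>)" for k
        using L2_measurable[OF L2_diff[OF vL(2) \<psi>L(2)]] .
      show "norm (D x - grad (\<psi> k) x) \<le> C + 2 * C * n" for k x
      proof -
        have "norm (grad (\<psi> k) x) \<le> (\<Sum>i\<in>UNIV. \<bar>grad (\<psi> k) x $ i\<bar>)" by (rule norm_le_l1_cart)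
        also have "\<dots> \<le> (\<Sum>i\<in>(UNIV::'n set). 2 * C)" by (intro sum_mono gbd)
        finally have "norm (grad (\<psi> k) x) \<le> 2 * C * n" by (simp add: n_def mult.commute)
        then show ?thesis using norm_triangle_ineq4[of "D x" "grad (\<psi> k) x"] Dbd[of x] by linarith
      qed
      have "AE x in lebesgue. x \<notin> - U" using U(2) by (intro AE_not_in) (simp add: negligible_iff_null_sets)
      then have "AE x in lebesgue. x \<in> \<Omega> \<longrightarrow> (\<lambda>k. D x - grad (\<psi> k) x) \<longlonglongrightarrow> 0"
      proof eventually_elim
        case (elim x)
        show ?case
        proof
          assume x: "x \<in> \<Omega>"
          have g: "(\<lambda>k. grad (\<psi> k) x) \<longlonglongrightarrow> D x" using glim x elim by (intro vec_tendstoI) auto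
          show "(\<lambda>k. D x - grad (\<psi> k) x) \<longlonglongrightarrow> 0" using tendsto_diff[OF tendsto_const[of "D x"] g] by simp
        qed
      qed
      then show "AE x in lebesgue_on \<Omega>. (\<lambda>k. D x - grad (\<psi> k) x) \<longlonglongrightarrow> 0"
        using AE_lebesgue_on_iff[OF fmeasurableD[OF lm]] by blast
    qed
  qed
qed

section \<open>Reference polynomials\<close>

lemma smooth_add:
  assumes "smooth f" "smooth g"
  shows "smooth (\<lambda>x. f x + g x)"
proof (rule smooth_closed_family[of product_sums])
  have "(\<lambda>x. 1 * f x) \<in> product_sums" "(\<lambda>x. 1 * g x) \<in> product_sums"
    by (intro product_sums.intros(1) smooth_const assms)+
  from product_sums.intros(2)[OF this] show "(\<lambda>x. f x + g x) \<in> product_sums" by simp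
qed (use product_sums_closed in blast)+

lemma smooth_sum:
  assumes "finite A" "\<And>i. i \<in> A \<Longrightarrow> smooth (f i)"
  shows "smooth (\<lambda>x. \<Sum>i\<in>A. f i x)"
  using assms by (induction A rule: finite_induct) (auto intro: smooth_add smooth_const)

lemma smooth_power: "smooth f \<Longrightarrow> smooth (\<lambda>x. f x ^ k)"
  by (induction k) (auto intro: smooth_mult smooth_const)

definition monomial :: "('n \<Rightarrow> nat) \<Rightarrow> real ^ 'n \<Rightarrow> real" where
  "monomial \<alpha> x = (\<Prod>i\<in>UNIV. (x $ i) ^ \<alpha> i)"

lemma smooth_monomial: "smooth (monomial \<alpha>)"
  unfolding monomial_def[abs_def] by (intro smooth_prod smooth_power smooth_coordinate) auto

lemma finite_exponents: "finite (exponents S r :: ('n::finite \<Rightarrow> nat) set)"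
proof -
  have "finite (PiE (UNIV :: 'n set) (\<lambda>_. {..r}))" by (intro finite_PiE) auto
  moreover have "\<alpha> i \<le> r" if "sum \<alpha> UNIV \<le> r" for \<alpha> :: "'n \<Rightarrow> nat" and i
    using member_le_sum[of i UNIV \<alpha>] that by simp
  then have "exponents S r \<subseteq> PiE (UNIV :: 'n set) (\<lambda>_. {..r})"
    by (cases S) (auto simp: PiE_def Pi_def extensional_def)
  ultimately show ?thesis by (rule rev_finite_subset)
qed

lemma ref_poly_iff:
  "p \<in> ref_poly S r \<longleftrightarrow> (\<exists>a. p = (\<lambda>x. \<Sum>\<alpha>\<in>exponents S r. a \<alpha> * monomial \<alpha> x))"
  unfolding ref_poly_def monomial_def by blast

lemma ref_polyI: "(\<lambda>x. \<Sum>\<alpha>\<in>exponents S r. a \<alpha> * monomial \<alpha> x) \<in> ref_poly S r"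
  unfolding ref_poly_iff by blast

lemma ref_poly_smooth: "p \<in> ref_poly S r \<Longrightarrow> smooth p"
  unfolding ref_poly_iff by (auto intro!: smooth_sum smooth_mult smooth_const smooth_monomial finite_exponents)

lemma ref_poly_add: "p \<in> ref_poly S r \<Longrightarrow> q \<in> ref_poly S r \<Longrightarrow> (\<lambda>x. p x + q x) \<in> ref_poly S r"
proof -
  assume "p \<in> ref_poly S r" "q \<in> ref_poly S r"
  then obtain a b where p: "p = (\<lambda>x. \<Sum>\<alpha>\<in>exponents S r. a \<alpha> * monomial \<alpha> x)"
    and q: "q = (\<lambda>x. \<Sum>\<alpha>\<in>exponents S r. b \<alpha> * monomial \<alpha> x)"
    unfolding ref_poly_iff by blast
  have "(\<lambda>x. p x + q x) = (\<lambda>x. \<Sum>\<alpha>\<in>exponents S r. (a \<alpha> + b \<alpha>) * monomial \<alpha> x)"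
    unfolding p q by (simp add: sum.distrib[symmetric] algebra_simps)
  then show ?thesis using ref_polyI[of "\<lambda>\<alpha>. a \<alpha> + b \<alpha>"] by simp
qed

lemma ref_poly_cmult: "p \<in> ref_poly S r \<Longrightarrow> (\<lambda>x. c * p x) \<in> ref_poly S r"
proof -
  assume "p \<in> ref_poly S r"
  then obtain a where p: "p = (\<lambda>x. \<Sum>\<alpha>\<in>exponents S r. a \<alpha> * monomial \<alpha> x)" unfolding ref_poly_iff by blast
  have "(\<lambda>x. c * p x) = (\<lambda>x. \<Sum>\<alpha>\<in>exponents S r. (c * a \<alpha>) * monomial \<alpha> x)"
    unfolding p by (simp add: sum_distrib_left mult.assoc)
  then show ?thesis using ref_polyI[of "\<lambda>\<alpha>. c * a \<alpha>"] by simp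
qed

lemma ref_poly_diff: "p \<in> ref_poly S r \<Longrightarrow> q \<in> ref_poly S r \<Longrightarrow> (\<lambda>x. p x - q x) \<in> ref_poly S r"
  using ref_poly_add[OF _ ref_poly_cmult[of q S r "-1"], of p] by simp

lemma sum_select:
  "finite A \<Longrightarrow> a \<in> A \<Longrightarrow> (\<Sum>\<beta>\<in>A. (if \<beta> = a then 1 else 0) * f \<beta>) = (f a :: real)"
  by (simp add: if_distrib if_distribR cong: if_cong)

lemma ref_poly_monomial:
  assumes "\<alpha> \<in> exponents S r"
  shows "monomial \<alpha> \<in> ref_poly S r"
proof -
  have eq: "monomial \<alpha> = (\<lambda>x. \<Sum>\<beta>\<in>exponents S r. (if \<beta> = \<alpha> then 1 else 0) * monomial \<beta> x)"
    by (rule ext) (rule sum_select[OF finite_exponents assms, symmetric])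
  show ?thesis by (subst eq) (rule ref_polyI)
qed

lemma ref_poly_const: "(\<lambda>x. c) \<in> ref_poly S r"
proof -
  have "(\<lambda>i. 0) \<in> exponents S r" by (cases S) auto
  from ref_poly_cmult[OF ref_poly_monomial[OF this], of c] show ?thesis by (simp add: monomial_def)
qed

lemma ref_poly_sum:
  assumes "finite A" "\<And>i. i \<in> A \<Longrightarrow> f i \<in> ref_poly S r"
  shows "(\<lambda>x. \<Sum>i\<in>A. f i x) \<in> ref_poly S r"
  using assms by (induction A rule: finite_induct) (auto intro: ref_poly_add ref_poly_const)

lemma ref_poly_coordinate:
  assumes "r \<ge> 1"
  shows "(\<lambda>x::real ^ 'n. x $ i) \<in> ref_poly S r"
proof -
  let ?\<alpha> = "\<lambda>j. if j = i then 1 else 0 :: nat"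
  have "?\<alpha> \<in> exponents S r" using assms by (cases S) auto
  from ref_poly_monomial[OF this] have "monomial ?\<alpha> \<in> ref_poly S r" .
  moreover have "monomial ?\<alpha> = (\<lambda>x::real ^ 'n. x $ i)"
  proof
    fix x :: "real ^ 'n"
    have "monomial ?\<alpha> x = (\<Prod>j\<in>UNIV. if j = i then x $ j else 1)"
      unfolding monomial_def by (intro prod.cong) auto
    then show "monomial ?\<alpha> x = x $ i" by simp
  qed
  ultimately show ?thesis by simp
qed

lemma ref_poly_simplicial_mult:
  assumes "p \<in> ref_poly Simplicial a" "q \<in> ref_poly Simplicial b"
  shows "(\<lambda>x. p x * q x) \<in> ref_poly Simplicial (a + b)"
proof -
  obtain c d where p: "p = (\<lambda>x. \<Sum>\<alpha>\<in>exponents Simplicial a. c \<alpha> * monomial \<alpha> x)"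
    and q: "q = (\<lambda>x. \<Sum>\<beta>\<in>exponents Simplicial b. d \<beta> * monomial \<beta> x)"
    using assms unfolding ref_poly_iff by blast
  have eq: "(\<lambda>x. p x * q x) = (\<lambda>x. \<Sum>\<alpha>\<in>exponents Simplicial a. \<Sum>\<beta>\<in>exponents Simplicial b.
      (c \<alpha> * d \<beta>) * monomial (\<lambda>i. \<alpha> i + \<beta> i) x)"
    unfolding p q by (simp add: sum_product monomial_def power_add prod.distrib mult_ac)
  have "monomial (\<lambda>i. \<alpha> i + \<beta> i) \<in> ref_poly Simplicial (a + b)"
    if "\<alpha> \<in> exponents Simplicial a" "\<beta> \<in> exponents Simplicial b" for \<alpha> \<beta> :: "'a \<Rightarrow> nat"
    by (rule ref_poly_monomial) (use that in \<open>simp add: sum.distrib\<close>)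
  then show ?thesis unfolding eq by (intro ref_poly_sum finite_exponents ref_poly_cmult)
qed

lemma ref_poly_simplicial_mono: "p \<in> ref_poly Simplicial a \<Longrightarrow> a \<le> b \<Longrightarrow> p \<in> ref_poly Simplicial b"
  using ref_poly_simplicial_mult[of p a "\<lambda>x. 1" "b - a"] ref_poly_const[of 1 Simplicial "b - a"] by simp

lemma ref_poly_simplicial_prod:
  assumes "finite A" "\<And>i. i \<in> A \<Longrightarrow> f i \<in> ref_poly Simplicial (n i)"
  shows "(\<lambda>x. \<Prod>i\<in>A. f i x) \<in> ref_poly Simplicial (\<Sum>i\<in>A. n i)"
  using assms by (induction A rule: finite_induct) (auto intro: ref_poly_simplicial_mult ref_poly_const)

lemma ref_poly_simplicial_power:
  assumes "f \<in> ref_poly Simplicial 1"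
  shows "(\<lambda>x. f x ^ k) \<in> ref_poly Simplicial k"
  using ref_poly_simplicial_prod[of "{..<k}" "\<lambda>_. f" "\<lambda>_. 1"] assms by simp

lemma ref_poly_cubical_prod:
  fixes p :: "'n::finite \<Rightarrow> real poly"
  assumes "\<And>i. degree (p i) \<le> r"
  shows "(\<lambda>x::real ^ 'n. \<Prod>i\<in>UNIV. poly (p i) (x $ i)) \<in> ref_poly Cubical r"
proof -
  have poly: "poly (p i) t = (\<Sum>k\<le>r. coeff (p i) k * t ^ k)" for i t
    unfolding poly_altdef using assms[of i] by (intro sum.mono_neutral_left) (auto simp: coeff_eq_0 not_le)
  have PiE: "PiE UNIV (\<lambda>_. {..r}) = (exponents Cubical r :: ('n \<Rightarrow> nat) set)"
    by (auto simp: PiE_def Pi_def extensional_def)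
  have "(\<lambda>x::real ^ 'n. \<Prod>i\<in>UNIV. poly (p i) (x $ i))
      = (\<lambda>x. \<Sum>\<alpha>\<in>exponents Cubical r. (\<Prod>i\<in>UNIV. coeff (p i) (\<alpha> i)) * monomial \<alpha> x)"
    unfolding poly by (subst prod_sum_PiE) (auto simp: PiE monomial_def prod.distrib simp del: exponents.simps)
  then show ?thesis using ref_polyI[of "\<lambda>\<alpha>. \<Prod>i\<in>UNIV. coeff (p i) (\<alpha> i)"] by (simp del: exponents.simps)
qed

text \<open>An affine substitution does not raise the total degree. This makes the polynomial space
  compatible with the subdivision of simplices.\<close>

lemma ref_poly_simplicial_compose:
  assumes p: "p \<in> ref_poly Simplicial r" and A: "\<And>i. (\<lambda>x. A x $ i) \<in> ref_poly Simplicial 1"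
  shows "(\<lambda>x. p (A x)) \<in> ref_poly Simplicial r"
proof -
  obtain a where p: "p = (\<lambda>x. \<Sum>\<alpha>\<in>exponents Simplicial r. a \<alpha> * monomial \<alpha> x)" using p unfolding ref_poly_iff by blast
  have "(\<lambda>x. monomial \<alpha> (A x)) \<in> ref_poly Simplicial r" if "\<alpha> \<in> exponents Simplicial r" for \<alpha>
    unfolding monomial_def using that
    by (intro ref_poly_simplicial_mono[OF ref_poly_simplicial_prod[where n=\<alpha>]] ref_poly_simplicial_power A) auto
  then show ?thesis unfolding p by (intro ref_poly_sum finite_exponents ref_poly_cmult) auto
qed

lemma ref_poly_cubical_compose:
  fixes A :: "real ^ 'n \<Rightarrow> real ^ 'n"
  assumes p: "p \<in> ref_poly Cubical r" and A: "\<And>x i. A x $ i = b i + c i * x $ i"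
  shows "(\<lambda>x. p (A x)) \<in> ref_poly Cubical r"
proof -
  obtain a where p: "p = (\<lambda>x. \<Sum>\<alpha>\<in>exponents Cubical r. a \<alpha> * monomial \<alpha> x)" using p unfolding ref_poly_iff by blast
  have "(\<lambda>x. monomial \<alpha> (A x)) \<in> ref_poly Cubical r" if \<alpha>: "\<alpha> \<in> exponents Cubical r" for \<alpha>
  proof -
    have "(\<lambda>x::real ^ 'n. \<Prod>i\<in>UNIV. poly ([:b i, c i:] ^ \<alpha> i) (x $ i)) \<in> ref_poly Cubical r"
    proof (rule ref_poly_cubical_prod)
      fix i
      have "degree ([:b i, c i:] ^ \<alpha> i) \<le> degree [:b i, c i:] * \<alpha> i" by (rule degree_power_le)
      also have "\<dots> \<le> 1 * \<alpha> i" by (intro mult_right_mono) auto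
      also have "\<dots> \<le> r" using \<alpha> by simp
      finally show "degree ([:b i, c i:] ^ \<alpha> i) \<le> r" .
    qed
    moreover have "(\<Prod>i\<in>UNIV. poly ([:b i, c i:] ^ \<alpha> i) (x $ i)) = monomial \<alpha> (A x)" for x :: "real ^ 'n"
      by (simp add: monomial_def A mult.commute)
    ultimately show ?thesis by simp
  qed
  then show ?thesis unfolding p by (intro ref_poly_sum finite_exponents ref_poly_cmult) auto
qed

section \<open>Lattice points and Lagrange polynomials\<close>

definition lattice_point :: "nat \<Rightarrow> ('n::finite \<Rightarrow> nat) \<Rightarrow> real ^ 'n" where
  "lattice_point r \<alpha> = (\<chi> i. real (\<alpha> i) / real r)"

lemma lattice_point_component [simp]: "lattice_point r \<alpha> $ i = real (\<alpha> i) / real r"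
  by (simp add: lattice_point_def)

lemma ref_nodes_eq: "ref_nodes S r = lattice_point r ` exponents S r"
  by (simp add: ref_nodes_def lattice_point_def[abs_def])

lemma prod_ratio_eq_1: "(\<Prod>j<a. (real a - real j) / (real a - real j)) = 1"
  by (intro prod.neutral) auto

lemma prod_ratio_eq_0: "b < a \<Longrightarrow> (\<Prod>j<a. (real b - real j) / (real a - real j)) = 0"
  by (intro prod_zero bexI[of _ b]) auto

text \<open>On the cube this is a product of one-dimensional Lagrange polynomials. On the simplex
  the factors use all barycentric coordinates: for each of them they vanish on the layers with a
  smaller index than that of the node, and any other lattice point has a smaller index in at least
  one coordinate.\<close>

lemma lagrange_exists:
  fixes \<alpha> :: "'n::finite \<Rightarrow> nat"
  assumes r: "r \<ge> 1" and \<alpha>: "\<alpha> \<in> exponents S r"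
  shows "\<exists>l\<in>ref_poly S r. \<forall>\<beta>\<in>exponents S r. l (lattice_point r \<beta>) = (if \<beta> = \<alpha> then 1 else 0)"
proof (cases S)
  case Cubical
  let ?p = "\<lambda>i. \<Prod>j\<in>{..r} - {\<alpha> i}. [:- real j / (real (\<alpha> i) - real j), real r / (real (\<alpha> i) - real j):]"
  let ?l = "\<lambda>x::real ^ 'n. \<Prod>i\<in>UNIV. poly (?p i) (x $ i)"
  have mem: "?l \<in> ref_poly S r"
    unfolding Cubical
  proof (rule ref_poly_cubical_prod)
    fix i
    have "degree (?p i) \<le> (\<Sum>j\<in>{..r} - {\<alpha> i}. 1)"
      by (rule order_trans[OF degree_prod_sum_le], simp, rule sum_mono) simp
    also have "\<dots> \<le> r" using \<alpha> Cubical by simp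
    finally show "degree (?p i) \<le> r" .
  qed
  have val: "?l (lattice_point r \<beta>) = (if \<beta> = \<alpha> then 1 else 0)"
    if \<beta>: "\<beta> \<in> exponents S r" for \<beta>
  proof -
    have val: "poly (?p i) (lattice_point r \<beta> $ i) = (\<Prod>j\<in>{..r} - {\<alpha> i}. (real (\<beta> i) - real j) / (real (\<alpha> i) - real j))" for i
      using r by (simp add: poly_prod diff_divide_distrib)
    show ?thesis
    proof (cases "\<beta> = \<alpha>")
      case True
      then show ?thesis unfolding val by (auto intro!: prod.neutral)
    next
      case False
      then obtain i where i: "\<beta> i \<noteq> \<alpha> i" by blast
      then have "poly (?p i) (lattice_point r \<beta> $ i) = 0"
        unfolding val using \<beta> Cubical by (intro prod_zero bexI[of _ "\<beta> i"]) auto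
      then show ?thesis using False by (simp only: if_False) (intro prod_zero, auto)
    qed
  qed
  show ?thesis by (rule bexI[of _ ?l]) (rule ballI, erule val, rule mem)
next
  case Simplicial
  \<comment> \<open>Index of the node in the remaining barycentric coordinate
    \<open>1 - sum x_i\<close>.\<close>
  let ?a0 = "r - sum \<alpha> UNIV"
  let ?f = "\<lambda>i j x. (real r * x $ i - real j) / (real (\<alpha> i) - real j)"
  let ?g = "\<lambda>j x. (real r * (1 - (\<Sum>i\<in>UNIV. x $ i)) - real j) / (real ?a0 - real j)"
  let ?l = "\<lambda>x. (\<Prod>i\<in>UNIV. \<Prod>j\<in>{..<\<alpha> i}. ?f i j x) * (\<Prod>j\<in>{..<?a0}. ?g j x)"
  have sum\<alpha>: "sum \<alpha> UNIV \<le> r" using \<alpha> Simplicial by simp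
  have f: "?f i j \<in> ref_poly Simplicial 1" for i j
    unfolding diff_divide_distrib times_divide_eq_left[symmetric]
    by (intro ref_poly_diff ref_poly_const ref_poly_cmult ref_poly_coordinate) simp
  have g: "?g j \<in> ref_poly Simplicial 1" for j
    unfolding diff_divide_distrib times_divide_eq_left[symmetric]
    by (intro ref_poly_diff ref_poly_const ref_poly_cmult ref_poly_sum ref_poly_coordinate) simp_all
  have "?l \<in> ref_poly Simplicial ((\<Sum>i\<in>UNIV. \<Sum>j\<in>{..<\<alpha> i}. 1) + (\<Sum>j\<in>{..<?a0}. 1))"
    by (intro ref_poly_simplicial_mult ref_poly_simplicial_prod f g) auto
  moreover have "(\<Sum>i\<in>UNIV. \<Sum>j\<in>{..<\<alpha> i}. 1) + (\<Sum>j\<in>{..<?a0}. 1) = r" using sum\<alpha> by simp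
  ultimately have mem: "?l \<in> ref_poly S r" unfolding Simplicial by (simp only:)
  have val: "?l (lattice_point r \<beta>) = (if \<beta> = \<alpha> then 1 else 0)" if \<beta>: "\<beta> \<in> exponents S r" for \<beta>
  proof -
    have sum\<beta>: "sum \<beta> UNIV \<le> r" using \<beta> Simplicial by simp
    have fv: "?f i j (lattice_point r \<beta>) = (real (\<beta> i) - real j) / (real (\<alpha> i) - real j)" for i j
      using r by simp
    have gv: "?g j (lattice_point r \<beta>) = (real (r - sum \<beta> UNIV) - real j) / (real ?a0 - real j)" for j
    proof -
      have "real r * (1 - (\<Sum>i\<in>UNIV. lattice_point r \<beta> $ i)) = real (r - sum \<beta> UNIV)"
        using r sum\<beta> by (simp add: sum_divide_distrib[symmetric] right_diff_distrib of_nat_diff)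
      then show ?thesis by (simp only:)
    qed
    show ?thesis
    proof (cases "\<beta> = \<alpha>")
      case True
      have "(\<Prod>j\<in>{..<\<alpha> i}. ?f i j (lattice_point r \<beta>)) = 1" for i
        unfolding fv unfolding True by (rule prod_ratio_eq_1)
      moreover have "(\<Prod>j\<in>{..<?a0}. ?g j (lattice_point r \<beta>)) = 1"
        unfolding gv unfolding True by (rule prod_ratio_eq_1)
      ultimately show ?thesis using True by simp
    next
      case False
      show ?thesis
      proof (cases "\<exists>i. \<beta> i < \<alpha> i")
        case True
        then obtain i where i: "\<beta> i < \<alpha> i" by blast
        have "(\<Prod>j\<in>{..<\<alpha> i}. ?f i j (lattice_point r \<beta>)) = 0"
          unfolding fv using i by (rule prod_ratio_eq_0)
        then have "(\<Prod>i\<in>UNIV. \<Prod>j\<in>{..<\<alpha> i}. ?f i j (lattice_point r \<beta>)) = 0"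
          by (intro prod_zero) auto
        then show ?thesis using False by simp
      next
        case no: False
        \<comment> \<open>All indices of \<open>\<beta>\<close> are at least those of
          \<open>\<alpha>\<close> and one is larger, so the remaining barycentric index is smaller
          and a factor \<open>?g\<close> vanishes.\<close>
        then have le: "\<alpha> i \<le> \<beta> i" for i by (simp add: not_less)
        obtain k where "\<beta> k \<noteq> \<alpha> k" using False by blast
        then have "\<alpha> k < \<beta> k" using le[of k] by simp
        then have "sum \<alpha> UNIV < sum \<beta> UNIV" using le by (intro sum_strict_mono_ex1) auto
        then have "r - sum \<beta> UNIV < ?a0" using sum\<beta> by simp
        then have "(\<Prod>j\<in>{..<?a0}. ?g j (lattice_point r \<beta>)) = 0"
          unfolding gv by (rule prod_ratio_eq_0)
        then show ?thesis using False by simp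
      qed
    qed
  qed
  show ?thesis by (rule bexI[of _ ?l]) (rule ballI, erule val, rule mem)
qed

text \<open>A right inverse of a square matrix is also a left inverse. This replaces a dimension
  count in the proof that the Lagrange polynomials span.\<close>

lemma finite_right_inverse_left_inverse:
  fixes V C :: "'a \<Rightarrow> 'a \<Rightarrow> real"
  assumes E: "finite E" and VC: "\<And>\<beta> \<alpha>. \<beta> \<in> E \<Longrightarrow> \<alpha> \<in> E \<Longrightarrow> (\<Sum>\<gamma>\<in>E. V \<beta> \<gamma> * C \<gamma> \<alpha>) = (if \<beta> = \<alpha> then 1 else 0)"
    and \<beta>: "\<beta> \<in> E" and \<alpha>: "\<alpha> \<in> E"
  shows "(\<Sum>\<gamma>\<in>E. C \<beta> \<gamma> * V \<gamma> \<alpha>) = (if \<beta> = \<alpha> then 1 else 0)"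
proof -
  let ?n = "card E"
  obtain e where e: "bij_betw e {0..<?n} E" using ex_bij_betw_nat_finite[OF E] by blast
  have inj: "e i = e j \<longleftrightarrow> i = j" if "i < ?n" "j < ?n" for i j
    using e that by (auto simp: bij_betw_def inj_on_def)
  have eE: "e i \<in> E" if "i < ?n" for i using e that by (auto simp: bij_betw_def)
  define A B where "A = mat ?n ?n (\<lambda>(i, j). V (e i) (e j))" and "B = mat ?n ?n (\<lambda>(i, j). C (e i) (e j))"
  have AB: "A \<in> carrier_mat ?n ?n" "B \<in> carrier_mat ?n ?n" by (auto simp: A_def B_def)
  have ij: "(A * B) $$ (i, j) = (\<Sum>\<gamma>\<in>E. V (e i) \<gamma> * C \<gamma> (e j))" "(B * A) $$ (i, j) = (\<Sum>\<gamma>\<in>E. C (e i) \<gamma> * V \<gamma> (e j))"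
    if "i < ?n" "j < ?n" for i j
    using that by (auto simp: A_def B_def scalar_prod_def sum.reindex_bij_betw[OF e, symmetric])
  have "A * B = 1\<^sub>m ?n"
    by (rule eq_matI) (use AB ij VC eE inj in auto)
  then have BA: "B * A = 1\<^sub>m ?n" by (rule mat_mult_left_right_inverse[OF AB])
  obtain i j where i: "\<beta> = e i" "i < ?n" and j: "\<alpha> = e j" "j < ?n"
    using e \<alpha> \<beta> unfolding bij_betw_def by (metis atLeastLessThan_iff imageE)
  then show ?thesis using ij(2)[OF i(2) j(2)] inj[OF i(2) j(2)] BA by simp
qed

text \<open>Since the Lagrange polynomials are dual to the nodes and there are as many nodes as monomials,
  they span the reference polynomials.\<close>

lemma lagrange_basis:
  assumes r: "r \<ge> 1"
  obtains l :: "('n::finite \<Rightarrow> nat) \<Rightarrow> real ^ 'n \<Rightarrow> real"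
    where "\<And>\<alpha>. \<alpha> \<in> exponents S r \<Longrightarrow> l \<alpha> \<in> ref_poly S r"
      "\<And>p x. p \<in> ref_poly S r \<Longrightarrow> p x = (\<Sum>\<alpha>\<in>exponents S r. p (lattice_point r \<alpha>) * l \<alpha> x)"
proof -
  let ?E = "exponents S r :: ('n \<Rightarrow> nat) set"
  have "\<forall>\<alpha>\<in>?E. \<exists>l. l \<in> ref_poly S r \<and> (\<forall>\<beta>\<in>?E. l (lattice_point r \<beta>) = (if \<beta> = \<alpha> then 1 else 0))"
    using lagrange_exists[OF r] by blast
  then obtain l where l: "\<And>\<alpha>. \<alpha> \<in> ?E \<Longrightarrow> l \<alpha> \<in> ref_poly S r"
      "\<And>\<alpha> \<beta>. \<alpha> \<in> ?E \<Longrightarrow> \<beta> \<in> ?E \<Longrightarrow> l \<alpha> (lattice_point r \<beta>) = (if \<beta> = \<alpha> then 1 else 0)"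
    by metis
  have "\<forall>\<alpha>\<in>?E. \<exists>c. l \<alpha> = (\<lambda>x. \<Sum>\<gamma>\<in>?E. c \<gamma> * monomial \<gamma> x)"
    using l(1) unfolding ref_poly_iff by blast
  then obtain c where c: "\<And>\<alpha>. \<alpha> \<in> ?E \<Longrightarrow> l \<alpha> = (\<lambda>x. \<Sum>\<gamma>\<in>?E. c \<alpha> \<gamma> * monomial \<gamma> x)"
    by metis
  \<comment> \<open>Duality says that the Vandermonde matrix times the coefficient matrix is the
    identity; expanding monomials in the Lagrange polynomials requires the product in the other
    order.\<close>
  have inv: "(\<Sum>\<alpha>\<in>?E. c \<alpha> \<gamma> * monomial \<gamma>' (lattice_point r \<alpha>)) = (if \<gamma> = \<gamma>' then 1 else 0)"
    if "\<gamma> \<in> ?E" "\<gamma>' \<in> ?E" for \<gamma> \<gamma>'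
  proof (rule finite_right_inverse_left_inverse[OF finite_exponents _ that, where C="\<lambda>\<gamma> \<alpha>. c \<alpha> \<gamma>" and V="\<lambda>\<alpha> \<gamma>. monomial \<gamma> (lattice_point r \<alpha>)"])
    fix \<beta> \<alpha> assume *: "\<beta> \<in> ?E" "\<alpha> \<in> ?E"
    have "(\<Sum>\<gamma>\<in>?E. monomial \<gamma> (lattice_point r \<beta>) * c \<alpha> \<gamma>) = l \<alpha> (lattice_point r \<beta>)"
      unfolding c[OF *(2)] by (simp add: mult.commute)
    then show "(\<Sum>\<gamma>\<in>?E. monomial \<gamma> (lattice_point r \<beta>) * c \<alpha> \<gamma>) = (if \<beta> = \<alpha> then 1 else 0)" using l(2) * by simp
  qed
  have mono: "monomial \<gamma>' x = (\<Sum>\<alpha>\<in>?E. monomial \<gamma>' (lattice_point r \<alpha>) * l \<alpha> x)" if "\<gamma>' \<in> ?E" for \<gamma>' x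
  proof -
    have "(\<Sum>\<alpha>\<in>?E. monomial \<gamma>' (lattice_point r \<alpha>) * l \<alpha> x)
        = (\<Sum>\<alpha>\<in>?E. \<Sum>\<gamma>\<in>?E. (c \<alpha> \<gamma> * monomial \<gamma>' (lattice_point r \<alpha>)) * monomial \<gamma> x)"
      by (intro sum.cong refl) (simp add: c sum_distrib_left mult_ac)
    also have "\<dots> = (\<Sum>\<gamma>\<in>?E. (\<Sum>\<alpha>\<in>?E. c \<alpha> \<gamma> * monomial \<gamma>' (lattice_point r \<alpha>)) * monomial \<gamma> x)"
      by (subst sum.swap) (simp add: sum_distrib_right)
    also have "\<dots> = (\<Sum>\<gamma>\<in>?E. (if \<gamma> = \<gamma>' then 1 else 0) * monomial \<gamma> x)"
      by (intro sum.cong refl) (simp add: inv that del: exponents.simps)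
    also have "\<dots> = monomial \<gamma>' x" by (rule sum_select[OF finite_exponents that])
    finally show ?thesis by simp
  qed
  have "p x = (\<Sum>\<alpha>\<in>?E. p (lattice_point r \<alpha>) * l \<alpha> x)" if "p \<in> ref_poly S r" for p x
  proof -
    obtain a where p: "p = (\<lambda>x. \<Sum>\<gamma>\<in>?E. a \<gamma> * monomial \<gamma> x)" using \<open>p \<in> ref_poly S r\<close> unfolding ref_poly_iff by blast
    have "p x = (\<Sum>\<gamma>\<in>?E. a \<gamma> * (\<Sum>\<alpha>\<in>?E. monomial \<gamma> (lattice_point r \<alpha>) * l \<alpha> x))"
      unfolding p by (intro sum.cong refl) (simp add: mono del: exponents.simps)
    also have "\<dots> = (\<Sum>\<alpha>\<in>?E. p (lattice_point r \<alpha>) * l \<alpha> x)"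
      unfolding p sum_distrib_left sum_distrib_right by (subst sum.swap) (simp add: mult.assoc)
    finally show ?thesis .
  qed
  then show ?thesis using that l(1) by blast
qed

section \<open>The reference cell\<close>

lemma compact_ref_cell: "compact (ref_cell S)"
  by (cases S) (auto intro!: finite_imp_compact_convex_hull simp: compact_cbox)

lemma convex_ref_cell: "convex (ref_cell S)"
  by (cases S) auto

lemma interior_ref_cell_nonempty: "interior (ref_cell S :: (real ^ 'n) set) \<noteq> {}"
proof (cases S)
  case Simplicial
  obtain a :: "real ^ 'n" where "a \<in> interior (convex hull (insert 0 Basis))" using interior_std_simplex_nonempty by blast
  then show ?thesis using Simplicial by auto
next
  case Cubical
  have "(1/2) *\<^sub>R 1 \<in> box 0 (1 :: real ^ 'n)" by (simp add: mem_box_cart)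
  then show ?thesis using Cubical interior_cbox[of "0 :: real ^ 'n" 1] by (metis ref_cell.simps(2) empty_iff)
qed

lemma lattice_point_ref_cell:
  fixes \<alpha> :: "'n::finite \<Rightarrow> nat"
  assumes r: "r \<ge> 1" and \<alpha>: "\<alpha> \<in> exponents S r"
  shows "lattice_point r \<alpha> \<in> ref_cell S"
proof (cases S)
  case Simplicial
  have inj: "inj_on (\<lambda>i::'n. axis i (1::real)) UNIV" by (simp add: inj_on_def axis_eq_axis)
  have B: "Basis = range (\<lambda>i::'n. axis i (1::real))" by (auto simp: Basis_vec_def)
  have "(\<Sum>b\<in>Basis. inner (lattice_point r \<alpha>) b) = (\<Sum>i\<in>UNIV. real (\<alpha> i) / real r)"
    unfolding B by (simp add: sum.reindex[OF inj] inner_axis)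
  also have "\<dots> = real (sum \<alpha> UNIV) / real r" by (simp add: sum_divide_distrib)
  also have "\<dots> \<le> 1" using \<alpha> r Simplicial by (simp add: divide_le_eq_1 del: of_nat_sum)
  finally have "(\<Sum>b\<in>Basis. inner (lattice_point r \<alpha>) b) \<le> 1" .
  moreover have "\<forall>b\<in>Basis. 0 \<le> inner (lattice_point r \<alpha>) b" unfolding B by (simp add: inner_axis)
  ultimately show ?thesis using Simplicial by (simp add: std_simplex)
next
  case Cubical
  then show ?thesis using \<alpha> r by (auto simp: mem_box_cart divide_le_eq_1)
qed

text \<open>An interior cone property from convexity: contracting the cell towards \<open>p\<close>
  by the factor \<open>t\<close> carries a fixed interior ball to one of radius \<open>t * s\<close>
  that is still in the cell and near \<open>p\<close>, uniformly in \<open>p\<close>.\<close>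

lemma ref_cell_fat:
  obtains s E where "s > 0" "E > 0"
    "\<And>p t. p \<in> (ref_cell S :: (real ^ 'n) set) \<Longrightarrow> 0 < t \<Longrightarrow> t \<le> 1 \<Longrightarrow>
       \<exists>z. ball z (t * s) \<subseteq> interior (ref_cell S) \<inter> cball p (t * E)"
proof -
  let ?R = "ref_cell S :: (real ^ 'n) set"
  obtain c where c: "c \<in> interior ?R" using interior_ref_cell_nonempty by blast
  then obtain s where s: "s > 0" "ball c s \<subseteq> ?R" by (auto simp: mem_interior)
  obtain B where B: "\<And>x. x \<in> ?R \<Longrightarrow> norm x \<le> B"
    using compact_imp_bounded[OF compact_ref_cell[of S]] by (auto simp: bounded_iff)
  have B0: "B \<ge> 0" using B[of c] c interior_subset norm_ge_zero[of c] by (meson order_trans subsetD)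
  have "\<exists>z. ball z (t * s) \<subseteq> interior ?R \<inter> cball p (t * (2 * B + s))" if p: "p \<in> ?R" and t: "0 < t" "t \<le> 1" for p t
  proof (intro exI[of _ "p + t *\<^sub>R (c - p)"] Int_greatest)
    \<comment> \<open>The image of the centre \<open>c\<close> of the fixed ball under the
      contraction towards \<open>p\<close>.\<close>
    let ?z = "p + t *\<^sub>R (c - p)"
    have "ball ?z (t * s) \<subseteq> ?R"
    proof
      fix x assume x: "x \<in> ball ?z (t * s)"
      define w where "w = x - ?z"
      let ?y = "c + (1 / t) *\<^sub>R w"
      have "norm w < t * s" using x by (simp add: w_def dist_norm norm_minus_commute)
      then have "?y \<in> ball c s" using t by (simp add: dist_norm pos_divide_less_eq mult.commute)
      then have "?y \<in> ?R" using s(2) by blast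
      then have "(1 - t) *\<^sub>R p + t *\<^sub>R ?y \<in> ?R" using p t by (intro convexD_alt convex_ref_cell) auto
      moreover have "(1 - t) *\<^sub>R p + t *\<^sub>R ?y = x" using t by (simp add: w_def algebra_simps)
      ultimately show "x \<in> ?R" by simp
    qed
    then show "ball ?z (t * s) \<subseteq> interior ?R" by (intro interior_maximal) auto
    show "ball ?z (t * s) \<subseteq> cball p (t * (2 * B + s))"
    proof
      fix x assume x: "x \<in> ball ?z (t * s)"
      have "norm (c - p) \<le> norm c + norm p" by (rule norm_triangle_ineq4)
      then have cp: "norm (c - p) \<le> 2 * B" using B[of c] B[OF p] c interior_subset by force
      have "norm (x - p) \<le> norm (x - ?z) + norm (t *\<^sub>R (c - p))" using norm_triangle_ineq[of "x - ?z" "t *\<^sub>R (c - p)"] by simp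
      also have "\<dots> \<le> t * s + t * (2 * B)" using x t cp by (intro add_mono) (simp_all add: dist_norm norm_minus_commute)
      finally show "x \<in> cball p (t * (2 * B + s))" by (simp add: dist_norm norm_minus_commute algebra_simps)
    qed
  qed
  then show ?thesis using that[of s "2 * B + s"] s(1) B0 by simp
qed

text \<open>Norm equivalence in finite dimension made explicit: the finitely many Lagrange
  polynomials have bounded gradients on the compact reference cell, and nodal values are their
  coefficients.\<close>

lemma ref_poly_bounds:
  assumes r: "r \<ge> 1"
  obtains K :: real where "K > 0"
    "\<And>(p :: real ^ 'n \<Rightarrow> real) m x. p \<in> ref_poly S r \<Longrightarrow> (\<And>\<alpha>. \<alpha> \<in> exponents S r \<Longrightarrow> \<bar>p (lattice_point r \<alpha>)\<bar> \<le> m) \<Longrightarrow>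
       x \<in> ref_cell S \<Longrightarrow> norm (grad p x) \<le> K * m"
proof -
  let ?E = "exponents S r :: ('n \<Rightarrow> nat) set"
  obtain l where l: "\<And>\<alpha>. \<alpha> \<in> ?E \<Longrightarrow> l \<alpha> \<in> ref_poly S r"
      "\<And>p x. p \<in> ref_poly S r \<Longrightarrow> p x = (\<Sum>\<alpha>\<in>?E. p (lattice_point r \<alpha>) * l \<alpha> x)"
    using lagrange_basis[OF r] by metis
  have "\<exists>B. \<forall>x\<in>ref_cell S. norm (grad (l \<alpha>) x) \<le> B" if "\<alpha> \<in> ?E" for \<alpha>
  proof -
    have "compact (grad (l \<alpha>) ` ref_cell S)"
      by (intro compact_continuous_image continuous_on_grad ref_poly_smooth[OF l(1)[OF that]] compact_ref_cell)
    then show ?thesis using compact_imp_bounded by (fastforce simp: bounded_iff)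
  qed
  then obtain B where B: "\<And>\<alpha> x. \<alpha> \<in> ?E \<Longrightarrow> x \<in> ref_cell S \<Longrightarrow> norm (grad (l \<alpha>) x) \<le> B \<alpha>" by metis
  \<comment> \<open>The summand \<open>1\<close> guarantees \<open>K > 0\<close>, so that
    \<open>K\<close> may be divided by later.\<close>
  define K where "K = (\<Sum>\<alpha>\<in>?E. \<bar>B \<alpha>\<bar>) + 1"
  have K0: "K > 0" unfolding K_def by (intro add_nonneg_pos sum_nonneg) auto
  have "norm (grad p x) \<le> K * m"
    if p: "p \<in> ref_poly S r" and m: "\<And>\<alpha>. \<alpha> \<in> ?E \<Longrightarrow> \<bar>p (lattice_point r \<alpha>)\<bar> \<le> m" and x: "x \<in> ref_cell S" for p :: "real ^ 'n \<Rightarrow> real" and m x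
  proof -
    have pe: "p = (\<lambda>x. \<Sum>\<alpha>\<in>?E. p (lattice_point r \<alpha>) * l \<alpha> x)" by (rule ext) (rule l(2)[OF p])
    have "(p has_derivative (\<lambda>h. \<Sum>\<alpha>\<in>?E. p (lattice_point r \<alpha>) * inner (grad (l \<alpha>) x) h)) (at x)"
      by (subst pe, intro has_derivative_sum has_derivative_mult_right has_derivative_grad smooth_differentiable)
        (rule ref_poly_smooth, erule l(1))
    then have pd: "pdiff i p x = (\<Sum>\<alpha>\<in>?E. p (lattice_point r \<alpha>) * inner (grad (l \<alpha>) x) (axis i 1))" for i
      by (rule pdiff_eq)
    have "grad p x = (\<Sum>\<alpha>\<in>?E. p (lattice_point r \<alpha>) *\<^sub>R grad (l \<alpha>) x)"
      by (simp add: grad_def[of p] pd Finite_Cartesian_Product.vec_eq_iff inner_axis)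
    also have "norm \<dots> \<le> (\<Sum>\<alpha>\<in>?E. m * \<bar>B \<alpha>\<bar>)"
    proof (rule sum_norm_le)
      fix \<alpha> assume \<alpha>: "\<alpha> \<in> ?E"
      have "\<bar>p (lattice_point r \<alpha>)\<bar> * norm (grad (l \<alpha>) x) \<le> m * \<bar>B \<alpha>\<bar>"
        using m[OF \<alpha>] B[OF \<alpha> x] by (intro mult_mono) auto
      then show "norm (p (lattice_point r \<alpha>) *\<^sub>R grad (l \<alpha>) x) \<le> m * \<bar>B \<alpha>\<bar>" by simp
    qed
    also have "\<dots> \<le> K * m"
    proof -
      have "(\<lambda>i. 0) \<in> ?E" by (cases S) auto
      from m[OF this] have "m \<ge> 0" by linarith
      then show ?thesis unfolding K_def by (simp add: sum_distrib_left[symmetric] algebra_simps)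
    qed
    finally show ?thesis .
  qed
  then show ?thesis using that K0 by blast
qed

text \<open>At some node the polynomial attains the maximal nodal modulus \<open>m\<close>, and its
  gradient is at most \<open>K * m\<close>. Hence it keeps at least half of \<open>m\<close> in a
  neighbourhood whose size does not depend on the polynomial, and \<open>ref_cell_fat\<close> finds
  a ball of fixed radius there inside the cell.\<close>

lemma ref_poly_lower:
  assumes r: "r \<ge> 1"
  obtains \<theta> :: real where "\<theta> > 0"
    "\<And>p :: real ^ 'n \<Rightarrow> real. p \<in> ref_poly S r \<Longrightarrow> \<exists>z. ball z \<theta> \<subseteq> interior (ref_cell S) \<and>
       (\<forall>x\<in>ball z \<theta>. \<forall>\<alpha>\<in>exponents S r. \<bar>p (lattice_point r \<alpha>)\<bar> \<le> 2 * \<bar>p x\<bar>)"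
proof -
  let ?E = "exponents S r :: ('n \<Rightarrow> nat) set"
  let ?R = "ref_cell S :: (real ^ 'n) set"
  obtain K :: real where K: "K > 0" "\<And>(p :: real ^ 'n \<Rightarrow> real) m x. p \<in> ref_poly S r \<Longrightarrow>
      (\<And>\<alpha>. \<alpha> \<in> ?E \<Longrightarrow> \<bar>p (lattice_point r \<alpha>)\<bar> \<le> m) \<Longrightarrow> x \<in> ref_cell S \<Longrightarrow> norm (grad p x) \<le> K * m"
    using ref_poly_bounds[OF r, where 'n='n and S=S] by blast
  obtain s E where sE: "s > 0" "E > 0"
    "\<And>p t. p \<in> ?R \<Longrightarrow> 0 < t \<Longrightarrow> t \<le> 1 \<Longrightarrow> \<exists>z. ball z (t * s) \<subseteq> interior ?R \<inter> cball p (t * E)"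
    using ref_cell_fat[of S] by metis
  \<comment> \<open>\<open>t\<close> is small enough that the loss \<open>K * m * (t * E)\<close> on
    the way from the node is at most \<open>m / 2\<close>.\<close>
  define t where "t = min 1 (1 / (2 * K * E))"
  have t: "0 < t" "t \<le> 1" "K * (t * E) \<le> 1 / 2"
  proof -
    have "K * (t * E) \<le> K * ((1 / (2 * K * E)) * E)" using K(1) sE(2) by (intro mult_left_mono mult_right_mono) (auto simp: t_def)
    also have "\<dots> = 1 / 2" using K(1) sE(2) by simp
    finally show "K * (t * E) \<le> 1 / 2" .
  qed (use K(1) sE(2) in \<open>auto simp: t_def\<close>)
  have "\<exists>z. ball z (t * s) \<subseteq> interior ?R \<and> (\<forall>x\<in>ball z (t * s). \<forall>\<alpha>\<in>?E. \<bar>p (lattice_point r \<alpha>)\<bar> \<le> 2 * \<bar>p x\<bar>)"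
    if p: "p \<in> ref_poly S r" for p :: "real ^ 'n \<Rightarrow> real"
  proof -
    let ?m = "Max ((\<lambda>\<alpha>. \<bar>p (lattice_point r \<alpha>)\<bar>) ` ?E)"
    have fin: "finite ((\<lambda>\<alpha>. \<bar>p (lattice_point r \<alpha>)\<bar>) ` ?E)" by (intro finite_imageI finite_exponents)
    have "(\<lambda>i. 0) \<in> ?E" by (cases S) auto
    then have "?m \<in> (\<lambda>\<alpha>. \<bar>p (lattice_point r \<alpha>)\<bar>) ` ?E" using fin by (intro Max_in) auto
    then obtain \<beta> where \<beta>: "\<beta> \<in> ?E" "\<bar>p (lattice_point r \<beta>)\<bar> = ?m" by auto
    have le: "\<bar>p (lattice_point r \<alpha>)\<bar> \<le> ?m" if "\<alpha> \<in> ?E" for \<alpha> using fin that by (intro Max_ge) auto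
    let ?b = "lattice_point r \<beta> :: real ^ 'n"
    have bR: "?b \<in> ?R" by (rule lattice_point_ref_cell[OF r \<beta>(1)])
    obtain z where z: "ball z (t * s) \<subseteq> interior ?R \<inter> cball ?b (t * E)" using sE(3)[OF bR t(1,2)] by blast
    have "\<bar>p (lattice_point r \<alpha>)\<bar> \<le> 2 * \<bar>p x\<bar>" if x: "x \<in> ball z (t * s)" and \<alpha>: "\<alpha> \<in> ?E" for x \<alpha>
    proof -
      have "x \<in> interior ?R \<inter> cball ?b (t * E)" using z x by blast
      then have xR: "x \<in> ?R" and xb: "norm (x - ?b) \<le> t * E"
        using interior_subset[of ?R] by (auto simp: dist_norm norm_minus_commute)
      have "norm (p x - p ?b) \<le> (K * ?m) * norm (x - ?b)"
      proof (rule differentiable_bound[OF convex_ref_cell _ _ xR bR])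
        fix y assume y: "y \<in> ?R"
        show "(p has_derivative inner (grad p y)) (at y within ?R)"
          using has_derivative_grad[OF smooth_differentiable[OF ref_poly_smooth[OF p]]] by (rule has_derivative_at_withinI)
        have "K * ?m \<ge> 0" using K(1) le[OF \<beta>(1)] by simp
        show "onorm (inner (grad p y)) \<le> K * ?m"
        proof (rule onorm_bound[OF \<open>K * ?m \<ge> 0\<close>])
          fix h
          have "\<bar>inner (grad p y) h\<bar> \<le> norm (grad p y) * norm h" by (rule Cauchy_Schwarz_ineq2)
          also have "\<dots> \<le> K * ?m * norm h" by (intro mult_right_mono K(2)[OF p le y]) auto
          finally show "norm (inner (grad p y) h) \<le> K * ?m * norm h" by simp
        qed
      qed
      also have "\<dots> \<le> (K * ?m) * (t * E)" using xb K(1) le[OF \<beta>(1)] by (intro mult_left_mono) auto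
      also have "\<dots> = ?m * (K * (t * E))" by simp
      also have "\<dots> \<le> ?m * (1 / 2)" using t(3) le[OF \<beta>(1)] by (intro mult_left_mono) auto
      finally have "\<bar>p ?b\<bar> - \<bar>p x\<bar> \<le> ?m / 2" unfolding real_norm_def by linarith
      then have "?m \<le> 2 * \<bar>p x\<bar>" using \<beta>(2) by linarith
      then show ?thesis using le[OF \<alpha>] by linarith
    qed
    then show ?thesis using z by blast
  qed
  then show ?thesis using that[of "t * s"] t(1) sE(1) by simp
qed

section \<open>Geometry of cells\<close>

definition cell_deriv :: "(real ^ 'n \<Rightarrow> real ^ 'n) \<Rightarrow> real ^ 'n \<Rightarrow> real ^ 'n \<Rightarrow> real ^ 'n" where
  "cell_deriv F x v = (\<chi> i. inner (grad (\<lambda>x. F x $ i) x) v)"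

lemma is_cell_smooth: "is_cell S F \<Longrightarrow> smooth (\<lambda>x. F x $ i)"
  using ref_poly_smooth unfolding is_cell_def by blast

lemma cell_has_derivative:
  assumes "is_cell S F"
  shows "(F has_derivative cell_deriv F x) (at x)"
proof (rule has_derivative_componentwise_within[THEN iffD2], intro ballI)
  fix b :: "real ^ 'a" assume "b \<in> Basis"
  then obtain i where b: "b = axis i 1" by (auto simp: Basis_vec_def)
  show "((\<lambda>x. inner (F x) b) has_derivative (\<lambda>v. inner (cell_deriv F x v) b)) (at x)"
    using has_derivative_grad[OF smooth_differentiable[OF is_cell_smooth[OF assms, of i]], of x]
    by (simp add: b inner_axis cell_deriv_def)
qed

lemma cell_deriv_eq:
  assumes "is_cell S F"
  shows "frechet_derivative F (at x) = cell_deriv F x"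
  using frechet_derivative_at[OF cell_has_derivative[OF assms]] by simp

lemma cell_continuous: "is_cell S F \<Longrightarrow> continuous_on A F"
  by (meson cell_has_derivative continuous_at_imp_continuous_on has_derivative_continuous)

lemma linear_cell_deriv: "linear (cell_deriv F x)"
  by (rule linearI) (simp_all add: cell_deriv_def Finite_Cartesian_Product.vec_eq_iff inner_add_right)

lemma cell_deriv_uniform:
  assumes F: "is_cell S F" and e: "e > 0"
  obtains \<delta> where "\<delta> > 0"
    "\<And>x y v. x \<in> ref_cell S \<Longrightarrow> y \<in> ref_cell S \<Longrightarrow> norm (x - y) < \<delta> \<Longrightarrow> norm (cell_deriv F x v - cell_deriv F y v) \<le> e * norm v"
proof -
  let ?n = "real CARD('a)"
  have e': "e / ?n > 0" using e by simp
  have "\<exists>\<delta>>0. \<forall>x\<in>ref_cell S. \<forall>y\<in>ref_cell S. norm (x - y) < \<delta> \<longrightarrow> norm (grad (\<lambda>x. F x $ i) x - grad (\<lambda>x. F x $ i) y) < e / ?n" for i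
  proof -
    have "uniformly_continuous_on (ref_cell S) (grad (\<lambda>x. F x $ i))"
      by (intro compact_uniformly_continuous continuous_on_grad is_cell_smooth[OF F] compact_ref_cell)
    then show ?thesis using e' unfolding uniformly_continuous_on_def dist_norm by (metis norm_minus_commute)
  qed
  then obtain \<delta> where \<delta>: "\<And>i. \<delta> i > 0" "\<And>i x y. x \<in> ref_cell S \<Longrightarrow> y \<in> ref_cell S \<Longrightarrow> norm (x - y) < \<delta> i \<Longrightarrow>
      norm (grad (\<lambda>x. F x $ i) x - grad (\<lambda>x. F x $ i) y) < e / ?n" by metis
  have "norm (cell_deriv F x v - cell_deriv F y v) \<le> e * norm v"
    if x: "x \<in> ref_cell S" and y: "y \<in> ref_cell S" and d: "norm (x - y) < Min (range \<delta>)" for x y v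
  proof -
    have "norm (cell_deriv F x v - cell_deriv F y v) \<le> (\<Sum>i\<in>UNIV. \<bar>(cell_deriv F x v - cell_deriv F y v) $ i\<bar>)"
      by (rule norm_le_l1_cart)
    also have "\<dots> \<le> (\<Sum>i\<in>(UNIV::'a set). e / ?n * norm v)"
    proof (rule sum_mono)
      fix i
      have "(cell_deriv F x v - cell_deriv F y v) $ i = inner (grad (\<lambda>x. F x $ i) x - grad (\<lambda>x. F x $ i) y) v"
        by (simp add: cell_deriv_def inner_diff_left)
      also have "\<bar>\<dots>\<bar> \<le> norm (grad (\<lambda>x. F x $ i) x - grad (\<lambda>x. F x $ i) y) * norm v" by (rule Cauchy_Schwarz_ineq2)
      also have "\<dots> \<le> e / ?n * norm v"
        using \<delta>(2)[OF x y, of i] d by (intro mult_right_mono) (auto intro: less_imp_le)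
      finally show "\<bar>(cell_deriv F x v - cell_deriv F y v) $ i\<bar> \<le> e / ?n * norm v" .
    qed
    also have "\<dots> = e * norm v" by simp
    finally show ?thesis .
  qed
  moreover have "Min (range \<delta>) > 0" using \<delta>(1) by (subst Min_gr_iff) auto
  ultimately show ?thesis using that by blast
qed

text \<open>The lower stretching bound of shape regularity in a form that is free of the cell
  diameter. It controls gradients after transport to the cell and the size of the balls a cell
  contains.\<close>

definition expanding_cell :: "real \<Rightarrow> shape \<Rightarrow> (real ^ 'n \<Rightarrow> real ^ 'n) \<Rightarrow> bool" where
  "expanding_cell c S F \<longleftrightarrow> is_cell S F \<and> c > 0 \<and> (\<forall>x\<in>ref_cell S. \<forall>v. c * norm v \<le> norm (cell_deriv F x v))"

text \<open>For nearby points the bound follows from the derivative; pairs at distance at least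
  \<open>\<delta>\<close> form a compact set on which injectivity keeps the images apart.
  \<open>B\<close> depends on the cell, which suffices since it only enters qualitative
  regularity.\<close>

lemma cell_inverse_lipschitz:
  assumes F: "expanding_cell c S F"
  obtains B where "B > 0" "\<And>x y. x \<in> ref_cell S \<Longrightarrow> y \<in> ref_cell S \<Longrightarrow> norm (x - y) \<le> B * norm (F x - F y)"
proof -
  let ?R = "ref_cell S :: (real ^ 'a) set"
  have cell: "is_cell S F" and c: "c > 0" and low: "\<And>x v. x \<in> ?R \<Longrightarrow> c * norm v \<le> norm (cell_deriv F x v)"
    using F by (auto simp: expanding_cell_def)
  have inj: "inj_on F ?R" using cell by (simp add: is_cell_def)
  have "c / 2 > 0" using c by simp
  then obtain \<delta> where \<delta>: "\<delta> > 0"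
    "\<And>x y v. x \<in> ?R \<Longrightarrow> y \<in> ?R \<Longrightarrow> norm (x - y) < \<delta> \<Longrightarrow> norm (cell_deriv F x v - cell_deriv F y v) \<le> c / 2 * norm v"
    using cell_deriv_uniform[OF cell] by metis
  have near: "norm (x - y) \<le> (2 / c) * norm (F x - F y)" if x: "x \<in> ?R" and y: "y \<in> ?R" and d: "norm (x - y) < \<delta>" for x y
  proof -
    let ?S = "?R \<inter> ball y \<delta>"
    \<comment> \<open>Mean value inequality for \<open>F\<close> minus its linearisation at
      \<open>y\<close>, whose derivative is at most \<open>c / 2\<close> near \<open>y\<close>; half
      of the stretching \<open>c\<close> then survives.\<close>
    have "norm ((F x - cell_deriv F y x) - (F y - cell_deriv F y y)) \<le> c / 2 * norm (x - y)"
    proof (rule differentiable_bound[of ?S "\<lambda>x. F x - cell_deriv F y x" "\<lambda>z v. cell_deriv F z v - cell_deriv F y v"])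
      show "convex ?S" by (intro convex_Int convex_ref_cell convex_ball)
      fix z assume z: "z \<in> ?S"
      have "(cell_deriv F y has_derivative cell_deriv F y) (at z within ?S)"
        using linear_cell_deriv linear_conv_bounded_linear bounded_linear_imp_has_derivative by blast
      then show "((\<lambda>x. F x - cell_deriv F y x) has_derivative (\<lambda>v. cell_deriv F z v - cell_deriv F y v)) (at z within ?S)"
        by (intro has_derivative_diff has_derivative_at_withinI[OF cell_has_derivative[OF cell]])
      show "onorm (\<lambda>v. cell_deriv F z v - cell_deriv F y v) \<le> c / 2"
        using \<delta>(2)[of z y] z y c by (intro onorm_bound) (auto simp: dist_norm norm_minus_commute)
    qed (use x y d \<delta>(1) in \<open>auto simp: dist_norm norm_minus_commute\<close>)
    moreover have "(F x - cell_deriv F y x) - (F y - cell_deriv F y y) = (F x - F y) - cell_deriv F y (x - y)"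
      by (simp add: linear_diff[OF linear_cell_deriv])
    ultimately have "norm (cell_deriv F y (x - y)) - norm (F x - F y) \<le> c / 2 * norm (x - y)"
      using norm_triangle_ineq2[of "cell_deriv F y (x - y)" "F x - F y"] by (simp add: norm_minus_commute)
    then have "c * norm (x - y) - norm (F x - F y) \<le> c / 2 * norm (x - y)" using low[OF y, of "x - y"] by linarith
    then show ?thesis using c by (simp add: field_simps)
  qed
  \<comment> \<open>The pairs of points that the local argument does not reach.\<close>
  let ?P = "(?R \<times> ?R) \<inter> {z. \<delta> \<le> norm (fst z - snd z)}"
  have P: "compact ?P"
    by (intro compact_Int_closed compact_Times compact_ref_cell closed_Collect_le continuous_intros)
  obtain D where D: "\<And>x. x \<in> ?R \<Longrightarrow> norm x \<le> D" using compact_imp_bounded[OF compact_ref_cell[of S]] by (auto simp: bounded_iff)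
  have "\<exists>m>0. \<forall>z\<in>?P. m \<le> norm (F (fst z) - F (snd z))"
  proof (cases "?P = {}")
    case False
    have "continuous_on ?P (\<lambda>z. norm (F (fst z) - F (snd z)))"
      by (intro continuous_intros continuous_on_compose2[OF cell_continuous[OF cell, of UNIV]]) auto
    then obtain z0 where z0: "z0 \<in> ?P" "\<And>z. z \<in> ?P \<Longrightarrow> norm (F (fst z0) - F (snd z0)) \<le> norm (F (fst z) - F (snd z))"
      using continuous_attains_inf[OF P False] by blast
    have "fst z0 \<noteq> snd z0" using z0(1) \<delta>(1) by auto
    then have "F (fst z0) \<noteq> F (snd z0)" using z0(1) inj by (auto dest: inj_onD)
    then show ?thesis using z0(2) by (intro exI[of _ "norm (F (fst z0) - F (snd z0))"]) auto
  qed (auto intro: exI[of _ 1])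
  then obtain m where m: "m > 0" "\<And>z. z \<in> ?P \<Longrightarrow> m \<le> norm (F (fst z) - F (snd z))" by blast
  define B where "B = max (2 / c) (2 * \<bar>D\<bar> / m)"
  have "B > 0" using c by (simp add: B_def less_max_iff_disj)
  moreover have "norm (x - y) \<le> B * norm (F x - F y)" if x: "x \<in> ?R" and y: "y \<in> ?R" for x y
  proof (cases "norm (x - y) < \<delta>")
    case True
    have "norm (x - y) \<le> (2 / c) * norm (F x - F y)" by (rule near[OF x y True])
    also have "\<dots> \<le> B * norm (F x - F y)" by (intro mult_right_mono) (auto simp: B_def)
    finally show ?thesis .
  next
    case False
    then have "m \<le> norm (F x - F y)" using m(2)[of "(x, y)"] x y by simp
    have "norm (x - y) \<le> 2 * \<bar>D\<bar>" using norm_triangle_ineq4[of x y] D[OF x] D[OF y] by linarith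
    also have "\<dots> = (2 * \<bar>D\<bar> / m) * m" using m(1) by simp
    also have "\<dots> \<le> B * norm (F x - F y)" using \<open>m \<le> norm (F x - F y)\<close> m(1) c by (intro mult_mono) (auto simp: B_def le_max_iff_disj)
    finally show ?thesis .
  qed
  ultimately show ?thesis using that by blast
qed

text \<open>The lower bound makes the derivative injective, hence bijective in finite dimension, so
  the inverse function theorem applies; it also bounds the derivative of the inverse by
  \<open>1 / c\<close>.\<close>

lemma cell_local_inverse:
  fixes F :: "real ^ 'n \<Rightarrow> real ^ 'n"
  assumes F: "expanding_cell c S F" and V: "open V" "V \<subseteq> ref_cell S" and G: "\<And>x. x \<in> V \<Longrightarrow> G (F x) = x" and x: "x \<in> V"
  obtains g' where "(G has_derivative g') (at (F x))" "\<And>v. c * norm (g' v) \<le> norm v" "\<And>v. cell_deriv F x (g' v) = v"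
proof -
  have cell: "is_cell S F" and c: "c > 0" and low: "\<And>v. c * norm v \<le> norm (cell_deriv F x v)"
    using F V x by (auto simp: expanding_cell_def)
  have "inj (cell_deriv F x)"
  proof (subst linear_injective_0[OF linear_cell_deriv], intro allI impI)
    fix v assume "cell_deriv F x v = 0"
    then show "v = 0" using low[of v] c by (simp add: mult_le_0_iff)
  qed
  then obtain g' where g': "\<And>v. cell_deriv F x (g' v) = v"
    using linear_injective_isomorphism[OF linear_cell_deriv] by metis
  have "(G has_derivative g') (at (F x))"
    by (rule has_derivative_inverse_strong[OF V(1) x cell_continuous[OF cell] G cell_has_derivative[OF cell]])
      (use g' in \<open>auto simp: fun_eq_iff\<close>)
  moreover have "c * norm (g' v) \<le> norm v" for v using low[of "g' v"] by (simp add: g')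
  ultimately show ?thesis using that g' by blast
qed

text \<open>Invariance of domain: the reference map is continuous and injective between spaces of
  equal dimension.\<close>

lemma cell_interior_open:
  assumes "is_cell S F" "open V" "V \<subseteq> ref_cell S"
  shows "open (F ` V)"
  using assms unfolding is_cell_def by (intro invariance_of_domain cell_continuous[of S]) (auto simp: is_cell_def intro: inj_on_subset)

text \<open>A segment issuing from \<open>F z\<close> is lifted through \<open>F\<close>; the lift cannot leave the ball before its end.\<close>

lemma cell_contains_ball:
  fixes F :: "real ^ 'n \<Rightarrow> real ^ 'n"
  assumes F: "expanding_cell c S F" and B: "ball z \<rho> \<subseteq> ref_cell S" and \<rho>: "\<rho> > 0"
  shows "ball (F z) (c * \<rho>) \<subseteq> F ` ball z \<rho>"
proof
  fix y assume y: "y \<in> ball (F z) (c * \<rho>)"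
  let ?B = "ball z \<rho>"
  have cell: "is_cell S F" and c: "c > 0" using F by (auto simp: expanding_cell_def)
  have inj: "inj_on F ?B" using cell B by (auto simp: is_cell_def intro: inj_on_subset)
  have W: "open (F ` ?B)" by (rule cell_interior_open[OF cell open_ball B])
  define G where "G = inv_into ?B F"
  have G: "G (F x) = x" if "x \<in> ?B" for x unfolding G_def by (rule inv_into_f_f[OF inj that])
  let ?\<gamma> = "\<lambda>t. F z + t *\<^sub>R (y - F z)"
  have cont: "continuous_on A ?\<gamma>" for A by (intro continuous_intros)
  show "y \<in> F ` ?B"
  proof (rule ccontr)
    assume ny: "y \<notin> F ` ?B"
    \<comment> \<open>The times at which the segment is outside the open image of the ball. If
      \<open>y\<close> were missed, this compact set would have a least element \<open>s\<close>,
      the first exit time.\<close>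
    let ?T = "{0..1} \<inter> ?\<gamma> -` (- (F ` ?B))"
    have "closed ?T" using W cont[of UNIV] by (intro closed_Int closed_vimage) auto
    then have "compact ?T" using compact_Int_closed[of "{0..1::real}" ?T] by (simp add: Int_absorb1)
    moreover have "1 \<in> ?T" using ny by simp
    ultimately obtain s where s: "s \<in> ?T" "\<And>t. t \<in> ?T \<Longrightarrow> s \<le> t" using compact_attains_inf[of ?T] by blast
    have "?\<gamma> 0 \<in> F ` ?B" using \<rho> by simp
    then have s0: "0 < s" "s \<le> 1" using s(1) by (auto simp: less_le)
    have below: "?\<gamma> t \<in> F ` ?B" if "0 \<le> t" "t < s" for t using s(2)[of t] that s0 by force
    \<comment> \<open>The lifted path has speed at most \<open>norm (y - F z) / c\<close>, so up to
      time \<open>s\<close> it remains in a closed ball of radius \<open>\<rho>'\<close>, strictly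
      smaller than \<open>\<rho>\<close>.\<close>
    define \<rho>' where "\<rho>' = s * (norm (y - F z) / c)"
    have "norm (y - F z) < c * \<rho>" using y by (simp add: dist_norm norm_minus_commute)
    then have "norm (y - F z) / c < \<rho>" using c by (simp add: field_simps)
    moreover have "\<rho>' \<le> 1 * (norm (y - F z) / c)" unfolding \<rho>'_def using s0 c by (intro mult_right_mono) auto
    ultimately have \<rho>': "\<rho>' < \<rho>" by linarith
    let ?N = "norm (y - F z) / c"
    have "\<exists>f'. ((\<lambda>u. G (?\<gamma> u)) has_derivative f') (at u within {0..<s}) \<and> onorm f' \<le> ?N" if u: "u \<in> {0..<s}" for u
    proof -
      obtain x where x: "x \<in> ?B" "?\<gamma> u = F x" using below[of u] u by auto
      obtain g' where g': "(G has_derivative g') (at (F x))" "\<And>v. c * norm (g' v) \<le> norm v"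
        using cell_local_inverse[OF F open_ball B G x(1)] by metis
      have "(?\<gamma> has_derivative (\<lambda>h. h *\<^sub>R (y - F z))) (at u within {0..<s})" by (auto intro!: derivative_eq_intros)
      moreover have "(G has_derivative g') (at (?\<gamma> u))" using g'(1) x(2) by simp
      ultimately have "((\<lambda>u. G (?\<gamma> u)) has_derivative (\<lambda>h. g' (h *\<^sub>R (y - F z)))) (at u within {0..<s})"
        by (rule has_derivative_compose)
      moreover have "onorm (\<lambda>h. g' (h *\<^sub>R (y - F z))) \<le> ?N"
      proof (rule onorm_bound)
        fix h :: real
        have "c * norm (g' (h *\<^sub>R (y - F z))) \<le> norm h * norm (y - F z)" using g'(2)[of "h *\<^sub>R (y - F z)"] by simp
        then show "norm (g' (h *\<^sub>R (y - F z))) \<le> ?N * norm h" using c by (simp add: field_simps)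
      qed (use c in simp)
      ultimately show ?thesis by blast
    qed
    then have "\<forall>u\<in>{0..<s}. \<exists>f'. ((\<lambda>u. G (?\<gamma> u)) has_derivative f') (at u within {0..<s}) \<and> onorm f' \<le> ?N" by blast
    from bchoice[OF this] obtain f' where f': "\<And>u. u \<in> {0..<s} \<Longrightarrow> ((\<lambda>u. G (?\<gamma> u)) has_derivative f' u) (at u within {0..<s})"
      "\<And>u. u \<in> {0..<s} \<Longrightarrow> onorm (f' u) \<le> ?N" by blast
    have sub: "{0..<s} \<subseteq> ?\<gamma> -` (F ` cball z \<rho>')"
    proof
      fix t assume t: "t \<in> {0..<s}"
      have "norm (G (?\<gamma> t) - G (?\<gamma> 0)) \<le> ?N * norm (t - 0)"
        by (rule differentiable_bound[of "{0..<s}" _ f']) (use f' t s0 in auto)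
      also have "\<dots> \<le> ?N * s" using t c by (intro mult_left_mono) auto
      finally have "norm (G (?\<gamma> t) - z) \<le> \<rho>'" using G[of z] \<rho> by (simp add: \<rho>'_def mult.commute)
      then have "G (?\<gamma> t) \<in> cball z \<rho>'" by (simp add: dist_norm norm_minus_commute)
      moreover have "F (G (?\<gamma> t)) = ?\<gamma> t" unfolding G_def using below[of t] t by (intro f_inv_into_f) auto
      ultimately show "t \<in> ?\<gamma> -` (F ` cball z \<rho>')" by (metis image_eqI vimage_eq)
    qed
    \<comment> \<open>The image of the smaller closed ball is closed, so the limit point at time
      \<open>s\<close> is still in the image, against the choice of \<open>s\<close>.\<close>
    have "compact (F ` cball z \<rho>')" by (intro compact_continuous_image cell_continuous[OF cell] compact_cball)
    then have "closed (?\<gamma> -` (F ` cball z \<rho>'))"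
      using cont[of UNIV] by (intro closed_vimage compact_imp_closed) auto
    from closure_minimal[OF sub this] have "closure {0..<s} \<subseteq> ?\<gamma> -` (F ` cball z \<rho>')" .
    moreover have "s \<in> closure {0..<s}" using s0 by simp
    ultimately have "?\<gamma> s \<in> F ` cball z \<rho>'" by blast
    moreover have "cball z \<rho>' \<subseteq> ?B" using \<rho>' by auto
    ultimately have "?\<gamma> s \<in> F ` ?B" by blast
    then show False using s(1) by simp
  qed
qed

section \<open>Finite element functions on a mesh\<close>

text \<open>All mesh estimates only depend on a lower bound \<open>c\<close> for the stretching of the reference maps and
  an upper bound \<open>h\<close> for the diameters of the cells.\<close>

definition uniform_mesh ::
  "real \<Rightarrow> real \<Rightarrow> shape \<Rightarrow> (real ^ 'n) set \<Rightarrow> (real ^ 'n \<Rightarrow> real ^ 'n) set \<Rightarrow> bool" where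
  "uniform_mesh c h S \<Omega> M \<longleftrightarrow> is_mesh S \<Omega> M \<and> (\<forall>F\<in>M. expanding_cell c S F \<and> cell_diam S F \<le> h)"

lemma uniform_meshD:
  assumes "uniform_mesh c h S \<Omega> M"
  shows "finite M" "(\<Union>F\<in>M. F ` ref_cell S) = closure \<Omega>"
    "\<And>F. F \<in> M \<Longrightarrow> is_cell S F" "\<And>F. F \<in> M \<Longrightarrow> expanding_cell c S F" "\<And>F. F \<in> M \<Longrightarrow> cell_diam S F \<le> h"
  using assms by (auto simp: uniform_mesh_def is_mesh_def)

lemma ref_poly_lipschitz:
  fixes p :: "real ^ 'n \<Rightarrow> real"
  assumes "p \<in> ref_poly S r"
  obtains B where "B \<ge> 0" "\<And>x y. x \<in> ref_cell S \<Longrightarrow> y \<in> ref_cell S \<Longrightarrow> \<bar>p x - p y\<bar> \<le> B * norm (x - y)"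
proof -
  have s: "smooth p" using assms by (rule ref_poly_smooth)
  have "compact (grad p ` ref_cell S)"
    by (intro compact_continuous_image continuous_on_grad s compact_ref_cell)
  then obtain B where B: "\<And>x. x \<in> ref_cell S \<Longrightarrow> norm (grad p x) \<le> B"
    using compact_imp_bounded by (fastforce simp: bounded_iff)
  have "\<bar>p x - p y\<bar> \<le> \<bar>B\<bar> * norm (x - y)" if x: "x \<in> ref_cell S" and y: "y \<in> ref_cell S" for x y
  proof -
    have "norm (p x - p y) \<le> \<bar>B\<bar> * norm (x - y)"
    proof (rule differentiable_bound[OF convex_ref_cell _ _ x y])
      fix z :: "real ^ 'n" assume z: "z \<in> ref_cell S"
      show "(p has_derivative inner (grad p z)) (at z within ref_cell S)"
        using has_derivative_grad[OF smooth_differentiable[OF s]] by (rule has_derivative_at_withinI)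
      show "onorm (inner (grad p z)) \<le> \<bar>B\<bar>"
      proof (rule onorm_bound)
        fix h
        have "\<bar>inner (grad p z) h\<bar> \<le> norm (grad p z) * norm h" by (rule Cauchy_Schwarz_ineq2)
        also have "\<dots> \<le> \<bar>B\<bar> * norm h" using B[OF z] by (intro mult_right_mono) auto
        finally show "norm (inner (grad p z) h) \<le> \<bar>B\<bar> * norm h" by simp
      qed simp
    qed
    then show ?thesis by simp
  qed
  then show ?thesis using that[of "\<bar>B\<bar>"] by simp
qed

lemma fe_spaceE:
  assumes "v \<in> fe_space S \<Omega> M r" "F \<in> M"
  obtains p where "p \<in> ref_poly S r" "\<And>x. x \<in> ref_cell S \<Longrightarrow> v (F x) = p x"
  using assms unfolding fe_space_def by blast

text \<open>On each cell \<open>v\<close> is a Lipschitz polynomial composed with a Lipschitz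
  inverse. By convexity the segment between two points stays in the closed domain, where finitely
  many closed pieces, one per cell, cover it; the sum of the constants serves all pieces.\<close>

lemma fe_space_lipschitz:
  fixes \<Omega> :: "(real ^ 'n) set"
  assumes \<Omega>: "convex \<Omega>" and M: "uniform_mesh c h S \<Omega> M" and v: "v \<in> fe_space S \<Omega> M r"
  obtains L where "L \<ge> 0" "\<And>x y. x \<in> closure \<Omega> \<Longrightarrow> y \<in> closure \<Omega> \<Longrightarrow> \<bar>v x - v y\<bar> \<le> L * norm (x - y)"
proof -
  let ?R = "ref_cell S :: (real ^ 'n) set"
  note m = uniform_meshD[OF M]
  have "\<exists>L\<ge>0. \<forall>y\<in>F ` ?R. \<forall>z\<in>F ` ?R. \<bar>v y - v z\<bar> \<le> L * norm (y - z)" if F: "F \<in> M" for F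
  proof -
    obtain p where p: "p \<in> ref_poly S r" "\<And>x. x \<in> ?R \<Longrightarrow> v (F x) = p x" using fe_spaceE[OF v F] by blast
    obtain B where B: "B \<ge> 0" "\<And>x y. x \<in> ?R \<Longrightarrow> y \<in> ?R \<Longrightarrow> \<bar>p x - p y\<bar> \<le> B * norm (x - y)"
      using ref_poly_lipschitz[OF p(1)] by blast
    obtain A where A: "A > 0" "\<And>x y. x \<in> ?R \<Longrightarrow> y \<in> ?R \<Longrightarrow> norm (x - y) \<le> A * norm (F x - F y)"
      using cell_inverse_lipschitz[OF m(4)[OF F]] by blast
    have "\<bar>v (F x) - v (F y)\<bar> \<le> (B * A) * norm (F x - F y)" if "x \<in> ?R" "y \<in> ?R" for x y
    proof -
      have "\<bar>v (F x) - v (F y)\<bar> \<le> B * norm (x - y)" using B(2)[OF that] p(2) that by simp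
      also have "\<dots> \<le> B * (A * norm (F x - F y))" using A(2)[OF that] B(1) by (intro mult_left_mono)
      finally show ?thesis by (simp add: mult.assoc)
    qed
    then show ?thesis using A(1) B(1) by (intro exI[of _ "B * A"]) auto
  qed
  then obtain L where L: "\<And>F. F \<in> M \<Longrightarrow> L F \<ge> 0"
    "\<And>F y z. F \<in> M \<Longrightarrow> y \<in> F ` ?R \<Longrightarrow> z \<in> F ` ?R \<Longrightarrow> \<bar>v y - v z\<bar> \<le> L F * norm (y - z)" by metis
  define K where "K = (\<Sum>F\<in>M. L F)"
  have K0: "K \<ge> 0" unfolding K_def by (intro sum_nonneg L)
  have LK: "L F \<le> K" if "F \<in> M" for F
    unfolding K_def using that L(1) m(1) by (intro member_le_sum) auto
  have "\<bar>v x - v y\<bar> \<le> K * norm (x - y)" if x: "x \<in> closure \<Omega>" and y: "y \<in> closure \<Omega>" for x y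
  proof -
    let ?\<gamma> = "\<lambda>t. x + t *\<^sub>R (y - x)"
    let ?U = "\<lambda>F. {0..1} \<inter> ?\<gamma> -` (F ` ?R)"
    have "(K * norm (y - x))-lipschitz_on {0..1} (\<lambda>t. v (?\<gamma> t))"
    proof (rule lipschitz_on_closed_Union[where U="?U" and I=M])
      show "finite M" by (rule m(1))
      show "0 \<le> K * norm (y - x)" using K0 by simp
      show "{0..1} \<subseteq> (\<Union>F\<in>M. ?U F)"
      proof
        fix t :: real assume t: "t \<in> {0..1}"
        have "(1 - t) *\<^sub>R x + t *\<^sub>R y \<in> closure \<Omega>" using t x y \<Omega> by (intro convexD_alt convex_closure) auto
        moreover have "(1 - t) *\<^sub>R x + t *\<^sub>R y = ?\<gamma> t" by (simp add: algebra_simps)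
        ultimately have "?\<gamma> t \<in> (\<Union>F\<in>M. F ` ?R)" unfolding m(2) by simp
        then show "t \<in> (\<Union>F\<in>M. ?U F)" using t by blast
      qed
      fix F assume F: "F \<in> M"
      have "closed (F ` ?R)" by (intro compact_imp_closed compact_continuous_image cell_continuous[OF m(3)[OF F]] compact_ref_cell)
      moreover have "continuous_on UNIV ?\<gamma>" by (intro continuous_intros)
      ultimately show "closed (?U F)" by (intro closed_Int closed_vimage) auto
      show "(K * norm (y - x))-lipschitz_on (?U F) (\<lambda>t. v (?\<gamma> t))"
      proof (rule lipschitz_onI)
        fix s t assume s: "s \<in> ?U F" and t: "t \<in> ?U F"
        have "\<bar>v (?\<gamma> s) - v (?\<gamma> t)\<bar> \<le> L F * norm (?\<gamma> s - ?\<gamma> t)" using s t by (intro L(2)[OF F]) auto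
        also have "\<dots> \<le> K * norm (?\<gamma> s - ?\<gamma> t)" using LK[OF F] by (intro mult_right_mono) auto
        also have "?\<gamma> s - ?\<gamma> t = (s - t) *\<^sub>R (y - x)" by (simp add: algebra_simps)
        finally show "dist (v (?\<gamma> s)) (v (?\<gamma> t)) \<le> K * norm (y - x) * dist s t"
          by (simp add: dist_real_def mult_ac)
      qed (use K0 in simp)
    qed
    from lipschitz_onD[OF this, of 0 1] show ?thesis by (simp add: dist_real_def norm_minus_commute)
  qed
  then show ?thesis using that K0 by blast
qed

text \<open>The image of the interior is open and lies in the closure of the domain, and an open
  convex set is the interior of its closure.\<close>

lemma cell_interior_subset:
  assumes \<Omega>: "open \<Omega>" "convex \<Omega>" and M: "uniform_mesh c h S \<Omega> M" and F: "F \<in> M"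
  shows "F ` interior (ref_cell S) \<subseteq> \<Omega>"
proof -
  note m = uniform_meshD[OF M]
  have "open (F ` interior (ref_cell S))" by (intro cell_interior_open[OF m(3)[OF F]] interior_subset open_interior)
  moreover have "F ` interior (ref_cell S) \<subseteq> closure \<Omega>" unfolding m(2)[symmetric] using F interior_subset by blast
  ultimately have "F ` interior (ref_cell S) \<subseteq> interior (closure \<Omega>)" by (intro interior_maximal)
  then show ?thesis using convex_interior_closure[OF \<Omega>(2)] interior_open[OF \<Omega>(1)] by simp
qed

text \<open>Two cells meet in the image of a proper face, and a proper face does not meet the
  interior of the reference cell; injectivity carries this over to the cells.\<close>

lemma cell_interiors_disjoint:
  assumes M: "uniform_mesh c h S \<Omega> M" and F: "F \<in> M" and G: "G \<in> M" and ne: "F \<noteq> G"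
  shows "F ` interior (ref_cell S) \<inter> G ` ref_cell S = {}"
proof (rule ccontr)
  assume "F ` interior (ref_cell S) \<inter> G ` ref_cell S \<noteq> {}"
  then obtain x where x: "x \<in> interior (ref_cell S)" "F x \<in> G ` ref_cell S" by blast
  then have xR: "x \<in> ref_cell S" using interior_subset by blast
  have "\<exists>A. A face_of ref_cell S \<and> A \<noteq> ref_cell S \<and> F ` ref_cell S \<inter> G ` ref_cell S = F ` A"
    using M F G ne unfolding uniform_mesh_def is_mesh_def by metis
  then obtain A where A: "A face_of ref_cell S" "A \<noteq> ref_cell S" "F ` ref_cell S \<inter> G ` ref_cell S = F ` A" by blast
  have "F x \<in> F ` A" using A(3) x xR by blast
  moreover have "inj_on F (ref_cell S)" using uniform_meshD(3)[OF M F] by (simp add: is_cell_def)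
  moreover have "A \<subseteq> ref_cell S" using A(1) by (rule face_of_imp_subset)
  ultimately have "x \<in> A" using xR by (auto dest: inj_onD)
  then show False using face_of_disjoint_interior[OF A(1,2)] x(1) by blast
qed

lemma cell_subset_cball:
  assumes M: "uniform_mesh c h S \<Omega> M" and F: "F \<in> M" and y: "y \<in> F ` ref_cell S"
  shows "F ` ref_cell S \<subseteq> cball y h"
proof
  fix z assume z: "z \<in> F ` ref_cell S"
  have "bounded (F ` ref_cell S)"
    by (intro compact_imp_bounded compact_continuous_image cell_continuous[OF uniform_meshD(3)[OF M F]] compact_ref_cell)
  then have "dist y z \<le> cell_diam S F" unfolding cell_diam_def using y z by (intro diameter_bounded_bound)
  then show "z \<in> cball y h" using uniform_meshD(5)[OF M F] by simp
qed

text \<open>The solution \<open>w x\<close> of a linear system with matrix \<open>DF(x)\<close>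
  depends continuously on \<open>x\<close>:
  \<open>DF(x) (w x - w x0) = (DF(x0) - DF(x)) (w x0)\<close>, and the lower bound \<open>c\<close>
  converts this into an estimate of the difference.\<close>

lemma continuous_component_local_inverse:
  fixes F :: "real ^ 'n \<Rightarrow> real ^ 'n"
  assumes F: "expanding_cell c S F" and R: "\<And>x. x \<in> V \<Longrightarrow> x \<in> ref_cell S"
    and w: "\<And>x. x \<in> V \<Longrightarrow> cell_deriv F x (w x) = e" "\<And>x. x \<in> V \<Longrightarrow> c * norm (w x) \<le> norm e"
  shows "continuous_on V w"
proof (rule continuous_on_iff[THEN iffD2], intro ballI allI impI)
  have cell: "is_cell S F" and c: "c > 0" and low: "\<And>x v. x \<in> ref_cell S \<Longrightarrow> c * norm v \<le> norm (cell_deriv F x v)"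
    using F by (auto simp: expanding_cell_def)
  fix x0 and \<epsilon> :: real assume x0: "x0 \<in> V" and \<epsilon>: "\<epsilon> > 0"
  define N where "N = norm e + 1"
  have N: "N > 0" by (simp add: N_def add_nonneg_pos)
  \<comment> \<open>\<open>N > 0\<close> also covers \<open>e = 0\<close>; one factor
    \<open>c\<close> comes from the lower bound on \<open>DF\<close> and one from the bound on
    \<open>w x0\<close>.\<close>
  define \<epsilon>' where "\<epsilon>' = \<epsilon> * c ^ 2 / (2 * N)"
  have \<epsilon>': "\<epsilon>' > 0" using \<epsilon> c N by (simp add: \<epsilon>'_def)
  obtain \<delta> where \<delta>: "\<delta> > 0"
    "\<And>x y v. x \<in> ref_cell S \<Longrightarrow> y \<in> ref_cell S \<Longrightarrow> norm (x - y) < \<delta> \<Longrightarrow> norm (cell_deriv F x v - cell_deriv F y v) \<le> \<epsilon>' * norm v"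
    using cell_deriv_uniform[OF cell \<epsilon>'] by metis
  have "dist (w x) (w x0) < \<epsilon>" if x: "x \<in> V" and d: "dist x x0 < \<delta>" for x
  proof -
    have "cell_deriv F x (w x - w x0) = cell_deriv F x0 (w x0) - cell_deriv F x (w x0)"
      using w(1)[OF x] w(1)[OF x0] by (simp add: linear_diff[OF linear_cell_deriv])
    also have "norm \<dots> \<le> \<epsilon>' * norm (w x0)"
      using \<delta>(2)[OF R[OF x0] R[OF x], of "w x0"] d by (simp add: dist_norm norm_minus_commute)
    finally have "c * norm (w x - w x0) \<le> \<epsilon>' * norm (w x0)" using low[OF R[OF x], of "w x - w x0"] by linarith
    then have "c * (c * norm (w x - w x0)) \<le> c * (\<epsilon>' * norm (w x0))" using c by (intro mult_left_mono) auto
    also have "\<dots> = \<epsilon>' * (c * norm (w x0))" by simp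
    also have "\<dots> \<le> \<epsilon>' * norm e" using w(2)[OF x0] \<epsilon>' by (intro mult_left_mono) auto
    also have "\<dots> \<le> \<epsilon>' * N" using \<epsilon>' by (intro mult_left_mono) (auto simp: N_def)
    also have "\<dots> = \<epsilon> * c ^ 2 / 2"
      using N by (simp add: \<epsilon>'_def)
    also have "\<dots> < \<epsilon> * c ^ 2" using \<epsilon> c by simp
    finally have "c ^ 2 * norm (w x - w x0) < c ^ 2 * \<epsilon>" by (simp add: power2_eq_square mult_ac)
    then show ?thesis using c by (simp add: dist_norm)
  qed
  then show "\<exists>\<delta>>0. \<forall>x\<in>V. dist x x0 < \<delta> \<longrightarrow> dist (w x) (w x0) < \<epsilon>" using \<delta>(1) by blast
qed

text \<open>On the cell \<open>v\<close> is \<open>p\<close> composed with the inverse of the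
  reference map. The chain rule gives its derivative, the factor \<open>1 / c\<close> comes from the
  inverse, and continuity of the gradient from that of the inverse derivative.\<close>

lemma fe_cell_gradient:
  fixes F :: "real ^ 'n \<Rightarrow> real ^ 'n"
  assumes F: "expanding_cell c S F" and p: "p \<in> ref_poly S r"
    and v: "\<And>x. x \<in> interior (ref_cell S) \<Longrightarrow> v (F x) = p x"
  shows "\<And>x. x \<in> interior (ref_cell S) \<Longrightarrow> v differentiable (at (F x))"
    and "continuous_on (F ` interior (ref_cell S)) (grad v)"
    and "\<And>x. x \<in> interior (ref_cell S) \<Longrightarrow> c * norm (grad v (F x)) \<le> norm (grad p x)"
proof -
  let ?V = "interior (ref_cell S) :: (real ^ 'n) set"
  have cell: "is_cell S F" and c: "c > 0" using F by (auto simp: expanding_cell_def)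
  have VR: "?V \<subseteq> ref_cell S" by (rule interior_subset)
  have inj: "inj_on F ?V" using cell VR by (auto simp: is_cell_def intro: inj_on_subset)
  define G where "G = inv_into ?V F"
  have G: "G (F x) = x" if "x \<in> ?V" for x unfolding G_def by (rule inv_into_f_f[OF inj that])
  have W: "open (F ` ?V)" by (rule cell_interior_open[OF cell open_interior VR])
  have "\<exists>g'. (G has_derivative g') (at (F x)) \<and> (\<forall>v. c * norm (g' v) \<le> norm v) \<and> (\<forall>v. cell_deriv F x (g' v) = v)"
    if "x \<in> ?V" for x
    using cell_local_inverse[OF F open_interior VR G that] by metis
  then obtain g where g: "\<And>x. x \<in> ?V \<Longrightarrow> (G has_derivative g x) (at (F x))"
    "\<And>x v. x \<in> ?V \<Longrightarrow> c * norm (g x v) \<le> norm v" "\<And>x v. x \<in> ?V \<Longrightarrow> cell_deriv F x (g x v) = v" by metis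
  have der: "(v has_derivative (\<lambda>h. inner (grad p x) (g x h))) (at (F x))" if x: "x \<in> ?V" for x
  proof -
    have "(p has_derivative inner (grad p x)) (at (G (F x)))"
      using has_derivative_grad[OF smooth_differentiable[OF ref_poly_smooth[OF p]], of x] by (simp add: G[OF x])
    from has_derivative_compose[OF g(1)[OF x] this]
    have "((\<lambda>y. p (G y)) has_derivative (\<lambda>h. inner (grad p x) (g x h))) (at (F x))" .
    then show ?thesis
      by (rule has_derivative_transform_within_open[OF _ W]) (use x v G in auto)
  qed
  show "v differentiable (at (F x))" if "x \<in> ?V" for x using der[OF that] unfolding differentiable_def by blast
  have gr: "grad v (F x) $ i = inner (grad p x) (g x (axis i 1))" if "x \<in> ?V" for x i
    using pdiff_eq[OF der[OF that], of i] by (simp add: grad_def)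
  have inn: "inner (grad v (F x)) h = inner (grad p x) (g x h)" if x: "x \<in> ?V" for x h
    using has_derivative_unique[OF has_derivative_grad[of v "F x"] der[OF x]] der[OF x]
    by (metis differentiable_def)
  show "c * norm (grad v (F x)) \<le> norm (grad p x)" if x: "x \<in> ?V" for x
  proof -
    \<comment> \<open>Testing the derivative with the gradient itself turns the bound for
      directional derivatives into one for the norm.\<close>
    let ?d = "grad v (F x)"
    have "norm ?d * norm ?d = inner (grad p x) (g x ?d)" using inn[OF x, of ?d] by (simp add: dot_square_norm power2_eq_square)
    also have "\<dots> \<le> norm (grad p x) * norm (g x ?d)" by (rule norm_cauchy_schwarz)
    finally have "c * (norm ?d * norm ?d) \<le> c * (norm (grad p x) * norm (g x ?d))" using c by (intro mult_left_mono) auto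
    also have "\<dots> = norm (grad p x) * (c * norm (g x ?d))" by simp
    also have "\<dots> \<le> norm (grad p x) * norm ?d" using g(2)[OF x] by (intro mult_left_mono) auto
    finally have "(c * norm ?d) * norm ?d \<le> norm (grad p x) * norm ?d" by (simp add: mult.assoc)
    then show ?thesis by (cases "norm ?d = 0") auto
  qed
  obtain B where B: "B > 0" "\<And>x y. x \<in> ref_cell S \<Longrightarrow> y \<in> ref_cell S \<Longrightarrow> norm (x - y) \<le> B * norm (F x - F y)"
    using cell_inverse_lipschitz[OF F] by blast
  have "B-lipschitz_on (F ` ?V) G"
  proof (rule lipschitz_onI)
    fix y z assume "y \<in> F ` ?V" "z \<in> F ` ?V"
    then obtain a b where ab: "a \<in> ?V" "b \<in> ?V" and yz: "y = F a" "z = F b" by blast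
    have "norm (a - b) \<le> B * norm (F a - F b)" using B(2) ab VR by blast
    then show "dist (G y) (G z) \<le> B * dist y z" unfolding yz G[OF ab(1)] G[OF ab(2)] dist_norm .
  qed (use B(1) in simp)
  then have contG: "continuous_on (F ` ?V) G" by (rule lipschitz_on_continuous_on)
  show "continuous_on (F ` ?V) (grad v)"
  proof (rule continuous_on_cong[THEN iffD1, OF refl])
    show "continuous_on (F ` ?V) (\<lambda>y. \<chi> i. inner (grad p (G y)) (g (G y) (axis i 1)))"
    proof (rule continuous_on_vec_lambda)
      fix i
      have "continuous_on ?V (\<lambda>x. g x (axis i 1))"
        by (rule continuous_component_local_inverse[OF F]) (use VR g in auto)
      then have "continuous_on (F ` ?V) (\<lambda>y. g (G y) (axis i 1))"
        by (rule continuous_on_compose2[OF _ contG]) (use G in auto)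
      moreover have "continuous_on (F ` ?V) (\<lambda>y. grad p (G y))"
        by (rule continuous_on_compose2[OF continuous_on_grad[OF ref_poly_smooth[OF p]] contG]) (rule subset_UNIV)
      ultimately show "continuous_on (F ` ?V) (\<lambda>y. inner (grad p (G y)) (g (G y) (axis i 1)))"
        by (intro continuous_on_inner)
    qed
    fix y assume "y \<in> F ` ?V"
    then obtain x where x: "x \<in> ?V" "y = F x" by blast
    show "(\<chi> i. inner (grad p (G y)) (g (G y) (axis i 1))) = grad v y"
      unfolding x(2) G[OF x(1)] by (simp add: gr[OF x(1)] Finite_Cartesian_Product.vec_eq_iff)
  qed
qed

text \<open>The zero boundary values make the extension by zero Lipschitz. Its gradient is
  continuous inside the cells and outside the closed domain; what is left is a null set. The bound
  on \<open>D\<close> in terms of reference gradients is kept for the inverse estimate.\<close>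

lemma fe_space0_lipschitz_C1:
  fixes \<Omega> :: "(real ^ 'n) set"
  assumes \<Omega>: "open \<Omega>" "bounded \<Omega>" "convex \<Omega>" and M: "uniform_mesh c h S \<Omega> M" and v: "v \<in> fe_space0 S \<Omega> M r"
  obtains D where "lipschitz_C1 \<Omega> (\<lambda>x. if x \<in> \<Omega> then v x else 0) D"
    "\<And>F p x. F \<in> M \<Longrightarrow> p \<in> ref_poly S r \<Longrightarrow> (\<And>x. x \<in> ref_cell S \<Longrightarrow> v (F x) = p x) \<Longrightarrow>
       x \<in> interior (ref_cell S) \<Longrightarrow> c * norm (D (F x)) \<le> norm (grad p x)"
    "\<And>y. y \<in> \<Omega> \<Longrightarrow> y \<notin> (\<Union>F\<in>M. F ` interior (ref_cell S)) \<Longrightarrow> D y = 0"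
proof -
  let ?V = "interior (ref_cell S) :: (real ^ 'n) set"
  note m = uniform_meshD[OF M]
  have vfe: "v \<in> fe_space S \<Omega> M r" and v0: "\<And>x. x \<in> frontier \<Omega> \<Longrightarrow> v x = 0"
    using v by (auto simp: fe_space0_def)
  let ?v = "\<lambda>x. if x \<in> \<Omega> then v x else 0"
  let ?W = "\<Union>F\<in>M. F ` ?V"
  \<comment> \<open>The exterior belongs to the set of regular points because the extension vanishes
    there.\<close>
  let ?U = "?W \<union> - closure \<Omega>"
  define D where "D = (\<lambda>y. if y \<in> ?U then grad ?v y else 0)"
  have sub: "F ` ?V \<subseteq> \<Omega>" if "F \<in> M" for F by (rule cell_interior_subset[OF \<Omega>(1,3) M that])
  have opW: "open (F ` ?V)" if "F \<in> M" for F by (rule cell_interior_open[OF m(3)[OF that] open_interior interior_subset])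
  have opC: "open (- closure \<Omega>)" by auto
  have cell: "(\<And>x. x \<in> ?V \<Longrightarrow> ?v differentiable (at (F x)))" "continuous_on (F ` ?V) (grad ?v)"
      "(\<And>x. x \<in> ?V \<Longrightarrow> c * norm (grad ?v (F x)) \<le> norm (grad p x))"
    if F: "F \<in> M" and p: "p \<in> ref_poly S r" "\<And>x. x \<in> ref_cell S \<Longrightarrow> v (F x) = p x" for F p
  proof -
    have "?v (F x) = p x" if "x \<in> ?V" for x
      using sub[OF F] p(2) that interior_subset[of "ref_cell S"] by auto
    from fe_cell_gradient[OF m(4)[OF F] p(1), of ?v, OF this]
    show "(\<And>x. x \<in> ?V \<Longrightarrow> ?v differentiable (at (F x)))" "continuous_on (F ` ?V) (grad ?v)"
      "(\<And>x. x \<in> ?V \<Longrightarrow> c * norm (grad ?v (F x)) \<le> norm (grad p x))" by blast+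
  qed
  have ext: "(?v has_derivative (\<lambda>h. 0)) (at x)" if "x \<in> - closure \<Omega>" for x
    by (rule has_derivative_transform_within_open[OF has_derivative_const[of "0::real"] opC that])
      (use closure_subset[of \<Omega>] in auto)
  have ext0: "grad ?v x = 0" if "x \<in> - closure \<Omega>" for x
    using pdiff_eq[OF ext[OF that]] by (simp add: grad_def Finite_Cartesian_Product.vec_eq_iff)
  obtain L where L: "L \<ge> 0" "\<And>x y. x \<in> closure \<Omega> \<Longrightarrow> y \<in> closure \<Omega> \<Longrightarrow> \<bar>v x - v y\<bar> \<le> L * norm (x - y)"
    using fe_space_lipschitz[OF \<Omega>(3) M vfe] by blast
  \<comment> \<open>The segment from an inner to an outer point crosses the boundary, where
    \<open>v\<close> is zero, so the Lipschitz bound up to the crossing point suffices.\<close>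
  have out: "\<bar>v x\<bar> \<le> L * norm (x - y)" if x: "x \<in> \<Omega>" and y: "y \<notin> \<Omega>" for x y
  proof -
    have "closed_segment x y \<inter> frontier \<Omega> \<noteq> {}"
      by (rule connected_Int_frontier) (use x y in auto)
    then obtain z where z: "z \<in> closed_segment x y" "z \<in> frontier \<Omega>" by blast
    have "\<bar>v x - v z\<bar> \<le> L * norm (x - z)"
      using L(2)[of x z] x z(2) closure_subset[of \<Omega>] by (auto simp: frontier_def)
    also have "\<dots> \<le> L * norm (x - y)"
      using dist_in_closed_segment[OF z(1)] L(1) by (intro mult_left_mono) (auto simp: dist_norm norm_minus_commute)
    finally show ?thesis using v0[OF z(2)] by simp
  qed
  have "L-lipschitz_on UNIV ?v"
  proof (rule lipschitz_onI)
    fix x y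
    show "dist (?v x) (?v y) \<le> L * dist x y"
      using out[of x y] out[of y x] L(2)[of x y] closure_subset[of \<Omega>] L(1)
      by (auto simp: dist_norm norm_minus_commute)
  qed (rule L(1))
  moreover have "open ?U" using opW opC by blast
  moreover have "negligible (- ?U)"
  proof (rule negligible_subset)
    \<comment> \<open>The frontier of a convex set is null and stays null under the differentiable
      maps \<open>F\<close>.\<close>
    show "negligible (\<Union>F\<in>M. F ` frontier (ref_cell S))"
    proof (intro negligible_Union finite_imageI m(1))
      fix T assume "T \<in> (\<lambda>F. F ` frontier (ref_cell S)) ` M"
      then obtain F where F: "F \<in> M" "T = F ` frontier (ref_cell S)" by blast
      have "F differentiable_on frontier (ref_cell S)"
        using cell_has_derivative[OF m(3)[OF F(1)]] has_derivative_at_withinI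
        unfolding differentiable_on_def differentiable_def by blast
      then show "negligible T" unfolding F(2)
        by (intro negligible_differentiable_image_negligible[OF order_refl] negligible_convex_frontier convex_ref_cell)
    qed
    have fr: "frontier (ref_cell S) = ref_cell S - ?V"
      unfolding frontier_def closure_closed[OF compact_imp_closed[OF compact_ref_cell[of S]]] by (rule refl)
    show "- ?U \<subseteq> (\<Union>F\<in>M. F ` frontier (ref_cell S))"
    proof
      fix x assume x: "x \<in> - ?U"
      then have "x \<in> (\<Union>F\<in>M. F ` ref_cell S)" using m(2) by simp
      then obtain F a where F: "F \<in> M" "a \<in> ref_cell S" "x = F a" by blast
      then have "a \<notin> ?V" using x by blast
      then show "x \<in> (\<Union>F\<in>M. F ` frontier (ref_cell S))" unfolding fr using F by blast
    qed
  qed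
  moreover have "(?v has_derivative inner (D x)) (at x)" if x: "x \<in> ?U" for x
  proof (cases "x \<in> ?W")
    case True
    then obtain F a where F: "F \<in> M" "a \<in> ?V" "x = F a" by blast
    obtain p where p: "p \<in> ref_poly S r" "\<And>x. x \<in> ref_cell S \<Longrightarrow> v (F x) = p x" using fe_spaceE[OF vfe F(1)] by blast
    have "?v differentiable (at x)" using cell(1)[OF F(1) p] F(2,3) by simp
    from has_derivative_grad[OF this] show ?thesis using x by (simp add: D_def)
  next
    case False
    then have "x \<in> - closure \<Omega>" using x by blast
    moreover have "inner (0 :: real ^ 'n) = (\<lambda>h. 0)" by (simp add: fun_eq_iff)
    ultimately show ?thesis using ext[of x] ext0[of x] x by (simp add: D_def)
  qed
  moreover have "continuous_on ?U D"
  proof -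
    have "continuous_on (F ` ?V) (grad ?v)" if F: "F \<in> M" for F
    proof -
      obtain p where p: "p \<in> ref_poly S r" "\<And>x. x \<in> ref_cell S \<Longrightarrow> v (F x) = p x" using fe_spaceE[OF vfe F] by blast
      show ?thesis by (rule cell(2)[OF F p])
    qed
    then have "continuous_on ?W (grad ?v)" using opW by (intro continuous_on_open_UN) auto
    moreover have "continuous_on (- closure \<Omega>) (grad ?v)"
      by (rule continuous_on_cong[THEN iffD1, OF refl _ continuous_on_const[of _ 0]]) (simp add: ext0)
    ultimately have "continuous_on ?U (grad ?v)" using opW opC by (intro continuous_on_open_Un) auto
    then show ?thesis by (rule continuous_on_cong[THEN iffD1, OF refl, rotated]) (simp add: D_def)
  qed
  moreover have "\<forall>x. x \<notin> ?U \<longrightarrow> D x = 0" by (simp add: D_def)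
  ultimately have "lipschitz_C1 \<Omega> ?v D" unfolding lipschitz_C1_def
    by (intro conjI exI[of _ L] exI[of _ ?U]) auto
  moreover have "c * norm (D (F x)) \<le> norm (grad p x)"
    if "F \<in> M" "p \<in> ref_poly S r" "\<And>x. x \<in> ref_cell S \<Longrightarrow> v (F x) = p x" "x \<in> ?V" for F p x
  proof -
    have "F x \<in> ?U" using that by blast
    then show ?thesis using cell(3)[OF that] by (simp add: D_def)
  qed
  moreover have "D y = 0" if "y \<in> \<Omega>" "y \<notin> ?W" for y
    using that closure_subset[of \<Omega>] by (auto simp: D_def)
  ultimately show ?thesis by (rule that) blast+
qed

lemma fe_space0_H10:
  assumes \<Omega>: "open \<Omega>" "bounded \<Omega>" "convex \<Omega>" "\<Omega> \<noteq> {}" and M: "uniform_mesh c h S \<Omega> M" and v: "v \<in> fe_space0 S \<Omega> M r"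
  shows "v \<in> H10 \<Omega>"
proof (rule fe_space0_lipschitz_C1[OF \<Omega>(1-3) M v])
  fix D assume "lipschitz_C1 \<Omega> (\<lambda>x. if x \<in> \<Omega> then v x else 0) D"
  then have "(\<lambda>x. if x \<in> \<Omega> then v x else 0) \<in> H10 \<Omega>" by (rule lipschitz_C1_H10[OF \<Omega>])
  then show ?thesis using H10_cong[of \<Omega> v "\<lambda>x. if x \<in> \<Omega> then v x else 0"] by simp
qed

section \<open>Packing of cells, sums over nodes, and inverse estimates\<close>

lemma measure_ball:
  fixes z :: "real ^ 'n"
  assumes "\<rho> \<ge> 0"
  shows "measure lborel (ball z \<rho>) = \<rho> ^ CARD('n) * measure lborel (ball (0 :: real ^ 'n) 1)"
  using content_ball_conv_unit_ball[OF assms, of z] by simp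

text \<open>A packing argument: every cell through \<open>y\<close> lies in the ball of radius
  \<open>h\<close> about \<open>y\<close> and contains a ball of radius \<open>c * \<rho>\<close>,
  and these balls are disjoint. Comparing volumes bounds the number of cells.\<close>

lemma mesh_overlap:
  fixes S :: shape
  obtains \<rho> where "\<rho> > 0"
    "\<And>c h (\<Omega> :: (real ^ 'n) set) M y. c > 0 \<Longrightarrow> h > 0 \<Longrightarrow> uniform_mesh c h S \<Omega> M \<Longrightarrow>
       real (card {F \<in> M. y \<in> F ` ref_cell S}) \<le> (h / (c * \<rho>)) ^ CARD('n)"
proof -
  let ?R = "ref_cell S :: (real ^ 'n) set"
  obtain z \<rho> where z: "\<rho> > 0" "ball z \<rho> \<subseteq> interior ?R"
    using interior_ref_cell_nonempty[of S] open_interior[of ?R] by (metis equals0I open_contains_ball)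
  have "real (card {F \<in> M. y \<in> F ` ?R}) \<le> (h / (c * \<rho>)) ^ CARD('n)"
    if c: "c > 0" and h: "h > 0" and M: "uniform_mesh c h S \<Omega> M" for c h and \<Omega> :: "(real ^ 'n) set" and M y
  proof -
    let ?K = "{F \<in> M. y \<in> F ` ?R}" and ?B = "\<lambda>F :: real ^ 'n \<Rightarrow> real ^ 'n. ball (F z) (c * \<rho>)"
    let ?\<omega> = "measure lborel (ball (0 :: real ^ 'n) 1)"
    note m = uniform_meshD[OF M]
    have \<omega>: "?\<omega> > 0" by (rule content_ball_pos) simp
    have B: "?B F \<subseteq> F ` interior ?R" if "F \<in> M" for F
      using cell_contains_ball[OF m(4)[OF that] _ z(1), of z] z(2) interior_subset[of ?R] by blast
    have disj: "disjoint_family_on ?B ?K"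
    proof (unfold disjoint_family_on_def, intro ballI impI)
      fix F G assume FG: "F \<in> ?K" "G \<in> ?K" "F \<noteq> G"
      have "?B F \<subseteq> F ` interior ?R" "?B G \<subseteq> G ` ?R" using B FG interior_subset[of ?R] by blast+
      moreover have "F ` interior ?R \<inter> G ` ?R = {}" using FG by (intro cell_interiors_disjoint[OF M]) auto
      ultimately show "?B F \<inter> ?B G = {}" by blast
    qed
    have "real (card ?K) * ((c * \<rho>) ^ CARD('n) * ?\<omega>) = (\<Sum>F\<in>?K. measure lborel (?B F))"
      using measure_ball[where 'n='n, of "c * \<rho>"] c z(1) by simp
    also have "\<dots> = measure lborel (\<Union>F\<in>?K. ?B F)"
    proof (intro measure_finite_Union[symmetric])
      fix F
      show "emeasure lborel (?B F) \<noteq> \<infinity>"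
        using emeasure_bounded_finite[OF bounded_ball, of "F z" "c * \<rho>"] by (simp add: less_top)
    qed (use m(1) disj in auto)
    also have "\<dots> \<le> measure lborel (cball y h)"
    proof (rule measure_mono_fmeasurable)
      show "(\<Union>F\<in>?K. ?B F) \<subseteq> cball y h"
      proof (rule UN_least)
        fix F assume F: "F \<in> ?K"
        have "F ` interior ?R \<subseteq> F ` ?R" using interior_subset by (intro image_mono)
        then show "?B F \<subseteq> cball y h" using B[of F] cell_subset_cball[OF M, of F y] F by blast
      qed
      have "open (\<Union>F\<in>?K. ?B F)" by blast
      then show "(\<Union>F\<in>?K. ?B F) \<in> sets lborel" by (simp add: borel_open)
    qed (simp add: fmeasurable_compact compact_cball)
    also have "\<dots> = h ^ CARD('n) * ?\<omega>" using measure_ball[of h y] h by (simp add: content_cball_conv_ball)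
    finally have "(real (card ?K) * (c * \<rho>) ^ CARD('n)) * ?\<omega> \<le> h ^ CARD('n) * ?\<omega>" by (simp add: mult.assoc)
    then have "real (card ?K) * (c * \<rho>) ^ CARD('n) \<le> h ^ CARD('n)" using \<omega> by simp
    then show ?thesis using c z(1) by (simp add: power_divide pos_le_divide_eq)
  qed
  then show ?thesis using that z(1) by blast
qed

lemma nodes_eq: "nodes S M r = (\<Union>F\<in>M. (\<lambda>\<alpha>. F (lattice_point r \<alpha>)) ` exponents S r)"
  by (simp add: nodes_def ref_nodes_eq image_image)

lemma finite_nodes: "finite M \<Longrightarrow> finite (nodes S M r)"
  unfolding nodes_eq by (intro finite_UN_I finite_imageI finite_exponents)

lemma lattice_point_inj:
  assumes "r \<ge> 1"
  shows "inj (lattice_point r)"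
proof (rule injI)
  fix \<alpha> \<beta> :: "'a \<Rightarrow> nat" assume "lattice_point r \<alpha> = lattice_point r \<beta>"
  then have "lattice_point r \<alpha> $ i = lattice_point r \<beta> $ i" for i by simp
  then show "\<alpha> = \<beta>" using assms by (auto simp: fun_eq_iff)
qed

text \<open>In the cellwise sum a node occurs at most once for each cell that contains it, hence at
  most \<open>N\<close> times.\<close>

lemma sum_cell_nodes_le:
  fixes w :: "real ^ 'n \<Rightarrow> real"
  assumes r: "r \<ge> 1" and M: "uniform_mesh c h S \<Omega> M"
    and N: "\<And>y. real (card {F \<in> M. y \<in> F ` ref_cell S}) \<le> N"
  shows "(\<Sum>F\<in>M. \<Sum>\<alpha>\<in>exponents S r. (w (F (lattice_point r \<alpha>)))\<^sup>2) \<le> N * (\<Sum>q\<in>nodes S M r. (w q)\<^sup>2)"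
proof -
  let ?E = "exponents S r :: ('n \<Rightarrow> nat) set"
  note m = uniform_meshD[OF M]
  have fin: "finite (nodes S M r)" using m(1) by (rule finite_nodes)
  have cell: "(\<Sum>\<alpha>\<in>?E. (w (F (lattice_point r \<alpha>)))\<^sup>2) \<le> (\<Sum>q\<in>nodes S M r. if q \<in> F ` ref_cell S then (w q)\<^sup>2 else 0)" if F: "F \<in> M" for F
  proof -
    let ?f = "\<lambda>\<alpha>. F (lattice_point r \<alpha>)"
    have "inj_on F (ref_cell S)" using m(3)[OF F] by (simp add: is_cell_def)
    then have inj: "inj_on ?f ?E"
    proof (intro inj_onI)
      fix \<alpha> \<beta> :: "'n \<Rightarrow> nat" assume ab: "\<alpha> \<in> ?E" "\<beta> \<in> ?E" "?f \<alpha> = ?f \<beta>"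
      then have "lattice_point r \<alpha> = lattice_point r \<beta>"
        using inj_onD[OF \<open>inj_on F (ref_cell S)\<close> ab(3)] lattice_point_ref_cell[OF r] by blast
      then show "\<alpha> = \<beta>" by (rule injD[OF lattice_point_inj[OF r]])
    qed
    have "(\<Sum>\<alpha>\<in>?E. (w (?f \<alpha>))\<^sup>2) = (\<Sum>q\<in>?f ` ?E. (w q)\<^sup>2)" by (simp add: sum.reindex[OF inj])
    also have "\<dots> = (\<Sum>q\<in>?f ` ?E. if q \<in> F ` ref_cell S then (w q)\<^sup>2 else 0)"
      using lattice_point_ref_cell[OF r] by (intro sum.cong) auto
    also have "\<dots> \<le> (\<Sum>q\<in>nodes S M r. if q \<in> F ` ref_cell S then (w q)\<^sup>2 else 0)"
      using F fin by (intro sum_mono2) (auto simp: nodes_eq)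
    finally show ?thesis .
  qed
  have "(\<Sum>F\<in>M. \<Sum>\<alpha>\<in>?E. (w (F (lattice_point r \<alpha>)))\<^sup>2)
      \<le> (\<Sum>F\<in>M. \<Sum>q\<in>nodes S M r. if q \<in> F ` ref_cell S then (w q)\<^sup>2 else 0)"
    by (intro sum_mono cell)
  also have "\<dots> = (\<Sum>q\<in>nodes S M r. \<Sum>F\<in>M. if q \<in> F ` ref_cell S then (w q)\<^sup>2 else 0)" by (rule sum.swap)
  also have "\<dots> = (\<Sum>q\<in>nodes S M r. real (card {F \<in> M. q \<in> F ` ref_cell S}) * (w q)\<^sup>2)"
    using m(1) by (intro sum.cong refl) (simp add: sum.If_cases Int_def)
  also have "\<dots> \<le> (\<Sum>q\<in>nodes S M r. N * (w q)\<^sup>2)" by (intro sum_mono mult_right_mono N) auto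
  finally show ?thesis by (simp add: sum_distrib_left)
qed

text \<open>In the cellwise sum every node occurs at least once and all terms are
  nonnegative.\<close>

lemma sum_nodes_le_cells:
  fixes w :: "real ^ 'n \<Rightarrow> real"
  assumes "finite M"
  shows "(\<Sum>q\<in>nodes S M r. (w q)\<^sup>2) \<le> (\<Sum>F\<in>M. \<Sum>\<alpha>\<in>exponents S r. (w (F (lattice_point r \<alpha>)))\<^sup>2)"
  using assms unfolding nodes_eq
proof (induction M rule: finite_induct)
  case (insert F M)
  let ?E = "exponents S r :: ('n \<Rightarrow> nat) set"
  let ?A = "\<lambda>F. (\<lambda>\<alpha>. F (lattice_point r \<alpha>)) ` ?E"
  have fin: "finite (?A F)" "finite (\<Union>F\<in>M. ?A F)" for F
    using insert(1) by (auto intro: finite_exponents)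
  have "(\<Sum>q\<in>?A F \<union> (\<Union>F\<in>M. ?A F). (w q)\<^sup>2) \<le> (\<Sum>q\<in>?A F. (w q)\<^sup>2) + (\<Sum>q\<in>(\<Union>F\<in>M. ?A F). (w q)\<^sup>2)"
    using sum.union_inter[OF fin, of "\<lambda>q. (w q)\<^sup>2" F] sum_nonneg[of "?A F \<inter> (\<Union>F\<in>M. ?A F)" "\<lambda>q. (w q)\<^sup>2"] by simp
  moreover have "(\<Sum>q\<in>?A F. (w q)\<^sup>2) \<le> (\<Sum>\<alpha>\<in>?E. (w (F (lattice_point r \<alpha>)))\<^sup>2)"
    using sum_image_le[OF finite_exponents, of S r "\<lambda>q. (w q)\<^sup>2" "\<lambda>\<alpha>. F (lattice_point r \<alpha>)"] by (simp add: o_def)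
  ultimately show ?case using insert by simp
qed simp

text \<open>On each cell the gradient is bounded by \<open>1 / c\<close> times the nodal
  values, and the volume of a cell is at most \<open>h ^ d\<close>.\<close>

lemma fe_inverse_estimate:
  assumes r: "r \<ge> 1"
  obtains K where "K > 0"
    "\<And>c h (\<Omega> :: (real ^ 'n) set) M w. c > 0 \<Longrightarrow> h > 0 \<Longrightarrow> open \<Omega> \<Longrightarrow> bounded \<Omega> \<Longrightarrow> convex \<Omega> \<Longrightarrow>
       uniform_mesh c h S \<Omega> M \<Longrightarrow> w \<in> fe_space0 S \<Omega> M r \<Longrightarrow>
       (L2_norm \<Omega> (weak_grad \<Omega> w))\<^sup>2 \<le> K * (h / c) ^ CARD('n) * (h ^ CARD('n) / c\<^sup>2) * (\<Sum>q\<in>nodes S M r. (w q)\<^sup>2)"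
proof -
  let ?E = "exponents S r :: ('n \<Rightarrow> nat) set"
  let ?\<omega> = "measure lborel (ball (0 :: real ^ 'n) 1)"
  have \<omega>: "?\<omega> > 0" by (rule content_ball_pos) simp
  obtain \<rho> where \<rho>: "\<rho> > 0" "\<And>c h (\<Omega> :: (real ^ 'n) set) M y. c > 0 \<Longrightarrow> h > 0 \<Longrightarrow> uniform_mesh c h S \<Omega> M \<Longrightarrow>
       real (card {F \<in> M. y \<in> F ` ref_cell S}) \<le> (h / (c * \<rho>)) ^ CARD('n)"
    using mesh_overlap[where 'n='n and S=S] by blast
  obtain K0 :: real where K0: "K0 > 0" "\<And>(p :: real ^ 'n \<Rightarrow> real) m x. p \<in> ref_poly S r \<Longrightarrow>
      (\<And>\<alpha>. \<alpha> \<in> ?E \<Longrightarrow> \<bar>p (lattice_point r \<alpha>)\<bar> \<le> m) \<Longrightarrow> x \<in> ref_cell S \<Longrightarrow> norm (grad p x) \<le> K0 * m"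
    using ref_poly_bounds[OF r, where 'n='n and S=S] by blast
  \<comment> \<open>\<open>?\<omega>\<close> stems from the volume of a ball of radius
    \<open>h\<close>, the square of \<open>K0\<close> from the gradients on the reference cell, and
    \<open>\<rho>\<close> from the number of cells sharing a node.\<close>
  define K where "K = ?\<omega> * K0\<^sup>2 / \<rho> ^ CARD('n)"
  have "(L2_norm \<Omega> (weak_grad \<Omega> w))\<^sup>2 \<le> K * (h / c) ^ CARD('n) * (h ^ CARD('n) / c\<^sup>2) * (\<Sum>q\<in>nodes S M r. (w q)\<^sup>2)"
    if c: "c > 0" and h: "h > 0" and \<Omega>: "open \<Omega>" "bounded \<Omega>" "convex \<Omega>" and M: "uniform_mesh c h S \<Omega> M"
      and w: "w \<in> fe_space0 S \<Omega> M r" for c h and \<Omega> :: "(real ^ 'n) set" and M w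
  proof -
    note m = uniform_meshD[OF M]
    have wfe: "w \<in> fe_space S \<Omega> M r" using w by (simp add: fe_space0_def)
    let ?w = "\<lambda>x. if x \<in> \<Omega> then w x else 0"
    obtain D where D: "lipschitz_C1 \<Omega> ?w D"
      "\<And>F p x. F \<in> M \<Longrightarrow> p \<in> ref_poly S r \<Longrightarrow> (\<And>x. x \<in> ref_cell S \<Longrightarrow> w (F x) = p x) \<Longrightarrow>
         x \<in> interior (ref_cell S) \<Longrightarrow> c * norm (D (F x)) \<le> norm (grad p x)"
      "\<And>y. y \<in> \<Omega> \<Longrightarrow> y \<notin> (\<Union>F\<in>M. F ` interior (ref_cell S)) \<Longrightarrow> D y = 0"
      using fe_space0_lipschitz_C1[OF \<Omega> M w] by blast
    define s where "s = (\<lambda>F :: real ^ 'n \<Rightarrow> real ^ 'n. \<Sum>\<alpha>\<in>?E. (w (F (lattice_point r \<alpha>)))\<^sup>2)"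
    have s0: "s F \<ge> 0" for F unfolding s_def by (intro sum_nonneg) simp
    have Dbd: "(norm (D (F x)))\<^sup>2 \<le> (K0 / c)\<^sup>2 * s F" if F: "F \<in> M" and x: "x \<in> interior (ref_cell S)" for F x
    proof -
      obtain p where p: "p \<in> ref_poly S r" "\<And>x. x \<in> ref_cell S \<Longrightarrow> w (F x) = p x" using fe_spaceE[OF wfe F] by blast
      have "\<bar>p (lattice_point r \<alpha>)\<bar> \<le> sqrt (s F)" if \<alpha>: "\<alpha> \<in> ?E" for \<alpha>
      proof -
        have "(w (F (lattice_point r \<alpha>)))\<^sup>2 \<le> s F" unfolding s_def
          using \<alpha> by (intro member_le_sum[of \<alpha> ?E "\<lambda>\<alpha>. (w (F (lattice_point r \<alpha>)))\<^sup>2"] finite_exponents) auto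
        then show ?thesis using p(2)[OF lattice_point_ref_cell[OF r \<alpha>]] by (simp add: real_le_rsqrt)
      qed
      then have "norm (grad p x) \<le> K0 * sqrt (s F)" using K0(2)[OF p(1)] x interior_subset by blast
      then have "c * norm (D (F x)) \<le> K0 * sqrt (s F)" using D(2)[OF F p x] by linarith
      then have "norm (D (F x)) \<le> (K0 / c) * sqrt (s F)" using c by (simp add: field_simps)
      then have "(norm (D (F x)))\<^sup>2 \<le> ((K0 / c) * sqrt (s F))\<^sup>2" by (intro power_mono) auto
      also have "\<dots> = (K0 / c)\<^sup>2 * s F" using s0[of F] by (simp only: power_mult_distrib real_sqrt_pow2)
      finally show ?thesis .
    qed
    obtain x0 where x0: "x0 \<in> (ref_cell S :: (real ^ 'n) set)" using interior_ref_cell_nonempty[of S] interior_subset by blast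
    have "(L2_norm \<Omega> (weak_grad \<Omega> w))\<^sup>2 = (L2_norm \<Omega> D)\<^sup>2"
      using L2_norm_has_weak_grad[OF \<Omega>(1,2) has_weak_deriv_lipschitz_C1[OF \<Omega>(1,2) D(1)]]
        weak_grad_cong[of \<Omega> w ?w] by simp
    \<comment> \<open>Each cell is majorised by the ball of radius \<open>h\<close> about one of its
      points. The volume of a ball is known, so no integral over the curved cell has to be
      transformed.\<close>
    also have "\<dots> \<le> integral\<^sup>L (lebesgue_on \<Omega>) (\<lambda>y. \<Sum>F\<in>M. ((K0 / c)\<^sup>2 * s F) * indicator (cball (F x0) h) y)"
      unfolding L2_norm_power2
    proof (rule integral_mono)
      show "integrable (lebesgue_on \<Omega>) (\<lambda>y. (norm (D y))\<^sup>2)" using lipschitz_C1_L2(2)[OF \<Omega>(1,2) D(1)] by (rule L2_integrable_norm)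
      have "integrable (lebesgue_on \<Omega>) (\<lambda>y. indicator (cball (F x0) h) y :: real)" for F :: "real ^ 'n \<Rightarrow> real ^ 'n"
        using \<Omega> by (intro integrable_bounded[where B=1] lmeasurable_open measurable_restrict_space1 borel_measurable_indicator) (auto simp: indicator_def)
      then show "integrable (lebesgue_on \<Omega>) (\<lambda>y. \<Sum>F\<in>M. ((K0 / c)\<^sup>2 * s F) * indicator (cball (F x0) h) y)"
        by (intro Bochner_Integration.integrable_sum integrable_mult_right)
      fix y assume "y \<in> space (lebesgue_on \<Omega>)"
      then have y: "y \<in> \<Omega>" by simp
      have nn: "0 \<le> ((K0 / c)\<^sup>2 * s F) * indicator (cball (F x0) h) y" for F :: "real ^ 'n \<Rightarrow> real ^ 'n" using s0 by simp
      show "(norm (D y))\<^sup>2 \<le> (\<Sum>F\<in>M. ((K0 / c)\<^sup>2 * s F) * indicator (cball (F x0) h) y)"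
      proof (cases "y \<in> (\<Union>F\<in>M. F ` interior (ref_cell S))")
        case True
        then obtain F x where F: "F \<in> M" "x \<in> interior (ref_cell S)" "y = F x" by blast
        have "y \<in> cball (F x0) h" using cell_subset_cball[OF M F(1), of "F x0"] F x0 interior_subset by blast
        then have "(norm (D y))\<^sup>2 \<le> ((K0 / c)\<^sup>2 * s F) * indicator (cball (F x0) h) y" using Dbd[OF F(1,2)] F(3) by simp
        also have "\<dots> \<le> (\<Sum>F\<in>M. ((K0 / c)\<^sup>2 * s F) * indicator (cball (F x0) h) y)"
          by (intro member_le_sum[of F M "\<lambda>F. ((K0 / c)\<^sup>2 * s F) * indicator (cball (F x0) h) y"] F(1) nn m(1))
        finally show ?thesis .
      next
        case False
        then show ?thesis using D(3)[OF y] nn by (simp add: sum_nonneg)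
      qed
    qed
    also have "\<dots> = (\<Sum>F\<in>M. ((K0 / c)\<^sup>2 * s F) * integral\<^sup>L (lebesgue_on \<Omega>) (indicator (cball (F x0) h)))"
    proof -
      have "integrable (lebesgue_on \<Omega>) (\<lambda>y. indicator (cball (F x0) h) y :: real)" for F :: "real ^ 'n \<Rightarrow> real ^ 'n"
        using \<Omega> by (intro integrable_bounded[where B=1] lmeasurable_open measurable_restrict_space1 borel_measurable_indicator) (auto simp: indicator_def)
      then show ?thesis by (subst Bochner_Integration.integral_sum) auto
    qed
    also have "\<dots> \<le> (\<Sum>F\<in>M. ((K0 / c)\<^sup>2 * s F) * (h ^ CARD('n) * ?\<omega>))"
    proof (intro sum_mono mult_left_mono)
      fix F
      have "integral\<^sup>L (lebesgue_on \<Omega>) (indicator (cball (F x0) h)) = integral\<^sup>L lebesgue (\<lambda>y. indicator \<Omega> y *\<^sub>R (indicator (cball (F x0) h) y :: real))"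
        using \<Omega>(1) by (subst integral_restrict_space) auto
      also have "\<dots> = integral\<^sup>L lebesgue (indicator (\<Omega> \<inter> cball (F x0) h) :: _ \<Rightarrow> real)"
        by (simp add: indicator_inter_arith[symmetric])
      also have "\<dots> = measure lebesgue (\<Omega> \<inter> cball (F x0) h)" by simp
      also have "\<dots> \<le> measure lebesgue (cball (F x0) h)" using \<Omega>(1) by (intro measure_mono_fmeasurable) auto
      also have "\<dots> = h ^ CARD('n) * ?\<omega>" using measure_ball[of h "F x0"] h by (simp add: content_cball_conv_ball measure_completion)
      finally show "integral\<^sup>L (lebesgue_on \<Omega>) (indicator (cball (F x0) h)) \<le> h ^ CARD('n) * ?\<omega>" .
    qed (use s0 in simp)
    also have "\<dots> = ((K0 / c)\<^sup>2 * (h ^ CARD('n) * ?\<omega>)) * (\<Sum>F\<in>M. s F)"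
      unfolding sum_distrib_left by (intro sum.cong refl) (simp add: mult_ac)
    also have "\<dots> \<le> ((K0 / c)\<^sup>2 * (h ^ CARD('n) * ?\<omega>)) * ((h / (c * \<rho>)) ^ CARD('n) * (\<Sum>q\<in>nodes S M r. (w q)\<^sup>2))"
      unfolding s_def using h \<omega> by (intro mult_left_mono sum_cell_nodes_le[OF r M] \<rho>(2)[OF c h M]) auto
    also have "\<dots> = K * (h / c) ^ CARD('n) * (h ^ CARD('n) / c\<^sup>2) * (\<Sum>q\<in>nodes S M r. (w q)\<^sup>2)"
      by (simp add: K_def power_divide power_mult_distrib mult_ac)
    finally show ?thesis .
  qed
  moreover have "K > 0" unfolding K_def using \<omega> K0(1) \<rho>(1) by simp
  ultimately show ?thesis using that by blast
qed

text \<open>The converse direction: each cell contains a ball of radius \<open>c * \<theta>\<close>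
  on which the function is at least half as large as its nodal values on that cell. These balls are
  disjoint, so the integrals over them add up to at most the whole integral.\<close>

lemma fe_nodal_estimate:
  assumes r: "r \<ge> 1"
  obtains K where "K > 0"
    "\<And>c h (\<Omega> :: (real ^ 'n) set) M v. c > 0 \<Longrightarrow> open \<Omega> \<Longrightarrow> bounded \<Omega> \<Longrightarrow> convex \<Omega> \<Longrightarrow>
       uniform_mesh c h S \<Omega> M \<Longrightarrow> v \<in> fe_space S \<Omega> M r \<Longrightarrow>
       (\<Sum>q\<in>nodes S M r. (v q)\<^sup>2) \<le> K / c ^ CARD('n) * (L2_norm \<Omega> v)\<^sup>2"
proof -
  let ?E = "exponents S r :: ('n \<Rightarrow> nat) set"
  let ?\<omega> = "measure lborel (ball (0 :: real ^ 'n) 1)"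
  have \<omega>: "?\<omega> > 0" by (rule content_ball_pos) simp
  obtain \<theta> :: real where \<theta>: "\<theta> > 0"
    "\<And>p :: real ^ 'n \<Rightarrow> real. p \<in> ref_poly S r \<Longrightarrow> \<exists>z. ball z \<theta> \<subseteq> interior (ref_cell S) \<and>
       (\<forall>x\<in>ball z \<theta>. \<forall>\<alpha>\<in>?E. \<bar>p (lattice_point r \<alpha>)\<bar> \<le> 2 * \<bar>p x\<bar>)"
    using ref_poly_lower[OF r, where 'n='n and S=S] by blast
  define e where "e = real (card ?E)"
  have "(\<lambda>i. 0) \<in> ?E" by (cases S) auto
  then have e: "e > 0" unfolding e_def using finite_exponents[of S r] by (auto simp: card_gt_0_iff)
  \<comment> \<open>\<open>4\<close> is the square of the factor \<open>2\<close> in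
    \<open>ref_poly_lower\<close>, and \<open>e\<close> the number of nodes per cell.\<close>
  define K where "K = 4 * e / (\<theta> ^ CARD('n) * ?\<omega>)"
  have est: "(\<Sum>q\<in>nodes S M r. (v q)\<^sup>2) \<le> K / c ^ CARD('n) * (L2_norm \<Omega> v)\<^sup>2"
    if c: "c > 0" and \<Omega>: "open \<Omega>" "bounded \<Omega>" "convex \<Omega>" and M: "uniform_mesh c h S \<Omega> M"
      and v: "v \<in> fe_space S \<Omega> M r" for c h and \<Omega> :: "(real ^ 'n) set" and M v
  proof -
    note m = uniform_meshD[OF M]
    define s where "s = (\<lambda>F :: real ^ 'n \<Rightarrow> real ^ 'n. \<Sum>\<alpha>\<in>?E. (v (F (lattice_point r \<alpha>)))\<^sup>2)"
    have "\<exists>z. ball (F z) (c * \<theta>) \<subseteq> F ` interior (ref_cell S) \<and> (\<forall>y\<in>ball (F z) (c * \<theta>). s F \<le> 4 * e * (v y)\<^sup>2)"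
      if F: "F \<in> M" for F
    proof -
      obtain p where p: "p \<in> ref_poly S r" "\<And>x. x \<in> ref_cell S \<Longrightarrow> v (F x) = p x" using fe_spaceE[OF v F] by blast
      obtain z where z: "ball z \<theta> \<subseteq> interior (ref_cell S)"
        "\<And>x \<alpha>. x \<in> ball z \<theta> \<Longrightarrow> \<alpha> \<in> ?E \<Longrightarrow> \<bar>p (lattice_point r \<alpha>)\<bar> \<le> 2 * \<bar>p x\<bar>" using \<theta>(2)[OF p(1)] by blast
      have zR: "ball z \<theta> \<subseteq> ref_cell S" using z(1) interior_subset by blast
      have sub: "ball (F z) (c * \<theta>) \<subseteq> F ` ball z \<theta>" by (rule cell_contains_ball[OF m(4)[OF F] zR \<theta>(1)])
      have "s F \<le> 4 * e * (v y)\<^sup>2" if y: "y \<in> ball (F z) (c * \<theta>)" for y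
      proof -
        obtain x where x: "x \<in> ball z \<theta>" "y = F x" using sub y by blast
        have "(v (F (lattice_point r \<alpha>)))\<^sup>2 \<le> 4 * (v y)\<^sup>2" if \<alpha>: "\<alpha> \<in> ?E" for \<alpha>
        proof -
          have "\<bar>v (F (lattice_point r \<alpha>))\<bar> \<le> \<bar>2 * v y\<bar>"
            using z(2)[OF x(1) \<alpha>] p(2)[OF lattice_point_ref_cell[OF r \<alpha>]] p(2)[of x] x zR by (auto simp: abs_mult)
          then have "(v (F (lattice_point r \<alpha>)))\<^sup>2 \<le> (2 * v y)\<^sup>2" by (simp only: abs_le_square_iff)
          then show ?thesis by (simp add: power_mult_distrib)
        qed
        then have "s F \<le> (\<Sum>\<alpha>\<in>?E. 4 * (v y)\<^sup>2)" unfolding s_def by (intro sum_mono)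
        then show ?thesis by (simp add: e_def mult_ac)
      qed
      then show ?thesis using sub z(1) by blast
    qed
    then obtain z where z: "\<And>F. F \<in> M \<Longrightarrow> ball (F (z F)) (c * \<theta>) \<subseteq> F ` interior (ref_cell S)"
      "\<And>F y. F \<in> M \<Longrightarrow> y \<in> ball (F (z F)) (c * \<theta>) \<Longrightarrow> s F \<le> 4 * e * (v y)\<^sup>2" by metis
    let ?B = "\<lambda>F. ball (F (z F)) (c * \<theta>)"
    have cont: "continuous_on (closure \<Omega>) v" using v by (simp add: fe_space_def)
    have vL: "v \<in> L2 \<Omega>" by (rule L2_continuous[OF \<Omega>(1,2) cont])
    have int: "integrable (lebesgue_on \<Omega>) (\<lambda>y. indicator (?B F) y :: real)" for F
      using \<Omega> by (intro integrable_bounded[where B=1] lmeasurable_open measurable_restrict_space1 borel_measurable_indicator) (auto simp: indicator_def)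
    have measB: "integral\<^sup>L (lebesgue_on \<Omega>) (indicator (?B F)) = (c * \<theta>) ^ CARD('n) * ?\<omega>" if F: "F \<in> M" for F
    proof -
      have "?B F \<subseteq> \<Omega>" using z(1)[OF F] cell_interior_subset[OF \<Omega>(1,3) M F] by blast
      then have eq: "(\<lambda>y. indicator \<Omega> y *\<^sub>R (indicator (?B F) y :: real)) = indicator (?B F)"
        by (auto simp: fun_eq_iff indicator_def)
      have "integral\<^sup>L (lebesgue_on \<Omega>) (indicator (?B F)) = integral\<^sup>L lebesgue (\<lambda>y. indicator \<Omega> y *\<^sub>R (indicator (?B F) y :: real))"
        using \<Omega>(1) by (subst integral_restrict_space) auto
      also have "\<dots> = measure lebesgue (?B F)" unfolding eq by simp
      also have "\<dots> = (c * \<theta>) ^ CARD('n) * ?\<omega>" using measure_ball[of "c * \<theta>" "F (z F)"] c \<theta>(1) by (simp add: measure_completion)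
      finally show ?thesis .
    qed
    have "(\<Sum>F\<in>M. s F) * ((c * \<theta>) ^ CARD('n) * ?\<omega>) = (\<Sum>F\<in>M. s F * integral\<^sup>L (lebesgue_on \<Omega>) (indicator (?B F)))"
      unfolding sum_distrib_right by (intro sum.cong refl) (simp only: measB)
    also have "\<dots> = integral\<^sup>L (lebesgue_on \<Omega>) (\<lambda>y. \<Sum>F\<in>M. s F * indicator (?B F) y)"
      using int by (subst Bochner_Integration.integral_sum) auto
    also have "\<dots> \<le> integral\<^sup>L (lebesgue_on \<Omega>) (\<lambda>y. 4 * e * (norm (v y))\<^sup>2)"
    proof (rule integral_mono)
      show "integrable (lebesgue_on \<Omega>) (\<lambda>y. \<Sum>F\<in>M. s F * indicator (?B F) y)"
        by (intro Bochner_Integration.integrable_sum integrable_mult_right int)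
      show "integrable (lebesgue_on \<Omega>) (\<lambda>y. 4 * e * (norm (v y))\<^sup>2)"
        by (intro integrable_mult_right L2_integrable_norm vL)
      fix y
      show "(\<Sum>F\<in>M. s F * indicator (?B F) y) \<le> 4 * e * (norm (v y))\<^sup>2"
      proof (cases "\<exists>F\<in>M. y \<in> ?B F")
        case True
        then obtain F where F: "F \<in> M" "y \<in> ?B F" by blast
        \<comment> \<open>Interiors of different cells are disjoint, so at most one indicator in the
          sum is nonzero at \<open>y\<close>.\<close>
        have "y \<notin> ?B G" if G: "G \<in> M" "G \<noteq> F" for G
        proof
          assume "y \<in> ?B G"
          then have "y \<in> G ` interior (ref_cell S)" "y \<in> F ` ref_cell S"
            using z(1)[OF G(1)] z(1)[OF F(1)] F(2) interior_subset[of "ref_cell S"] by blast+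
          then show False using cell_interiors_disjoint[OF M G(1) F(1) G(2)] by blast
        qed
        then have "(\<Sum>G\<in>M - {F}. s G * indicator (?B G) y) = 0" by (intro sum.neutral) auto
        then have "(\<Sum>G\<in>M. s G * indicator (?B G) y) = s F" using sum.remove[OF m(1) F(1), of "\<lambda>G. s G * indicator (?B G) y"] F(2) by simp
        then show ?thesis using z(2)[OF F] by simp
      next
        case False
        then have "(\<Sum>G\<in>M. s G * indicator (?B G) y) = 0" by (intro sum.neutral) auto
        then show ?thesis using e by simp
      qed
    qed
    also have "\<dots> = 4 * e * (L2_norm \<Omega> v)\<^sup>2" by (simp add: L2_norm_power2)
    finally have "(\<Sum>F\<in>M. s F) \<le> 4 * e * (L2_norm \<Omega> v)\<^sup>2 / ((c * \<theta>) ^ CARD('n) * ?\<omega>)"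
      using c \<theta>(1) \<omega> by (simp add: pos_le_divide_eq)
    also have "\<dots> = K / c ^ CARD('n) * (L2_norm \<Omega> v)\<^sup>2" by (simp add: K_def power_mult_distrib mult_ac)
    finally show ?thesis using sum_nodes_le_cells[OF m(1), where S=S and r=r and w=v] by (simp add: s_def)
  qed
  have "K > 0" unfolding K_def using \<omega> e \<theta>(1) by simp
  then show ?thesis by (rule that) (rule est; assumption)
qed

section \<open>Refinement\<close>

text \<open>What the estimates need from repeated uniform refinement, in a form that composes: fine
  reference maps factor through coarse ones by self-maps of the reference cell under which the
  reference polynomials are invariant. Polynomials live on the reference cell, so inclusion of the
  cells alone would not suffice.\<close>

definition mesh_refines :: "shape \<Rightarrow> (real ^ 'n \<Rightarrow> real ^ 'n) set \<Rightarrow> (real ^ 'n \<Rightarrow> real ^ 'n) set \<Rightarrow> bool" where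
  "mesh_refines S M M' \<longleftrightarrow> (\<forall>G\<in>M'. \<exists>F\<in>M. \<exists>A. G = F \<circ> A \<and> A ` ref_cell S \<subseteq> ref_cell S \<and>
     (\<forall>r. \<forall>p\<in>ref_poly S r. (\<lambda>x. p (A x)) \<in> ref_poly S r))"

lemma mesh_refinesE:
  assumes M: "mesh_refines S M M'" and G: "G \<in> M'"
  obtains F A where "F \<in> M" "G = F \<circ> A" "A ` ref_cell S \<subseteq> ref_cell S"
    "\<forall>r. \<forall>p\<in>ref_poly S r. (\<lambda>x. p (A x)) \<in> ref_poly S r"
proof -
  have "\<exists>F\<in>M. \<exists>A. G = F \<circ> A \<and> A ` ref_cell S \<subseteq> ref_cell S \<and>
      (\<forall>r. \<forall>p\<in>ref_poly S r. (\<lambda>x. p (A x)) \<in> ref_poly S r)"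
    using M[unfolded mesh_refines_def] G by (rule bspec)
  then show ?thesis
  proof (elim bexE exE conjE)
    fix F A assume F: "F \<in> M" "G = F \<circ> A" "A ` ref_cell S \<subseteq> ref_cell S"
      and p: "\<forall>r. \<forall>p\<in>ref_poly S r. (\<lambda>x. p (A x)) \<in> ref_poly S r"
    show ?thesis by (rule that[OF F p])
  qed
qed

lemma uniform_subdivision_cell:
  fixes R :: "(real ^ 'n \<Rightarrow> real ^ 'n) set"
  assumes R: "uniform_subdivision S R" and A: "A \<in> R"
  shows "A ` ref_cell S \<subseteq> ref_cell S" and "p \<in> ref_poly S r \<Longrightarrow> (\<lambda>x. p (A x)) \<in> ref_poly S r"
proof -
  have "A ` ref_cell S \<subseteq> ref_cell S \<and> (\<forall>p\<in>ref_poly S r. (\<lambda>x. p (A x)) \<in> ref_poly S r)"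
  proof (cases S)
    case Cubical
    then obtain v where v: "v \<in> ref_vertices Cubical" "A = midpoint v" using R A by auto
    have vR: "v \<in> ref_cell Cubical" using v(1) by (simp add: ref_vertices_def extreme_point_of_def del: ref_cell.simps)
    have "midpoint v x \<in> ref_cell Cubical" if "x \<in> ref_cell Cubical" for x
    proof -
      have "(1 - 1/2) *\<^sub>R v + (1/2) *\<^sub>R x \<in> ref_cell Cubical" by (intro convexD_alt convex_ref_cell vR that) auto
      then show ?thesis by (simp add: midpoint_def scaleR_add_right del: ref_cell.simps)
    qed
    moreover have "A x $ i = v $ i / 2 + 1 / 2 * x $ i" for x i by (simp add: v(2) midpoint_def)
    then have "(\<lambda>x. p (A x)) \<in> ref_poly Cubical r" if "p \<in> ref_poly Cubical r" for p
      by (rule ref_poly_cubical_compose[OF that])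
    ultimately show ?thesis unfolding Cubical v(2) by blast
  next
    case Simplicial
    have mesh: "is_mesh Simplicial (interior (ref_cell Simplicial)) R" using R Simplicial by (simp del: ref_cell.simps)
    have "closure (interior (ref_cell Simplicial)) = (ref_cell Simplicial :: (real ^ 'n) set)"
      using convex_closure_interior[OF convex_ref_cell interior_ref_cell_nonempty] compact_imp_closed[OF compact_ref_cell]
      by (metis closure_closed)
    then have "A ` ref_cell Simplicial \<subseteq> ref_cell Simplicial" using mesh A unfolding is_mesh_def by blast
    moreover have "is_cell Simplicial A" using mesh A by (simp add: is_mesh_def del: ref_cell.simps)
    then have "(\<lambda>x. A x $ i) \<in> ref_poly Simplicial 1" for i by (simp add: is_cell_def)
    then have "(\<lambda>x. p (A x)) \<in> ref_poly Simplicial r" if "p \<in> ref_poly Simplicial r" for p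
      by (rule ref_poly_simplicial_compose[OF that])
    ultimately show ?thesis unfolding Simplicial by blast
  qed
  then show "A ` ref_cell S \<subseteq> ref_cell S" "p \<in> ref_poly S r \<Longrightarrow> (\<lambda>x. p (A x)) \<in> ref_poly S r" by blast+
qed

lemma mesh_refines_rtranclp:
  assumes "(uniform_refinement S)\<^sup>*\<^sup>* M M'"
  shows "mesh_refines S M M'"
  using assms
proof (induction rule: rtranclp_induct)
  case base
  show ?case unfolding mesh_refines_def
  proof
    fix G assume "G \<in> M"
    then show "\<exists>F\<in>M. \<exists>A. G = F \<circ> A \<and> A ` ref_cell S \<subseteq> ref_cell S \<and> (\<forall>r. \<forall>p\<in>ref_poly S r. (\<lambda>x. p (A x)) \<in> ref_poly S r)"
      by (intro bexI[of _ G] exI[of _ id]) auto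
  qed
next
  case (step M1 M2)
  show ?case unfolding mesh_refines_def
  proof
    fix G assume "G \<in> M2"
    obtain R0 where R0: "\<forall>F\<in>M1. uniform_subdivision S (R0 F)" "M2 = (\<Union>F\<in>M1. (\<lambda>A. F \<circ> A) ` R0 F)"
      using step(2) unfolding uniform_refinement_def by (elim exE conjE)
    obtain F1 A1 where F1: "F1 \<in> M1" "A1 \<in> R0 F1" "G = F1 \<circ> A1"
      using \<open>G \<in> M2\<close> unfolding R0(2) by blast
    have R: "uniform_subdivision S (R0 F1)" using R0(1) F1(1) by blast
    obtain F A where F: "F \<in> M" "F1 = F \<circ> A" "A ` ref_cell S \<subseteq> ref_cell S"
      "\<forall>r. \<forall>p\<in>ref_poly S r. (\<lambda>x. p (A x)) \<in> ref_poly S r"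
      by (rule mesh_refinesE[OF step(3) F1(1)])
    note A1 = uniform_subdivision_cell[OF R F1(2)]
    have "(A \<circ> A1) ` ref_cell S \<subseteq> ref_cell S" using F(3) A1(1) by auto
    moreover have "(\<lambda>x. p ((A \<circ> A1) x)) \<in> ref_poly S r" if "p \<in> ref_poly S r" for p r
      using A1(2)[OF F(4)[rule_format, OF that]] by simp
    moreover have "G = F \<circ> (A \<circ> A1)" using F1(3) F(2) by (simp add: comp_assoc)
    ultimately show "\<exists>F\<in>M. \<exists>A. G = F \<circ> A \<and> A ` ref_cell S \<subseteq> ref_cell S \<and> (\<forall>r. \<forall>p\<in>ref_poly S r. (\<lambda>x. p (A x)) \<in> ref_poly S r)"
      using F(1) by blast
  qed
qed

text \<open>Nestedness of the spaces: coarse functions are finite element functions on the fine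
  mesh, so that they may be added to fine ones and read off at fine nodes.\<close>

lemma mesh_refines_fe_space0:
  assumes M: "mesh_refines S M M'" and v: "v \<in> fe_space0 S \<Omega> M r"
  shows "v \<in> fe_space0 S \<Omega> M' r"
proof -
  have "\<exists>p\<in>ref_poly S r. \<forall>x\<in>ref_cell S. v (G x) = p x" if G: "G \<in> M'" for G
  proof -
    obtain F A where F: "F \<in> M" "G = F \<circ> A" "A ` ref_cell S \<subseteq> ref_cell S"
      "\<forall>r. \<forall>p\<in>ref_poly S r. (\<lambda>x. p (A x)) \<in> ref_poly S r"
      by (rule mesh_refinesE[OF M G])
    obtain p where p: "p \<in> ref_poly S r" "\<forall>x\<in>ref_cell S. v (F x) = p x"
      using v F(1) unfolding fe_space0_def fe_space_def by blast
    then have "\<forall>x\<in>ref_cell S. v (G x) = p (A x)" using F(2,3) by auto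
    then show ?thesis using F(4)[rule_format, OF p(1)] by (intro bexI[of _ "\<lambda>x. p (A x)"])
  qed
  then show ?thesis using v unfolding fe_space0_def fe_space_def by blast
qed

lemma mesh_nonempty:
  assumes "is_mesh S \<Omega> M" "\<Omega> \<noteq> {}"
  shows "M \<noteq> {}"
proof
  assume "M = {}"
  then have "closure \<Omega> = {}" using assms(1) by (auto simp: is_mesh_def)
  then show False using assms(2) by (simp add: closure_eq_empty)
qed

lemma mesh_refines_mesh_size:
  assumes M: "mesh_refines S M M'" and mesh: "is_mesh S \<Omega> M" "is_mesh S \<Omega> M'" and ne: "\<Omega> \<noteq> {}"
  shows "mesh_size S M' \<le> mesh_size S M"
proof -
  have fin: "finite M" "finite M'" using mesh by (auto simp: is_mesh_def)
  have "M' \<noteq> {}" by (rule mesh_nonempty[OF mesh(2) ne])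
  have "cell_diam S G \<le> mesh_size S M" if G: "G \<in> M'" for G
  proof -
    obtain F A where F: "F \<in> M" "G = F \<circ> A" "A ` ref_cell S \<subseteq> ref_cell S"
      "\<forall>r. \<forall>p\<in>ref_poly S r. (\<lambda>x. p (A x)) \<in> ref_poly S r"
      by (rule mesh_refinesE[OF M G])
    have cell: "is_cell S F" using mesh(1) F(1) by (simp add: is_mesh_def)
    have "G ` ref_cell S \<subseteq> F ` ref_cell S" using F(2,3) by auto
    then have "cell_diam S G \<le> cell_diam S F" unfolding cell_diam_def
      by (intro diameter_subset compact_imp_bounded compact_continuous_image cell_continuous[OF cell] compact_ref_cell)
    also have "\<dots> \<le> mesh_size S M" unfolding mesh_size_def using fin F(1) by (intro Max_ge) auto
    finally show ?thesis .
  qed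
  then show ?thesis unfolding mesh_size_def[of S M'] using fin \<open>M' \<noteq> {}\<close> by (subst Max_le_iff) auto
qed

text \<open>Shape regularity gives the stretching \<open>cell_diam S F / \<kappa>\<close>, and
  quasi-uniformity replaces the diameter of a cell by \<open>mesh_size S M / q\<close>; this is the
  origin of the constant \<open>q * \<kappa>\<close>.\<close>

lemma mesh_uniform:
  fixes M :: "(real ^ 'n \<Rightarrow> real ^ 'n) set"
  assumes mesh: "is_mesh S \<Omega> M" and sr: "shape_regular \<kappa> S M" and qu: "quasi_uniform q S M" and ne: "\<Omega> \<noteq> {}"
  shows "mesh_size S M > 0" and "q * \<kappa> > 0" and "uniform_mesh (mesh_size S M / (q * \<kappa>)) (mesh_size S M) S \<Omega> M"
proof -
  let ?R = "ref_cell S :: (real ^ 'n) set" and ?h = "mesh_size S M"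
  have fin: "finite M" using mesh by (simp add: is_mesh_def)
  have "M \<noteq> {}" by (rule mesh_nonempty[OF mesh ne])
  then obtain F0 where F0: "F0 \<in> M" by blast
  obtain z e where z: "e > 0" "ball z e \<subseteq> ?R"
    using interior_ref_cell_nonempty[of S] by (auto simp: mem_interior ex_in_conv[symmetric])
  have zR: "z \<in> ?R" using z centre_in_ball[of z e] by blast
  let ?a = "axis undefined 1 :: real ^ 'n"
  have na: "norm ?a = 1" by simp
  have diam: "cell_diam S F > 0" if F: "F \<in> M" for F
  proof -
    have cell: "is_cell S F" using mesh F by (simp add: is_mesh_def)
    let ?y = "z + (e / 2) *\<^sub>R ?a"
    have yR: "?y \<in> ?R" using z na by (intro subsetD[OF z(2)]) (simp add: dist_norm)
    have "?y \<noteq> z" using z(1) na by (metis add_cancel_right_right divide_eq_0_iff less_irrefl norm_zero scaleR_eq_0_iff zero_neq_numeral zero_neq_one)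
    then have "F ?y \<noteq> F z" using cell yR zR by (auto simp: is_cell_def dest: inj_onD)
    then have "0 < dist (F ?y) (F z)" by simp
    also have "\<dots> \<le> cell_diam S F" unfolding cell_diam_def using yR zR
      by (intro diameter_bounded_bound compact_imp_bounded compact_continuous_image cell_continuous[OF cell] compact_ref_cell) auto
    finally show ?thesis .
  qed
  have le: "cell_diam S F \<le> ?h" if "F \<in> M" for F unfolding mesh_size_def using fin that by (intro Max_ge) auto
  show h: "?h > 0" using diam[OF F0] le[OF F0] by linarith
  have low: "norm v \<le> \<kappa> / cell_diam S F * norm (cell_deriv F x v)" if "F \<in> M" "x \<in> ?R" for F x v
  proof -
    have "is_cell S F" using mesh that(1) by (simp add: is_mesh_def)
    then show ?thesis using sr that unfolding shape_regular_def by (metis cell_deriv_eq)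
  qed
  \<comment> \<open>The signs of \<open>\<kappa>\<close> and \<open>q\<close> are forced by the
    existence of one nondegenerate cell.\<close>
  have \<kappa>: "\<kappa> > 0"
  proof (rule ccontr)
    assume "\<not> \<kappa> > 0"
    then have "\<kappa> / cell_diam S F0 \<le> 0" using diam[OF F0] by (simp add: divide_le_0_iff)
    then have "\<kappa> / cell_diam S F0 * norm (cell_deriv F0 z ?a) \<le> 0" by (intro mult_nonpos_nonneg) auto
    then show False using low[OF F0 zR, of ?a] na by linarith
  qed
  have q: "q > 0"
  proof (rule ccontr)
    assume "\<not> q > 0"
    then have "q * cell_diam S F0 \<le> 0" using diam[OF F0] by (intro mult_nonpos_nonneg) auto
    then show False using qu F0 h unfolding quasi_uniform_def by force
  qed
  show qk: "q * \<kappa> > 0" using q \<kappa> by simp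
  have "expanding_cell (?h / (q * \<kappa>)) S F" if F: "F \<in> M" for F
    unfolding expanding_cell_def
  proof (intro conjI ballI allI)
    show "is_cell S F" using mesh F by (simp add: is_mesh_def)
    show "0 < ?h / (q * \<kappa>)" using h qk by simp
    fix x v :: "real ^ 'n" assume x: "x \<in> ?R"
    have "?h \<le> q * cell_diam S F" using qu F by (simp add: quasi_uniform_def)
    then have "?h / (q * \<kappa>) \<le> cell_diam S F / \<kappa>" using q \<kappa> by (simp add: field_simps)
    then have "?h / (q * \<kappa>) * norm v \<le> cell_diam S F / \<kappa> * norm v" by (intro mult_right_mono) auto
    also have "\<dots> \<le> cell_diam S F / \<kappa> * (\<kappa> / cell_diam S F * norm (cell_deriv F x v))"
      using low[OF F x, of v] diam[OF F] \<kappa> by (intro mult_left_mono) auto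
    also have "\<dots> = norm (cell_deriv F x v)" using diam[OF F] \<kappa> by simp
    finally show "?h / (q * \<kappa>) * norm v \<le> norm (cell_deriv F x v)" .
  qed
  then show "uniform_mesh (?h / (q * \<kappa>)) ?h S \<Omega> M" using mesh le by (simp add: uniform_mesh_def)
qed

section \<open>Galerkin solutions and the network correction\<close>

lemma fe_space_diff:
  assumes "v \<in> fe_space S \<Omega> M r" "w \<in> fe_space S \<Omega> M r"
  shows "(\<lambda>x. v x - w x) \<in> fe_space S \<Omega> M r"
proof -
  have "\<exists>p\<in>ref_poly S r. \<forall>x\<in>ref_cell S. v (F x) - w (F x) = p x" if F: "F \<in> M" for F
  proof -
    obtain p q where "p \<in> ref_poly S r" "q \<in> ref_poly S r"
      "\<And>x. x \<in> ref_cell S \<Longrightarrow> v (F x) = p x" "\<And>x. x \<in> ref_cell S \<Longrightarrow> w (F x) = q x"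
      using fe_spaceE[OF assms(1) F] fe_spaceE[OF assms(2) F] by metis
    then show ?thesis by (intro bexI[of _ "\<lambda>x. p x - q x"] ref_poly_diff) auto
  qed
  then show ?thesis using assms by (auto simp: fe_space_def intro!: continuous_on_diff)
qed

lemma fe_space0_diff:
  "v \<in> fe_space0 S \<Omega> M r \<Longrightarrow> w \<in> fe_space0 S \<Omega> M r \<Longrightarrow> (\<lambda>x. v x - w x) \<in> fe_space0 S \<Omega> M r"
  using fe_space_diff unfolding fe_space0_def by fastforce

lemma fe_space0_zero: "(\<lambda>x. 0) \<in> fe_space0 S \<Omega> M r"
  using ref_poly_const[of 0 S r] by (auto simp: fe_space0_def fe_space_def)

lemma fe_space0_cmult:
  assumes "v \<in> fe_space0 S \<Omega> M r"
  shows "(\<lambda>x. c * v x) \<in> fe_space0 S \<Omega> M r"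
proof -
  have v: "v \<in> fe_space S \<Omega> M r" using assms by (simp add: fe_space0_def)
  have "\<exists>p\<in>ref_poly S r. \<forall>x\<in>ref_cell S. c * v (F x) = p x" if F: "F \<in> M" for F
  proof -
    obtain p where "p \<in> ref_poly S r" "\<And>x. x \<in> ref_cell S \<Longrightarrow> v (F x) = p x"
      using fe_spaceE[OF v F] by metis
    then show ?thesis by (intro bexI[of _ "\<lambda>x. c * p x"] ref_poly_cmult) auto
  qed
  then show ?thesis using assms by (auto simp: fe_space0_def fe_space_def intro!: continuous_on_mult)
qed

lemma fe_space0_add:
  assumes "v \<in> fe_space0 S \<Omega> M r" "w \<in> fe_space0 S \<Omega> M r"
  shows "(\<lambda>x. v x + w x) \<in> fe_space0 S \<Omega> M r"
  using fe_space0_diff[OF assms(1) fe_space0_cmult[OF assms(2), of "-1"]] by simp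

lemma fe_space0_sum:
  assumes "finite A" "\<And>j. j \<in> A \<Longrightarrow> f j \<in> fe_space0 S \<Omega> M r"
  shows "(\<lambda>x. \<Sum>j\<in>A. f j x) \<in> fe_space0 S \<Omega> M r"
  using assms by (induction A rule: finite_induct) (auto intro: fe_space0_add fe_space0_zero)

lemma H10_sobolev_1: "u \<in> H10 \<Omega> \<Longrightarrow> u \<in> sobolev 1 \<Omega>"
  using H10_has_weak_grad sobolev_1_iff by blast

lemma sobolev_1_add:
  assumes \<Omega>: "open \<Omega>" "bounded \<Omega>" and u: "u \<in> sobolev 1 \<Omega>" and v: "v \<in> sobolev 1 \<Omega>"
  shows "(\<lambda>x. u x + v x) \<in> sobolev 1 \<Omega>"
    and "L2_norm \<Omega> (weak_grad \<Omega> (\<lambda>x. u x + v x)) \<le> L2_norm \<Omega> (weak_grad \<Omega> u) + L2_norm \<Omega> (weak_grad \<Omega> v)"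
proof -
  obtain D E where D: "u \<in> L2 \<Omega>" "has_weak_grad \<Omega> u D" and E: "v \<in> L2 \<Omega>" "has_weak_grad \<Omega> v E"
    using u v unfolding sobolev_1_iff by blast
  have sum: "has_weak_grad \<Omega> (\<lambda>x. u x + v x) (\<lambda>x. D x + E x)"
    by (intro has_weak_grad_add \<Omega> D E)
  then show "(\<lambda>x. u x + v x) \<in> sobolev 1 \<Omega>" unfolding sobolev_1_iff using L2_add[OF D(1) E(1)] by blast
  show "L2_norm \<Omega> (weak_grad \<Omega> (\<lambda>x. u x + v x)) \<le> L2_norm \<Omega> (weak_grad \<Omega> u) + L2_norm \<Omega> (weak_grad \<Omega> v)"
    using L2_norm_triangle[OF has_weak_grad_L2[OF D(2)] has_weak_grad_L2[OF E(2)]]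
    by (simp add: L2_norm_has_weak_grad[OF \<Omega> sum] L2_norm_has_weak_grad[OF \<Omega> D(2)] L2_norm_has_weak_grad[OF \<Omega> E(2)])
qed

lemma sobolev_1_diff:
  assumes \<Omega>: "open \<Omega>" "bounded \<Omega>" and u: "u \<in> sobolev 1 \<Omega>" and v: "v \<in> sobolev 1 \<Omega>"
  shows "(\<lambda>x. u x - v x) \<in> sobolev 1 \<Omega>"
  using u v has_weak_grad_diff[OF \<Omega>, of u v] L2_diff[of u \<Omega> v] unfolding sobolev_1_iff by blast

text \<open>The difference of the solutions is an admissible test function. The energy identity and
  the dual norm bound yield its squared norm, from which one factor is cancelled; if the norm is
  zero, nonnegativity of \<open>Hm1_norm\<close> suffices.\<close>

lemma galerkin_stability:
  assumes \<Omega>: "open \<Omega>" "bounded \<Omega>" "convex \<Omega>" "\<Omega> \<noteq> {}" and M: "uniform_mesh c h S \<Omega> M"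
    and f: "f \<in> L2 \<Omega>" "g \<in> L2 \<Omega>"
    and v: "galerkin_solution S \<Omega> M r f v" and w: "galerkin_solution S \<Omega> M r g w"
  shows "L2_norm \<Omega> (weak_grad \<Omega> (\<lambda>x. v x - w x)) \<le> Hm1_norm \<Omega> (\<lambda>x. f x - g x)"
proof -
  let ?e = "\<lambda>x. v x - w x"
  have V: "v \<in> fe_space0 S \<Omega> M r" "w \<in> fe_space0 S \<Omega> M r" using v w by (auto simp: galerkin_solution_def)
  have e: "?e \<in> fe_space0 S \<Omega> M r" by (rule fe_space0_diff[OF V])
  note H = fe_space0_H10[OF \<Omega> M]
  note gv = H10_has_weak_grad[OF H[OF V(1)]] and gw = H10_has_weak_grad[OF H[OF V(2)]] and ge = H10_has_weak_grad[OF H[OF e]]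
  have gd: "has_weak_grad \<Omega> ?e (\<lambda>x. weak_grad \<Omega> v x - weak_grad \<Omega> w x)"
    by (intro has_weak_grad_diff \<Omega> gv gw)
  have "(L2_norm \<Omega> (weak_grad \<Omega> ?e))\<^sup>2 = L2_inner \<Omega> (weak_grad \<Omega> ?e) (weak_grad \<Omega> ?e)" by (rule L2_inner_self[symmetric])
  also have "\<dots> = L2_inner \<Omega> (\<lambda>x. weak_grad \<Omega> v x - weak_grad \<Omega> w x) (weak_grad \<Omega> ?e)"
    by (intro L2_inner_cong_AE has_weak_grad_unique[OF \<Omega>(1,2) ge(2) gd] has_weak_grad_L2[OF ge(2)] has_weak_grad_L2[OF gd]) simp
  also have "\<dots> = L2_inner \<Omega> (weak_grad \<Omega> v) (weak_grad \<Omega> ?e) - L2_inner \<Omega> (weak_grad \<Omega> w) (weak_grad \<Omega> ?e)"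
    by (intro L2_inner_diff_left has_weak_grad_L2[OF gv(2)] has_weak_grad_L2[OF gw(2)] has_weak_grad_L2[OF ge(2)])
  also have "\<dots> = L2_inner \<Omega> f ?e - L2_inner \<Omega> g ?e" using v w e by (simp add: galerkin_solution_def)
  also have "\<dots> = L2_inner \<Omega> (\<lambda>x. f x - g x) ?e" by (rule L2_inner_diff_left[symmetric, OF f ge(1)])
  also have "\<dots> \<le> Hm1_norm \<Omega> (\<lambda>x. f x - g x) * L2_norm \<Omega> (weak_grad \<Omega> ?e)"
    using Hm1_norm_bound(2)[OF \<Omega>(1,2) L2_diff[OF f] H[OF e]] by linarith
  finally have "L2_norm \<Omega> (weak_grad \<Omega> ?e) * L2_norm \<Omega> (weak_grad \<Omega> ?e) \<le> Hm1_norm \<Omega> (\<lambda>x. f x - g x) * L2_norm \<Omega> (weak_grad \<Omega> ?e)"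
    by (simp add: power2_eq_square)
  moreover have "L2_norm \<Omega> (weak_grad \<Omega> ?e) \<ge> 0" by simp
  ultimately show ?thesis
    using Hm1_norm_bound(1)[OF \<Omega>(1,2) L2_diff[OF f]] by (cases "L2_norm \<Omega> (weak_grad \<Omega> ?e) = 0") auto
qed

section \<open>Network vectors and nodal values\<close>

lemma mlp_carrier: "mlp_dims n ls m \<Longrightarrow> mlp \<sigma> ls x \<in> carrier_vec m"
  by (induction n ls m arbitrary: x rule: mlp_dims.induct) (auto simp: affine_layer_def intro!: carrier_vecI)

lemma enorm_nonneg: "enorm x \<ge> 0"
  by (simp add: enorm_def scalar_prod_def sum_nonneg)

lemma enorm_power2: "(enorm x)\<^sup>2 = (\<Sum>i<dim_vec x. (vec_index x i)\<^sup>2)"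
  by (simp add: enorm_def scalar_prod_def sum_nonneg power2_eq_square lessThan_atLeast0)

lemma sum_enumerate:
  assumes "enumerates xs A"
  shows "(\<Sum>q\<in>A. f q) = (\<Sum>k<length xs. f (xs ! k))"
proof -
  have "bij_betw ((!) xs) {..<length xs} (set xs)" using assms by (intro bij_betw_nth) (auto simp: enumerates_def)
  then show ?thesis using sum.reindex_bij_betw[of "(!) xs" "{..<length xs}" A f] assms by (simp add: enumerates_def)
qed

lemma enorm_net_input_diff:
  assumes X: "enumerates X A" and Y: "enumerates Y B"
  shows "(enorm (net_input X Y u f - net_input X Y v g))\<^sup>2 = (\<Sum>p\<in>A. (u p - v p)\<^sup>2) + (\<Sum>p\<in>B. (f p - g p)\<^sup>2)"
proof -
  let ?a = "length X" and ?b = "length Y"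
  have dim: "dim_vec (net_input X Y u f - net_input X Y v g) = ?a + ?b" by (simp add: net_input_def)
  have idx: "vec_index (net_input X Y u f - net_input X Y v g) i = (map u X @ map f Y) ! i - (map v X @ map g Y) ! i"
    if "i < ?a + ?b" for i
    using that by (simp add: net_input_def vec_of_list_index)
  have "(enorm (net_input X Y u f - net_input X Y v g))\<^sup>2
      = (\<Sum>i<?a + ?b. ((map u X @ map f Y) ! i - (map v X @ map g Y) ! i)\<^sup>2)"
    unfolding enorm_power2 dim by (intro sum.cong refl) (simp add: idx)
  also have "\<dots> = (\<Sum>i<?a. (u (X ! i) - v (X ! i))\<^sup>2) + (\<Sum>i<?b. (f (Y ! i) - g (Y ! i))\<^sup>2)"
  proof -
    have split: "{..<?a + ?b} = {..<?a} \<union> (\<lambda>i. i + ?a) ` {..<?b}"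
    proof (intro subset_antisym subsetI)
      fix i assume "i \<in> {..<?a + ?b}"
      then show "i \<in> {..<?a} \<union> (\<lambda>i. i + ?a) ` {..<?b}"
        by (cases "i < ?a") (auto intro!: image_eqI[of _ _ "i - ?a"])
    qed auto
    show ?thesis
      unfolding split
      by (subst sum.union_disjoint) (auto simp: sum.reindex nth_append intro!: arg_cong2[of _ _ _ _ "(+)"] sum.cong)
  qed
  finally show ?thesis by (simp add: sum_enumerate[OF X] sum_enumerate[OF Y])
qed

lemma net_correction_fe_space0:
  assumes X: "enumerates X (nodes S M r)" and \<phi>: "nodal_basis S \<Omega> M r \<phi>"
  shows "net_correction \<Omega> X \<phi> y \<in> fe_space0 S \<Omega> M r"
proof -
  have "\<phi> (X ! j) \<in> fe_space0 S \<Omega> M r" if "j < length X" "X ! j \<notin> frontier \<Omega>" for j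
  proof -
    have "X ! j \<in> nodes S M r" using X nth_mem[OF that(1)] by (simp add: enumerates_def)
    then show ?thesis using \<phi> that(2) by (simp add: nodal_basis_def)
  qed
  then show ?thesis unfolding net_correction_def[abs_def]
    by (intro fe_space0_sum fe_space0_cmult) auto
qed

lemma net_correction_node:
  assumes X: "enumerates X (nodes S M r)" and \<phi>: "nodal_basis S \<Omega> M r \<phi>" and k: "k < length X" "X ! k \<notin> frontier \<Omega>"
  shows "net_correction \<Omega> X \<phi> y (X ! k) = vec_index y k"
proof -
  let ?J = "{j. j < length X \<and> X ! j \<notin> frontier \<Omega>}"
  have node: "X ! j \<in> nodes S M r" if "j < length X" for j using X nth_mem[OF that] by (simp add: enumerates_def)
  have val: "\<phi> (X ! j) (X ! k) = (if j = k then 1 else 0)" if "j \<in> ?J" for j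
  proof -
    have "\<phi> (X ! j) (X ! k) = (if X ! k = X ! j then 1 else 0)"
      using \<phi> node[of j] node[of k] that k by (simp add: nodal_basis_def)
    moreover have "X ! k = X ! j \<longleftrightarrow> j = k" using X that k nth_eq_iff_index_eq[of X k j] by (auto simp: enumerates_def)
    ultimately show ?thesis by simp
  qed
  have "net_correction \<Omega> X \<phi> y (X ! k) = (\<Sum>j\<in>?J. vec_index y j * (if j = k then 1 else 0))"
    unfolding net_correction_def by (intro sum.cong refl) (simp add: val)
  also have "\<dots> = vec_index y k" using k by (simp add: if_distrib cong: if_cong)
  finally show ?thesis .
qed

text \<open>At boundary nodes \<open>w\<close> vanishes, so the discarded vector components only
  enlarge the right-hand side; at all other nodes the terms agree.\<close>

lemma sum_nodes_le_enorm:
  assumes X: "enumerates X (nodes S M r)" and w: "w \<in> fe_space0 S \<Omega> M r" and z: "dim_vec z = length X"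
    and eq: "\<And>k. k < length X \<Longrightarrow> X ! k \<notin> frontier \<Omega> \<Longrightarrow> w (X ! k) = vec_index z k"
  shows "(\<Sum>q\<in>nodes S M r. (w q)\<^sup>2) \<le> (enorm z)\<^sup>2"
proof -
  have "(w (X ! k))\<^sup>2 \<le> (vec_index z k)\<^sup>2" if "k < length X" for k
    using eq[OF that] w by (cases "X ! k \<in> frontier \<Omega>") (auto simp: fe_space0_def)
  then show ?thesis unfolding sum_enumerate[OF X] enorm_power2 z by (intro sum_mono) simp
qed

section \<open>The error estimate\<close>

lemma sobolev_1_diff_le:
  assumes \<Omega>: "open \<Omega>" "bounded \<Omega>" and u: "u \<in> sobolev 1 \<Omega>" and v: "v \<in> sobolev 1 \<Omega>"
  shows "L2_norm \<Omega> (weak_grad \<Omega> (\<lambda>x. u x - v x)) \<le> L2_norm \<Omega> (weak_grad \<Omega> u) + L2_norm \<Omega> (weak_grad \<Omega> v)"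
proof -
  obtain D E where D: "u \<in> L2 \<Omega>" "has_weak_grad \<Omega> u D" and E: "v \<in> L2 \<Omega>" "has_weak_grad \<Omega> v E"
    using u v unfolding sobolev_1_iff by blast
  have diff: "has_weak_grad \<Omega> (\<lambda>x. u x - v x) (\<lambda>x. D x - E x)"
    by (intro has_weak_grad_diff \<Omega> D E)
  have DE: "D \<in> L2 \<Omega>" "E \<in> L2 \<Omega>" using D E has_weak_grad_L2 by blast+
  have "L2_norm \<Omega> (\<lambda>x. D x + (- 1) *\<^sub>R E x) \<le> L2_norm \<Omega> D + L2_norm \<Omega> (\<lambda>x. (- 1) *\<^sub>R E x)"
    by (rule L2_norm_triangle[OF DE(1) L2_scaleR[OF DE(2)]])
  then have "L2_norm \<Omega> (\<lambda>x. D x - E x) \<le> L2_norm \<Omega> D + L2_norm \<Omega> E"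
    unfolding L2_norm_scaleR by simp
  then show ?thesis
    by (simp add: L2_norm_has_weak_grad[OF \<Omega> diff] L2_norm_has_weak_grad[OF \<Omega> D(2)] L2_norm_has_weak_grad[OF \<Omega> E(2)])
qed

text \<open>In the theorem the constant is chosen before the shape, so the constants of both shapes
  and both estimates are merged into one.\<close>

lemma fe_estimates:
  assumes r: "r \<ge> 1"
  obtains K where "K > 0"
    "\<And>S c h (\<Omega> :: (real ^ 'n) set) M w. c > 0 \<Longrightarrow> h > 0 \<Longrightarrow> open \<Omega> \<Longrightarrow> bounded \<Omega> \<Longrightarrow> convex \<Omega> \<Longrightarrow>
       uniform_mesh c h S \<Omega> M \<Longrightarrow> w \<in> fe_space0 S \<Omega> M r \<Longrightarrow>
       (L2_norm \<Omega> (weak_grad \<Omega> w))\<^sup>2 \<le> K * (h / c) ^ CARD('n) * (h ^ CARD('n) / c\<^sup>2) * (\<Sum>q\<in>nodes S M r. (w q)\<^sup>2)"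
    "\<And>S c h (\<Omega> :: (real ^ 'n) set) M v. c > 0 \<Longrightarrow> open \<Omega> \<Longrightarrow> bounded \<Omega> \<Longrightarrow> convex \<Omega> \<Longrightarrow>
       uniform_mesh c h S \<Omega> M \<Longrightarrow> v \<in> fe_space S \<Omega> M r \<Longrightarrow>
       (\<Sum>q\<in>nodes S M r. (v q)\<^sup>2) \<le> K / c ^ CARD('n) * (L2_norm \<Omega> v)\<^sup>2"
proof -
  let ?inv = "\<lambda>S K. \<forall>c h (\<Omega> :: (real ^ 'n) set) M w. c > 0 \<longrightarrow> h > 0 \<longrightarrow> open \<Omega> \<longrightarrow> bounded \<Omega> \<longrightarrow> convex \<Omega> \<longrightarrow>
       uniform_mesh c h S \<Omega> M \<longrightarrow> w \<in> fe_space0 S \<Omega> M r \<longrightarrow>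
       (L2_norm \<Omega> (weak_grad \<Omega> w))\<^sup>2 \<le> K * (h / c) ^ CARD('n) * (h ^ CARD('n) / c\<^sup>2) * (\<Sum>q\<in>nodes S M r. (w q)\<^sup>2)"
  let ?nod = "\<lambda>S K. \<forall>c h (\<Omega> :: (real ^ 'n) set) M v. c > 0 \<longrightarrow> open \<Omega> \<longrightarrow> bounded \<Omega> \<longrightarrow> convex \<Omega> \<longrightarrow>
       uniform_mesh c h S \<Omega> M \<longrightarrow> v \<in> fe_space S \<Omega> M r \<longrightarrow>
       (\<Sum>q\<in>nodes S M r. (v q)\<^sup>2) \<le> K / c ^ CARD('n) * (L2_norm \<Omega> v)\<^sup>2"
  have i: "\<exists>K>0. ?inv S K" for S
    by (rule fe_inverse_estimate[OF r, where 'n='n and S=S]) (intro exI conjI allI impI, assumption)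
  have n: "\<exists>K>0. ?nod S K" for S
    by (rule fe_nodal_estimate[OF r, where 'n='n and S=S]) (intro exI conjI allI impI, assumption)
  obtain I where I: "\<And>S. I S > 0" "\<And>S. ?inv S (I S)" using i by metis
  obtain N where N: "\<And>S. N S > 0" "\<And>S. ?nod S (N S)" using n by metis
  define K where "K = I Simplicial + I Cubical + N Simplicial + N Cubical"
  have K: "I S \<le> K" "N S \<le> K" for S
    using I(1)[of Simplicial] I(1)[of Cubical] N(1)[of Simplicial] N(1)[of Cubical] by (cases S; simp add: K_def)+
  show ?thesis
  proof (rule that[of K])
    show "K > 0" using K(1)[of Simplicial] I(1)[of Simplicial] by linarith
    fix S c h and \<Omega> :: "(real ^ 'n) set" and M w
    assume *: "c > 0" "h > 0" "open \<Omega>" "bounded \<Omega>" "convex \<Omega>" "uniform_mesh c h S \<Omega> M" "w \<in> fe_space0 S \<Omega> M r"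
    have "(L2_norm \<Omega> (weak_grad \<Omega> w))\<^sup>2 \<le> I S * (h / c) ^ CARD('n) * (h ^ CARD('n) / c\<^sup>2) * (\<Sum>q\<in>nodes S M r. (w q)\<^sup>2)"
      by (rule I(2)[rule_format, OF *])
    also have "\<dots> \<le> K * (h / c) ^ CARD('n) * (h ^ CARD('n) / c\<^sup>2) * (\<Sum>q\<in>nodes S M r. (w q)\<^sup>2)"
      using *(1,2) by (intro mult_right_mono K) (auto intro!: sum_nonneg)
    finally show "(L2_norm \<Omega> (weak_grad \<Omega> w))\<^sup>2 \<le> K * (h / c) ^ CARD('n) * (h ^ CARD('n) / c\<^sup>2) * (\<Sum>q\<in>nodes S M r. (w q)\<^sup>2)" .
  next
    fix S c h and \<Omega> :: "(real ^ 'n) set" and M v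
    assume *: "c > 0" "open \<Omega>" "bounded \<Omega>" "convex \<Omega>" "uniform_mesh c h S \<Omega> M" "v \<in> fe_space S \<Omega> M r"
    have "(\<Sum>q\<in>nodes S M r. (v q)\<^sup>2) \<le> N S / c ^ CARD('n) * (L2_norm \<Omega> v)\<^sup>2"
      by (rule N(2)[rule_format, OF *])
    also have "\<dots> \<le> K / c ^ CARD('n) * (L2_norm \<Omega> v)\<^sup>2"
      using *(1) by (intro mult_right_mono divide_right_mono K) auto
    finally show "(\<Sum>q\<in>nodes S M r. (v q)\<^sup>2) \<le> K / c ^ CARD('n) * (L2_norm \<Omega> v)\<^sup>2" .
  qed
qed

text \<open>Two distinct inputs exist as soon as the input dimension is positive. The sign of
  \<open>L\<close> is needed to multiply the input estimate by it.\<close>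

lemma lipschitz_net_nonneg:
  assumes "lipschitz_net n L N" "n \<ge> 1"
  shows "L \<ge> 0"
proof -
  let ?x = "Matrix.vec n (\<lambda>_. 1 :: real)" and ?y = "0\<^sub>v n :: real Matrix.vec"
  have "(enorm (?x - ?y))\<^sup>2 = real n" unfolding enorm_power2 by simp
  then have "enorm (?x - ?y) > 0" using assms(2) enorm_nonneg[of "?x - ?y"] by (cases "enorm (?x - ?y) = 0") auto
  moreover have "0 \<le> L * enorm (?x - ?y)"
    using assms(1) enorm_nonneg[of "N ?x - N ?y"] unfolding lipschitz_net_def by (meson order_trans vec_carrier zero_carrier_vec)
  ultimately show ?thesis by (simp add: zero_le_mult_iff)
qed

text \<open>The estimate for one fixed training problem. The constants contain
  \<open>\<bar>q * \<kappa>\<bar>\<close> and \<open>\<bar>C\<bar>\<close>, so that they can be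
  named before any mesh is given; positivity of \<open>q * \<kappa>\<close> is known only once there
  is a mesh.\<close>

lemma hybrid_error:
  fixes \<Omega> :: "(real ^ 'n) set" and K :: real
  assumes \<Omega>: "open \<Omega>" "bounded \<Omega>" "convex \<Omega>" "\<Omega> \<noteq> {}" and r: "r \<ge> 1" and K: "K > 0"
    and inv: "\<And>S c h M w. c > 0 \<Longrightarrow> h > 0 \<Longrightarrow> uniform_mesh c h S \<Omega> M \<Longrightarrow> w \<in> fe_space0 S \<Omega> M r \<Longrightarrow>
       (L2_norm \<Omega> (weak_grad \<Omega> w))\<^sup>2 \<le> K * (h / c) ^ CARD('n) * (h ^ CARD('n) / c\<^sup>2) * (\<Sum>q\<in>nodes S M r. (w q)\<^sup>2)"
    and nod: "\<And>S c h M v. c > 0 \<Longrightarrow> uniform_mesh c h S \<Omega> M \<Longrightarrow> v \<in> fe_space S \<Omega> M r \<Longrightarrow>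
       (\<Sum>q\<in>nodes S M r. (v q)\<^sup>2) \<le> K / c ^ CARD('n) * (L2_norm \<Omega> v)\<^sup>2"
    and M\<^sub>H: "is_mesh S \<Omega> M\<^sub>H" "shape_regular \<kappa> S M\<^sub>H" "quasi_uniform q S M\<^sub>H"
    and M\<^sub>h: "is_mesh S \<Omega> M\<^sub>h" "shape_regular \<kappa> S M\<^sub>h" "quasi_uniform q S M\<^sub>h"
    and ref: "(uniform_refinement S)\<^sup>*\<^sup>* M\<^sub>H M\<^sub>h"
    and X: "enumerates X\<^sub>H (nodes S M\<^sub>H r)" "enumerates X\<^sub>h (nodes S M\<^sub>h r)" and \<phi>: "nodal_basis S \<Omega> M\<^sub>h r \<phi>"
    and dims: "mlp_dims (length X\<^sub>H + length X\<^sub>h) ls (length X\<^sub>h)"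
    and lip: "lipschitz_net (length X\<^sub>H + length X\<^sub>h) L (mlp \<sigma> ls)"
    and \<epsilon>: "\<epsilon> \<ge> 0"
    and g: "g \<in> L2 \<Omega>" "galerkin_solution S \<Omega> M\<^sub>h r g v\<^sub>h" "galerkin_solution S \<Omega> M\<^sub>H r g v\<^sub>H"
    and loss: "(enorm (net_target X\<^sub>h v\<^sub>h v\<^sub>H - mlp \<sigma> ls (net_input X\<^sub>H X\<^sub>h v\<^sub>H g)))\<^sup>2 \<le> C * \<epsilon>\<^sup>2"
    and I: "lagrange_interpolant S \<Omega> M\<^sub>h r (\<lambda>x. f x - g x) Ig"
    and f: "f \<in> L2 \<Omega>" and u: "u \<in> H10 \<Omega>"
    and fs: "galerkin_solution S \<Omega> M\<^sub>h r f u\<^sub>h" "galerkin_solution S \<Omega> M\<^sub>H r f u\<^sub>H"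
    and err: "L2_norm \<Omega> (\<lambda>x. u x - u\<^sub>h x) + mesh_size S M\<^sub>h * L2_norm \<Omega> (weak_grad \<Omega> (\<lambda>x. u x - u\<^sub>h x))
         \<le> c\<^sub>0 * mesh_size S M\<^sub>h ^ (r + 1) * sobolev_norm (r - 1) \<Omega> f"
  shows "L \<ge> 0" and "mesh_size S M\<^sub>h > 0"
    and "L2_norm \<Omega> (weak_grad \<Omega> (\<lambda>x. u x - hybrid_solution \<Omega> X\<^sub>H X\<^sub>h \<phi> (mlp \<sigma> ls) u\<^sub>H f x))
      \<le> \<bar>c\<^sub>0\<bar> * (mesh_size S M\<^sub>h ^ r * sobolev_norm (r - 1) \<Omega> f) + 2 * Hm1_norm \<Omega> (\<lambda>x. f x - g x)
        + sqrt (K * \<bar>q * \<kappa>\<bar> ^ CARD('n) * (q * \<kappa>)\<^sup>2) * sqrt (K * \<bar>q * \<kappa>\<bar> ^ CARD('n)) *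
            (L * inverse (mesh_size S M\<^sub>h) * (L2_norm \<Omega> (\<lambda>x. u\<^sub>H x - v\<^sub>H x) + L2_norm \<Omega> Ig))
        + sqrt (K * \<bar>q * \<kappa>\<bar> ^ CARD('n) * (q * \<kappa>)\<^sup>2) * sqrt \<bar>C\<bar> * (mesh_size S M\<^sub>h powr (real CARD('n) / 2 - 1) * \<epsilon>)"
proof -
  define h H \<tau> n where "h = mesh_size S M\<^sub>h" and "H = mesh_size S M\<^sub>H" and "\<tau> = q * \<kappa>" and "n = CARD('n)"
  note mh = mesh_uniform[OF M\<^sub>h \<Omega>(4), folded h_def \<tau>_def] and mH = mesh_uniform[OF M\<^sub>H \<Omega>(4), folded H_def \<tau>_def]
  have h: "h > 0" and \<tau>: "\<tau> > 0" and H: "H > 0" using mh(1,2) mH(1) by auto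
  show "mesh_size S M\<^sub>h > 0" using h by (simp add: h_def)
  have refm: "mesh_refines S M\<^sub>H M\<^sub>h" by (rule mesh_refines_rtranclp[OF ref])
  have hH: "h \<le> H" unfolding h_def H_def by (rule mesh_refines_mesh_size[OF refm M\<^sub>H(1) M\<^sub>h(1) \<Omega>(4)])
  \<comment> \<open>With \<open>c = h / \<tau>\<close> the inverse estimate has the factor
    \<open>A * P\<close>, and the nodal estimate the factor \<open>B / sqrt (h ^ n)\<close>.\<close>
  define A B P where "A = sqrt (K * \<tau> ^ n * \<tau>\<^sup>2)" and "B = sqrt (K * \<tau> ^ n)" and "P = h powr (real n / 2 - 1)"
  have A: "A \<ge> 0" "A\<^sup>2 = K * \<tau> ^ n * \<tau>\<^sup>2" and B: "B \<ge> 0" "B\<^sup>2 = K * \<tau> ^ n" and P: "P > 0"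
    using K \<tau> h by (auto simp: A_def B_def P_def)
  have P2: "P\<^sup>2 = h ^ n / h\<^sup>2"
  proof -
    have "P\<^sup>2 = h powr ((real n / 2 - 1) + (real n / 2 - 1))" unfolding P_def power2_eq_square by (rule powr_add[symmetric])
    also have "(real n / 2 - 1) + (real n / 2 - 1) = real n - real 2" by simp
    also have "h powr (real n - real 2) = h ^ n / h\<^sup>2" using h by (simp only: powr_diff powr_realpow)
    finally show ?thesis .
  qed
  have "length X\<^sub>h \<ge> 1"
  proof -
    obtain F where "F \<in> M\<^sub>h" using mesh_nonempty[OF M\<^sub>h(1) \<Omega>(4)] by blast
    moreover have "(\<lambda>i. 0) \<in> (exponents S r :: ('n \<Rightarrow> nat) set)" by (cases S) auto
    ultimately have "nodes S M\<^sub>h r \<noteq> {}" unfolding nodes_eq by blast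
    then show ?thesis using X(2) by (cases X\<^sub>h) (auto simp: enumerates_def)
  qed
  then show L: "L \<ge> 0" by (intro lipschitz_net_nonneg[OF lip]) simp
  have gradient: "L2_norm \<Omega> (weak_grad \<Omega> w) \<le> A * (P * e)"
    if w: "w \<in> fe_space0 S \<Omega> M\<^sub>h r" and e: "(\<Sum>q\<in>nodes S M\<^sub>h r. (w q)\<^sup>2) \<le> e\<^sup>2" "e \<ge> 0" for w e
  proof (rule power2_le_imp_le)
    have "(L2_norm \<Omega> (weak_grad \<Omega> w))\<^sup>2 \<le> K * (h / (h / \<tau>)) ^ n * (h ^ n / (h / \<tau>)\<^sup>2) * (\<Sum>q\<in>nodes S M\<^sub>h r. (w q)\<^sup>2)"
      unfolding n_def using h \<tau> by (intro inv[OF _ h mh(3) w]) simp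
    also have "\<dots> \<le> K * (h / (h / \<tau>)) ^ n * (h ^ n / (h / \<tau>)\<^sup>2) * e\<^sup>2"
      using K h \<tau> e(1) by (intro mult_left_mono) auto
    also have "\<dots> = (A * (P * e))\<^sup>2"
      using h \<tau> by (simp add: power_mult_distrib A P2 power_divide)
    finally show "(L2_norm \<Omega> (weak_grad \<Omega> w))\<^sup>2 \<le> (A * (P * e))\<^sup>2" .
  qed (use A P e in simp)
  have Vh: "u\<^sub>h \<in> fe_space0 S \<Omega> M\<^sub>h r" "v\<^sub>h \<in> fe_space0 S \<Omega> M\<^sub>h r"
    and VH: "u\<^sub>H \<in> fe_space0 S \<Omega> M\<^sub>H r" "v\<^sub>H \<in> fe_space0 S \<Omega> M\<^sub>H r"
    using fs g by (auto simp: galerkin_solution_def)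
  \<comment> \<open>The correction acts on the fine mesh, so the coarse solutions are needed as
    elements of the fine space.\<close>
  have VHh: "u\<^sub>H \<in> fe_space0 S \<Omega> M\<^sub>h r" "v\<^sub>H \<in> fe_space0 S \<Omega> M\<^sub>h r"
    using VH mesh_refines_fe_space0[OF refm] by blast+
  have sob: "w \<in> sobolev 1 \<Omega>" if "w \<in> fe_space0 S \<Omega> M\<^sub>h r" for w
    by (rule H10_sobolev_1[OF fe_space0_H10[OF \<Omega> mh(3) that]])
  let ?N = "mlp \<sigma> ls" and ?x = "net_input X\<^sub>H X\<^sub>h u\<^sub>H f" and ?y = "net_input X\<^sub>H X\<^sub>h v\<^sub>H g"
  let ?w = "net_correction \<Omega> X\<^sub>h \<phi>"
  have Nc: "dim_vec (?N z) = length X\<^sub>h" for z using mlp_carrier[OF dims, of \<sigma> z] by simp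
  have wfe: "?w z \<in> fe_space0 S \<Omega> M\<^sub>h r" for z by (rule net_correction_fe_space0[OF X(2) \<phi>])
  define e1 e2 e3 e4 e5 where "e1 = (\<lambda>x. u x - u\<^sub>h x)" and "e2 = (\<lambda>x. u\<^sub>h x - v\<^sub>h x)" and "e3 = (\<lambda>x. u\<^sub>H x - v\<^sub>H x)"
    and "e4 = (\<lambda>x. (v\<^sub>h x - v\<^sub>H x) - ?w (?N ?y) x)" and "e5 = (\<lambda>x. ?w (?N ?x) x - ?w (?N ?y) x)"
  have fe: "e3 \<in> fe_space0 S \<Omega> M\<^sub>h r" "e2 \<in> fe_space0 S \<Omega> M\<^sub>h r" "e4 \<in> fe_space0 S \<Omega> M\<^sub>h r" "e5 \<in> fe_space0 S \<Omega> M\<^sub>h r"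
    unfolding e2_def e3_def e4_def e5_def by (intro fe_space0_diff Vh VHh wfe)+
  have s1: "e1 \<in> sobolev 1 \<Omega>" unfolding e1_def by (intro sobolev_1_diff \<Omega> H10_sobolev_1[OF u] sob Vh)
  have b1: "L2_norm \<Omega> (weak_grad \<Omega> e1) \<le> \<bar>c\<^sub>0\<bar> * (h ^ r * sobolev_norm (r - 1) \<Omega> f)"
  proof -
    have s0: "sobolev_norm (r - 1) \<Omega> f \<ge> 0" by (simp add: sobolev_norm_def sum_nonneg)
    have "h * L2_norm \<Omega> (weak_grad \<Omega> e1) \<le> c\<^sub>0 * h ^ (r + 1) * sobolev_norm (r - 1) \<Omega> f"
      using err L2_norm_nonneg[of \<Omega> e1] unfolding e1_def h_def[symmetric] by linarith
    also have "\<dots> = h * (c\<^sub>0 * (h ^ r * sobolev_norm (r - 1) \<Omega> f))" by simp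
    finally have "L2_norm \<Omega> (weak_grad \<Omega> e1) \<le> c\<^sub>0 * (h ^ r * sobolev_norm (r - 1) \<Omega> f)" using h by simp
    also have "\<dots> \<le> \<bar>c\<^sub>0\<bar> * (h ^ r * sobolev_norm (r - 1) \<Omega> f)" using s0 h by (intro mult_right_mono) auto
    finally show ?thesis .
  qed
  have b2: "L2_norm \<Omega> (weak_grad \<Omega> e2) \<le> Hm1_norm \<Omega> (\<lambda>x. f x - g x)"
    unfolding e2_def by (rule galerkin_stability[OF \<Omega> mh(3) f g(1) fs(1) g(2)])
  have b3: "L2_norm \<Omega> (weak_grad \<Omega> e3) \<le> Hm1_norm \<Omega> (\<lambda>x. f x - g x)"
    unfolding e3_def by (rule galerkin_stability[OF \<Omega> mH(3) f g(1) fs(2) g(3)])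
  have b4: "L2_norm \<Omega> (weak_grad \<Omega> e4) \<le> A * (P * (sqrt \<bar>C\<bar> * \<epsilon>))"
  proof (rule gradient[OF fe(3)])
    let ?z = "net_target X\<^sub>h v\<^sub>h v\<^sub>H - ?N ?y"
    have "(\<Sum>q\<in>nodes S M\<^sub>h r. (e4 q)\<^sup>2) \<le> (enorm ?z)\<^sup>2"
    proof (rule sum_nodes_le_enorm[OF X(2) fe(3)])
      show "dim_vec ?z = length X\<^sub>h" by (simp add: Nc)
      fix k assume k: "k < length X\<^sub>h" "X\<^sub>h ! k \<notin> frontier \<Omega>"
      show "e4 (X\<^sub>h ! k) = vec_index ?z k"
        using k net_correction_node[OF X(2) \<phi> k] by (simp add: e4_def Nc net_target_def vec_of_list_index)
    qed
    also have "\<dots> \<le> \<bar>C\<bar> * \<epsilon>\<^sup>2" using loss mult_right_mono[OF abs_ge_self[of C], of "\<epsilon>\<^sup>2"] by simp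
    also have "\<dots> = (sqrt \<bar>C\<bar> * \<epsilon>)\<^sup>2" by (simp add: power_mult_distrib)
    finally show "(\<Sum>q\<in>nodes S M\<^sub>h r. (e4 q)\<^sup>2) \<le> (sqrt \<bar>C\<bar> * \<epsilon>)\<^sup>2" .
  qed (use \<epsilon> in simp)
  define s where "s = L2_norm \<Omega> (\<lambda>x. u\<^sub>H x - v\<^sub>H x) + L2_norm \<Omega> Ig"
  have s: "s \<ge> 0" by (simp add: s_def)
  \<comment> \<open>Both blocks of the input difference are nodal values of finite element
    functions: \<open>u\<^sub>H - v\<^sub>H\<close> on the coarse mesh, and the interpolant of
    \<open>f - g\<close> on the fine one.\<close>
  have input: "enorm (?x - ?y) \<le> B * s / sqrt (h ^ n)"
  proof (rule power2_le_imp_le)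
    have "(\<Sum>p\<in>nodes S M\<^sub>H r. (u\<^sub>H p - v\<^sub>H p)\<^sup>2) \<le> K / (H / \<tau>) ^ n * (L2_norm \<Omega> (\<lambda>x. u\<^sub>H x - v\<^sub>H x))\<^sup>2"
      unfolding n_def
    proof (rule nod[OF _ mH(3)])
      show "(\<lambda>x. u\<^sub>H x - v\<^sub>H x) \<in> fe_space S \<Omega> M\<^sub>H r" using fe_space0_diff[OF VH] by (simp add: fe_space0_def)
    qed (use H \<tau> in simp)
    \<comment> \<open>The coarse estimate is better by a power of \<open>h / H\<close>; it is
      weakened to the fine scale so that both blocks share one factor.\<close>
    also have "\<dots> \<le> K / (h / \<tau>) ^ n * (L2_norm \<Omega> (\<lambda>x. u\<^sub>H x - v\<^sub>H x))\<^sup>2"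
      using K h \<tau> hH by (intro mult_right_mono divide_left_mono power_mono divide_right_mono) auto
    finally have 1: "(\<Sum>p\<in>nodes S M\<^sub>H r. (u\<^sub>H p - v\<^sub>H p)\<^sup>2) \<le> K / (h / \<tau>) ^ n * (L2_norm \<Omega> (\<lambda>x. u\<^sub>H x - v\<^sub>H x))\<^sup>2" .
    have "(\<Sum>p\<in>nodes S M\<^sub>h r. (Ig p)\<^sup>2) \<le> K / (h / \<tau>) ^ n * (L2_norm \<Omega> Ig)\<^sup>2"
      unfolding n_def
    proof (rule nod[OF _ mh(3)])
      show "Ig \<in> fe_space S \<Omega> M\<^sub>h r" using I by (simp add: lagrange_interpolant_def)
    qed (use h \<tau> in simp)
    moreover have "(\<Sum>p\<in>nodes S M\<^sub>h r. (f p - g p)\<^sup>2) = (\<Sum>p\<in>nodes S M\<^sub>h r. (Ig p)\<^sup>2)"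
      using I by (intro sum.cong) (auto simp: lagrange_interpolant_def)
    ultimately have 2: "(\<Sum>p\<in>nodes S M\<^sub>h r. (f p - g p)\<^sup>2) \<le> K / (h / \<tau>) ^ n * (L2_norm \<Omega> Ig)\<^sup>2" by simp
    have "(enorm (?x - ?y))\<^sup>2 = (\<Sum>p\<in>nodes S M\<^sub>H r. (u\<^sub>H p - v\<^sub>H p)\<^sup>2) + (\<Sum>p\<in>nodes S M\<^sub>h r. (f p - g p)\<^sup>2)"
      by (rule enorm_net_input_diff[OF X])
    also have "\<dots> \<le> K / (h / \<tau>) ^ n * ((L2_norm \<Omega> (\<lambda>x. u\<^sub>H x - v\<^sub>H x))\<^sup>2 + (L2_norm \<Omega> Ig)\<^sup>2)"
      using 1 2 by (simp add: distrib_left)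
    also have "\<dots> \<le> K / (h / \<tau>) ^ n * s\<^sup>2"
      using K h \<tau> by (intro mult_left_mono) (auto simp: s_def power2_sum)
    also have "\<dots> = (B * s / sqrt (h ^ n))\<^sup>2"
      using h \<tau> by (simp add: power_mult_distrib power_divide B)
    finally show "(enorm (?x - ?y))\<^sup>2 \<le> (B * s / sqrt (h ^ n))\<^sup>2" .
  qed (use B s h in simp)
  \<comment> \<open>The powers of order \<open>n / 2\<close> from the inverse and the nodal estimate
    cancel, which leaves the factor \<open>1 / h\<close> next to \<open>L\<close> in the
    claim.\<close>
  have PS: "P / sqrt (h ^ n) = inverse h"
  proof (rule power2_eq_imp_eq)
    show "(P / sqrt (h ^ n))\<^sup>2 = (inverse h)\<^sup>2"
      using h by (simp add: power_divide P2 power_inverse field_simps)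
  qed (use P h in auto)
  have b5: "L2_norm \<Omega> (weak_grad \<Omega> e5) \<le> A * B * (L * inverse h * s)"
  proof -
    have "L2_norm \<Omega> (weak_grad \<Omega> e5) \<le> A * (P * enorm (?N ?x - ?N ?y))"
    proof (rule gradient[OF fe(4) _ enorm_nonneg], rule sum_nodes_le_enorm[OF X(2) fe(4)])
      show "dim_vec (?N ?x - ?N ?y) = length X\<^sub>h" by (simp add: Nc)
      fix k assume k: "k < length X\<^sub>h" "X\<^sub>h ! k \<notin> frontier \<Omega>"
      show "e5 (X\<^sub>h ! k) = vec_index (?N ?x - ?N ?y) k"
        using k by (simp add: e5_def Nc net_correction_node[OF X(2) \<phi> k])
    qed
    also have "\<dots> \<le> A * (P * (L * (B * s / sqrt (h ^ n))))"
    proof (intro mult_left_mono)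
      have c: "net_input X\<^sub>H X\<^sub>h v k \<in> carrier_vec (length X\<^sub>H + length X\<^sub>h)" for v k
        by (intro carrier_vecI) (simp add: net_input_def)
      have "enorm (?N ?x - ?N ?y) \<le> L * enorm (?x - ?y)" using lip c unfolding lipschitz_net_def by blast
      also have "\<dots> \<le> L * (B * s / sqrt (h ^ n))" using input L by (intro mult_left_mono)
      finally show "enorm (?N ?x - ?N ?y) \<le> L * (B * s / sqrt (h ^ n))" .
    qed (use A P in auto)
    also have "\<dots> = A * B * (L * (P / sqrt (h ^ n)) * s)" by simp
    finally show ?thesis unfolding PS .
  qed
  have eq: "(\<lambda>x. u x - hybrid_solution \<Omega> X\<^sub>H X\<^sub>h \<phi> ?N u\<^sub>H f x) = (\<lambda>x. ((e1 x + (e2 x - e3 x)) + e4 x) - e5 x)"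
    by (auto simp: fun_eq_iff hybrid_solution_def e1_def e2_def e3_def e4_def e5_def)
  have d23: "(\<lambda>x. e2 x - e3 x) \<in> sobolev 1 \<Omega>" by (intro sobolev_1_diff \<Omega> sob fe)
  have d123: "(\<lambda>x. e1 x + (e2 x - e3 x)) \<in> sobolev 1 \<Omega>" by (rule sobolev_1_add(1)[OF \<Omega>(1,2) s1 d23])
  have d1234: "(\<lambda>x. (e1 x + (e2 x - e3 x)) + e4 x) \<in> sobolev 1 \<Omega>" by (rule sobolev_1_add(1)[OF \<Omega>(1,2) d123 sob[OF fe(3)]])
  have "L2_norm \<Omega> (weak_grad \<Omega> (\<lambda>x. u x - hybrid_solution \<Omega> X\<^sub>H X\<^sub>h \<phi> ?N u\<^sub>H f x))
      \<le> L2_norm \<Omega> (weak_grad \<Omega> e1) + (L2_norm \<Omega> (weak_grad \<Omega> e2) + L2_norm \<Omega> (weak_grad \<Omega> e3))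
        + L2_norm \<Omega> (weak_grad \<Omega> e4) + L2_norm \<Omega> (weak_grad \<Omega> e5)"
    unfolding eq
    using sobolev_1_diff_le[OF \<Omega>(1,2) d1234 sob[OF fe(4)]] sobolev_1_add(2)[OF \<Omega>(1,2) d123 sob[OF fe(3)]]
      sobolev_1_add(2)[OF \<Omega>(1,2) s1 d23] sobolev_1_diff_le[OF \<Omega>(1,2) sob[OF fe(2)] sob[OF fe(1)]] by linarith
  also have "\<dots> \<le> \<bar>c\<^sub>0\<bar> * (h ^ r * sobolev_norm (r - 1) \<Omega> f) + 2 * Hm1_norm \<Omega> (\<lambda>x. f x - g x)
      + A * B * (L * inverse h * s) + A * sqrt \<bar>C\<bar> * (P * \<epsilon>)"
  proof -
    have "A * (P * (sqrt \<bar>C\<bar> * \<epsilon>)) = A * sqrt \<bar>C\<bar> * (P * \<epsilon>)" by simp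
    then show ?thesis using b1 b2 b3 b4 b5 by linarith
  qed
  finally show "L2_norm \<Omega> (weak_grad \<Omega> (\<lambda>x. u x - hybrid_solution \<Omega> X\<^sub>H X\<^sub>h \<phi> (mlp \<sigma> ls) u\<^sub>H f x))
      \<le> \<bar>c\<^sub>0\<bar> * (mesh_size S M\<^sub>h ^ r * sobolev_norm (r - 1) \<Omega> f) + 2 * Hm1_norm \<Omega> (\<lambda>x. f x - g x)
        + sqrt (K * \<bar>q * \<kappa>\<bar> ^ CARD('n) * (q * \<kappa>)\<^sup>2) * sqrt (K * \<bar>q * \<kappa>\<bar> ^ CARD('n)) *
            (L * inverse (mesh_size S M\<^sub>h) * (L2_norm \<Omega> (\<lambda>x. u\<^sub>H x - v\<^sub>H x) + L2_norm \<Omega> Ig))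
        + sqrt (K * \<bar>q * \<kappa>\<bar> ^ CARD('n) * (q * \<kappa>)\<^sup>2) * sqrt \<bar>C\<bar> * (mesh_size S M\<^sub>h powr (real CARD('n) / 2 - 1) * \<epsilon>)"
    using \<tau> unfolding A_def B_def P_def s_def h_def n_def \<tau>_def by (simp only: abs_of_pos)
qed

theorem theorem1:
  fixes \<Omega> :: "(real ^ 'n) set" and r :: nat and \<kappa> q c\<^sub>0 C :: real
  assumes "CARD('n) \<in> {2, 3}"
    and "open \<Omega>" "convex \<Omega>" "\<Omega> \<noteq> {}" "polytope (closure \<Omega>)"
    and "r \<ge> 1"
  shows "\<exists>c>0. \<forall>(S :: shape) (M\<^sub>H :: (real ^ 'n \<Rightarrow> real ^ 'n) set) (M\<^sub>h :: (real ^ 'n \<Rightarrow> real ^ 'n) set)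
      (X\<^sub>H :: (real ^ 'n) list) (X\<^sub>h :: (real ^ 'n) list) (\<phi> :: real ^ 'n \<Rightarrow> real ^ 'n \<Rightarrow> real)
      (\<sigma> :: real \<Rightarrow> real) (ls :: layer list) (L :: real) (\<epsilon> :: real) (N\<^sub>T :: nat)
      (f\<^sub>i :: nat \<Rightarrow> real ^ 'n \<Rightarrow> real) (u\<^sub>h\<^sub>i :: nat \<Rightarrow> real ^ 'n \<Rightarrow> real)
      (u\<^sub>H\<^sub>i :: nat \<Rightarrow> real ^ 'n \<Rightarrow> real) (I\<^sub>i :: nat \<Rightarrow> real ^ 'n \<Rightarrow> real)
      (f :: real ^ 'n \<Rightarrow> real) (u :: real ^ 'n \<Rightarrow> real) (u\<^sub>h :: real ^ 'n \<Rightarrow> real) (u\<^sub>H :: real ^ 'n \<Rightarrow> real).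
    (let h = mesh_size S M\<^sub>h; N = mlp \<sigma> ls; n = length X\<^sub>H + length X\<^sub>h;
         u\<^sub>N = hybrid_solution \<Omega> X\<^sub>H X\<^sub>h \<phi> N u\<^sub>H f
     in
       is_mesh S \<Omega> M\<^sub>H \<and> shape_regular \<kappa> S M\<^sub>H \<and> quasi_uniform q S M\<^sub>H \<and>
       is_mesh S \<Omega> M\<^sub>h \<and> shape_regular \<kappa> S M\<^sub>h \<and> quasi_uniform q S M\<^sub>h \<and>
       (uniform_refinement S)\<^sup>*\<^sup>* M\<^sub>H M\<^sub>h \<and>
       enumerates X\<^sub>H (nodes S M\<^sub>H r) \<and> enumerates X\<^sub>h (nodes S M\<^sub>h r) \<and> nodal_basis S \<Omega> M\<^sub>h r \<phi> \<and>
       mlp_dims n ls (length X\<^sub>h) \<and> lipschitz_net n L N \<and>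
       N\<^sub>T \<ge> 1 \<and> \<epsilon> \<ge> 0 \<and>
       (\<forall>i<N\<^sub>T. continuous_on (closure \<Omega>) (f\<^sub>i i) \<and>
          galerkin_solution S \<Omega> M\<^sub>h r (f\<^sub>i i) (u\<^sub>h\<^sub>i i) \<and> galerkin_solution S \<Omega> M\<^sub>H r (f\<^sub>i i) (u\<^sub>H\<^sub>i i) \<and>
          (enorm (net_target X\<^sub>h (u\<^sub>h\<^sub>i i) (u\<^sub>H\<^sub>i i) - N (net_input X\<^sub>H X\<^sub>h (u\<^sub>H\<^sub>i i) (f\<^sub>i i))))\<^sup>2 \<le> C * \<epsilon>\<^sup>2 \<and>
          lagrange_interpolant S \<Omega> M\<^sub>h r (\<lambda>x. f x - f\<^sub>i i x) (I\<^sub>i i)) \<and>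
       f \<in> sobolev (r - 1) \<Omega> \<and> continuous_on (closure \<Omega>) f \<and>
       poisson_solution \<Omega> f u \<and> u \<in> sobolev (r + 1) \<Omega> \<and>
       galerkin_solution S \<Omega> M\<^sub>h r f u\<^sub>h \<and> galerkin_solution S \<Omega> M\<^sub>H r f u\<^sub>H \<and>
       L2_norm \<Omega> (\<lambda>x. u x - u\<^sub>h x) + h * L2_norm \<Omega> (weak_grad \<Omega> (\<lambda>x. u x - u\<^sub>h x))
         \<le> c\<^sub>0 * h ^ (r + 1) * sobolev_norm (r - 1) \<Omega> f
       \<longrightarrow>
       L2_norm \<Omega> (weak_grad \<Omega> (\<lambda>x. u x - u\<^sub>N x))
         \<le> c * (h ^ r * sobolev_norm (r - 1) \<Omega> f
                + Min ((\<lambda>i. Hm1_norm \<Omega> (\<lambda>x. f x - f\<^sub>i i x)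
                          + L * inverse h * (L2_norm \<Omega> (\<lambda>x. u\<^sub>H x - u\<^sub>H\<^sub>i i x) + L2_norm \<Omega> (I\<^sub>i i))) ` {..<N\<^sub>T})
                + h powr (real CARD('n) / 2 - 1) * \<epsilon>))"
proof -
  have \<Omega>: "open \<Omega>" "bounded \<Omega>" "convex \<Omega>" "\<Omega> \<noteq> {}"
    using assms(2-4) bounded_subset[OF polytope_imp_bounded[OF assms(5)] closure_subset] by auto
  have r: "r \<ge> 1" by (rule assms(6))
  obtain K where K: "K > 0"
    "\<And>S c h (\<Omega> :: (real ^ 'n) set) M w. c > 0 \<Longrightarrow> h > 0 \<Longrightarrow> open \<Omega> \<Longrightarrow> bounded \<Omega> \<Longrightarrow> convex \<Omega> \<Longrightarrow>
       uniform_mesh c h S \<Omega> M \<Longrightarrow> w \<in> fe_space0 S \<Omega> M r \<Longrightarrow>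
       (L2_norm \<Omega> (weak_grad \<Omega> w))\<^sup>2 \<le> K * (h / c) ^ CARD('n) * (h ^ CARD('n) / c\<^sup>2) * (\<Sum>q\<in>nodes S M r. (w q)\<^sup>2)"
    "\<And>S c h (\<Omega> :: (real ^ 'n) set) M v. c > 0 \<Longrightarrow> open \<Omega> \<Longrightarrow> bounded \<Omega> \<Longrightarrow> convex \<Omega> \<Longrightarrow>
       uniform_mesh c h S \<Omega> M \<Longrightarrow> v \<in> fe_space S \<Omega> M r \<Longrightarrow>
       (\<Sum>q\<in>nodes S M r. (v q)\<^sup>2) \<le> K / c ^ CARD('n) * (L2_norm \<Omega> v)\<^sup>2"
    using fe_estimates[OF r, where 'n='n] by metis
  define A B where "A = sqrt (K * \<bar>q * \<kappa>\<bar> ^ CARD('n) * (q * \<kappa>)\<^sup>2)" and "B = sqrt (K * \<bar>q * \<kappa>\<bar> ^ CARD('n))"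
  have AB: "A \<ge> 0" "B \<ge> 0" using K(1) by (auto simp: A_def B_def)
  \<comment> \<open>The sum of the factors of all contributions, so it dominates each of them;
    \<open>2\<close> counts the fine and the coarse Galerkin difference. Only \<open>K\<close>,
    which depends on dimension and degree, and the given parameters enter.\<close>
  define c where "c = \<bar>c\<^sub>0\<bar> + 2 + A * B + A * sqrt \<bar>C\<bar>"
  have c: "c > 0" "\<bar>c\<^sub>0\<bar> \<le> c" "2 \<le> c" "A * B \<le> c" "A * sqrt \<bar>C\<bar> \<le> c"
    using mult_nonneg_nonneg[OF AB] mult_nonneg_nonneg[OF AB(1) real_sqrt_ge_zero[OF abs_ge_zero], of C] abs_ge_zero[of c\<^sub>0]
    unfolding c_def by linarith+
  show ?thesis unfolding Let_def
  proof (intro exI[of _ c] conjI allI impI, goal_cases)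
    case 1
    show ?case by (rule c(1))
  next
    case (2 S M\<^sub>H M\<^sub>h X\<^sub>H X\<^sub>h \<phi> \<sigma> ls L \<epsilon> N\<^sub>T f\<^sub>i u\<^sub>h\<^sub>i u\<^sub>H\<^sub>i I\<^sub>i f u u\<^sub>h u\<^sub>H)
    let ?h = "mesh_size S M\<^sub>h"
    let ?T = "\<lambda>i. L * inverse ?h * (L2_norm \<Omega> (\<lambda>x. u\<^sub>H x - u\<^sub>H\<^sub>i i x) + L2_norm \<Omega> (I\<^sub>i i))"
    let ?G = "\<lambda>i. Hm1_norm \<Omega> (\<lambda>x. f x - f\<^sub>i i x) + ?T i"
    have "N\<^sub>T \<ge> 1" using 2 by blast
    \<comment> \<open>There is at least one training problem, so the minimum is attained; the
      estimate is applied to a minimising index.\<close>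
    then have "Min (?G ` {..<N\<^sub>T}) \<in> ?G ` {..<N\<^sub>T}" by (intro Min_in) (auto simp: lessThan_empty_iff)
    then obtain i where i: "i < N\<^sub>T" "Min (?G ` {..<N\<^sub>T}) = ?G i" by auto
    have fi: "f\<^sub>i i \<in> L2 \<Omega>" using 2 i(1) by (intro L2_continuous \<Omega>) blast
    have f: "f \<in> L2 \<Omega>" using 2 unfolding sobolev_def by blast
    have u: "u \<in> H10 \<Omega>" using 2 unfolding poisson_solution_def by blast
    have est: "L \<ge> 0" "?h > 0"
      "L2_norm \<Omega> (weak_grad \<Omega> (\<lambda>x. u x - hybrid_solution \<Omega> X\<^sub>H X\<^sub>h \<phi> (mlp \<sigma> ls) u\<^sub>H f x))
        \<le> \<bar>c\<^sub>0\<bar> * (?h ^ r * sobolev_norm (r - 1) \<Omega> f) + 2 * Hm1_norm \<Omega> (\<lambda>x. f x - f\<^sub>i i x)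
          + A * B * ?T i + A * sqrt \<bar>C\<bar> * (?h powr (real CARD('n) / 2 - 1) * \<epsilon>)"
      unfolding A_def B_def
      by (rule hybrid_error[OF \<Omega> r K(1) K(2)[OF _ _ \<Omega>(1-3)] K(3)[OF _ \<Omega>(1-3)], where S=S and M\<^sub>H=M\<^sub>H and M\<^sub>h=M\<^sub>h
            and X\<^sub>H=X\<^sub>H and X\<^sub>h=X\<^sub>h and \<phi>=\<phi> and \<sigma>=\<sigma> and ls=ls and L=L and \<epsilon>=\<epsilon> and g="f\<^sub>i i" and v\<^sub>h="u\<^sub>h\<^sub>i i"
            and v\<^sub>H="u\<^sub>H\<^sub>i i" and Ig="I\<^sub>i i" and f=f and u=u and u\<^sub>h=u\<^sub>h and u\<^sub>H=u\<^sub>H and c\<^sub>0=c\<^sub>0 and \<kappa>=\<kappa> and q=q and C=C];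
          use 2 i(1) fi f u in \<open>(assumption | blast)\<close>)+
    have nn: "0 \<le> ?h ^ r * sobolev_norm (r - 1) \<Omega> f" "0 \<le> Hm1_norm \<Omega> (\<lambda>x. f x - f\<^sub>i i x)" "0 \<le> ?T i"
      "0 \<le> ?h powr (real CARD('n) / 2 - 1) * \<epsilon>"
      using est(1,2) 2 Hm1_norm_bound(1)[OF \<Omega>(1,2) L2_diff[OF f fi]] by (auto simp: sobolev_norm_def sum_nonneg)
    have "\<bar>c\<^sub>0\<bar> * (?h ^ r * sobolev_norm (r - 1) \<Omega> f) + 2 * Hm1_norm \<Omega> (\<lambda>x. f x - f\<^sub>i i x)
          + A * B * ?T i + A * sqrt \<bar>C\<bar> * (?h powr (real CARD('n) / 2 - 1) * \<epsilon>)
        \<le> c * (?h ^ r * sobolev_norm (r - 1) \<Omega> f) + c * Hm1_norm \<Omega> (\<lambda>x. f x - f\<^sub>i i x)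
          + c * ?T i + c * (?h powr (real CARD('n) / 2 - 1) * \<epsilon>)"
      by (intro add_mono mult_right_mono c nn)
    also have "\<dots> = c * (?h ^ r * sobolev_norm (r - 1) \<Omega> f + ?G i + ?h powr (real CARD('n) / 2 - 1) * \<epsilon>)"
      by (simp only: distrib_left add.assoc)
    finally show ?case unfolding i(2) using est(3) by (rule order_trans[rotated])
  qed
qed

end
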